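(* Let $n\ge 1$. For each $(\mathbf m,\mathbf r)\in\mathcal P_{q,n}$ the closed subset $\mathscr K_{q,(\mathbf m,\mathbf r)}$ is an irreducible component of $\mathscr K_{q,n}$, and $$\mathscr K_{q,n}=\bigcup_{(\mathbf m,\mathbf r)\in\mathcal P_{q,n}}\mathscr K_{q,(\mathbf m,\mathbf r)}.$$ Moreover, for every $(\mathbf m,\mathbf r)\in\mathcal P_{q,n}$, $\dim\mathscr K_{q,(\mathbf m,\mathbf r)}=n^2+m_\ell$ if $\ell<\infty$, and $\dim\mathscr K_{q,(\mathbf m,\mathbf r)}=n^2$ if $\ell=\infty$.
   Context: $K$ is an algebraically closed field of characteristic zero and $q\in K^*=K\setminus\{0\}$. Let $\ell$ be the smallest positive integer with $q^\ell=1$ if $q$ is a root of unity, and $\ell=\infty$ otherwise. $\mathbb N$ denotes the nonnegative integers. For $n\ge1$, $\mathscr K_{q,n}=\{(A,B)\in M_{n\times n}(K)\times M_{n\times n}(K)\mid AB=qBA\}$, with the Zariski topology (as an algebraic set); $\mathrm{GL}_n=\mathrm{GL}_n(K)$ acts by $g\cdot(A,B)=(gAg^{-1},gBg^{-1})$. Overlines denote Zariski closure in the relevant $\mathscr K_{q,n}$. For $1\le i\le\ell$ (all $i\geq 1$ if $\ell=\infty$), $\mathscr D_{q,i}$ is the Zariski closure in $\mathscr K_{q,i}$ of the union of the $\mathrm{GL}_i$-orbits of all $(A,B)\in\mathscr K_{q,i}$ with $A=\mathrm{diag}(a,aq^{-1},\ldots,aq^{-(i-1)})$, $a\in K^*$.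 For $1\le i<\ell$ (all $i\ge1$ if $\ell=\infty$), $\mathscr N_{q,i}$ is the Zariski closure in $\mathscr K_{q,i}$ of the union of the $\mathrm{GL}_i$-orbits of all $(J_i(0),B)\in\mathscr K_{q,i}$, where $J_i(0)$ is the $i\times i$ nilpotent Jordan block. For subsets $\mathscr V\subseteq\mathscr K_{q,i}$, $\mathscr W\subseteq\mathscr K_{q,j}$, $\mathscr V\oplus\mathscr W$ denotes the set of all pairs in $\mathscr K_{q,i+j}$ that are $\mathrm{GL}_{i+j}$-conjugate to $(\mathrm{diag}(A_1,A_2),\mathrm{diag}(B_1,B_2))$ with $(A_1,B_1)\in\mathscr V$, $(A_2,B_2)\in\mathscr W$; $\mathscr V^{\oplus m}$ is the $m$-fold iteration (and $\mathscr V^{\oplus 0}$ is omitted). For a vector $\mathbf v=(v_1,v_2,\ldots)$ of nonnegative integers with finitely many nonzero entries, $\|\mathbf v\|=v_1+2v_2+3v_3+\cdots$. If $\ell<\infty$: $\mathcal P_{q,n}=\{(\mathbf m,\mathbf r)\mid \mathbf m=(m_1,\ldots,m_\ell)\in\mathbb N^\ell,\ \mathbf r=(r_1,\ldots,r_{\ell-1})\in\mathbb N^{\ell-1},\ \|\mathbf m\|+\|\mathbf r\|=n\}$ and $$\mathscr K_{q,(\mathbf m,\mathbf r)}=\overline{\mathscr D_{q,1}^{\oplus m_1}\oplus\cdots\oplus\mathscr D_{q,\ell}^{\oplus m_\ell}\oplus\mathscr N_{q,1}^{\oplus r_1}\oplus\cdots\oplus\mathscr N_{q,\ell-1}^{\oplus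 r_{\ell-1}}}\subseteq\mathscr K_{q,n}.$$ If $\ell=\infty$: $\mathcal P_{q,n}$ is the set of pairs $(\mathbf m,\mathbf r)$ of finitely supported sequences $\mathbf m=(m_1,m_2,\ldots)$, $\mathbf r=(r_1,r_2,\ldots)$ of nonnegative integers with $\|\mathbf m\|+\|\mathbf r\|=n$, and $$\mathscr K_{q,(\mathbf m,\mathbf r)}=\overline{\mathscr D_{q,1}^{\oplus m_1}\oplus\mathscr D_{q,2}^{\oplus m_2}\oplus\cdots\oplus\mathscr N_{q,1}^{\oplus r_1}\oplus\mathscr N_{q,2}^{\oplus r_2}\oplus\cdots}\subseteq\mathscr K_{q,n}.$$ *)

theory Defs
  imports
    "HOL-Analysis.Abstract_Topology"
    "HOL-Library.Extended_Nat"
    "HOL-Computational_Algebra.Polynomial"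
    "Jordan_Normal_Form.Jordan_Normal_Form"
begin

section \<open>Irreducibility and Krull dimension of topological spaces\<close>

definition irreducible_space :: "'a topology \<Rightarrow> bool" where
  "irreducible_space X \<longleftrightarrow> topspace X \<noteq> {} \<and>
     (\<forall>C D. closedin X C \<and> closedin X D \<and> C \<union> D = topspace X \<longrightarrow>
        C = topspace X \<or> D = topspace X)"

definition irreducible_in :: "'a topology \<Rightarrow> 'a set \<Rightarrow> bool" where
  "irreducible_in X S \<longleftrightarrow> S \<subseteq> topspace X \<and> irreducible_space (subtopology X S)"

definition irreducible_component_of :: "'a topology \<Rightarrow> 'a set \<Rightarrow> bool" where
  "irreducible_component_of X S \<longleftrightarrow> irreducible_in X S \<and>
     (\<forall>T. irreducible_in X T \<and> S \<subseteq> T \<longrightarrow> T = S)"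

text \<open>Supremum of the lengths \<open>k\<close> of strict chains \<open>Z 0 \<subset> \<dots> \<subset> Z k\<close> of irreducible closed
  subsets. The empty space gets the junk value 0.\<close>

definition krull_dim :: "'a topology \<Rightarrow> enat" where
  "krull_dim X = Sup {enat k | k. \<exists>Z. (\<forall>i\<le>k. closedin X (Z i) \<and> irreducible_in X (Z i)) \<and>
     (\<forall>i<k. Z i \<subset> Z (Suc i))}"


section \<open>The Zariski topology on pairs of matrices\<close>

inductive_set poly_funs :: "nat \<Rightarrow> ('a::comm_ring_1 mat \<times> 'a mat \<Rightarrow> 'a) set" for n :: nat where
  const: "(\<lambda>_. c) \<in> poly_funs n"
| fst_entry: "i < n \<Longrightarrow> j < n \<Longrightarrow> (\<lambda>p. fst p $$ (i, j)) \<in> poly_funs n"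
| snd_entry: "i < n \<Longrightarrow> j < n \<Longrightarrow> (\<lambda>p. snd p $$ (i, j)) \<in> poly_funs n"
| add: "f \<in> poly_funs n \<Longrightarrow> g \<in> poly_funs n \<Longrightarrow> (\<lambda>p. f p + g p) \<in> poly_funs n"
| mult: "f \<in> poly_funs n \<Longrightarrow> g \<in> poly_funs n \<Longrightarrow> (\<lambda>p. f p * g p) \<in> poly_funs n"

definition zariski :: "nat \<Rightarrow> ('a::idom mat \<times> 'a mat) topology" where
  "zariski n = topology (\<lambda>U. \<exists>F \<subseteq> poly_funs n.
     U = {p \<in> carrier_mat n n \<times> carrier_mat n n. \<exists>f\<in>F. f p \<noteq> 0})"

lemma openin_zariski:
  "openin (zariski n) U \<longleftrightarrow>
     (\<exists>F \<subseteq> poly_funs n. U = {p \<in> carrier_mat n n \<times> carrier_mat n n. \<exists>f\<in>F. f p \<noteq> 0})"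
proof -
  let ?M = "carrier_mat n n \<times> carrier_mat n n :: ('a mat \<times> 'a mat) set"
  let ?L = "\<lambda>U. \<exists>F \<subseteq> poly_funs n. U = {p \<in> ?M. \<exists>f\<in>F. f p \<noteq> 0}"
  have "?L (S \<inter> T)" if S: "?L S" and T: "?L T" for S T
  proof -
    from S obtain F where F: "F \<subseteq> poly_funs n" "S = {p \<in> ?M. \<exists>f\<in>F. f p \<noteq> 0}" by blast
    from T obtain G where G: "G \<subseteq> poly_funs n" "T = {p \<in> ?M. \<exists>f\<in>G. f p \<noteq> 0}" by blast
    let ?H = "{\<lambda>p. f p * g p | f g. f \<in> F \<and> g \<in> G}"
    have "?H \<subseteq> poly_funs n" using F(1) G(1) by (auto intro: poly_funs.mult)
    moreover have "S \<inter> T = {p \<in> ?M. \<exists>h\<in>?H. h p \<noteq> 0}"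
    proof (intro equalityI subsetI)
      fix p assume "p \<in> S \<inter> T"
      then obtain f g where "p \<in> ?M" "f \<in> F" "f p \<noteq> 0" "g \<in> G" "g p \<noteq> 0"
        unfolding F(2) G(2) by auto
      moreover from this have "(\<lambda>p. f p * g p) \<in> ?H" by blast
      ultimately show "p \<in> {p \<in> ?M. \<exists>h\<in>?H. h p \<noteq> 0}"
        by (intro CollectI conjI bexI[of _ "\<lambda>p. f p * g p"]) simp_all
    next
      fix p assume "p \<in> {p \<in> ?M. \<exists>h\<in>?H. h p \<noteq> 0}"
      then obtain f g where "p \<in> ?M" "f \<in> F" "g \<in> G" "f p * g p \<noteq> 0" by auto
      then show "p \<in> S \<inter> T" unfolding F(2) G(2) by auto
    qed
    ultimately show ?thesis by blast
  qed
  moreover have "?L (\<Union>\<K>)" if K: "\<forall>S\<in>\<K>. ?L S" for \<K>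
  proof -
    let ?F = "{f \<in> poly_funs n. \<forall>p\<in>?M. f p \<noteq> 0 \<longrightarrow> p \<in> \<Union>\<K>}"
    have "\<Union>\<K> = {p \<in> ?M. \<exists>f\<in>?F. f p \<noteq> 0}"
    proof (intro equalityI subsetI)
      fix p assume "p \<in> \<Union>\<K>"
      then obtain S where S: "S \<in> \<K>" "p \<in> S" by blast
      with K obtain F where F: "F \<subseteq> poly_funs n" "S = {p \<in> ?M. \<exists>f\<in>F. f p \<noteq> 0}" by blast
      with S(2) obtain f where f: "p \<in> ?M" "f \<in> F" "f p \<noteq> 0" by blast
      have "p' \<in> S" if "p' \<in> ?M" "f p' \<noteq> 0" for p'
        using that f(2) unfolding F(2) by blast
      with S(1) F(1) f(2) have "f \<in> ?F" by blast
      with f show "p \<in> {p \<in> ?M. \<exists>f\<in>?F. f p \<noteq> 0}" by blast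
    qed blast
    moreover have "?F \<subseteq> poly_funs n" by blast
    ultimately show ?thesis by blast
  qed
  ultimately have "istopology ?L" unfolding istopology_def by presburger
  then have "openin (zariski n) = ?L" unfolding zariski_def by (rule topology_inverse')
  then show ?thesis by simp
qed

lemma topspace_zariski [simp]: "topspace (zariski n) = carrier_mat n n \<times> carrier_mat n n"
proof -
  let ?M = "carrier_mat n n \<times> carrier_mat n n :: ('a mat \<times> 'a mat) set"
  have "p \<in> ?M" if p: "p \<in> topspace (zariski n)" for p
  proof -
    from p obtain U where U: "openin (zariski n) U" "p \<in> U" unfolding topspace_def by blast
    from U(1) have "U \<subseteq> ?M" unfolding openin_zariski by (elim exE conjE) simp
    with U(2) show ?thesis by (rule subsetD[rotated])
  qed
  moreover have "openin (zariski n) ?M"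
    unfolding openin_zariski
    by (intro exI[of _ "{\<lambda>_. 1}"] conjI) (simp_all add: poly_funs.const)
  ultimately show ?thesis using openin_subset subset_antisym by (metis subsetI)
qed

lemma closedin_zariski:
  "closedin (zariski n) C \<longleftrightarrow>
     (\<exists>F \<subseteq> poly_funs n. C = {p \<in> carrier_mat n n \<times> carrier_mat n n. \<forall>f\<in>F. f p = 0})"
proof -
  let ?M = "carrier_mat n n \<times> carrier_mat n n :: ('a mat \<times> 'a mat) set"
  have eq: "C \<subseteq> ?M \<and> ?M - C = {p \<in> ?M. \<exists>f\<in>F. f p \<noteq> 0} \<longleftrightarrow> C = {p \<in> ?M. \<forall>f\<in>F. f p = 0}"
    for F :: "('a mat \<times> 'a mat \<Rightarrow> 'a) set"
  proof -
    let ?N = "{p \<in> ?M. \<exists>f\<in>F. f p \<noteq> 0}"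
    have Z: "{p \<in> ?M. \<forall>f\<in>F. f p = 0} = ?M - ?N"
    proof (rule Set.set_eqI)
      fix p show "p \<in> {p \<in> ?M. \<forall>f\<in>F. f p = 0} \<longleftrightarrow> p \<in> ?M - ?N"
        by (cases "p \<in> ?M") simp_all
    qed
    have "?N \<subseteq> ?M" by (rule Collect_restrict)
    moreover have "X \<subseteq> M \<and> M - X = N \<longleftrightarrow> X = M - N" if "N \<subseteq> M"
      for M N X :: "('a mat \<times> 'a mat) set"
      using that by blast
    ultimately show ?thesis unfolding Z by simp
  qed
  show ?thesis
    unfolding closedin_def openin_zariski topspace_zariski eq[symmetric]
    by (rule iffI; elim exE conjE; intro exI conjI; assumption)
qed


section \<open>Quantum commuting pairs\<close>

definition qorder :: "'a::field \<Rightarrow> enat" where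
  "qorder q = (if \<exists>k>0. q ^ k = 1 then enat (LEAST k. k > 0 \<and> q ^ k = 1) else \<infinity>)"

definition qpairs :: "'a::field \<Rightarrow> nat \<Rightarrow> ('a mat \<times> 'a mat) set" where
  "qpairs q n = {(A, B). A \<in> carrier_mat n n \<and> B \<in> carrier_mat n n \<and> A * B = q \<cdot>\<^sub>m (B * A)}"

definition qpairs_top :: "'a::field \<Rightarrow> nat \<Rightarrow> ('a mat \<times> 'a mat) topology" where
  "qpairs_top q n = subtopology (zariski n) (qpairs q n)"

lemma topspace_qpairs_top [simp]: "topspace (qpairs_top q n) = qpairs q n"
  by (auto simp: qpairs_top_def qpairs_def)

definition gl_conj :: "'a::field mat \<times> 'a mat \<Rightarrow> 'a mat \<times> 'a mat \<Rightarrow> bool" where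
  "gl_conj p p' \<longleftrightarrow>
     (\<exists>g h. similar_mat_wit (fst p) (fst p') g h \<and> similar_mat_wit (snd p) (snd p') g h)"

definition gl_orbits :: "('a::field mat \<times> 'a mat) set \<Rightarrow> ('a mat \<times> 'a mat) set" where
  "gl_orbits V = {p. \<exists>p'\<in>V. gl_conj p p'}"

definition D_comp :: "'a::field \<Rightarrow> nat \<Rightarrow> ('a mat \<times> 'a mat) set" where
  "D_comp q i = qpairs_top q i closure_of
     gl_orbits {(A, B) \<in> qpairs q i. \<exists>a. a \<noteq> 0 \<and> A = mat_diag i (\<lambda>k. a * inverse q ^ k)}"

definition N_comp :: "'a::field \<Rightarrow> nat \<Rightarrow> ('a mat \<times> 'a mat) set" where
  "N_comp q i = qpairs_top q i closure_of
     gl_orbits {(A, B) \<in> qpairs q i. A = jordan_block i 0}"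

text \<open>The sizes \<open>i\<close> and \<open>j\<close> are carried by the matrices, and the sum consists of
  \<open>q\<close>-commuting pairs automatically; see \<open>dsum2_subset\<close>.\<close>

definition dsum2 :: "('a::field mat \<times> 'a mat) set \<Rightarrow> ('a mat \<times> 'a mat) set
    \<Rightarrow> ('a mat \<times> 'a mat) set" where
  "dsum2 V W = gl_orbits
     {(diag_block_mat [A1, A2], diag_block_mat [B1, B2]) | A1 B1 A2 B2.
        (A1, B1) \<in> V \<and> (A2, B2) \<in> W}"

text \<open>Iterated sums. A one-element list gives \<open>V\<close> itself, with no further conjugation; the empty
  sum consists of the pair of \<open>0 \<times> 0\<close> matrices.\<close>

fun dsum :: "('a::field mat \<times> 'a mat) set list \<Rightarrow> ('a mat \<times> 'a mat) set" where
  "dsum [] = {(0\<^sub>m 0 0, 0\<^sub>m 0 0)}"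
| "dsum [V] = V"
| "dsum (V # W # Vs) = dsum2 V (dsum (W # Vs))"

definition dpow :: "('a::field mat \<times> 'a mat) set \<Rightarrow> nat \<Rightarrow> ('a mat \<times> 'a mat) set" where
  "dpow V m = dsum (replicate m V)"


section \<open>The index set and the candidate components\<close>

text \<open>A vector \<open>(v\<^sub>1, v\<^sub>2, \<dots>)\<close>, finite or infinite, is a function \<open>v\<close> on the naturals vanishing
  outside the index range of the vector; in particular \<open>v 0 = 0\<close>.\<close>

definition wnorm :: "(nat \<Rightarrow> nat) \<Rightarrow> nat" where
  "wnorm v = (\<Sum>i | v i \<noteq> 0. i * v i)"

definition qparams :: "'a::field \<Rightarrow> nat \<Rightarrow> ((nat \<Rightarrow> nat) \<times> (nat \<Rightarrow> nat)) set" where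
  "qparams q n = {(m, r).
     finite {i. m i \<noteq> 0} \<and> (\<forall>i. m i \<noteq> 0 \<longrightarrow> 1 \<le> i \<and> enat i \<le> qorder q) \<and>
     finite {i. r i \<noteq> 0} \<and> (\<forall>i. r i \<noteq> 0 \<longrightarrow> 1 \<le> i \<and> enat i < qorder q) \<and>
     wnorm m + wnorm r = n}"

text \<open>The lists run over the supports of \<open>m\<close> and \<open>r\<close> only, so zeroth powers are omitted.\<close>

definition K_comp :: "'a::field \<Rightarrow> nat \<Rightarrow> (nat \<Rightarrow> nat) \<Rightarrow> (nat \<Rightarrow> nat) \<Rightarrow> ('a mat \<times> 'a mat) set" where
  "K_comp q n m r = qpairs_top q n closure_of dsum
     (map (\<lambda>i. dpow (D_comp q i) (m i)) (sorted_list_of_set {i. m i \<noteq> 0}) @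
      map (\<lambda>i. dpow (N_comp q i) (r i)) (sorted_list_of_set {i. r i \<noteq> 0}))"

lemma gl_orbits_subset:
  assumes V: "V \<subseteq> qpairs q n"
  shows "gl_orbits V \<subseteq> qpairs q n"
proof
  fix p assume "p \<in> gl_orbits V"
  then obtain p' g h where p': "p' \<in> V"
    and w: "similar_mat_wit (fst p) (fst p') g h" "similar_mat_wit (snd p) (snd p') g h"
    unfolding gl_orbits_def gl_conj_def by blast
  obtain A B A' B' where p: "p = (A, B)" and pp: "p' = (A', B')" by (metis surj_pair)
  have c: "A' \<in> carrier_mat n n" "B' \<in> carrier_mat n n" and AB: "A' * B' = q \<cdot>\<^sub>m (B' * A')"
    using V p' unfolding pp qpairs_def by auto
  from similar_mat_witD2[OF c(1) similar_mat_wit_sym[OF w(1)[unfolded p pp fst_conv]]]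
    similar_mat_witD2[OF c(2) similar_mat_wit_sym[OF w(2)[unfolded p pp snd_conv]]]
  have car: "A \<in> carrier_mat n n" "B \<in> carrier_mat n n"
    and gh: "g \<in> carrier_mat n n" "h \<in> carrier_mat n n" "h * g = 1\<^sub>m n" by auto
  have eq: "A = g * A' * h" "B = g * B' * h"
    using similar_mat_witD(3)[OF refl w(1)] similar_mat_witD(3)[OF refl w(2)]
    unfolding p pp fst_conv snd_conv .
  have mul: "g * X * h * (g * Y * h) = g * (X * Y) * h"
    if X: "X \<in> carrier_mat n n" and Y: "Y \<in> carrier_mat n n" for X Y
  proof -
    have "g * X * h * (g * Y * h) = g * X * (h * g) * Y * h"
      using X Y gh(1,2) by (simp add: assoc_mult_mat[of _ n n _ n _ n])
    then show ?thesis using X Y gh by (simp add: assoc_mult_mat[of _ n n _ n _ n])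
  qed
  have "A * B = g * (q \<cdot>\<^sub>m (B' * A')) * h"
    unfolding eq by (simp add: mul c AB)
  also have "\<dots> = q \<cdot>\<^sub>m (g * (B' * A') * h)"
    using c gh(1,2) by (simp add: mult_smult_distrib[of _ n n _ n] mult_smult_assoc_mat[of _ n n _ n])
  also have "\<dots> = q \<cdot>\<^sub>m (B * A)"
    unfolding eq by (simp add: mul c)
  finally show "p \<in> qpairs q n" using car unfolding p qpairs_def by simp
qed

lemma dsum2_subset:
  assumes V: "V \<subseteq> qpairs q i" and W: "W \<subseteq> qpairs q j"
  shows "dsum2 V W \<subseteq> qpairs q (i + j)"
  unfolding dsum2_def
proof (rule gl_orbits_subset, clarify)
  fix A1 B1 A2 B2 assume "(A1, B1) \<in> V" "(A2, B2) \<in> W"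
  then have c: "A1 \<in> carrier_mat i i" "B1 \<in> carrier_mat i i"
     "A2 \<in> carrier_mat j j" "B2 \<in> carrier_mat j j"
    and e: "A1 * B1 = q \<cdot>\<^sub>m (B1 * A1)" "A2 * B2 = q \<cdot>\<^sub>m (B2 * A2)"
    using V W unfolding qpairs_def by auto
  have d: "diag_block_mat [X, Y] = four_block_mat X (0\<^sub>m i j) (0\<^sub>m j i) Y"
    if "X \<in> carrier_mat i i" "Y \<in> carrier_mat j j" for X Y :: "'a mat"
    using that by (simp only: diag_block_mat.simps(2)[of X] diag_block_mat_singleton Let_def) auto
  show "(diag_block_mat [A1, A2], diag_block_mat [B1, B2]) \<in> qpairs q (i + j)"
    unfolding qpairs_def d[OF c(1,3)] d[OF c(2,4)] using c
    by (auto simp: mult_four_block_mat[of _ i i _ j _ j _ _ i _ j] smult_four_block_mat[of _ i i _ j _ j] e)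
qed

end

theory Submission
  imports Defs "Jordan_Normal_Form.Jordan_Normal_Form_Existence" "Jordan_Normal_Form.Spectral_Radius"
begin

text \<open>Why the theorem holds. Write \<open>l\<close> for the order of \<open>q\<close>. In a summand of type \<open>D\<close> the matrix \<open>A\<close> is diagonal,
  with eigenvalues \<open>a, a q\<^sup>-\<^sup>1, \<dots>\<close>, and \<open>B\<close> is a weighted shift, which may close up to a weighted
  cycle if the size is \<open>l\<close>. In a generic summand of type \<open>N\<close> the roles are exchanged: \<open>B\<close> is diagonal and \<open>A\<close> a weighted
  shift. Block sums of these normal forms, conjugated by all matrices \<open>G\<close>, are dense in a candidate \<open>K\<close>. As diagonal
  matrices only rescale the weights, \<open>G\<close> may be taken with unit diagonal. Hence \<open>K\<close> is the closure of the image
  of a rational map (\<open>K_types_eq_par\<close>) whose parameters are the \<open>n\<^sup>2 - n\<close> entries of \<open>G\<close>, one eigenvalue or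
  weight for each of the \<open>n\<close> indices, and one corner entry for each of the \<open>m\<^sub>l\<close> summands \<open>D\<close> of size \<open>l\<close>. So \<open>K\<close> is
  irreducible. Its dimension is at most \<open>n\<^sup>2 + m\<^sub>l\<close>, since more functions than parameters are algebraically
  dependent (\<open>chain_length_le\<close>). It is not smaller, since releasing the parameters one by one gives a strict chain of
  irreducible sets (\<open>K_types_chain\<close>): each parameter is detected by a polynomial in \<open>A\<close> and \<open>B\<close>.

  The candidates cover everything (\<open>all_pairs_mem\<close>, \<open>qpairs_eq_Union_K_types\<close>). Their union, for all \<open>n\<close>, is closed under
  conjugation, block sums and limits along polynomial curves. If the spectrum of \<open>A\<close> or \<open>B\<close> falls into two parts not linked by
  multiplication with \<open>q\<close>, then the pair is a block sum, and induction on \<open>n\<close> applies. So it suffices to deform every pair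
  until its spectrum is disconnected or it is one of the normal forms. This is done by hand when \<open>A\<close> or \<open>B\<close> is
  nilpotent. Otherwise both are invertible, \<open>l\<close> is finite, and the pair is obtained from a commuting pair of size \<open>n / l\<close>;
  for commuting pairs, \<open>A\<close> can be translated to a nilpotent matrix.

  No candidate contains another. As irreducible closed sets of equal dimension cannot be properly contained in each other,
  an inclusion of \<open>K\<close> in \<open>K'\<close> has to be excluded only if \<open>K'\<close> has more summands \<open>D\<close> of size \<open>l\<close> than \<open>K\<close>. The space of all \<open>Z\<close> with
  \<open>Z A = q A Z\<close> and \<open>B Z = q Z B\<close> has at least the dimension \<open>m'\<^sub>l\<close> on the image for \<open>K'\<close>, but at most \<open>m\<^sub>l\<close> at a
  suitable point of \<open>K\<close>, and small dimension is an open condition (\<open>full_count_mono\<close>). Finally, an irreducible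
  set containing a candidate lies in one of the finitely many candidates, hence equals the given one.\<close>

abbreviation Mat :: "nat \<Rightarrow> 'a mat set" where
  "Mat n \<equiv> carrier_mat n n"

abbreviation pairs :: "nat \<Rightarrow> ('a mat \<times> 'a mat) set" where
  "pairs n \<equiv> Mat n \<times> Mat n"

section \<open>Rings of functions and matrices over them\<close>

text \<open>Polynomial functions on pairs of matrices, on a parameter space and in one variable are all
  handled as rings of functions. What matters is that sums, products and determinants of matrices
  whose entries vary in such a ring vary in it again.\<close>

locale function_ring =
  fixes R :: "('x \<Rightarrow> 'a::comm_ring_1) set"
  assumes const: "(\<lambda>_. c) \<in> R"
    and add: "f \<in> R \<Longrightarrow> g \<in> R \<Longrightarrow> (\<lambda>x. f x + g x) \<in> R"
    and mult: "f \<in> R \<Longrightarrow> g \<in> R \<Longrightarrow> (\<lambda>x. f x * g x) \<in> R"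
begin

lemma uminus: "f \<in> R \<Longrightarrow> (\<lambda>x. - f x) \<in> R"
  using mult[OF const[of "-1"], of f] by simp

lemma diff: "f \<in> R \<Longrightarrow> g \<in> R \<Longrightarrow> (\<lambda>x. f x - g x) \<in> R"
  using add[OF _ uminus, of f g] by simp

lemma power: "f \<in> R \<Longrightarrow> (\<lambda>x. f x ^ k) \<in> R"
  by (induction k) (simp_all add: const mult)

lemma sum: "(\<And>i. i \<in> I \<Longrightarrow> f i \<in> R) \<Longrightarrow> (\<lambda>x. \<Sum>i\<in>I. f i x) \<in> R"
  by (induction I rule: infinite_finite_induct) (simp_all add: const add)

lemma prod: "(\<And>i. i \<in> I \<Longrightarrow> f i \<in> R) \<Longrightarrow> (\<lambda>x. \<Prod>i\<in>I. f i x) \<in> R"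
  by (induction I rule: infinite_finite_induct) (simp_all add: const mult)

definition mats :: "nat \<Rightarrow> nat \<Rightarrow> ('x \<Rightarrow> 'a mat) set" where
  "mats m n = {M. (\<forall>x. M x \<in> carrier_mat m n) \<and> (\<forall>i<m. \<forall>j<n. (\<lambda>x. M x $$ (i, j)) \<in> R)}"

lemma mats_carrier: "M \<in> mats m n \<Longrightarrow> M x \<in> carrier_mat m n"
  and mats_entry: "M \<in> mats m n \<Longrightarrow> i < m \<Longrightarrow> j < n \<Longrightarrow> (\<lambda>x. M x $$ (i, j)) \<in> R"
  by (auto simp: mats_def)

lemma mats_mat: "(\<And>i j. i < m \<Longrightarrow> j < n \<Longrightarrow> (\<lambda>x. f x (i, j)) \<in> R) \<Longrightarrow> (\<lambda>x. mat m n (f x)) \<in> mats m n"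
  by (auto simp: mats_def)

lemma mats_const: "M \<in> carrier_mat m n \<Longrightarrow> (\<lambda>_. M) \<in> mats m n"
  by (auto simp: mats_def const)

lemma mats_add: "M \<in> mats m n \<Longrightarrow> N \<in> mats m n \<Longrightarrow> (\<lambda>x. M x + N x) \<in> mats m n"
proof -
  assume M: "M \<in> mats m n" and N: "N \<in> mats m n"
  have "(\<lambda>x. (M x + N x) $$ (i, j)) = (\<lambda>x. M x $$ (i, j) + N x $$ (i, j))" if "i < m" "j < n" for i j
    using that mats_carrier[OF M] mats_carrier[OF N] by (intro ext) (metis carrier_matD index_add_mat(1))
  then show ?thesis
    using M N by (auto simp: mats_def intro: add)
qed

lemma mats_smult: "c \<in> R \<Longrightarrow> M \<in> mats m n \<Longrightarrow> (\<lambda>x. c x \<cdot>\<^sub>m M x) \<in> mats m n"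
proof -
  assume M: "M \<in> mats m n" and c: "c \<in> R"
  have "(\<lambda>x. (c x \<cdot>\<^sub>m M x) $$ (i, j)) = (\<lambda>x. c x * M x $$ (i, j))" if "i < m" "j < n" for i j
    using that mats_carrier[OF M] by (intro ext) (metis carrier_matD index_smult_mat(1))
  then show ?thesis
    using M c by (auto simp: mats_def intro: mult)
qed

lemma mats_minus: "M \<in> mats m n \<Longrightarrow> N \<in> mats m n \<Longrightarrow> (\<lambda>x. M x - N x) \<in> mats m n"
proof -
  assume M: "M \<in> mats m n" and N: "N \<in> mats m n"
  have "(\<lambda>x. (M x - N x) $$ (i, j)) = (\<lambda>x. M x $$ (i, j) - N x $$ (i, j))" if "i < m" "j < n" for i j
    using that mats_carrier[OF M] mats_carrier[OF N] by (intro ext) (metis carrier_matD index_minus_mat(1))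
  moreover have "M x - N x \<in> carrier_mat m n" for x
    using mats_carrier[OF M, of x] mats_carrier[OF N, of x] by auto
  ultimately show ?thesis
    using M N by (auto simp: mats_def intro: diff)
qed

lemma mats_mult: "M \<in> mats m k \<Longrightarrow> N \<in> mats k n \<Longrightarrow> (\<lambda>x. M x * N x) \<in> mats m n"
proof -
  assume M: "M \<in> mats m k" and N: "N \<in> mats k n"
  have "(\<lambda>x. (M x * N x) $$ (i, j)) = (\<lambda>x. \<Sum>l\<in>{0..<k}. M x $$ (i, l) * N x $$ (l, j))"
    if "i < m" "j < n" for i j
  proof
    fix x
    show "(M x * N x) $$ (i, j) = (\<Sum>l\<in>{0..<k}. M x $$ (i, l) * N x $$ (l, j))"
      using that mats_carrier[OF M, of x] mats_carrier[OF N, of x]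
      by (auto simp: scalar_prod_def intro!: sum.cong)
  qed
  moreover have "M x * N x \<in> carrier_mat m n" for x
    using mats_carrier[OF M, of x] mats_carrier[OF N, of x] by auto
  moreover have "(\<lambda>x. \<Sum>l\<in>{0..<k}. M x $$ (i, l) * N x $$ (l, j)) \<in> R" if "i < m" "j < n" for i j
    using that by (intro sum mult mats_entry[OF M] mats_entry[OF N]) auto
  ultimately show ?thesis
    by (auto simp: mats_def)
qed

lemma mats_pow: "M \<in> mats n n \<Longrightarrow> (\<lambda>x. M x ^\<^sub>m k) \<in> mats n n"
proof (induction k)
  case 0
  have "M x ^\<^sub>m 0 = 1\<^sub>m n" for x
    using mats_carrier[OF 0, of x] by simp
  then show ?case by (simp add: mats_const)
next
  case (Suc k)
  then show ?case using mats_mult[of "\<lambda>x. M x ^\<^sub>m k" n n M n] by simp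
qed

lemma mats_det: "M \<in> mats n n \<Longrightarrow> (\<lambda>x. det (M x)) \<in> R"
proof -
  assume M: "M \<in> mats n n"
  have "(\<lambda>x. det (M x)) = (\<lambda>x. \<Sum>p\<in>{p. p permutes {0..<n}}. signof p * (\<Prod>i = 0..<n. M x $$ (i, p i)))"
    using det_def'[OF mats_carrier[OF M]] by auto
  moreover have "\<dots> \<in> R"
    by (intro sum mult const prod mats_entry[OF M]) auto
  ultimately show ?thesis by simp
qed

lemma mats_adj: "M \<in> mats n n \<Longrightarrow> (\<lambda>x. adj_mat (M x)) \<in> mats n n"
proof -
  assume M: "M \<in> mats n n"
  have "(\<lambda>x. adj_mat (M x) $$ (i, j)) \<in> R" if ij: "i < n" "j < n" for i j
  proof -
    let ?D = "\<lambda>x. mat (n - 1) (n - 1) (\<lambda>(i', j'). M x $$ (if i' < j then i' else Suc i', if j' < i then j' else Suc j'))"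
    have "?D \<in> mats (n - 1) (n - 1)"
      using ij by (intro mats_mat) (auto intro!: mats_entry[OF M])
    then have "(\<lambda>x. (- 1) ^ (j + i) * det (?D x)) \<in> R"
      by (intro mult const mats_det)
    moreover have "adj_mat (M x) $$ (i, j) = (- 1) ^ (j + i) * det (?D x)" for x
      using mats_carrier[OF M, of x] ij
      by (auto simp: adj_mat_def cofactor_def mat_delete_def)
    ultimately show ?thesis by simp
  qed
  then show ?thesis using adj_mat(1)[OF mats_carrier[OF M]] by (auto simp: mats_def)
qed

lemma poly_funs_comp:
  assumes f: "f \<in> poly_funs n" and A: "A \<in> mats n n" and B: "B \<in> mats n n"
  shows "(\<lambda>x. f (A x, B x)) \<in> R"
  using f by induction (simp_all add: const add mult mats_entry[OF A] mats_entry[OF B])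

end

interpretation poly_funs: function_ring "poly_funs n"
  by unfold_locales (auto intro: poly_funs.intros)

text \<open>The two projections, normalised so that their values are \<open>n \<times> n\<close> matrices for every
  argument; on the space of pairs they agree with \<open>fst\<close> and \<open>snd\<close>.\<close>

definition proj1 :: "nat \<Rightarrow> 'a mat \<times> 'a mat \<Rightarrow> 'a mat" where
  "proj1 n p = mat n n (\<lambda>ij. fst p $$ ij)"

definition proj2 :: "nat \<Rightarrow> 'a mat \<times> 'a mat \<Rightarrow> 'a mat" where
  "proj2 n p = mat n n (\<lambda>ij. snd p $$ ij)"

lemma proj_eq: "A \<in> Mat n \<Longrightarrow> proj1 n (A, B) = A" "B \<in> Mat n \<Longrightarrow> proj2 n (A, B) = B"
  by (auto simp: proj1_def proj2_def)

lemma proj_mats: "proj1 n \<in> poly_funs.mats n n n" "proj2 n \<in> poly_funs.mats n n n"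
  unfolding proj1_def proj2_def poly_funs.mats_def by (auto intro: poly_funs.intros)

definition upoly_funs :: "('a::comm_ring_1 \<Rightarrow> 'a) set" where
  "upoly_funs = range poly"

interpretation upoly: function_ring upoly_funs
proof
  show "(\<lambda>_. c) \<in> upoly_funs" for c :: 'a
    unfolding upoly_funs_def by (rule range_eqI[of _ _ "[:c:]"]) auto
  show "(\<lambda>x. f x + g x) \<in> upoly_funs" "(\<lambda>x. f x * g x) \<in> upoly_funs"
    if "f \<in> upoly_funs" "g \<in> upoly_funs" for f g :: "'a \<Rightarrow> 'a"
    using that unfolding upoly_funs_def
    by (auto simp flip: poly_add poly_mult)
qed

lemma upoly_ident: "(\<lambda>u. u) \<in> upoly_funs"
  unfolding upoly_funs_def by (rule range_eqI[of _ _ "[:0, 1:]"]) auto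

lemma upoly_finite_zeros:
  fixes f :: "'a::idom \<Rightarrow> 'a"
  assumes "f \<in> upoly_funs" and "f v \<noteq> 0"
  shows "finite {u. f u = 0}"
proof -
  obtain p where p: "f = poly p" using assms(1) by (auto simp: upoly_funs_def)
  then have "p \<noteq> 0" using assms(2) by auto
  then show ?thesis unfolding p by (rule poly_roots_finite)
qed

lemma upoly_zero:
  fixes f :: "'a::idom \<Rightarrow> 'a"
  assumes "f \<in> upoly_funs" and "infinite {u. f u = 0}"
  shows "f v = 0"
  using upoly_finite_zeros assms by blast


section \<open>Closures and irreducibility in terms of polynomial functions\<close>

definition zcl :: "nat \<Rightarrow> ('a::idom mat \<times> 'a mat) set \<Rightarrow> ('a mat \<times> 'a mat) set" where
  "zcl n S = {p \<in> Mat n \<times> carrier_mat n n. \<forall>f\<in>poly_funs n. (\<forall>s\<in>S. f s = 0) \<longrightarrow> f p = 0}"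

lemma zclD: "p \<in> zcl n S \<Longrightarrow> f \<in> poly_funs n \<Longrightarrow> \<forall>s\<in>S. f s = 0 \<Longrightarrow> f p = 0"
  unfolding zcl_def by simp

lemma zcl_closed: "closedin (zariski n) (zcl n S)"
  unfolding closedin_zariski zcl_def
  by (rule exI[of _ "{f \<in> poly_funs n. \<forall>s\<in>S. f s = 0}"]) auto

lemma zcl_superset: "S \<subseteq> pairs n \<Longrightarrow> S \<subseteq> zcl n S"
  unfolding zcl_def by auto

lemma zcl_subset: "zcl n S \<subseteq> pairs n"
  unfolding zcl_def by auto

lemma zcl_minimal: "closedin (zariski n) C \<Longrightarrow> S \<subseteq> C \<Longrightarrow> zcl n S \<subseteq> C"
proof
  fix p assume C: "closedin (zariski n) C" and S: "S \<subseteq> C" and p: "p \<in> zcl n S"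
  obtain F where F: "F \<subseteq> poly_funs n" "C = {p \<in> Mat n \<times> carrier_mat n n. \<forall>f\<in>F. f p = 0}"
    using C unfolding closedin_zariski by blast
  show "p \<in> C" using p S F(1) unfolding F(2) zcl_def by blast
qed

lemma zcl_mono: "S \<subseteq> T \<Longrightarrow> zcl n S \<subseteq> zcl n T"
  unfolding zcl_def by blast

lemma zcl_zcl: "zcl n (zcl n S) = zcl n S"
  by (rule subset_antisym[OF zcl_minimal[OF zcl_closed order_refl] zcl_superset[OF zcl_subset]])

lemma zcl_least: "S \<subseteq> zcl n T \<Longrightarrow> zcl n S \<subseteq> zcl n T"
  by (rule zcl_minimal[OF zcl_closed])

lemma zcl_eq_closure_of:
  assumes "S \<subseteq> pairs n"
  shows "zariski n closure_of S = zcl n S"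
  by (intro subset_antisym closure_of_minimal zcl_minimal zcl_closed closedin_closure_of
      zcl_superset closure_of_subset) (use assms in auto)

lemma qpairs_subset: "qpairs q n \<subseteq> pairs n"
  unfolding qpairs_def by auto

lemma closedin_qpairs: "closedin (zariski n) (qpairs q n)"
proof -
  let ?f = "\<lambda>i j p. (proj1 n p * proj2 n p - q \<cdot>\<^sub>m (proj2 n p * proj1 n p)) $$ (i, j)"
  let ?F = "{?f i j | i j. i < n \<and> j < n}"
  have "?F \<subseteq> poly_funs n"
    by (auto intro!: poly_funs.mats_entry poly_funs.mats_minus poly_funs.mats_mult proj_mats
      poly_funs.mats_smult poly_funs.const)
  moreover have "qpairs q n = {p \<in> Mat n \<times> carrier_mat n n. \<forall>f\<in>?F. f p = 0}"
  proof -
    have "A * B = q \<cdot>\<^sub>m (B * A) \<longleftrightarrow> (\<forall>i<n. \<forall>j<n. ?f i j (A, B) = 0)"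
      if c: "A \<in> Mat n" "B \<in> Mat n" for A B
    proof -
      have "A * B = q \<cdot>\<^sub>m (B * A) \<longleftrightarrow> (\<forall>i<n. \<forall>j<n. (A * B) $$ (i, j) = (q \<cdot>\<^sub>m (B * A)) $$ (i, j))"
        using c by (auto simp: mat_eq_iff)
      also have "\<dots> \<longleftrightarrow> (\<forall>i<n. \<forall>j<n. ?f i j (A, B) = 0)"
        using c by (simp add: proj_eq)
      finally show ?thesis .
    qed
    then have "p \<in> qpairs q n \<longleftrightarrow> p \<in> pairs n \<and> (\<forall>i<n. \<forall>j<n. ?f i j p = 0)" for p
      by (cases p) (auto simp: qpairs_def)
    moreover have "(\<forall>f\<in>{g i j | i j. i < n \<and> j < n}. f p = 0) \<longleftrightarrow> (\<forall>i<n. \<forall>j<n. g i j p = 0)"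
      for g :: "nat \<Rightarrow> nat \<Rightarrow> 'a mat \<times> 'a mat \<Rightarrow> 'a" and p by blast
    ultimately have mem: "p \<in> qpairs q n \<longleftrightarrow> p \<in> pairs n \<and> (\<forall>f\<in>?F. f p = 0)" for p
      by presburger
    show ?thesis by (rule Set.set_eqI) (use mem in simp)
  qed
  ultimately show ?thesis unfolding closedin_zariski by blast
qed

lemma zcl_subset_qpairs: "S \<subseteq> qpairs q n \<Longrightarrow> zcl n S \<subseteq> qpairs q n"
  by (rule zcl_minimal[OF closedin_qpairs])

lemma qpairs_closure_of: "S \<subseteq> qpairs q n \<Longrightarrow> qpairs_top q n closure_of S = zcl n S"
  using closure_of_subtopology_open[of "zariski n" "qpairs q n" S]
    zcl_eq_closure_of[OF order_trans[OF _ qpairs_subset[of q]]] Int_absorb1[OF zcl_subset_qpairs]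
  unfolding qpairs_top_def by simp

text \<open>Continuity of the maps between matrix spaces that arise below.\<close>

lemma zcl_image:
  assumes x: "x \<in> zcl n S"
    and h: "\<And>f. f \<in> poly_funs m \<Longrightarrow> (\<lambda>p. f (h p)) \<in> poly_funs n"
    and c: "h x \<in> pairs m"
    and S: "\<And>s. s \<in> S \<Longrightarrow> h s \<in> zcl m T"
  shows "h x \<in> zcl m T"
  unfolding zcl_def
proof (intro CollectI conjI c ballI impI)
  fix f assume f: "f \<in> poly_funs m" "\<forall>s\<in>T. f s = 0"
  then have "\<forall>s\<in>S. f (h s) = 0" using zclD[OF S] by simp
  then show "f (h x) = 0" by (rule zclD[OF x h[OF f(1)]])
qed

text \<open>A polynomial curve that lies in a closed set for infinitely many values of the parameter lies
  in it altogether; this is how all degenerations are obtained.\<close>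

lemma zcl_curve:
  fixes S :: "('a::idom mat \<times> 'a mat) set"
  assumes A: "A \<in> upoly.mats n n" and B: "B \<in> upoly.mats n n"
    and inf: "infinite {u. (A u, B u) \<in> zcl n S}"
  shows "(A v, B v) \<in> zcl n S"
  unfolding zcl_def
proof (safe)
  show "A v \<in> Mat n" "B v \<in> Mat n"
    using A B upoly.mats_carrier by blast+
  fix f :: "'a mat \<times> 'a mat \<Rightarrow> 'a" assume f: "f \<in> poly_funs n" "\<forall>s\<in>S. f s = 0"
  have "{u. (A u, B u) \<in> zcl n S} \<subseteq> {u. f (A u, B u) = 0}"
    using f unfolding zcl_def by blast
  then show "f (A v, B v) = 0"
    using upoly_zero[OF upoly.poly_funs_comp[OF f(1) A B]] inf finite_subset by blast
qed

definition pirr :: "nat \<Rightarrow> ('a::idom mat \<times> 'a mat) set \<Rightarrow> bool" where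
  "pirr n Z \<longleftrightarrow> Z \<noteq> {} \<and> (\<forall>f\<in>poly_funs n. \<forall>g\<in>poly_funs n.
     (\<forall>z\<in>Z. f z * g z = 0) \<longrightarrow> (\<forall>z\<in>Z. f z = 0) \<or> (\<forall>z\<in>Z. g z = 0))"

lemma pirrD:
  "pirr n Z \<Longrightarrow> f \<in> poly_funs n \<Longrightarrow> g \<in> poly_funs n \<Longrightarrow> (\<And>z. z \<in> Z \<Longrightarrow> f z * g z = 0) \<Longrightarrow>
    (\<forall>z\<in>Z. f z = 0) \<or> (\<forall>z\<in>Z. g z = 0)"
  unfolding pirr_def by simp

lemma pirr_zcl:
  assumes S: "pirr n S" and c: "S \<subseteq> pairs n"
  shows "pirr n (zcl n S)"
  unfolding pirr_def
proof (intro conjI ballI impI)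
  have sub: "S \<subseteq> zcl n S" by (rule zcl_superset[OF c])
  then show "zcl n S \<noteq> {}" using S unfolding pirr_def by blast
  fix f g assume fg: "f \<in> poly_funs n" "g \<in> poly_funs n" "\<forall>z\<in>zcl n S. f z * g z = 0"
  then have "(\<forall>z\<in>S. f z = 0) \<or> (\<forall>z\<in>S. g z = 0)"
    using S sub unfolding pirr_def by blast
  then show "(\<forall>z\<in>zcl n S. f z = 0) \<or> (\<forall>z\<in>zcl n S. g z = 0)"
    using fg unfolding zcl_def by blast
qed

lemma irreducible_in_iff_pirr:
  assumes Z: "Z \<subseteq> Y" and Y: "Y \<subseteq> pairs n"
  shows "irreducible_in (subtopology (zariski n) Y) Z \<longleftrightarrow> pirr n Z"
proof -
  have st: "subtopology (subtopology (zariski n) Y) Z = subtopology (zariski n) Z"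
    using Z by (simp add: subtopology_subtopology Int_absorb1)
  have ts: "topspace (subtopology (zariski n) Z) = Z" using Z Y by auto
  have "irreducible_space (subtopology (zariski n) Z) \<longleftrightarrow> pirr n Z"
  proof
    assume irr: "irreducible_space (subtopology (zariski n) Z)"
    show "pirr n Z" unfolding pirr_def
    proof (intro conjI ballI impI)
      show "Z \<noteq> {}" using irr unfolding irreducible_space_def ts by blast
      have cl: "closedin (subtopology (zariski n) Z) {z \<in> Z. f z = 0}" if f: "f \<in> poly_funs n" for f
      proof -
        have "closedin (zariski n) {p \<in> pairs n. \<forall>g\<in>{f}. g p = 0}" unfolding closedin_zariski using f by blast
        moreover have "{z \<in> Z. f z = 0} = {p \<in> pairs n. \<forall>g\<in>{f}. g p = 0} \<inter> Z" using Z Y by blast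
        ultimately show ?thesis unfolding closedin_subtopology by blast
      qed
      fix f g assume fg: "f \<in> poly_funs n" "g \<in> poly_funs n" "\<forall>z\<in>Z. f z * g z = 0"
      have "{z \<in> Z. f z = 0} \<union> {z \<in> Z. g z = 0} = Z" using fg(3) by auto
      then have "{z \<in> Z. f z = 0} = Z \<or> {z \<in> Z. g z = 0} = Z"
        using irr cl[OF fg(1)] cl[OF fg(2)] unfolding irreducible_space_def ts by blast
      then show "(\<forall>z\<in>Z. f z = 0) \<or> (\<forall>z\<in>Z. g z = 0)" by blast
    qed
  next
    assume p: "pirr n Z"
    have sep: "\<exists>f\<in>poly_funs n. (\<forall>z\<in>C. f z = 0) \<and> (\<exists>z\<in>Z. f z \<noteq> 0)"
      if C: "closedin (subtopology (zariski n) Z) C" "C \<noteq> Z" for C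
    proof -
      obtain T where T: "closedin (zariski n) T" "C = T \<inter> Z" using C(1) unfolding closedin_subtopology by blast
      obtain F where F: "F \<subseteq> poly_funs n" "T = {p \<in> pairs n. \<forall>f\<in>F. f p = 0}"
        using T(1) unfolding closedin_zariski by (elim exE conjE)
      have "C = {z \<in> Z. \<forall>f\<in>F. f z = 0}" using Z Y unfolding T(2) F(2) by auto
      then show ?thesis using C(2) F(1) by blast
    qed
    show "irreducible_space (subtopology (zariski n) Z)" unfolding irreducible_space_def ts
    proof (intro conjI allI impI)
      show "Z \<noteq> {}" using p unfolding pirr_def by blast
      fix C D assume a: "closedin (subtopology (zariski n) Z) C \<and> closedin (subtopology (zariski n) Z) D \<and> C \<union> D = Z"
      show "C = Z \<or> D = Z"
      proof (rule ccontr)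
        assume "\<not> (C = Z \<or> D = Z)"
        then obtain f g where f: "f \<in> poly_funs n" "\<forall>z\<in>C. f z = 0" "\<exists>z\<in>Z. f z \<noteq> 0"
          and g: "g \<in> poly_funs n" "\<forall>z\<in>D. g z = 0" "\<exists>z\<in>Z. g z \<noteq> 0" using sep[of C] sep[of D] a by blast
        have "f z * g z = 0" if "z \<in> Z" for z using that a f(2) g(2) by (metis UnE mult_zero_left mult_zero_right)
        then show False using p f g unfolding pirr_def by blast
      qed
    qed
  qed
  then show ?thesis unfolding irreducible_in_def st using Z Y by auto
qed

lemma closedin_subtopology_zcl_iff:
  assumes "closedin (zariski n) Y"
  shows "closedin (subtopology (zariski n) Y) Z \<longleftrightarrow> Z \<subseteq> Y \<and> zcl n Z = Z"
proof -
  have Y: "Y \<subseteq> pairs n"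
    using closedin_subset[OF assms] by simp
  have "closedin (subtopology (zariski n) Y) Z \<longleftrightarrow> Z \<subseteq> Y \<and> closedin (zariski n) Z"
    using closedin_closed_subtopology[OF assms] by blast
  also have "\<dots> \<longleftrightarrow> Z \<subseteq> Y \<and> zcl n Z = Z"
    using zcl_closed[of n Z] zcl_minimal[OF _ order_refl, of n Z] zcl_superset[of Z n] Y
    by (metis order_trans subset_antisym)
  finally show ?thesis .
qed


section \<open>Linear systems\<close>

lemma underdetermined_system_nontrivial:
  fixes a :: "'e \<Rightarrow> 'm \<Rightarrow> 'a::field"
  assumes "finite M" "finite E" "card M < card E"
  shows "\<exists>c. (\<exists>e\<in>E. c e \<noteq> 0) \<and> (\<forall>m\<in>M. (\<Sum>e\<in>E. c e * a e m) = 0)"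
  using assms
proof (induction M arbitrary: E a rule: finite_induct)
  case empty
  then obtain e where "e \<in> E" by fastforce
  then show ?case by (intro exI[of _ "\<lambda>_. 1"]) auto
next
  case (insert m M)
  show ?case
  proof (cases "\<forall>e\<in>E. a e m = 0")
    case True
    obtain c where "\<exists>e\<in>E. c e \<noteq> 0" "\<forall>m\<in>M. (\<Sum>e\<in>E. c e * a e m) = 0"
      using insert.IH[of E a] insert.prems insert.hyps by auto
    then show ?thesis using True by (intro exI[of _ c]) auto
  next
    case False
    then obtain e0 where e0: "e0 \<in> E" "a e0 m \<noteq> 0" by blast
    define b where "b e k = a e k - a e0 k * a e m / a e0 m" for e k
    have "card M < card (E - {e0})" using insert.prems insert.hyps e0 by simp
    then obtain c where c: "\<exists>e\<in>E - {e0}. c e \<noteq> 0" "\<forall>k\<in>M. (\<Sum>e\<in>E - {e0}. c e * b e k) = 0"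
      using insert.IH[of "E - {e0}" b] insert.prems by auto
    define s where "s = (\<Sum>e\<in>E - {e0}. c e * a e m)"
    let ?c = "c(e0 := - s / a e0 m)"
    have tot: "(\<Sum>e\<in>E. ?c e * a e k) = (\<Sum>e\<in>E - {e0}. c e * a e k) - s / a e0 m * a e0 k" for k
    proof -
      have "(\<Sum>e\<in>E. ?c e * a e k) = ?c e0 * a e0 k + (\<Sum>e\<in>E - {e0}. ?c e * a e k)"
        using e0 insert.prems by (simp add: sum.remove)
      also have "(\<Sum>e\<in>E - {e0}. ?c e * a e k) = (\<Sum>e\<in>E - {e0}. c e * a e k)"
        by (rule sum.cong) auto
      finally show ?thesis by simp
    qed
    have "(\<Sum>e\<in>E. ?c e * a e k) = 0" if "k \<in> insert m M" for k
    proof (cases "k = m")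
      case True
      then show ?thesis using e0 tot[of m] unfolding s_def by (simp only: True) simp
    next
      case False
      then have "(\<Sum>e\<in>E - {e0}. c e * b e k) = 0" using c that by auto
      also have "(\<Sum>e\<in>E - {e0}. c e * b e k) =
          (\<Sum>e\<in>E - {e0}. c e * a e k) - (\<Sum>e\<in>E - {e0}. c e * a e m * (a e0 k / a e0 m))"
        unfolding b_def sum_subtractf[symmetric] by (rule sum.cong) (auto simp: algebra_simps)
      also have "(\<Sum>e\<in>E - {e0}. c e * a e m * (a e0 k / a e0 m)) = s / a e0 m * a e0 k"
        unfolding s_def sum_distrib_right[symmetric] by simp
      finally show ?thesis unfolding tot by simp
    qed
    moreover have "\<exists>e\<in>E. ?c e \<noteq> 0" using c(1) by auto
    ultimately show ?thesis by blast
  qed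
qed

text \<open>Having only the trivial solution is an open condition on the coefficients. Elimination of one
  unknown after the other produces a function detecting it near a given point.\<close>

lemma (in function_ring) trivial_kernel_open:
  fixes x0 :: 'x and a :: "'e \<Rightarrow> 'j \<Rightarrow> 'x \<Rightarrow> 'a"
  assumes dom: "\<And>u v :: 'a. u * v = 0 \<Longrightarrow> u = 0 \<or> v = 0"
    and inv: "\<And>u::'a. u \<noteq> 0 \<Longrightarrow> \<exists>v. u * v = 1"
    and "finite J" "\<And>e j. e \<in> E \<Longrightarrow> j \<in> J \<Longrightarrow> a e j \<in> R"
    and "\<And>z. (\<And>e. e \<in> E \<Longrightarrow> (\<Sum>j\<in>J. a e j x0 * z j) = 0) \<Longrightarrow> \<forall>j\<in>J. z j = 0"
  shows "\<exists>P\<in>R. P x0 \<noteq> 0 \<and> (\<forall>x. P x \<noteq> 0 \<longrightarrow>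
     (\<forall>z. (\<forall>e\<in>E. (\<Sum>j\<in>J. a e j x * z j) = 0) \<longrightarrow> (\<forall>j\<in>J. z j = 0)))"
  using assms(3-)
proof (induction J arbitrary: a rule: finite_induct)
  case empty
  then show ?case by (intro bexI[of _ "\<lambda>_. 1"]) (auto simp: const)
next
  case (insert j0 J)
  have "\<exists>e0\<in>E. a e0 j0 x0 \<noteq> 0"
  proof (rule ccontr)
    assume c: "\<not> (\<exists>e0\<in>E. a e0 j0 x0 \<noteq> 0)"
    let ?z = "\<lambda>j. if j = j0 then 1 else 0 :: 'a"
    have "(\<Sum>j\<in>insert j0 J. a e j x0 * ?z j) = 0" if "e \<in> E" for e
      using c that insert.hyps by (auto intro!: sum.neutral)
    from insert.prems(2)[of ?z, OF this] show False by auto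
  qed
  then obtain e0 where e0: "e0 \<in> E" "a e0 j0 x0 \<noteq> 0" by blast
  define b where "b e j x = a e0 j0 x * a e j x - a e j0 x * a e0 j x" for e j x
  have bR: "b e j \<in> R" if "e \<in> E" "j \<in> J" for e j
    using that e0 insert.prems(1) unfolding b_def by (intro diff mult) auto
  have key: "(\<Sum>j\<in>J. b e j x * z j) = a e0 j0 x * (\<Sum>j\<in>J. a e j x * z j) - a e j0 x * (\<Sum>j\<in>J. a e0 j x * z j)"
    for e x z
    unfolding b_def sum_distrib_left sum_subtractf[symmetric] by (rule sum.cong) (auto simp: algebra_simps)
  have "\<forall>j\<in>J. z j = 0" if z: "\<And>e. e \<in> E \<Longrightarrow> (\<Sum>j\<in>J. b e j x0 * z j) = 0" for z
  proof -
    obtain v where v: "a e0 j0 x0 * v = 1" using inv e0(2) by blast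
    define s where "s = - v * (\<Sum>j\<in>J. a e0 j x0 * z j)"
    have s: "a e0 j0 x0 * s = - (\<Sum>j\<in>J. a e0 j x0 * z j)"
      unfolding s_def using v by (metis (no_types, lifting) mult.assoc mult_1 mult_minus_left mult_minus_right)
    have J: "(\<Sum>j\<in>J. a e j x0 * (z(j0 := s)) j) = (\<Sum>j\<in>J. a e j x0 * z j)" for e
      using insert.hyps by (intro sum.cong) auto
    have "(\<Sum>j\<in>insert j0 J. a e j x0 * (z(j0 := s)) j) = 0" if e: "e \<in> E" for e
    proof -
      have "a e0 j0 x0 * (\<Sum>j\<in>insert j0 J. a e j x0 * (z(j0 := s)) j) =
          a e j0 x0 * (a e0 j0 x0 * s) + a e0 j0 x0 * (\<Sum>j\<in>J. a e j x0 * z j)"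
        using insert.hyps J by (simp add: algebra_simps)
      also have "\<dots> = 0" using z[OF e] unfolding key s by (simp add: algebra_simps)
      finally show ?thesis using e0(2) dom by blast
    qed
    from insert.prems(2)[of "z(j0 := s)", OF this] show ?thesis
      using insert.hyps by (metis fun_upd_other insertCI)
  qed
  from insert.IH[of b, OF bR this] obtain P where P: "P \<in> R" "P x0 \<noteq> 0"
    "\<And>x z. P x \<noteq> 0 \<Longrightarrow> (\<forall>e\<in>E. (\<Sum>j\<in>J. b e j x * z j) = 0) \<Longrightarrow> \<forall>j\<in>J. z j = 0" by blast
  show ?case
  proof (intro bexI[of _ "\<lambda>x. a e0 j0 x * P x"] conjI allI impI)
    show "(\<lambda>x. a e0 j0 x * P x) \<in> R" using P(1) e0 insert.prems(1) by (intro mult) auto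
    show "a e0 j0 x0 * P x0 \<noteq> 0" using P(2) e0(2) dom by blast
    fix x z assume nz: "a e0 j0 x * P x \<noteq> 0"
      and z: "\<forall>e\<in>E. (\<Sum>j\<in>insert j0 J. a e j x * z j) = 0"
    have sp: "a e j0 x * z j0 + (\<Sum>j\<in>J. a e j x * z j) = 0" if "e \<in> E" for e
      using z that insert.hyps by auto
    have "(\<Sum>j\<in>J. b e j x * z j) = 0" if e: "e \<in> E" for e
    proof -
      have "(\<Sum>j\<in>J. a e j x * z j) = - (a e j0 x * z j0)"
        "(\<Sum>j\<in>J. a e0 j x * z j) = - (a e0 j0 x * z j0)"
        using sp[OF e] sp[OF e0(1)] by (metis add_eq_0_iff)+
      then show ?thesis unfolding key by (simp add: algebra_simps)
    qed
    then have J: "\<forall>j\<in>J. z j = 0" using P(3)[of x z] nz by (metis mult_zero_right)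
    then have "(\<Sum>j\<in>J. a e0 j x * z j) = 0" by (intro sum.neutral) auto
    then have "a e0 j0 x * z j0 = 0" using sp[OF e0(1)] by simp
    then have "z j0 = 0" using nz dom[of "a e0 j0 x" "z j0"] by auto
    then show "\<forall>j\<in>insert j0 J. z j = 0" using J by auto
  qed
qed

section \<open>Polynomial functions on a parameter space\<close>

definition box_funs :: "'i set \<Rightarrow> nat \<Rightarrow> (('i \<Rightarrow> 'a::comm_ring_1) \<Rightarrow> 'a) set" where
  "box_funs I D = {f. \<exists>c. \<forall>T. f T = (\<Sum>e\<in>I \<rightarrow>\<^sub>E {..D}. c e * (\<Prod>i\<in>I. T i ^ e i))}"

lemma box_funs_monom:
  fixes k :: "'b::comm_ring_1"
  assumes "finite I" and e: "\<And>i. i \<in> I \<Longrightarrow> e i \<le> D"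
  shows "(\<lambda>T. k * (\<Prod>i\<in>I. T i ^ e i)) \<in> box_funs I D"
proof -
  let ?E = "I \<rightarrow>\<^sub>E {..D}" and ?e = "restrict e I"
  have "?e \<in> ?E" and fin: "finite ?E" using assms by (auto intro: finite_PiE)
  moreover have "(\<Prod>i\<in>I. T i ^ ?e i) = (\<Prod>i\<in>I. T i ^ e i)" for T :: "_ \<Rightarrow> 'b"
    by (rule prod.cong) auto
  ultimately have "k * (\<Prod>i\<in>I. T i ^ e i) = (\<Sum>e'\<in>?E. (if e' = ?e then k else 0) * (\<Prod>i\<in>I. T i ^ e' i))"
    for T
    by (subst sum.remove[of _ ?e]) (auto intro: sum.neutral)
  then show ?thesis unfolding box_funs_def by (auto intro!: exI[of _ "\<lambda>e'. if e' = ?e then k else 0"])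
qed

lemma box_funs_add: "f \<in> box_funs I D \<Longrightarrow> g \<in> box_funs I D \<Longrightarrow> (\<lambda>T. f T + g T) \<in> box_funs I D"
proof -
  assume "f \<in> box_funs I D" "g \<in> box_funs I D"
  then obtain c d where c: "\<And>T. f T = (\<Sum>e\<in>I \<rightarrow>\<^sub>E {..D}. c e * (\<Prod>i\<in>I. T i ^ e i))"
    and d: "\<And>T. g T = (\<Sum>e\<in>I \<rightarrow>\<^sub>E {..D}. d e * (\<Prod>i\<in>I. T i ^ e i))"
    unfolding box_funs_def by blast
  have "f T + g T = (\<Sum>e\<in>I \<rightarrow>\<^sub>E {..D}. (c e + d e) * (\<Prod>i\<in>I. T i ^ e i))" for T
    unfolding c d by (simp add: sum.distrib algebra_simps)
  then show ?thesis unfolding box_funs_def by (intro CollectI exI[of _ "\<lambda>e. c e + d e"] allI)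
qed

lemma box_funs_zero: "(\<lambda>_. 0) \<in> box_funs I D"
  unfolding box_funs_def by (auto intro!: exI[of _ "\<lambda>_. 0"])

lemma box_funs_sum: "(\<And>x. x \<in> X \<Longrightarrow> f x \<in> box_funs I D) \<Longrightarrow> (\<lambda>T. \<Sum>x\<in>X. f x T) \<in> box_funs I D"
  by (induction X rule: infinite_finite_induct) (simp_all add: box_funs_add box_funs_zero)

lemma box_funs_mult:
  assumes I: "finite I" and f: "f \<in> box_funs I D" and g: "g \<in> box_funs I D'"
  shows "(\<lambda>T. f T * g T) \<in> box_funs I (D + D')"
proof -
  obtain c d where c: "\<And>T. f T = (\<Sum>e\<in>I \<rightarrow>\<^sub>E {..D}. c e * (\<Prod>i\<in>I. T i ^ e i))"
    and d: "\<And>T. g T = (\<Sum>e\<in>I \<rightarrow>\<^sub>E {..D'}. d e * (\<Prod>i\<in>I. T i ^ e i))"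
    using f g unfolding box_funs_def by blast
  have "f T * g T = (\<Sum>e\<in>I \<rightarrow>\<^sub>E {..D}. \<Sum>e'\<in>I \<rightarrow>\<^sub>E {..D'}. c e * d e' * (\<Prod>i\<in>I. T i ^ (e i + e' i)))" for T
    unfolding c d sum_product
    by (intro sum.cong refl) (simp add: power_add prod.distrib algebra_simps)
  moreover have "(\<lambda>T. \<Sum>e\<in>I \<rightarrow>\<^sub>E {..D}. \<Sum>e'\<in>I \<rightarrow>\<^sub>E {..D'}. c e * d e' * (\<Prod>i\<in>I. T i ^ (e i + e' i)))
      \<in> box_funs I (D + D')"
    by (intro box_funs_sum box_funs_monom I add_mono) (auto simp: PiE_iff)
  ultimately show ?thesis by simp
qed

lemma box_funs_const: "finite I \<Longrightarrow> (\<lambda>_. c) \<in> box_funs I D"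
  using box_funs_monom[of I "\<lambda>_. 0" D c] by simp

lemma box_funs_mono:
  assumes "finite I" "f \<in> box_funs I D" "D \<le> D'"
  shows "f \<in> box_funs I D'"
  using box_funs_mult[OF assms(1,2) box_funs_const[OF assms(1), of 1 "D' - D"]] assms(3) by simp

lemma box_funs_power: "finite I \<Longrightarrow> f \<in> box_funs I D \<Longrightarrow> (\<lambda>T. f T ^ k) \<in> box_funs I (k * D)"
  by (induction k) (simp_all add: box_funs_const box_funs_mult)

lemma box_funs_prod:
  assumes "finite I" "finite X" "\<And>x. x \<in> X \<Longrightarrow> f x \<in> box_funs I D"
  shows "(\<lambda>T. \<Prod>x\<in>X. f x T) \<in> box_funs I (card X * D)"
  using assms(2,3)
proof (induction X rule: finite_induct)
  case (insert x X)
  then have "(\<lambda>T. f x T * (\<Prod>x\<in>X. f x T)) \<in> box_funs I (D + card X * D)"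
    by (intro box_funs_mult assms(1)) auto
  then show ?case using insert by simp
qed (simp add: box_funs_const assms(1))

definition par_funs :: "'i set \<Rightarrow> (('i \<Rightarrow> 'a::comm_ring_1) \<Rightarrow> 'a) set" where
  "par_funs I = (\<Union>D. box_funs I D)"

lemma par_funs_ring: "finite I \<Longrightarrow> function_ring (par_funs I)"
proof
  assume I: "finite I"
  show "(\<lambda>_. c) \<in> par_funs I" for c :: 'b unfolding par_funs_def using box_funs_const[OF I] by blast
  fix f g :: "('a \<Rightarrow> 'b) \<Rightarrow> 'b" assume "f \<in> par_funs I" "g \<in> par_funs I"
  then obtain D D' where fg: "f \<in> box_funs I D" "g \<in> box_funs I D'" unfolding par_funs_def by blast
  have "f \<in> box_funs I (D + D')" "g \<in> box_funs I (D + D')"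
    by (rule box_funs_mono[OF I fg(1)], simp) (rule box_funs_mono[OF I fg(2)], simp)
  then show "(\<lambda>x. f x + g x) \<in> par_funs I" unfolding par_funs_def using box_funs_add by blast
  show "(\<lambda>x. f x * g x) \<in> par_funs I" unfolding par_funs_def using box_funs_mult[OF I fg] by blast
qed

lemma par_funs_coord:
  fixes i :: 'i
  assumes "finite I" "i \<in> I"
  shows "(\<lambda>T :: 'i \<Rightarrow> 'b::comm_ring_1. T i) \<in> par_funs I"
proof -
  have "(\<Prod>j\<in>I. T j ^ (if j = i then 1 else 0)) = T i" for T :: "'i \<Rightarrow> 'b"
    using assms by (subst prod.remove[of _ i]) auto
  moreover have le: "\<And>j. j \<in> I \<Longrightarrow> (if j = i then 1 else 0) \<le> (1::nat)" by simp
  ultimately have "(\<lambda>T :: 'i \<Rightarrow> 'b. T i) \<in> box_funs I 1"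
    using box_funs_monom[of I "\<lambda>j. if j = i then 1 else 0" 1 "1::'b", OF assms(1) le] by simp
  then show ?thesis unfolding par_funs_def by blast
qed

lemma par_funs_line:
  assumes "f \<in> par_funs I"
  shows "(\<lambda>u. f (\<lambda>i. S i + u * (T i - S i))) \<in> upoly_funs"
proof -
  obtain D c where c: "\<And>T. f T = (\<Sum>e\<in>I \<rightarrow>\<^sub>E {..D}. c e * (\<Prod>i\<in>I. T i ^ e i))"
    using assms unfolding par_funs_def box_funs_def by blast
  show ?thesis unfolding c
    by (intro upoly.sum upoly.mult upoly.const upoly.prod upoly.power upoly.add upoly_ident)
qed


section \<open>Rationally parametrised families\<close>

lemma (in function_ring) clear_denominators:
  assumes d: "d \<in> R"
    and A: "\<And>i j. i < n \<Longrightarrow> j < n \<Longrightarrow> \<exists>p\<in>R. \<forall>x. d x \<noteq> 0 \<longrightarrow> d x * fst (Phi x) $$ (i, j) = p x"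
    and B: "\<And>i j. i < n \<Longrightarrow> j < n \<Longrightarrow> \<exists>p\<in>R. \<forall>x. d x \<noteq> 0 \<longrightarrow> d x * snd (Phi x) $$ (i, j) = p x"
    and f: "f \<in> poly_funs n"
  shows "\<exists>c. \<exists>p\<in>R. \<forall>x. d x \<noteq> 0 \<longrightarrow> d x ^ c * f (Phi x) = p x"
  using f
proof induction
  case (const c)
  then show ?case by (intro exI[of _ 0] bexI[of _ "\<lambda>_. c"]) (auto simp: function_ring.const[OF function_ring_axioms])
next
  case (fst_entry i j)
  then show ?case using A[of i j] by (intro exI[of _ 1]) simp
next
  case (snd_entry i j)
  then show ?case using B[of i j] by (intro exI[of _ 1]) simp
next
  case (add f g)
  then obtain c1 p1 c2 p2 where p: "p1 \<in> R" "p2 \<in> R"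
    "\<And>x. d x \<noteq> 0 \<Longrightarrow> d x ^ c1 * f (Phi x) = p1 x" "\<And>x. d x \<noteq> 0 \<Longrightarrow> d x ^ c2 * g (Phi x) = p2 x" by blast
  have "d x ^ (c1 + c2) * (f (Phi x) + g (Phi x)) = d x ^ c2 * p1 x + d x ^ c1 * p2 x" if "d x \<noteq> 0" for x
    using p(3,4)[OF that] by (simp add: power_add algebra_simps flip: p(3,4)[OF that])
  moreover have "(\<lambda>x. d x ^ c2 * p1 x + d x ^ c1 * p2 x) \<in> R"
    by (rule function_ring.add[OF function_ring_axioms function_ring.mult[OF function_ring_axioms power[OF d] p(1)]
          function_ring.mult[OF function_ring_axioms power[OF d] p(2)]])
  ultimately show ?case
    by (intro exI[of _ "c1 + c2"] bexI[of _ "\<lambda>x. d x ^ c2 * p1 x + d x ^ c1 * p2 x"]) auto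
next
  case (mult f g)
  then obtain c1 p1 c2 p2 where p: "p1 \<in> R" "p2 \<in> R"
    "\<And>x. d x \<noteq> 0 \<Longrightarrow> d x ^ c1 * f (Phi x) = p1 x" "\<And>x. d x \<noteq> 0 \<Longrightarrow> d x ^ c2 * g (Phi x) = p2 x" by blast
  have "d x ^ (c1 + c2) * (f (Phi x) * g (Phi x)) = p1 x * p2 x" if "d x \<noteq> 0" for x
    by (simp add: power_add algebra_simps flip: p(3,4)[OF that])
  moreover have "(\<lambda>x. p1 x * p2 x) \<in> R"
    by (intro function_ring.mult[OF function_ring_axioms] p(1,2))
  ultimately show ?case
    by (intro exI[of _ "c1 + c2"] bexI[of _ "\<lambda>x. p1 x * p2 x"]) auto
qed

text \<open>A rational map from affine space with coordinates \<open>I\<close> to pairs of matrices; the denominator is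
  a power of \<open>d\<close>.\<close>

locale param_family =
  fixes n :: nat and I :: "'i set" and d :: "('i \<Rightarrow> 'a::field_char_0) \<Rightarrow> 'a"
    and Phi :: "('i \<Rightarrow> 'a) \<Rightarrow> 'a mat \<times> 'a mat"
  assumes finI: "finite I" and d: "d \<in> par_funs I"
    and carr: "d T \<noteq> 0 \<Longrightarrow> Phi T \<in> pairs n"
    and clear: "f \<in> poly_funs n \<Longrightarrow> \<exists>c. \<exists>p\<in>par_funs I. \<forall>T. d T \<noteq> 0 \<longrightarrow> d T ^ c * f (Phi T) = p T"
begin

sublocale par: function_ring "par_funs I :: (('i \<Rightarrow> 'a) \<Rightarrow> 'a) set"
  by (rule par_funs_ring[OF finI])

text \<open>On the line through two parameter values, both functions become polynomials in one variable.\<close>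

lemma pirr_slice:
  assumes lin: "\<And>S T u. S \<in> X \<Longrightarrow> T \<in> X \<Longrightarrow> (\<lambda>i. S i + u * (T i - S i)) \<in> X"
    and ne: "T0 \<in> X" "d T0 \<noteq> 0"
  shows "pirr n (Phi ` {T \<in> X. d T \<noteq> 0})"
  unfolding pirr_def
proof (intro conjI ballI impI)
  show "Phi ` {T \<in> X. d T \<noteq> 0} \<noteq> {}" using ne by blast
  fix f g assume fg: "f \<in> poly_funs n" "g \<in> poly_funs n" "\<forall>z\<in>Phi ` {T \<in> X. d T \<noteq> 0}. f z * g z = 0"
  obtain cf pf where pf: "pf \<in> par_funs I" "\<And>T. d T \<noteq> 0 \<Longrightarrow> d T ^ cf * f (Phi T) = pf T"
    using clear[OF fg(1)] by blast
  obtain cg pg where pg: "pg \<in> par_funs I" "\<And>T. d T \<noteq> 0 \<Longrightarrow> d T ^ cg * g (Phi T) = pg T"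
    using clear[OF fg(2)] by blast
  show "(\<forall>z\<in>Phi ` {T \<in> X. d T \<noteq> 0}. f z = 0) \<or> (\<forall>z\<in>Phi ` {T \<in> X. d T \<noteq> 0}. g z = 0)"
  proof (rule ccontr)
    assume "\<not> ?thesis"
    then obtain S T where S: "S \<in> X" "d S \<noteq> 0" "f (Phi S) \<noteq> 0" and T: "T \<in> X" "d T \<noteq> 0" "g (Phi T) \<noteq> 0"
      by blast
    let ?L = "\<lambda>u i. S i + u * (T i - S i)"
    have L0: "?L 0 = S" and L1: "?L 1 = T" by auto
    let ?a = "\<lambda>u. d (?L u) * pf (?L u)" and ?b = "\<lambda>u. pg (?L u)"
    have a: "?a \<in> upoly_funs" "?b \<in> upoly_funs"
      using par_funs_line[OF d] par_funs_line[OF pf(1)] par_funs_line[OF pg(1)]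
      by (auto intro: upoly.mult)
    have "?a 0 \<noteq> 0" unfolding L0 using S pf(2)[of S] by auto
    then have f1: "finite {u. ?a u = 0}" by (rule upoly_finite_zeros[OF a(1)])
    have "?b 1 \<noteq> 0" unfolding L1 using T pg(2)[of T] by auto
    then have f2: "finite {u. ?b u = 0}" by (rule upoly_finite_zeros[OF a(2)])
    have "\<exists>u. u \<notin> {u. ?a u = 0} \<union> {u. ?b u = 0}"
      using ex_new_if_finite[OF infinite_UNIV_char_0, of "{u. ?a u = 0} \<union> {u. ?b u = 0}"] f1 f2 by blast
    then obtain u where u: "?a u \<noteq> 0" "?b u \<noteq> 0" by blast
    have LX: "?L u \<in> X" using lin S T by blast
    have dn: "d (?L u) \<noteq> 0" using u by auto
    have "f (Phi (?L u)) \<noteq> 0" "g (Phi (?L u)) \<noteq> 0" using pf(2)[OF dn] pg(2)[OF dn] u by auto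
    then show False using fg(3) LX dn by auto
  qed
qed

end


section \<open>Chains of irreducible sets and algebraic independence\<close>

text \<open>Functions cutting out the successive members of a chain satisfy no polynomial relation on its
  top: restricted to the last but one member, a relation loses all terms involving the last function,
  and irreducibility permits division by it.\<close>

lemma chain_algebraically_independent:
  fixes Z :: "nat \<Rightarrow> ('a::idom mat \<times> 'a mat) set"
  assumes f: "\<And>j. j < k \<Longrightarrow> f j \<in> poly_funs n"
    and van: "\<And>j z. j < k \<Longrightarrow> z \<in> Z j \<Longrightarrow> f j z = 0"
    and nz: "\<And>j. j < k \<Longrightarrow> \<exists>z\<in>Z (Suc j). f j z \<noteq> 0"
    and irr: "\<And>j. j \<le> k \<Longrightarrow> pirr n (Z j)"
    and sub: "\<And>j. j < k \<Longrightarrow> Z j \<subseteq> Z (Suc j)"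
    and rel: "\<And>z. z \<in> Z k \<Longrightarrow> (\<Sum>e\<in>{..<k} \<rightarrow>\<^sub>E {..D}. c e * (\<Prod>j<k. f j z ^ e j)) = 0"
    and e: "e \<in> {..<k} \<rightarrow>\<^sub>E {..D::nat}"
  shows "c e = 0"
  using assms
proof (induction k arbitrary: c e)
  case 0
  obtain z where "z \<in> Z 0" using "0.prems"(4)[of 0] unfolding pirr_def by auto
  from "0.prems"(6)[OF this] "0.prems"(7) show ?case by simp
next
  case (Suc k)
  let ?E = "{..<k} \<rightarrow>\<^sub>E {..D}"
  have fin: "finite ?E" by (intro finite_PiE) auto
  define G where "G s z = (\<Sum>e\<in>?E. c (e(k := s)) * (\<Prod>j<k. f j z ^ e j))" for s z
  have inj: "inj_on (\<lambda>(y, g). g(k := y)) ({..D} \<times> ?E)" by (rule inj_combinator) simp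
  have split: "(\<Sum>e\<in>{..<Suc k} \<rightarrow>\<^sub>E {..D}. c e * (\<Prod>j<Suc k. f j z ^ e j)) = (\<Sum>s\<le>D. f k z ^ s * G s z)" for z
  proof -
    have "(\<Sum>e\<in>{..<Suc k} \<rightarrow>\<^sub>E {..D}. c e * (\<Prod>j<Suc k. f j z ^ e j)) =
       (\<Sum>(s, e)\<in>{..D} \<times> ?E. c (e(k := s)) * (\<Prod>j<Suc k. f j z ^ (e(k := s)) j))"
      unfolding lessThan_Suc[of k] PiE_insert_eq sum.reindex[OF inj] by (simp only: o_def case_prod_unfold)
    also have "\<dots> = (\<Sum>s\<le>D. \<Sum>e\<in>?E. c (e(k := s)) * (\<Prod>j<Suc k. f j z ^ (e(k := s)) j))"
      by (rule sum.cartesian_product[symmetric])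
    also have "\<dots> = (\<Sum>s\<le>D. f k z ^ s * G s z)"
      unfolding G_def sum_distrib_left
    proof (intro sum.cong refl)
      fix s e
      have "(\<Prod>j<k. f j z ^ (e(k := s)) j) = (\<Prod>j<k. f j z ^ e j)" by (rule prod.cong) auto
      then show "c (e(k := s)) * (\<Prod>j<Suc k. f j z ^ (e(k := s)) j) = f k z ^ s * (c (e(k := s)) * (\<Prod>j<k. f j z ^ e j))"
        by (simp add: algebra_simps)
    qed
    finally show ?thesis .
  qed
  have GR: "G s \<in> poly_funs n" for s
    unfolding G_def using Suc.prems(1)
    by (intro poly_funs.sum poly_funs.mult poly_funs.const poly_funs.prod poly_funs.power) auto
  have main: "c (e(k := s)) = 0" if "s \<le> D" "e \<in> ?E" for s e
    using that
  proof (induction s arbitrary: e rule: less_induct)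
    case (less s)
    define H where "H z = (\<Sum>t\<in>{s..D}. f k z ^ (t - s) * G t z)" for z
    have HR: "H \<in> poly_funs n" unfolding H_def using Suc.prems(1) GR
      by (intro poly_funs.sum poly_funs.mult poly_funs.power) auto
    have "f k z ^ s * H z = 0" if z: "z \<in> Z (Suc k)" for z
    proof -
      have "G t z = 0" if "t < s" for t
        unfolding G_def using less.IH[OF that] less.prems that
        by (intro sum.neutral ballI) (simp del: fun_upd_apply)
      then have "(\<Sum>t\<le>D. f k z ^ t * G t z) = (\<Sum>t\<in>{s..D}. f k z ^ t * G t z)"
        by (intro sum.mono_neutral_right) auto
      also have "\<dots> = f k z ^ s * H z"
        unfolding H_def sum_distrib_left
        by (intro sum.cong refl) (auto simp: power_add[symmetric] mult.assoc[symmetric])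
      finally show ?thesis using Suc.prems(6)[OF z] split by simp
    qed
    moreover have "\<not> (\<forall>z\<in>Z (Suc k). f k z ^ s = 0)" using Suc.prems(3)[of k] by auto
    moreover have "(\<lambda>z. f k z ^ s) \<in> poly_funs n" using Suc.prems(1) by (intro poly_funs.power) auto
    ultimately have H0: "\<forall>z\<in>Z (Suc k). H z = 0"
      using pirrD[OF Suc.prems(4)[of "Suc k"], of "\<lambda>z. f k z ^ s" H] HR by blast
    have "G s z = 0" if z: "z \<in> Z k" for z
    proof -
      have "H z = f k z ^ (s - s) * G s z + (\<Sum>t\<in>{s..D} - {s}. f k z ^ (t - s) * G t z)"
        unfolding H_def using less.prems by (subst sum.remove[of _ s]) auto
      also have "(\<Sum>t\<in>{s..D} - {s}. f k z ^ (t - s) * G t z) = 0"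
        using Suc.prems(2)[of k z] z by (intro sum.neutral) auto
      finally show ?thesis using H0 Suc.prems(5)[of k] z by auto
    qed
    then show ?case
      using Suc.IH[of "\<lambda>e. c (e(k := s))" e] Suc.prems(1-5) less.prems unfolding G_def by (simp del: fun_upd_apply)
  qed
  have "e \<in> (\<lambda>(y, g). g(k := y)) ` ({..D} \<times> ?E)"
    using Suc.prems(7) unfolding lessThan_Suc PiE_insert_eq by auto
  then obtain s e' where "e = e'(k := s)" "s \<le> D" "e' \<in> ?E" by auto
  then show ?case using main by blast
qed

text \<open>Conversely, more functions than parameters always satisfy a relation: up to a common denominator,
  the monomials of degree at most \<open>D\<close> in each of \<open>c + 1\<close> functions of \<open>c\<close> parameters number \<open>(D + 1)\<^bsup>c + 1\<^esup>\<close>, but lie in a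
  space of dimension \<open>O(D\<^bsup>c\<^esup>)\<close>.\<close>

lemma (in param_family) more_functions_than_parameters_dependent:
  assumes f: "\<And>j. j < Suc (card I) \<Longrightarrow> f j \<in> poly_funs n"
  shows "\<exists>D c. (\<exists>e\<in>{..<Suc (card I)} \<rightarrow>\<^sub>E {..D}. c e \<noteq> 0) \<and> (\<forall>T. d T \<noteq> 0 \<longrightarrow>
      (\<Sum>e\<in>{..<Suc (card I)} \<rightarrow>\<^sub>E {..D}. c e * (\<Prod>j<Suc (card I). f j (Phi T) ^ e j)) = 0)"
proof -
  let ?k = "Suc (card I)"
  have "\<exists>cj pj. pj \<in> par_funs I \<and> (\<forall>T. d T \<noteq> 0 \<longrightarrow> d T ^ cj * f j (Phi T) = pj T)" if "j < ?k" for j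
    using clear[OF f[OF that]] by blast
  then obtain cj pj where cp: "\<And>j. j < ?k \<Longrightarrow> pj j \<in> par_funs I"
    "\<And>j T. j < ?k \<Longrightarrow> d T \<noteq> 0 \<Longrightarrow> d T ^ cj j * f j (Phi T) = pj j T"
    by metis
  define C where "C = Max (cj ` {..<?k})"
  have C: "cj j \<le> C" if "j < ?k" for j unfolding C_def using that by (intro Max_ge) auto
  define p where "p j T = d T ^ (C - cj j) * pj j T" for j T
  have p: "p j \<in> par_funs I" "\<And>T. d T \<noteq> 0 \<Longrightarrow> d T ^ C * f j (Phi T) = p j T" if "j < ?k" for j
  proof -
    show "p j \<in> par_funs I" unfolding p_def using cp that by (intro par.mult par.power d) auto
    show "d T ^ C * f j (Phi T) = p j T" if dT: "d T \<noteq> 0" for T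
      unfolding p_def cp(2)[OF \<open>j < ?k\<close> dT, symmetric] mult.assoc[symmetric] power_add[symmetric]
      using C[OF \<open>j < ?k\<close>] by simp
  qed
  have "\<forall>j<?k. \<exists>e. p j \<in> box_funs I e" using p(1) unfolding par_funs_def by blast
  then obtain Ej where Ej: "\<And>j. j < ?k \<Longrightarrow> p j \<in> box_funs I (Ej j)" by metis
  have "(\<lambda>T. d T ^ C) \<in> par_funs I" by (intro par.power d)
  then obtain E0 where E0: "(\<lambda>T. d T ^ C) \<in> box_funs I E0" unfolding par_funs_def by blast
  define E where "E = Max (insert E0 (Ej ` {..<?k}))"
  have E: "(\<lambda>T. d T ^ C) \<in> box_funs I E" "\<And>j. j < ?k \<Longrightarrow> p j \<in> box_funs I E"
    using box_funs_mono[OF finI E0, of E] box_funs_mono[OF finI Ej, of _ E] unfolding E_def by (auto intro: Max_ge)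
  define D where "D = (?k * E + 1) ^ card I"
  define M where "M = I \<rightarrow>\<^sub>E {..?k * (D * E)}"
  let ?E = "{..<?k} \<rightarrow>\<^sub>E {..D}"
  define Q where "Q e T = (\<Prod>j<?k. p j T ^ e j * (d T ^ C) ^ (D - e j))" for e T
  have "Q e \<in> box_funs I (?k * (D * E))" if e: "e \<in> ?E" for e
  proof -
    have "(\<lambda>T. p j T ^ e j * (d T ^ C) ^ (D - e j)) \<in> box_funs I (D * E)" if j: "j \<in> {..<?k}" for j
    proof -
      have "e j \<le> D" using e j by auto
      then have "e j * E + (D - e j) * E = D * E" by (metis add_mult_distrib le_add_diff_inverse)
      then show ?thesis
        using box_funs_mult[OF finI box_funs_power[OF finI E(2)] box_funs_power[OF finI E(1)], of j "e j" "D - e j"] j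
        by simp
    qed
    from box_funs_prod[OF finI finite_lessThan this] show ?thesis unfolding Q_def card_lessThan .
  qed
  then have "\<forall>e\<in>?E. \<exists>a. \<forall>T. Q e T = (\<Sum>m\<in>M. a m * (\<Prod>i\<in>I. T i ^ m i))"
    unfolding box_funs_def M_def by blast
  from bchoice[OF this] obtain a where
    a: "\<And>e T. e \<in> ?E \<Longrightarrow> Q e T = (\<Sum>m\<in>M. a e m * (\<Prod>i\<in>I. T i ^ m i))" by blast
  have fM: "finite M" and fE: "finite ?E" unfolding M_def using finI by (auto intro!: finite_PiE)
  have cM: "card M = (?k * (D * E) + 1) ^ card I" unfolding M_def using finI by (simp add: card_PiE)
  have cE: "card ?E = (D + 1) ^ ?k" by (simp add: card_PiE)
  have "?k * (D * E) + 1 \<le> (?k * E + 1) * (D + 1)" by (simp add: algebra_simps)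
  then have "card M \<le> ((?k * E + 1) * (D + 1)) ^ card I" unfolding cM by (rule power_mono) simp
  also have "\<dots> = D * (D + 1) ^ card I" unfolding power_mult_distrib D_def ..
  also have "\<dots> < (D + 1) ^ ?k" by simp
  finally have "card M < card ?E" unfolding cE .
  from underdetermined_system_nontrivial[OF fM fE this, of a] obtain c where c: "\<exists>e\<in>?E. c e \<noteq> 0" "\<And>m. m \<in> M \<Longrightarrow> (\<Sum>e\<in>?E. c e * a e m) = 0" by auto
  have "(\<Sum>e\<in>?E. c e * (\<Prod>j<?k. f j (Phi T) ^ e j)) = 0" if dT: "d T \<noteq> 0" for T
  proof -
    have "Q e T = d T ^ (C * D * ?k) * (\<Prod>j<?k. f j (Phi T) ^ e j)" if e: "e \<in> ?E" for e
    proof -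
      have "Q e T = (\<Prod>j<?k. d T ^ (C * D) * f j (Phi T) ^ e j)"
        unfolding Q_def
      proof (intro prod.cong refl)
        fix j assume j: "j \<in> {..<?k}"
        have "e j \<le> D" using e j by auto
        then have pw: "(d T ^ C) ^ e j * (d T ^ C) ^ (D - e j) = d T ^ (C * D)"
          by (metis power_add power_mult le_add_diff_inverse)
        have "p j T = d T ^ C * f j (Phi T)" using p(2)[OF _ dT, of j] j by simp
        then show "p j T ^ e j * (d T ^ C) ^ (D - e j) = d T ^ (C * D) * f j (Phi T) ^ e j"
          unfolding pw[symmetric] by (simp only: power_mult_distrib mult_ac)
      qed
      also have "\<dots> = d T ^ (C * D * ?k) * (\<Prod>j<?k. f j (Phi T) ^ e j)"
        unfolding prod.distrib by (simp only: prod_constant card_lessThan power_mult)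
      finally show ?thesis .
    qed
    then have "d T ^ (C * D * ?k) * (\<Sum>e\<in>?E. c e * (\<Prod>j<?k. f j (Phi T) ^ e j)) = (\<Sum>e\<in>?E. c e * Q e T)"
      unfolding sum_distrib_left by (intro sum.cong refl) (simp add: algebra_simps)
    also have "\<dots> = (\<Sum>e\<in>?E. \<Sum>m\<in>M. c e * a e m * (\<Prod>i\<in>I. T i ^ m i))"
      by (intro sum.cong refl) (simp add: a sum_distrib_left algebra_simps)
    also have "\<dots> = (\<Sum>m\<in>M. (\<Sum>e\<in>?E. c e * a e m) * (\<Prod>i\<in>I. T i ^ m i))"
      unfolding sum_distrib_right by (rule sum.swap)
    also have "\<dots> = 0" using c(2) by (intro sum.neutral) auto
    finally show ?thesis using dT by simp
  qed
  then show ?thesis using c(1) by blast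
qed


section \<open>Krull dimension of a parametrised family\<close>

definition irr_chain :: "nat \<Rightarrow> ('a::idom mat \<times> 'a mat) set \<Rightarrow> nat \<Rightarrow> (nat \<Rightarrow> ('a mat \<times> 'a mat) set) \<Rightarrow> bool" where
  "irr_chain n K k Z \<longleftrightarrow> (\<forall>i\<le>k. Z i \<subseteq> K \<and> zcl n (Z i) = Z i \<and> pirr n (Z i)) \<and> (\<forall>i<k. Z i \<subset> Z (Suc i))"

lemma krull_dim_eqI:
  assumes K: "closedin (zariski n) K" "K \<subseteq> qpairs q n"
    and up: "\<And>k Z. irr_chain n K k Z \<Longrightarrow> k \<le> m" and low: "irr_chain n K m Z0"
  shows "krull_dim (subtopology (qpairs_top q n) K) = enat m"
proof -
  have top: "subtopology (qpairs_top q n) K = subtopology (zariski n) K"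
    unfolding qpairs_top_def using K(2) by (simp add: subtopology_subtopology Int_absorb1)
  have Kc: "K \<subseteq> pairs n" using closedin_subset[OF K(1)] by simp
  have "(\<forall>i\<le>k. closedin (subtopology (zariski n) K) (Z i) \<and> irreducible_in (subtopology (zariski n) K) (Z i)) \<and>
     (\<forall>i<k. Z i \<subset> Z (Suc i)) \<longleftrightarrow> irr_chain n K k Z" for k Z
    unfolding irr_chain_def closedin_subtopology_zcl_iff[OF K(1)]
    using irreducible_in_iff_pirr[OF _ Kc, of "Z _"] by (metis (no_types, lifting))
  then have "krull_dim (subtopology (qpairs_top q n) K) = Sup {enat k | k. \<exists>Z. irr_chain n K k Z}"
    unfolding krull_dim_def top by simp
  also have "\<dots> = enat m"
  proof (rule antisym)
    show "Sup {enat k | k. \<exists>Z. irr_chain n K k Z} \<le> enat m"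
      using up by (intro Sup_least) auto
    show "enat m \<le> Sup {enat k | k. \<exists>Z. irr_chain n K k Z}"
      using low by (intro Sup_upper) auto
  qed
  finally show ?thesis .
qed

text \<open>A longer chain would provide functions that are both independent and dependent.\<close>

lemma (in param_family) chain_length_le:
  assumes ch: "irr_chain n (zcl n (Phi ` {T. d T \<noteq> 0})) k Z"
  shows "k \<le> card I"
proof (rule ccontr)
  assume "\<not> k \<le> card I"
  then have k: "Suc (card I) \<le> k" by simp
  let ?k = "Suc (card I)"
  have "\<exists>f\<in>poly_funs n. (\<forall>z\<in>Z j. f z = 0) \<and> (\<exists>z\<in>Z (Suc j). f z \<noteq> 0)" if "j < ?k" for j
  proof -
    have "Z j \<subset> Z (Suc j)" "zcl n (Z j) = Z j" "Z (Suc j) \<subseteq> pairs n"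
      using ch that k zcl_subset[of n "Z (Suc j)"] unfolding irr_chain_def by auto
    then obtain z where "z \<in> Z (Suc j)" "z \<notin> zcl n (Z j)" "z \<in> pairs n" by blast
    then show ?thesis unfolding zcl_def by blast
  qed
  then have "\<forall>j. \<exists>f. j < ?k \<longrightarrow> f \<in> poly_funs n \<and> (\<forall>z\<in>Z j. f z = 0) \<and> (\<exists>z\<in>Z (Suc j). f z \<noteq> 0)" by blast
  from choice[OF this] obtain f where
    "\<forall>j. j < ?k \<longrightarrow> f j \<in> poly_funs n \<and> (\<forall>z\<in>Z j. f j z = 0) \<and> (\<exists>z\<in>Z (Suc j). f j z \<noteq> 0)" ..
  then have f: "\<And>j. j < ?k \<Longrightarrow> f j \<in> poly_funs n"
    "\<And>j z. j < ?k \<Longrightarrow> z \<in> Z j \<Longrightarrow> f j z = 0" "\<And>j. j < ?k \<Longrightarrow> \<exists>z\<in>Z (Suc j). f j z \<noteq> 0" by auto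
  have "\<exists>D c. (\<exists>e\<in>{..<?k} \<rightarrow>\<^sub>E {..D}. c e \<noteq> 0) \<and> (\<forall>T. d T \<noteq> 0 \<longrightarrow>
      (\<Sum>e\<in>{..<?k} \<rightarrow>\<^sub>E {..D}. c e * (\<Prod>j<?k. f j (Phi T) ^ e j)) = 0)"
    by (rule more_functions_than_parameters_dependent[OF f(1)])
  then obtain D c where c: "\<exists>e\<in>{..<?k} \<rightarrow>\<^sub>E {..D}. c e \<noteq> 0"
    "\<forall>T. d T \<noteq> 0 \<longrightarrow> (\<Sum>e\<in>{..<?k} \<rightarrow>\<^sub>E {..D}. c e * (\<Prod>j<?k. f j (Phi T) ^ e j)) = 0"
    by blast
  let ?G = "\<lambda>z. \<Sum>e\<in>{..<?k} \<rightarrow>\<^sub>E {..D}. c e * (\<Prod>j<?k. f j z ^ e j)"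
  have "?G \<in> poly_funs n"
    using f(1) by (intro poly_funs.sum poly_funs.mult poly_funs.const poly_funs.prod poly_funs.power) auto
  then have G: "?G z = 0" if "z \<in> zcl n (Phi ` {T. d T \<noteq> 0})" for z
    using zclD[OF that, of ?G] c(2) by blast
  have "c e = 0" if "e \<in> {..<?k} \<rightarrow>\<^sub>E {..D}" for e
  proof (rule chain_algebraically_independent[where Z = Z and k = ?k and n = n and f = f and D = D and c = c and e = e])
    show "?G z = 0" if "z \<in> Z ?k" for z using G that ch k unfolding irr_chain_def by blast
    show "e \<in> {..<?k} \<rightarrow>\<^sub>E {..D}" by (rule that)
    show "pirr n (Z j)" if "j \<le> ?k" for j using ch k that unfolding irr_chain_def by auto
    show "Z j \<subseteq> Z (Suc j)" if "j < ?k" for j using ch k that unfolding irr_chain_def by (meson less_le_trans psubset_imp_subset)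
  qed (use f in blast)+
  then show False using c(1) by blast
qed

text \<open>Releasing the parameters one after the other, the closures of the images form a strict chain as
  soon as each release destroys some relation.\<close>

lemma (in param_family) chain_from_slices:
  fixes idx :: "nat \<Rightarrow> 'i"
  assumes T0: "d T0 \<noteq> 0" and bij: "bij_betw idx {..<card I} I"
    and dep: "\<And>S T. (\<And>i. i \<in> I \<Longrightarrow> S i = T i) \<Longrightarrow> Phi S = Phi T \<and> d S = d T"
    and rel: "\<And>j. j < card I \<Longrightarrow> \<exists>F\<in>poly_funs n.
        (\<forall>T. d T \<noteq> 0 \<longrightarrow> (\<forall>k<card I. j \<le> k \<longrightarrow> T (idx k) = T0 (idx k)) \<longrightarrow> F (Phi T) = 0) \<and>
        (\<exists>T. d T \<noteq> 0 \<and> (\<forall>k<card I. j < k \<longrightarrow> T (idx k) = T0 (idx k)) \<and> F (Phi T) \<noteq> 0)"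
  shows "irr_chain n (zcl n (Phi ` {T. d T \<noteq> 0})) (card I)
    (\<lambda>j. zcl n (Phi ` {T. (\<forall>k<card I. j \<le> k \<longrightarrow> T (idx k) = T0 (idx k)) \<and> d T \<noteq> 0}))"
proof -
  let ?X = "\<lambda>j. {T. \<forall>k<card I. j \<le> k \<longrightarrow> T (idx k) = T0 (idx k)}"
  let ?S = "\<lambda>j. Phi ` {T. (\<forall>k<card I. j \<le> k \<longrightarrow> T (idx k) = T0 (idx k)) \<and> d T \<noteq> 0}"
  have c: "?S j \<subseteq> pairs n" for j using carr by blast
  have p: "pirr n (zcl n (?S j))" for j
  proof (rule pirr_zcl[OF _ c])
    have "pirr n (Phi ` {T \<in> ?X j. d T \<noteq> 0})" by (rule pirr_slice[of _ T0]) (auto simp: T0)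
    then show "pirr n (?S j)" by simp
  qed
  have "zcl n (?S j) \<subset> zcl n (?S (Suc j))" if j: "j < card I" for j
  proof -
    have "?S j \<subseteq> ?S (Suc j)" by auto
    then have sub: "zcl n (?S j) \<subseteq> zcl n (?S (Suc j))" by (rule zcl_mono)
    obtain F T where F: "F \<in> poly_funs n"
      "\<And>T. d T \<noteq> 0 \<Longrightarrow> (\<forall>k<card I. j \<le> k \<longrightarrow> T (idx k) = T0 (idx k)) \<Longrightarrow> F (Phi T) = 0"
      "d T \<noteq> 0" "\<forall>k<card I. j < k \<longrightarrow> T (idx k) = T0 (idx k)" "F (Phi T) \<noteq> 0"
      using rel[OF j] by blast
    have "Phi T \<in> ?S (Suc j)" using F by auto
    then have "Phi T \<in> zcl n (?S (Suc j))" using zcl_superset[OF c] by blast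
    moreover have "Phi T \<notin> zcl n (?S j)"
    proof
      assume a: "Phi T \<in> zcl n (?S j)"
      show False using zclD[OF a F(1)] F(2,5) by blast
    qed
    ultimately show ?thesis using sub by blast
  qed
  moreover have "zcl n (?S j) \<subseteq> zcl n (Phi ` {T. d T \<noteq> 0})" for j by (rule zcl_mono) auto
  ultimately show ?thesis unfolding irr_chain_def by (intro conjI allI impI p zcl_zcl)
qed

section \<open>Conjugation and block sums of pairs\<close>

lemma conj_cancel:
  fixes B :: "'a::semiring_1 mat"
  assumes c: "B \<in> Mat n" "P \<in> Mat n" "Q \<in> Mat n" and PQ: "P * Q = 1\<^sub>m n"
  shows "P * (Q * B * P) * Q = B"
proof -
  have "P * (Q * B * P) = P * (Q * (B * P))"
    using assoc_mult_mat[OF c(3,1,2)] by simp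
  also have "\<dots> = (P * Q) * (B * P)"
    using c by (intro assoc_mult_mat[symmetric, of P n n Q n _ n]) auto
  also have "\<dots> = B * P" using c PQ by simp
  finally have "P * (Q * B * P) * Q = B * (P * Q)"
    using c assoc_mult_mat[of B n n P n Q n] by simp
  then show ?thesis using c PQ by simp
qed

lemma gl_conjI:
  fixes A :: "'a::field mat"
  assumes c: "A \<in> Mat n" "B \<in> Mat n" "A' \<in> Mat n" "B' \<in> Mat n"
    and P: "P \<in> Mat n" "Q \<in> Mat n" "P * Q = 1\<^sub>m n"
    and A: "A * P = P * A'" and B: "B * P = P * B'"
  shows "gl_conj (A, B) (A', B')"
proof -
  have QP: "Q * P = 1\<^sub>m n" by (rule mat_mult_left_right_inverse[OF P])
  have "X = P * X' * Q" if "X \<in> Mat n" "X * P = P * X'" for X X'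
  proof -
    have "X = X * (P * Q)" using that P by simp
    also have "\<dots> = X * P * Q" using that P by (intro assoc_mult_mat[symmetric, of X n n P n Q n])
    finally show ?thesis unfolding that(2) .
  qed
  then have "A = P * A' * Q" "B = P * B' * Q" using c A B by auto
  then show ?thesis
    unfolding gl_conj_def fst_conv snd_conv using c P QP
    by (intro exI[of _ P] exI[of _ Q] conjI similar_mat_witI[of _ _ n]) auto
qed

lemma gl_conjE:
  assumes "gl_conj p p'" "p \<in> pairs n"
  obtains P Q where "P \<in> Mat n" "Q \<in> Mat n" "P * Q = 1\<^sub>m n" "Q * P = 1\<^sub>m n"
    "p' \<in> pairs n" "fst p = P * fst p' * Q" "snd p = P * snd p' * Q"
    "fst p * P = P * fst p'" "snd p * P = P * snd p'"
proof -
  obtain P Q where w: "similar_mat_wit (fst p) (fst p') P Q" "similar_mat_wit (snd p) (snd p') P Q"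
    using assms(1) unfolding gl_conj_def by blast
  have c: "fst p \<in> Mat n" "snd p \<in> Mat n" using assms(2) by auto
  note d = similar_mat_witD2[OF c(1) w(1)] similar_mat_witD2[OF c(2) w(2)]
  have cancel: "P * X * Q * P = P * X" if "X \<in> Mat n" for X
  proof -
    have "P * X * Q * P = P * X * (Q * P)" using that d(1-7) by (intro assoc_mult_mat[of _ n n _ n _ n]) auto
    then show ?thesis using that d(1-7) by simp
  qed
  show thesis
    by (rule that[of P Q]) (use d cancel in \<open>auto simp: mem_Times_iff\<close>)
qed

lemma gl_conj_refl: "p \<in> pairs n \<Longrightarrow> gl_conj p p"
  unfolding gl_conj_def by (auto intro!: exI similar_mat_wit_refl)

lemma gl_conj_sym: "gl_conj p p' \<Longrightarrow> gl_conj p' p"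
  unfolding gl_conj_def using similar_mat_wit_sym by blast

lemma gl_conj_trans: "gl_conj p p' \<Longrightarrow> gl_conj p' p'' \<Longrightarrow> gl_conj p p''"
  unfolding gl_conj_def using similar_mat_wit_trans by blast

lemma gl_conj_pairs: "gl_conj p p' \<Longrightarrow> p \<in> pairs n \<Longrightarrow> p' \<in> pairs n"
  by (erule gl_conjE) auto

lemma gl_conj_qpairs: "gl_conj p p' \<Longrightarrow> p \<in> qpairs q n \<Longrightarrow> p' \<in> qpairs q n"
  using gl_orbits_subset[of "{p}" q n] gl_conj_sym unfolding gl_orbits_def by blast

definition blk :: "'a::zero mat \<Rightarrow> 'a mat \<Rightarrow> 'a mat" where
  "blk A B = diag_block_mat [A, B]"

definition psum :: "'a::zero mat \<times> 'a mat \<Rightarrow> 'a mat \<times> 'a mat \<Rightarrow> 'a mat \<times> 'a mat" where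
  "psum p r = (blk (fst p) (fst r), blk (snd p) (snd r))"

lemma blk_expand:
  "blk A B = four_block_mat A (0\<^sub>m (dim_row A) (dim_col B)) (0\<^sub>m (dim_row B) (dim_col A)) B"
  unfolding blk_def diag_block_mat.simps(2)[of A] diag_block_mat_singleton Let_def ..

lemma blk_eq:
  "A \<in> Mat n \<Longrightarrow> B \<in> Mat m \<Longrightarrow>
    blk A B = four_block_mat A (0\<^sub>m n m) (0\<^sub>m m n) B"
  by (simp only: blk_def diag_block_mat.simps(2)[of A] diag_block_mat_singleton Let_def) auto

lemma blk_entry:
  assumes "A \<in> Mat k" "B \<in> Mat m" "i < k + m" "j < k + m"
  shows "blk A B $$ (i, j) = (if i < k then if j < k then A $$ (i, j) else 0
    else if j < k then 0 else B $$ (i - k, j - k))"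
  unfolding blk_eq[OF assms(1,2)] using assms by (simp split: if_splits)

lemma mat_eqI:
  "M \<in> carrier_mat n m \<Longrightarrow> N \<in> carrier_mat n m \<Longrightarrow>
    (\<And>i j. i < n \<Longrightarrow> j < m \<Longrightarrow> M $$ (i, j) = N $$ (i, j)) \<Longrightarrow> M = N"
  by (rule eq_matI) auto

lemma blk_carrier:
  "A \<in> Mat n \<Longrightarrow> B \<in> Mat m \<Longrightarrow> blk A B \<in> Mat (n + m)"
  by (simp add: blk_eq)

lemma blk_mult:
  fixes A :: "'a::semiring_0 mat"
  assumes "A \<in> Mat n" "B \<in> Mat m" "C \<in> Mat n" "D \<in> Mat m"
  shows "blk A B * blk C D = blk (A * C) (B * D)"
  unfolding blk_eq[OF assms(1,2)] blk_eq[OF assms(3,4)]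
    blk_eq[OF mult_carrier_mat[OF assms(1,3)] mult_carrier_mat[OF assms(2,4)]]
  using assms by (subst mult_four_block_mat[of _ n n _ m _ m _ _ n _ m]) auto

lemma blk_one: "blk (1\<^sub>m n) (1\<^sub>m m) = 1\<^sub>m (n + m)"
  by (simp add: blk_eq[of _ n _ m])

lemma psum_pairs: "p \<in> pairs n \<Longrightarrow> r \<in> pairs m \<Longrightarrow> psum p r \<in> pairs (n + m)"
  unfolding psum_def by (auto simp: blk_carrier)

lemma gl_conj_psum:
  fixes p :: "'a::field mat \<times> 'a mat"
  assumes "gl_conj p p'" "gl_conj r r'" "p \<in> pairs n" "r \<in> pairs m"
  shows "gl_conj (psum p r) (psum p' r')"
proof -
  from gl_conjE[OF assms(1,3)] obtain P Q where 1: "P \<in> Mat n" "Q \<in> Mat n" "P * Q = 1\<^sub>m n"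
    "p' \<in> pairs n" "fst p * P = P * fst p'" "snd p * P = P * snd p'" by metis
  from gl_conjE[OF assms(2,4)] obtain R S where 2: "R \<in> Mat m" "S \<in> Mat m" "R * S = 1\<^sub>m m"
    "r' \<in> pairs m" "fst r * R = R * fst r'" "snd r * R = R * snd r'" by metis
  have c: "fst p \<in> Mat n" "snd p \<in> Mat n" "fst r \<in> Mat m" "snd r \<in> Mat m"
    "fst p' \<in> Mat n" "snd p' \<in> Mat n" "fst r' \<in> Mat m" "snd r' \<in> Mat m"
    using assms(3,4) 1(4) 2(4) by (simp_all add: mem_Times_iff)
  show ?thesis unfolding psum_def
    by (rule gl_conjI[of _ "n + m" _ _ _ "blk P R" "blk Q S"])
      (use c 1 2 in \<open>simp_all add: blk_carrier blk_mult[of _ n _ m] blk_one\<close>)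
qed

lemma gl_conj_psum_comm:
  fixes p :: "'a::field mat \<times> 'a mat"
  assumes "p \<in> pairs n" "r \<in> pairs m"
  shows "gl_conj (psum p r) (psum r p)"
proof -
  let ?P = "four_block_mat (0\<^sub>m n m) (1\<^sub>m n) (1\<^sub>m m) (0\<^sub>m m n) :: 'a mat"
  let ?Q = "four_block_mat (0\<^sub>m m n) (1\<^sub>m m) (1\<^sub>m n) (0\<^sub>m n m) :: 'a mat"
  have PQ: "?P \<in> Mat (n + m)" "?Q \<in> Mat (n + m)" by auto
  have "?P * ?Q = 1\<^sub>m (n + m)"
    by (subst mult_four_block_mat[of _ n m _ n _ m _ _ n _ m]) auto
  moreover have "blk X Y * ?P = ?P * blk Y X"
    if "X \<in> Mat n" "Y \<in> Mat m" for X Y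
    unfolding blk_eq[OF that] blk_eq[OF that(2,1)] using that
    by (subst mult_four_block_mat[of _ n n _ m _ m _ _ m _ n], simp_all)
       (subst mult_four_block_mat[of _ n m _ n _ m _ _ m _ n], simp_all)
  moreover have "blk X Y \<in> Mat (n + m)" "blk Y X \<in> Mat (n + m)"
    if "X \<in> Mat n" "Y \<in> Mat m" for X Y :: "'a mat"
    using blk_carrier[OF that] blk_carrier[OF that(2,1)] by (simp_all add: add.commute)
  ultimately show ?thesis using assms PQ unfolding psum_def
    by (intro gl_conjI[of _ "n + m" _ _ _ ?P ?Q]) auto
qed

definition psum_list :: "('a::zero mat \<times> 'a mat) list \<Rightarrow> 'a mat \<times> 'a mat" where
  "psum_list ps = (diag_block_mat (map fst ps), diag_block_mat (map snd ps))"

definition square_pair :: "'a mat \<times> 'a mat \<Rightarrow> bool" where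
  "square_pair p \<longleftrightarrow> p \<in> pairs (dim_row (fst p))"

lemma square_pairI: "p \<in> pairs n \<Longrightarrow> square_pair p"
  unfolding square_pair_def by auto

lemma square_pairD: "square_pair p \<Longrightarrow> p \<in> pairs (dim_row (fst p))"
  unfolding square_pair_def by auto

lemma psum_list_pairs:
  "\<forall>p\<in>set ps. square_pair p \<Longrightarrow> psum_list ps \<in> pairs (\<Sum>p\<leftarrow>ps. dim_row (fst p))"
proof -
  assume a: "\<forall>p\<in>set ps. square_pair p"
  have d: "dim_col (fst p) = dim_row (fst p)" "dim_row (snd p) = dim_row (fst p)" "dim_col (snd p) = dim_row (fst p)"
    if "p \<in> set ps" for p
  proof -
    have "p \<in> pairs (dim_row (fst p))" using a that unfolding square_pair_def by blast
    then have c: "fst p \<in> carrier_mat (dim_row (fst p)) (dim_row (fst p))"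
      "snd p \<in> carrier_mat (dim_row (fst p)) (dim_row (fst p))" unfolding mem_Times_iff by blast+
    show "dim_col (fst p) = dim_row (fst p)" by (rule carrier_matD(2)[OF c(1)])
    show "dim_row (snd p) = dim_row (fst p)" by (rule carrier_matD(1)[OF c(2)])
    show "dim_col (snd p) = dim_row (fst p)" by (rule carrier_matD(2)[OF c(2)])
  qed
  then have "map dim_row (map fst ps) = map (\<lambda>p. dim_row (fst p)) ps"
    "map dim_col (map fst ps) = map (\<lambda>p. dim_row (fst p)) ps"
    "map dim_row (map snd ps) = map (\<lambda>p. dim_row (fst p)) ps"
    "map dim_col (map snd ps) = map (\<lambda>p. dim_row (fst p)) ps"
    by (simp_all add: o_def)
  then show ?thesis unfolding psum_list_def carrier_mat_def dim_diag_block_mat mem_Times_iff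
    by (simp add: dim_diag_block_mat o_def cong: map_cong)
qed

lemma psum_list_Cons: "psum_list (p # ps) = psum p (psum_list ps)"
  unfolding psum_list_def psum_def blk_expand by (simp add: Let_def)

lemma psum_list_single: "psum_list [p] = p"
  unfolding psum_list_def by (simp only: list.map diag_block_mat_singleton prod.collapse)

lemma psum_list_append:
  assumes "\<forall>p\<in>set ps. square_pair p" "\<forall>p\<in>set qs. square_pair p"
  shows "psum_list (ps @ qs) = psum (psum_list ps) (psum_list qs)"
  unfolding psum_list_def psum_def blk_expand by (simp add: diag_block_mat_append[unfolded Let_def] Let_def)

lemma gl_conj_psum_list_perm:
  fixes ps :: "('a::field mat \<times> 'a mat) list"
  assumes "mset ps = mset qs" "\<forall>p\<in>set ps. square_pair p"
  shows "gl_conj (psum_list ps) (psum_list qs)"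
  using assms
proof (induction ps arbitrary: qs)
  case Nil
  then show ?case by (auto intro!: gl_conj_refl[of _ 0] simp: psum_list_def)
next
  case (Cons p ps)
  have "p \<in> set qs" using mset_eq_setD[OF Cons.prems(1)] by auto
  then obtain xs ys where qs: "qs = xs @ p # ys" by (meson split_list)
  have sq: "\<forall>p\<in>set xs. square_pair p" "\<forall>p\<in>set ys. square_pair p" "square_pair p" "\<forall>p\<in>set ps. square_pair p"
    using Cons.prems mset_eq_setD[OF Cons.prems(1)] unfolding qs by auto
  let ?X = "psum_list xs" and ?Y = "psum_list ys"
  note c = psum_list_pairs[OF sq(1)] psum_list_pairs[OF sq(2)] square_pairD[OF sq(3)] psum_list_pairs[OF sq(4)]
  have "gl_conj (psum_list ps) (psum_list (xs @ ys))"
    using Cons.IH[of "xs @ ys"] Cons.prems unfolding qs by auto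
  then have 1: "gl_conj (psum_list (p # ps)) (psum p (psum_list (xs @ ys)))"
    unfolding psum_list_Cons by (rule gl_conj_psum[OF gl_conj_refl[OF c(3)] _ c(3,4)])
  have "psum p (psum_list (xs @ ys)) = psum_list ((p # xs) @ ys)" by (simp add: psum_list_Cons)
  also have "\<dots> = psum (psum p ?X) ?Y" using sq by (subst psum_list_append) (auto simp: psum_list_Cons)
  finally have 2: "psum p (psum_list (xs @ ys)) = psum (psum p ?X) ?Y" .
  have "psum_list qs = psum_list ((xs @ [p]) @ ys)" unfolding qs by simp
  also have "\<dots> = psum (psum ?X p) ?Y" using sq
    by (subst psum_list_append; (subst psum_list_append)?) (auto simp: psum_list_single)
  finally have 3: "psum_list qs = psum (psum ?X p) ?Y" .
  have "gl_conj (psum (psum p ?X) ?Y) (psum (psum ?X p) ?Y)"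
    by (rule gl_conj_psum[OF gl_conj_psum_comm[OF c(3,1)] gl_conj_refl[OF c(2)] psum_pairs[OF c(3,1)] c(2)])
  then show ?case using 1 2 3 gl_conj_trans by metis
qed

lemma psum_qpairs_iff:
  assumes p: "p \<in> pairs n" and r: "r \<in> pairs m"
  shows "psum p r \<in> qpairs q (n + m) \<longleftrightarrow> p \<in> qpairs q n \<and> r \<in> qpairs q m"
proof -
  obtain A B C D where pr: "p = (A, B)" "r = (C, D)" by fastforce
  have c: "A \<in> Mat n" "B \<in> Mat n" "C \<in> Mat m" "D \<in> Mat m"
    using p r unfolding pr by auto
  have "q \<cdot>\<^sub>m blk (B * A) (D * C) = blk (q \<cdot>\<^sub>m (B * A)) (q \<cdot>\<^sub>m (D * C))"
    using c by (simp add: blk_eq[of _ n _ m] smult_four_block_mat[of _ n n _ m _ m])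
  moreover have "blk X Y = blk X' Y' \<longleftrightarrow> X = X' \<and> Y = Y'"
    if z: "X \<in> Mat n" "Y \<in> Mat m" "X' \<in> Mat n" "Y' \<in> Mat m" for X Y X' Y' :: "'a mat"
  proof
    assume e: "blk X Y = blk X' Y'"
    have "X $$ (i, j) = X' $$ (i, j)" if "i < n" "j < n" for i j
      using arg_cong[OF e, of "\<lambda>M. M $$ (i, j)"] that z unfolding blk_eq[OF z(1,2)] blk_eq[OF z(3,4)] by simp
    moreover have "Y $$ (i, j) = Y' $$ (i, j)" if "i < m" "j < m" for i j
      using arg_cong[OF e, of "\<lambda>M. M $$ (i + n, j + n)"] that z unfolding blk_eq[OF z(1,2)] blk_eq[OF z(3,4)] by simp
    ultimately show "X = X' \<and> Y = Y'" using z by auto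
  qed auto
  ultimately show ?thesis unfolding pr psum_def qpairs_def using c
    by (simp add: blk_carrier blk_mult[of _ n _ m])
qed


section \<open>Triangular and Jordan form\<close>

lemma exists_eigenvalue:
  fixes A :: "'a::alg_closed_field mat"
  assumes "A \<in> Mat n" "n > 0"
  shows "\<exists>x. eigenvalue A x"
proof -
  have "degree (char_poly A) > 0" using assms degree_monic_char_poly[OF assms(1)] by simp
  then show ?thesis using alg_closed_imp_poly_has_root eigenvalue_root_char_poly[OF assms(1)] by blast
qed

lemma vector_extends_to_invertible:
  fixes v :: "'a::field vec"
  assumes v: "v \<in> carrier_vec n" "v \<noteq> 0\<^sub>v n"
  shows "\<exists>P Q. P \<in> Mat n \<and> Q \<in> Mat n \<and> P * Q = 1\<^sub>m n \<and> Q * P = 1\<^sub>m n \<and> col P 0 = v"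
proof -
  obtain k where k: "k < n" "v $ k \<noteq> 0" using v by (auto simp: vec_eq_iff)
  define P where "P = mat n n (\<lambda>(i, j). if j = 0 then v $ i else if i = (if j = k then 0 else j) then 1 else 0)"
  have P: "P \<in> Mat n" unfolding P_def by simp
  have "det P \<noteq> 0"
  proof
    assume "det P = 0"
    then obtain w where w: "w \<in> carrier_vec n" "w \<noteq> 0\<^sub>v n" "P *\<^sub>v w = 0\<^sub>v n"
      unfolding det_0_iff_vec_prod_zero_field[OF P] by blast
    have row: "v $ i * w $ 0 + (\<Sum>j\<in>{0<..<n}. (if i = (if j = k then 0 else j) then w $ j else 0)) = 0"
      if i: "i < n" for i
    proof -
      have "0 = (P *\<^sub>v w) $ i" using w i by simp
      also have "\<dots> = (\<Sum>j\<in>{0..<n}. P $$ (i, j) * w $ j)"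
        unfolding index_mult_mat_vec[OF i[folded carrier_matD(1)[OF P]]] scalar_prod_def using w(1) i P by simp
      also have "{0..<n} = insert 0 {0<..<n}" using i by auto
      also have "(\<Sum>j\<in>insert 0 {0<..<n}. P $$ (i, j) * w $ j) =
         v $ i * w $ 0 + (\<Sum>j\<in>{0<..<n}. P $$ (i, j) * w $ j)"
        using i by (subst sum.insert) (auto simp: P_def)
      also have "(\<Sum>j\<in>{0<..<n}. P $$ (i, j) * w $ j) =
         (\<Sum>j\<in>{0<..<n}. (if i = (if j = k then 0 else j) then w $ j else 0))"
        using i by (intro sum.cong refl) (auto simp: P_def)
      finally show ?thesis by simp
    qed
    have "(\<Sum>j\<in>{0<..<n}. (if k = (if j = k then 0 else j) then w $ j else 0)) = 0"
      by (rule sum.neutral) auto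
    then have w0: "w $ 0 = 0" using row[OF k(1)] k(2) by simp
    have "w $ j = 0" if j: "j < n" "j \<noteq> 0" for j
    proof -
      define i where "i = (if j = k then 0 else j)"
      have "i < n" unfolding i_def using j by auto
      have "(\<Sum>j'\<in>{0<..<n}. (if i = (if j' = k then 0 else j') then w $ j' else 0)) = (\<Sum>j'\<in>{j}. w $ j')"
        using j by (intro sum.mono_neutral_cong_right) (auto simp: i_def split: if_splits)
      then show ?thesis using row[OF \<open>i < n\<close>] w0 by simp
    qed
    then have "w $ j = 0" if "j < n" for j using that w0 by (cases "j = 0") auto
    then have "w = 0\<^sub>v n" using w(1) by (intro eq_vecI) auto
    then show False using w(2) by simp
  qed
  then obtain Q where "Q \<in> Mat n" "P * Q = 1\<^sub>m n" "Q * P = 1\<^sub>m n"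
    using det_non_zero_imp_unit[OF P, of "()"] unfolding Units_def ring_mat_simps by auto
  moreover have "col P 0 = v" using v k by (intro eq_vecI) (auto simp: P_def)
  ultimately show ?thesis using P by blast
qed

lemma similar_upper_triangular:
  fixes A :: "'a::alg_closed_field mat"
  assumes "A \<in> Mat n"
  shows "\<exists>U \<in> carrier_mat n n. upper_triangular U \<and> similar_mat A U"
  using assms
proof (induction n arbitrary: A)
  case 0
  then show ?case by (intro bexI[of _ A]) (auto simp: upper_triangular_def intro: similar_mat_refl)
next
  case (Suc n)
  obtain l v where v: "v \<in> carrier_vec (Suc n)" "v \<noteq> 0\<^sub>v (Suc n)" "A *\<^sub>v v = l \<cdot>\<^sub>v v"
    using exists_eigenvalue[OF Suc.prems] Suc.prems unfolding eigenvalue_def eigenvector_def by auto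
  obtain P Q where P: "P \<in> Mat (Suc n)" "Q \<in> Mat (Suc n)"
    "P * Q = 1\<^sub>m (Suc n)" "Q * P = 1\<^sub>m (Suc n)" "col P 0 = v"
    using vector_extends_to_invertible[OF v(1,2)] by blast
  define C where "C = Q * A * P"
  have C: "C \<in> Mat (Suc n)" unfolding C_def using P Suc.prems by simp
  have sim: "similar_mat C A"
    unfolding similar_mat_def C_def
    using P Suc.prems by (intro exI[of _ Q] exI[of _ P] similar_mat_witI[of _ _ "Suc n"]) auto
  have "col C 0 = (Q * A) *\<^sub>v v" unfolding C_def using P Suc.prems col_mult2[of "Q * A" "Suc n" "Suc n" P "Suc n" 0] by simp
  also have "\<dots> = Q *\<^sub>v (l \<cdot>\<^sub>v v)" using P Suc.prems v by (simp add: assoc_mult_mat_vec[of _ "Suc n" "Suc n" _ "Suc n"])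
  also have "\<dots> = l \<cdot>\<^sub>v (Q *\<^sub>v col P 0)" using P v by (auto simp: mult_mat_vec[of _ "Suc n" "Suc n"])
  also have "Q *\<^sub>v col P 0 = col (Q * P) 0" using P(1,2) col_mult2[of Q "Suc n" "Suc n" P "Suc n" 0] by simp
  finally have col: "C $$ (i, 0) = (if i = 0 then l else 0)" if "i < Suc n" for i
    using that P(4) C by (auto simp: vec_eq_iff)
  obtain C1 C2 C3 C4 where sb: "split_block C 1 1 = (C1, C2, C3, C4)" by (metis surj_pair)
  note s = split_block[OF sb, of n n]
  have s: "C1 \<in> Mat 1" "C2 \<in> carrier_mat 1 n" "C3 \<in> carrier_mat n 1" "C4 \<in> Mat n"
    "C = four_block_mat C1 C2 C3 C4" using s C by auto
  have C3: "C3 = 0\<^sub>m n 1"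
  proof (rule eq_matI)
    fix i j assume "i < dim_row (0\<^sub>m n 1 :: 'a mat)" "j < dim_col (0\<^sub>m n 1 :: 'a mat)"
    then have "i < n" "j = 0" by auto
    then show "C3 $$ (i, j) = (0\<^sub>m n 1 :: 'a mat) $$ (i, j)"
      using col[of "Suc i"] s(1-4) unfolding s(5) by simp
  qed (use s in auto)
  obtain U where U: "U \<in> Mat n" "upper_triangular U" "similar_mat C4 U"
    using Suc.IH[OF s(4)] by blast
  obtain B0 where B0: "B0 \<in> carrier_mat 1 n"
    "similar_mat (four_block_mat C1 C2 (0\<^sub>m n 1) C4) (four_block_mat C1 B0 (0\<^sub>m n 1) U)"
    using similar_mat_four_block_0_ex[OF similar_mat_refl[OF s(1)] U(3) s(2,1,4)] by blast
  let ?U = "four_block_mat C1 B0 (0\<^sub>m n 1) U"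
  have "?U \<in> Mat (Suc n)" using four_block_carrier_mat[OF s(1) U(1)] by simp
  moreover have "upper_triangular ?U"
    using U s(1) by (auto simp: upper_triangular_def)
  moreover have "similar_mat A ?U"
    using B0(2) sim unfolding s(5) C3 by (meson similar_mat_sym similar_mat_trans)
  ultimately show ?case by blast
qed

lemma jordan_nf_exists_alg_closed:
  fixes A :: "'a::alg_closed_field mat"
  assumes "A \<in> Mat n"
  shows "\<exists>n_as. jordan_nf A n_as"
proof -
  obtain U where U: "U \<in> Mat n" "upper_triangular U" "similar_mat A U"
    using similar_upper_triangular[OF assms] by blast
  then show ?thesis using triangular_to_jnf_vector[OF U(1,2)] similar_mat_trans unfolding jordan_nf_def by blast
qed

lemma eigenvalue_upper_triangular:
  fixes U :: "'a::field mat"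
  assumes "U \<in> Mat n" "upper_triangular U"
  shows "eigenvalue U x \<longleftrightarrow> (\<exists>i<n. U $$ (i, i) = x)"
  unfolding eigenvalue_root_char_poly[OF assms(1)] char_poly_upper_triangular[OF assms]
    poly_prod_list prod_list_zero_iff diag_mat_def using assms(1) by auto

lemma eigenvalue_similar:
  fixes A :: "'a::field mat"
  assumes "similar_mat A B" "A \<in> Mat n"
  shows "eigenvalue A x \<longleftrightarrow> eigenvalue B x"
proof -
  obtain m where m: "A \<in> Mat m" "B \<in> Mat m" using similar_matD[OF assms(1)] by blast
  show ?thesis
    unfolding eigenvalue_root_char_poly[OF m(1)] eigenvalue_root_char_poly[OF m(2)] char_poly_similar[OF assms(1)] ..
qed

lemma eigenvalue_jordan_nf:
  fixes A :: "'a::field mat"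
  assumes "jordan_nf A n_as" "A \<in> Mat n"
  shows "eigenvalue A x \<longleftrightarrow> x \<in> snd ` set n_as"
proof -
  have "0 \<notin> fst ` set n_as" using assms(1) unfolding jordan_nf_def by blast
  then show ?thesis
    unfolding eigenvalue_root_char_poly[OF assms(2)] jordan_nf_char_poly[OF assms(1)]
    by (auto simp: poly_prod_list prod_list_zero_iff image_iff split: prod.splits) force+
qed

lemma jordan_matrix_append:
  "jordan_matrix (xs @ ys) = blk (jordan_matrix xs) (jordan_matrix ys)"
  unfolding jordan_matrix_def blk_expand by (simp add: diag_block_mat_append[unfolded Let_def] Let_def)

lemma jordan_matrix_perm:
  fixes xs :: "(nat \<times> 'a::field) list"
  assumes "mset xs = mset ys"
  shows "similar_mat (jordan_matrix xs) (jordan_matrix ys)"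
proof -
  let ?f = "\<lambda>(k, a). (jordan_block k a :: 'a mat, jordan_block k a)"
  have "mset (map ?f xs) = mset (map ?f ys)" using assms by (metis mset_map)
  moreover have "\<forall>p\<in>set (map ?f xs). square_pair p" by (auto intro!: square_pairI)
  ultimately have "gl_conj (psum_list (map ?f xs)) (psum_list (map ?f ys))" by (rule gl_conj_psum_list_perm)
  moreover have "fst (psum_list (map ?f zs)) = jordan_matrix zs" for zs
    unfolding psum_list_def jordan_matrix_def by (simp add: o_def case_prod_unfold)
  ultimately show ?thesis unfolding gl_conj_def similar_mat_def by auto
qed

lemma jordan_matrix_eigenvalue:
  "eigenvalue (jordan_matrix xs :: 'a::field mat) x \<Longrightarrow> x \<in> snd ` set xs"
  unfolding eigenvalue_root_char_poly[OF jordan_matrix_carrier] jordan_matrix_char_poly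
  by (force simp: poly_prod_list prod_list_zero_iff image_iff)

lemma jordan_matrix_upper_triangular': "upper_triangular (jordan_matrix xs)"
  unfolding upper_triangular_def using jordan_matrix_upper_triangular by auto


section \<open>Splitting a pair along the spectrum\<close>

text \<open>A nonzero \<open>X\<close> with \<open>J X = q X U\<close> forces a common eigenvalue: the first nonzero column of \<open>X\<close>
  is an eigenvector of \<open>J\<close> when \<open>U\<close> is upper triangular.\<close>

lemma no_intertwiner:
  fixes J :: "'a::field mat"
  assumes J: "J \<in> Mat a" and U: "U \<in> Mat b" "upper_triangular U" and X: "X \<in> carrier_mat a b"
    and eq: "J * X = q \<cdot>\<^sub>m (X * U)"
    and ev: "\<And>x. eigenvalue U x \<Longrightarrow> \<not> eigenvalue J (q * x)"
  shows "X = 0\<^sub>m a b"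
proof (rule ccontr)
  assume "X \<noteq> 0\<^sub>m a b"
  then obtain i k where ik: "i < a" "k < b" "X $$ (i, k) \<noteq> 0" using X by (auto simp: mat_eq_iff)
  then have "col X k $ i \<noteq> 0\<^sub>v a $ i" using X by simp
  then have "\<exists>j<b. col X j \<noteq> 0\<^sub>v a" using ik(2) by metis
  then obtain j where jb: "j < b" and "col X j \<noteq> 0\<^sub>v a" and "\<forall>i<j. \<not> (i < b \<and> col X i \<noteq> 0\<^sub>v a)"
    using exists_least_iff[of "\<lambda>j. j < b \<and> col X j \<noteq> 0\<^sub>v a"] by blast
  then have j: "j < b" "col X j \<noteq> 0\<^sub>v a" "\<And>i. i < j \<Longrightarrow> col X i = 0\<^sub>v a"
    using less_trans by blast+
  let ?v = "col X j"
  have "J *\<^sub>v ?v = (q * U $$ (j, j)) \<cdot>\<^sub>v ?v"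
  proof (rule eq_vecI)
    fix i assume i: "i < dim_vec ((q * U $$ (j, j)) \<cdot>\<^sub>v ?v)"
    then have i: "i < a" using X by simp
    have "(J *\<^sub>v ?v) $ i = (J * X) $$ (i, j)" using J X i j by simp
    also have "\<dots> = q * (\<Sum>k\<in>{0..<b}. X $$ (i, k) * U $$ (k, j))"
      unfolding eq using X U i j by (auto simp: scalar_prod_def)
    also have "(\<Sum>k\<in>{0..<b}. X $$ (i, k) * U $$ (k, j)) = (\<Sum>k\<in>{j}. X $$ (i, k) * U $$ (k, j))"
    proof (rule sum.mono_neutral_right)
      show "\<forall>k\<in>{0..<b} - {j}. X $$ (i, k) * U $$ (k, j) = 0"
      proof
        fix k assume k: "k \<in> {0..<b} - {j}"
        show "X $$ (i, k) * U $$ (k, j) = 0"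
        proof (cases "k < j")
          case True
          then have "col X k $ i = 0" using j(3) i by simp
          then show ?thesis using X i k by simp
        next
          case False
          then show ?thesis using k U by (auto simp: upper_triangular_def)
        qed
      qed
    qed (use j in auto)
    finally show "(J *\<^sub>v ?v) $ i = ((q * U $$ (j, j)) \<cdot>\<^sub>v ?v) $ i" using X i j by simp
  qed (use J X in auto)
  then have "eigenvalue J (q * U $$ (j, j))"
    unfolding eigenvalue_def eigenvector_def using J X j by (intro exI[of _ ?v]) auto
  moreover have "eigenvalue U (U $$ (j, j))" using eigenvalue_upper_triangular[OF U] j by blast
  ultimately show False using ev by blast
qed

lemma jordan_nf_partition:
  fixes A :: "'a::field mat"
  assumes "jordan_nf A xs"
  shows "similar_mat A (blk (jordan_matrix (filter P xs)) (jordan_matrix (filter (\<lambda>z. \<not> P z) xs)))"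
proof -
  have "mset xs = mset (filter P xs @ filter (\<lambda>z. \<not> P z) xs)" by (simp add: multiset_partition)
  then show ?thesis
    using assms jordan_matrix_perm[of xs "filter P xs @ filter (\<lambda>z. \<not> P z) xs"] similar_mat_trans
    unfolding jordan_nf_def jordan_matrix_append by blast
qed

lemma similar_wit_intertwine:
  assumes A: "A \<in> Mat n" and w: "similar_mat_wit A J P Q"
  shows "A * P = P * J" "Q * A = J * Q"
proof -
  note w = similar_mat_witD2[OF A w]
  have J: "P * J \<in> Mat n" "J * Q \<in> Mat n" using w by auto
  show "A * P = P * J" unfolding w(3) assoc_mult_mat[OF J(1) w(7,6)] w(2) by (rule right_mult_one_mat[OF J(1)])
  show "Q * A = J * Q"
    unfolding w(3) assoc_mult_mat[OF w(6,5,7)] assoc_mult_mat[OF w(7,6) J(2), symmetric] w(2) by (rule left_mult_one_mat[OF J(2)])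
qed

text \<open>The blocks of \<open>B\<close> between the two parts of the spectrum vanish by \<open>no_intertwiner\<close>.\<close>

lemma spectral_split:
  fixes A :: "'a::alg_closed_field mat"
  assumes q: "q \<noteq> 0" and AB: "(A, B) \<in> qpairs q n"
    and S: "\<And>x y. eigenvalue A x \<Longrightarrow> eigenvalue A y \<Longrightarrow> x = q * y \<Longrightarrow> x \<in> S \<longleftrightarrow> y \<in> S"
    and x0: "eigenvalue A x0" "x0 \<in> S" and y0: "eigenvalue A y0" "y0 \<notin> S"
  shows "\<exists>n1 n2 p1 p2. 0 < n1 \<and> 0 < n2 \<and> n1 + n2 = n \<and> p1 \<in> qpairs q n1 \<and> p2 \<in> qpairs q n2 \<and>
     gl_conj (A, B) (psum p1 p2)"
proof -
  have c: "A \<in> Mat n" "B \<in> Mat n" using AB unfolding qpairs_def by auto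
  obtain xs where xs: "jordan_nf A xs" using jordan_nf_exists_alg_closed[OF c(1)] by blast
  define ys where "ys = filter (\<lambda>z. snd z \<in> S) xs"
  define zs where "zs = filter (\<lambda>z. snd z \<notin> S) xs"
  let ?n1 = "sum_list (map fst ys)" and ?n2 = "sum_list (map fst zs)"
  let ?J1 = "jordan_matrix ys" and ?J2 = "jordan_matrix zs"
  let ?J = "blk ?J1 ?J2"
  have "similar_mat A ?J" unfolding ys_def zs_def by (rule jordan_nf_partition[OF xs])
  then obtain P Q where w: "similar_mat_wit A ?J P Q" unfolding similar_mat_def by blast
  note w' = similar_mat_witD2[OF c(1) w]
  have J: "?J \<in> Mat (?n1 + ?n2)" by (rule blk_carrier) auto
  then have n: "?n1 + ?n2 = n" using w'(5) by auto
  have pos: "k > 0" if "(k, a) \<in> set xs" for k a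
    using xs that unfolding jordan_nf_def by (metis fst_conv gr0I image_eqI)
  have n1: "?n1 > 0"
  proof -
    obtain k where "(k, x0) \<in> set xs" using x0(1) unfolding eigenvalue_jordan_nf[OF xs c(1)] by auto
    then have "(k, x0) \<in> set ys" "k > 0" using x0 pos unfolding ys_def by auto
    then show ?thesis by (metis fst_conv image_eqI list.set_map sum_list_eq_0_iff neq0_conv)
  qed
  have n2: "?n2 > 0"
  proof -
    obtain k where "(k, y0) \<in> set xs" using y0(1) unfolding eigenvalue_jordan_nf[OF xs c(1)] by auto
    then have "(k, y0) \<in> set zs" "k > 0" using y0 pos unfolding zs_def by auto
    then show ?thesis by (metis fst_conv image_eqI list.set_map sum_list_eq_0_iff neq0_conv)
  qed
  define B' where "B' = Q * B * P"
  have B': "B' \<in> Mat n" unfolding B'_def using w' c by simp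
  have wB: "similar_mat_wit B B' P Q"
    unfolding B'_def using w' c
    by (intro similar_mat_witI[of _ _ n] conj_cancel[symmetric, of _ n]) auto
  have con: "gl_conj (A, B) (?J, B')" unfolding gl_conj_def using w wB by auto
  then have "(?J, B') \<in> qpairs q n" using AB gl_conj_qpairs by blast
  then have rel: "?J * B' = q \<cdot>\<^sub>m (B' * ?J)" unfolding qpairs_def by simp
  obtain B1 B2 B3 B4 where sb: "split_block B' ?n1 ?n1 = (B1, B2, B3, B4)" by (metis surj_pair)
  have s: "B1 \<in> carrier_mat ?n1 ?n1" "B2 \<in> carrier_mat ?n1 ?n2" "B3 \<in> carrier_mat ?n2 ?n1" "B4 \<in> carrier_mat ?n2 ?n2"
    "B' = four_block_mat B1 B2 B3 B4" using split_block[OF sb, of ?n2 ?n2] B' n by auto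
  have J2: "?J = four_block_mat ?J1 (0\<^sub>m ?n1 ?n2) (0\<^sub>m ?n2 ?n1) ?J2"
    by (rule blk_eq) auto
  have L: "?J * B' = four_block_mat (?J1 * B1) (?J1 * B2) (?J2 * B3) (?J2 * B4)"
    unfolding J2 s(5) using s by (subst mult_four_block_mat[of _ ?n1 ?n1 _ ?n2 _ ?n2 _ _ ?n1 _ ?n2]) auto
  have R: "q \<cdot>\<^sub>m (B' * ?J) = four_block_mat (q \<cdot>\<^sub>m (B1 * ?J1)) (q \<cdot>\<^sub>m (B2 * ?J2)) (q \<cdot>\<^sub>m (B3 * ?J1)) (q \<cdot>\<^sub>m (B4 * ?J2))"
    unfolding J2 s(5) using s
    by (subst mult_four_block_mat[of _ ?n1 ?n1 _ ?n2 _ ?n2 _ _ ?n1 _ ?n2])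
      (auto simp: smult_four_block_mat[of _ ?n1 ?n1 _ ?n2 _ ?n2])
  have evA1: "eigenvalue A x \<and> x \<in> S" if "eigenvalue ?J1 x" for x
    using jordan_matrix_eigenvalue[OF that] unfolding eigenvalue_jordan_nf[OF xs c(1)] ys_def by force
  have evA2: "eigenvalue A x \<and> x \<notin> S" if "eigenvalue ?J2 x" for x
    using jordan_matrix_eigenvalue[OF that] unfolding eigenvalue_jordan_nf[OF xs c(1)] zs_def by force
  have e2: "?J1 * B2 = q \<cdot>\<^sub>m (B2 * ?J2)"
  proof (rule eq_matI)
    fix i j assume ij: "i < dim_row (q \<cdot>\<^sub>m (B2 * ?J2))" "j < dim_col (q \<cdot>\<^sub>m (B2 * ?J2))"
    then have "(?J * B') $$ (i, j + ?n1) = (q \<cdot>\<^sub>m (B' * ?J)) $$ (i, j + ?n1)" using rel by simp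
    then show "(?J1 * B2) $$ (i, j) = (q \<cdot>\<^sub>m (B2 * ?J2)) $$ (i, j)"
      unfolding L R using ij s(1-4) by simp
  qed (use s in auto)
  have e3: "?J2 * B3 = q \<cdot>\<^sub>m (B3 * ?J1)"
  proof (rule eq_matI)
    fix i j assume ij: "i < dim_row (q \<cdot>\<^sub>m (B3 * ?J1))" "j < dim_col (q \<cdot>\<^sub>m (B3 * ?J1))"
    then have "(?J * B') $$ (i + ?n1, j) = (q \<cdot>\<^sub>m (B' * ?J)) $$ (i + ?n1, j)" using rel by simp
    then show "(?J2 * B3) $$ (i, j) = (q \<cdot>\<^sub>m (B3 * ?J1)) $$ (i, j)"
      unfolding L R using ij s(1-4) by simp
  qed (use s in auto)
  have "B2 = 0\<^sub>m ?n1 ?n2"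
    by (rule no_intertwiner[OF jordan_matrix_carrier jordan_matrix_carrier jordan_matrix_upper_triangular' s(2) e2])
      (use evA1 evA2 S in blast)
  moreover have "B3 = 0\<^sub>m ?n2 ?n1"
    by (rule no_intertwiner[OF jordan_matrix_carrier jordan_matrix_carrier jordan_matrix_upper_triangular' s(3) e3])
      (use evA1 evA2 S in blast)
  ultimately have "B' = blk B1 B4" unfolding s(5) by (simp add: blk_eq[OF s(1,4)])
  then have con': "gl_conj (A, B) (psum (?J1, B1) (?J2, B4))" using con unfolding psum_def by simp
  then have "psum (?J1, B1) (?J2, B4) \<in> qpairs q (?n1 + ?n2)" using AB gl_conj_qpairs unfolding n by blast
  then have "(?J1, B1) \<in> qpairs q ?n1" "(?J2, B4) \<in> qpairs q ?n2"
    using psum_qpairs_iff[of "(?J1, B1)" ?n1 "(?J2, B4)" ?n2] s by auto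
  then show ?thesis using n1 n2 n con' by blast
qed

text \<open>The spectrum as a graph: eigenvalues with quotient \<open>q\<close> are adjacent.\<close>

definition q_link :: "'a::field \<Rightarrow> 'a mat \<Rightarrow> ('a \<times> 'a) set" where
  "q_link q A = {(x, y). eigenvalue A x \<and> eigenvalue A y \<and> (x = q * y \<or> y = q * x)}"

definition q_connected :: "'a::field \<Rightarrow> 'a mat \<Rightarrow> bool" where
  "q_connected q A \<longleftrightarrow> (\<forall>x y. eigenvalue A x \<longrightarrow> eigenvalue A y \<longrightarrow> (x, y) \<in> (q_link q A)\<^sup>*)"

lemma disconnected_split:
  fixes A :: "'a::alg_closed_field mat"
  assumes q: "q \<noteq> 0" and AB: "(A, B) \<in> qpairs q n" and d: "\<not> q_connected q A"
  shows "\<exists>n1 n2 p1 p2. 0 < n1 \<and> 0 < n2 \<and> n1 + n2 = n \<and> p1 \<in> qpairs q n1 \<and> p2 \<in> qpairs q n2 \<and>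
     gl_conj (A, B) (psum p1 p2)"
proof -
  obtain x y where xy: "eigenvalue A x" "eigenvalue A y" "(x, y) \<notin> (q_link q A)\<^sup>*"
    using d unfolding q_connected_def by blast
  show ?thesis
  proof (rule spectral_split[OF q AB, of "{z. (x, z) \<in> (q_link q A)\<^sup>*}" x y])
    fix u v assume "eigenvalue A u" "eigenvalue A v" "u = q * v"
    then have "(u, v) \<in> q_link q A" "(v, u) \<in> q_link q A" unfolding q_link_def by auto
    then show "u \<in> {z. (x, z) \<in> (q_link q A)\<^sup>*} \<longleftrightarrow> v \<in> {z. (x, z) \<in> (q_link q A)\<^sup>*}"
      by (auto intro: rtrancl_into_rtrancl)
  qed (use xy in auto)
qed

lemma q_link_powi:
  fixes A :: "'a::field mat"
  assumes q: "q \<noteq> 0" and A: "A \<in> Mat n" and xy: "(x, y) \<in> (q_link q A)\<^sup>*"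
  shows "\<exists>k. \<bar>k\<bar> \<le> int (n * n) \<and> x = q powi k * y"
proof -
  have R: "q_link q A \<subseteq> spectrum A \<times> spectrum A" unfolding q_link_def spectrum_def by auto
  then have fin: "finite (q_link q A)" using card_finite_spectrum[OF A] by (meson finite_SigmaI finite_subset)
  have "card (q_link q A) \<le> card (spectrum A \<times> spectrum A)"
    using R card_finite_spectrum[OF A] by (intro card_mono) auto
  also have "\<dots> \<le> n * n" unfolding card_cartesian_product using card_finite_spectrum[OF A] by (intro mult_le_mono)
  finally have card: "card (q_link q A) \<le> n * n" .
  have step: "\<exists>k. \<bar>k\<bar> \<le> int m \<and> x = q powi k * y" if "(x, y) \<in> q_link q A ^^ m" for m
    using that
  proof (induction m arbitrary: y)
    case 0
    then show ?case by (intro exI[of _ 0]) auto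
  next
    case (Suc m)
    then obtain z where z: "(x, z) \<in> q_link q A ^^ m" "(z, y) \<in> q_link q A" by auto
    obtain k where k: "\<bar>k\<bar> \<le> int m" "x = q powi k * z" using Suc.IH[OF z(1)] by blast
    from z(2) have "z = q * y \<or> z = inverse q * y" unfolding q_link_def using q by (auto simp: field_simps)
    then show ?case
    proof
      assume "z = q * y"
      then show ?thesis using k q by (intro exI[of _ "k + 1"]) (auto simp: power_int_add)
    next
      assume "z = inverse q * y"
      then show ?thesis using k q by (intro exI[of _ "k - 1"]) (auto simp: power_int_diff field_simps)
    qed
  qed
  obtain m where m: "m \<le> card (q_link q A)" "(x, y) \<in> q_link q A ^^ m"
    using xy unfolding rtrancl_finite_eq_relpow[OF fin] by blast
  obtain k where "\<bar>k\<bar> \<le> int m" "x = q powi k * y" using step[OF m(2)] by blast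
  moreover have "int m \<le> int (n * n)" using m(1) card by (simp only: of_nat_le_iff)
  ultimately have "\<bar>k\<bar> \<le> int (n * n) \<and> x = q powi k * y" by linarith
  then show ?thesis ..
qed

text \<open>If the spectrum is connected, every eigenvalue \<open>x\<close> is a power of \<open>q\<close> times any other one, so \<open>x\<^sup>n\<close> is the determinant times a
  power of \<open>q\<close>; the bound on the exponent leaves finitely many polynomial equations.\<close>

lemma q_connected_imp_det_zero:
  fixes A :: "'a::alg_closed_field mat"
  assumes q: "q \<noteq> 0" and A: "A \<in> Mat n" and n: "n > 0" and con: "q_connected q A"
  shows "\<exists>k. \<bar>k\<bar> \<le> int (n * (n * n)) \<and> det (A ^\<^sub>m n - (q powi k * det A) \<cdot>\<^sub>m 1\<^sub>m n) = 0"
proof -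
  obtain U where U: "U \<in> Mat n" "upper_triangular U" "similar_mat A U"
    using similar_upper_triangular[OF A] by blast
  obtain x where x: "eigenvalue A x" using exists_eigenvalue[OF A n] by blast
  have "\<exists>k. \<bar>k\<bar> \<le> int (n * n) \<and> U $$ (i, i) = q powi k * x" if "i < n" for i
  proof -
    have "eigenvalue A (U $$ (i, i))"
      using eigenvalue_upper_triangular[OF U(1,2)] eigenvalue_similar[OF U(3) A] that by blast
    then show ?thesis using q_link_powi[OF q A] x con unfolding q_connected_def by blast
  qed
  then obtain k where k: "\<And>i. i < n \<Longrightarrow> \<bar>k i\<bar> \<le> int (n * n)" "\<And>i. i < n \<Longrightarrow> U $$ (i, i) = q powi k i * x" by metis
  have powi_sum: "(\<Prod>i<m. q powi k i) = q powi (\<Sum>i<m. k i)" for m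
    by (induction m) (simp_all add: power_int_add q)
  have "det A = det U" by (rule det_similar[OF U(3)])
  also have "\<dots> = (\<Prod>i<n. U $$ (i, i))"
    unfolding det_upper_triangular[OF U(2,1)] using U(1) by (simp add: prod_list_diag_prod atLeast0LessThan)
  also have "\<dots> = (\<Prod>i<n. q powi k i * x)" using k by simp
  also have "\<dots> = q powi (\<Sum>i<n. k i) * x ^ n"
    by (simp add: prod.distrib powi_sum)
  finally have det: "det A = q powi (\<Sum>i<n. k i) * x ^ n" .
  have "\<bar>\<Sum>i<n. k i\<bar> \<le> (\<Sum>i<n. \<bar>k i\<bar>)" by (rule sum_abs)
  also have "\<dots> \<le> (\<Sum>i<n. int (n * n))" using k(1) by (intro sum_mono) auto
  finally have b: "\<bar>- (\<Sum>i<n. k i)\<bar> \<le> int (n * (n * n))" by simp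
  have xn: "q powi (- (\<Sum>i<n. k i)) * det A = x ^ n"
    unfolding det using q by (simp add: power_int_minus)
  obtain v where v: "v \<in> carrier_vec n" "v \<noteq> 0\<^sub>v n" "eigenvector A v x"
    using x A unfolding eigenvalue_def eigenvector_def by auto
  have "A ^\<^sub>m n *\<^sub>v v = x ^ n \<cdot>\<^sub>v v" by (rule eigenvector_pow[OF A v(3)])
  then have "(A ^\<^sub>m n - x ^ n \<cdot>\<^sub>m 1\<^sub>m n) *\<^sub>v v = 0\<^sub>v n"
    using v A by (subst minus_mult_distrib_mat_vec[of _ n n]) auto
  then have "det (A ^\<^sub>m n - x ^ n \<cdot>\<^sub>m 1\<^sub>m n) = 0"
    using v A by (subst det_0_iff_vec_prod_zero_field[of _ n]) auto
  then show ?thesis using b xn by metis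
qed

section \<open>Families of pairs closed under degeneration\<close>

text \<open>The properties of the union of the candidate components by which it is shown to be everything.
  Stating them for an arbitrary family permits exchanging the two matrices, and transporting the
  result for commuting pairs to roots of unity.\<close>

locale degeneration_closed =
  fixes q :: "'a::{alg_closed_field, field_char_0}" and F :: "nat \<Rightarrow> ('a mat \<times> 'a mat) set"
  assumes q0: "q \<noteq> 0"
    and sub: "F n \<subseteq> qpairs q n"
    and curve: "A \<in> upoly.mats n n \<Longrightarrow> B \<in> upoly.mats n n \<Longrightarrow> infinite {u. (A u, B u) \<in> F n} \<Longrightarrow> (A v, B v) \<in> F n"
    and conj: "gl_conj p p' \<Longrightarrow> p' \<in> F n \<Longrightarrow> p \<in> F n"
    and psum: "p \<in> F n \<Longrightarrow> r \<in> F m \<Longrightarrow> psum p r \<in> F (n + m)"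

lemma mat_mult_entry:
  "M \<in> carrier_mat n k \<Longrightarrow> N \<in> carrier_mat k m \<Longrightarrow> i < n \<Longrightarrow> j < m \<Longrightarrow>
    (M * N) $$ (i, j) = (\<Sum>r\<in>{0..<k}. M $$ (i, r) * N $$ (r, j))"
  by (auto simp: scalar_prod_def intro!: sum.cong)

lemma smat_smat: "a \<cdot>\<^sub>m (b \<cdot>\<^sub>m M) = (a * b) \<cdot>\<^sub>m (M :: 'a::semiring_1 mat)"
  by (rule eq_matI) (auto simp: mult.assoc)

lemma smat_one: "1 \<cdot>\<^sub>m M = (M :: 'a::semiring_1 mat)"
  by (rule eq_matI) auto

lemma pow_mat_comm:
  fixes A :: "'a::semiring_1 mat"
  assumes "A \<in> Mat n"
  shows "A ^\<^sub>m k * A = A * A ^\<^sub>m k"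
proof (induction k)
  case (Suc k)
  have "A ^\<^sub>m Suc k * A = A * A ^\<^sub>m k * A" using Suc by simp
  also have "\<dots> = A * A ^\<^sub>m Suc k" using assms by (simp add: assoc_mult_mat[of _ n n _ n _ n])
  finally show ?case .
qed (use assms in simp)

lemma swap_psum: "prod.swap (psum p r) = psum (prod.swap p) (prod.swap r)"
  unfolding psum_def by simp

lemma gl_conj_swap: "gl_conj (prod.swap p) (prod.swap p') \<longleftrightarrow> gl_conj p p'"
  unfolding gl_conj_def by auto

lemma qpairs_swap:
  assumes q: "(q::'a::field) \<noteq> 0"
  shows "(B, A) \<in> qpairs (inverse q) n \<longleftrightarrow> (A, B) \<in> qpairs q n"
proof -
  have "B * A = inverse q \<cdot>\<^sub>m (A * B) \<longleftrightarrow> A * B = q \<cdot>\<^sub>m (B * A)"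
    if "A \<in> Mat n" "B \<in> Mat n"
  proof
    assume "B * A = inverse q \<cdot>\<^sub>m (A * B)"
    then have "q \<cdot>\<^sub>m (B * A) = (q * inverse q) \<cdot>\<^sub>m (A * B)" by (simp only: smat_smat)
    then show "A * B = q \<cdot>\<^sub>m (B * A)" using q by (simp add: smat_one)
  next
    assume "A * B = q \<cdot>\<^sub>m (B * A)"
    then have "inverse q \<cdot>\<^sub>m (A * B) = (inverse q * q) \<cdot>\<^sub>m (B * A)" by (simp only: smat_smat)
    then show "B * A = inverse q \<cdot>\<^sub>m (A * B)" using q by (simp add: smat_one)
  qed
  then show ?thesis unfolding qpairs_def by auto
qed

lemma qorder_inverse: "qorder (inverse q) = qorder (q::'a::field)"
  unfolding qorder_def by (simp add: power_inverse)

lemma degeneration_closed_swap: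
  assumes "degeneration_closed q F"
  shows "degeneration_closed (inverse q) (\<lambda>n. prod.swap ` F n)"
proof -
  interpret degeneration_closed q F by fact
  have mem: "(A, B) \<in> prod.swap ` F n \<longleftrightarrow> (B, A) \<in> F n" for A B n by force
  show ?thesis
  proof
    show "inverse q \<noteq> 0" using q0 by simp
    show "prod.swap ` F n \<subseteq> qpairs (inverse q) n" for n
      using sub qpairs_swap[OF q0] by (force simp: mem)
    show "(A v, B v) \<in> prod.swap ` F n" if "A \<in> upoly.mats n n" "B \<in> upoly.mats n n"
      "infinite {u. (A u, B u) \<in> prod.swap ` F n}" for A B n v
      using curve[OF that(2,1)] that(3) unfolding mem by blast
    show "p \<in> prod.swap ` F n" if "gl_conj p p'" "p' \<in> prod.swap ` F n" for p p' n
    proof -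
      have "prod.swap p' \<in> F n" using that(2) by force
      then have "prod.swap p \<in> F n" using that(1) conj gl_conj_swap by blast
      then show ?thesis by (metis image_eqI swap_swap)
    qed
    show "psum p r \<in> prod.swap ` F (n + m)" if "p \<in> prod.swap ` F n" "r \<in> prod.swap ` F m" for p r n m
    proof -
      have "prod.swap p \<in> F n" "prod.swap r \<in> F m" using that by force+
      then have "prod.swap (psum p r) \<in> F (n + m)" unfolding swap_psum by (rule psum)
      then show ?thesis by (metis image_eqI swap_swap)
    qed
  qed
qed

lemma upoly_line:
  assumes "A \<in> Mat n" "A' \<in> Mat n"
  shows "(\<lambda>u. A + u \<cdot>\<^sub>m (A' - A)) \<in> upoly.mats n n"
  using assms by (intro upoly.mats_add upoly.mats_smult upoly_ident upoly.mats_const) auto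

lemma infinite_nonzero:
  fixes f :: "'a::{idom, ring_char_0} \<Rightarrow> 'a"
  assumes "f \<in> upoly_funs" "f v \<noteq> 0"
  shows "infinite {u. f u \<noteq> 0}"
proof
  assume "finite {u. f u \<noteq> 0}"
  then have "finite ({u. f u \<noteq> 0} \<union> {u. f u = 0})" using upoly_finite_zeros[OF assms] by blast
  moreover have "{u. f u \<noteq> 0} \<union> {u. f u = 0} = UNIV" by auto
  ultimately show False using infinite_UNIV_char_0[where 'a = 'a] by simp
qed

text \<open>If a generic member of the linear space of all \<open>A\<close> that \<open>q\<close>-commute with \<open>B\<close> gives a pair in a
  closed set, then every member does.\<close>

lemma perturb_generic:
  fixes q :: "'a::field_char_0"
  assumes curve: "\<And>X Y v. X \<in> upoly.mats n n \<Longrightarrow> Y \<in> upoly.mats n n \<Longrightarrow> infinite {u. (X u, Y u) \<in> F} \<Longrightarrow> (X v, Y v) \<in> F"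
    and AB: "(A, B) \<in> qpairs q n" and A'B: "(A', B) \<in> qpairs q n"
    and P: "\<And>X. X \<in> upoly.mats n n \<Longrightarrow> (\<lambda>u. P (X u)) \<in> upoly_funs" and nz: "P A' \<noteq> 0"
    and F: "\<And>X. (X, B) \<in> qpairs q n \<Longrightarrow> P X \<noteq> 0 \<Longrightarrow> (X, B) \<in> F"
  shows "(A, B) \<in> F"
proof -
  have c: "A \<in> Mat n" "B \<in> Mat n" "A' \<in> Mat n"
    and e: "A * B = q \<cdot>\<^sub>m (B * A)" "A' * B = q \<cdot>\<^sub>m (B * A')" using AB A'B unfolding qpairs_def by auto
  let ?X = "\<lambda>u. A + u \<cdot>\<^sub>m (A' - A)"
  have X: "?X \<in> upoly.mats n n" by (rule upoly_line[OF c(1,3)])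
  have qp: "(?X u, B) \<in> qpairs q n" for u
  proof -
    have d: "A' - A \<in> Mat n" "u \<cdot>\<^sub>m (A' - A) \<in> Mat n" using c by auto
    have "?X u * B = A * B + u \<cdot>\<^sub>m (A' * B - A * B)"
      unfolding add_mult_distrib_mat[OF c(1) d(2) c(2)] mult_smult_assoc_mat[OF d(1) c(2)]
        minus_mult_distrib_mat[OF c(3,1,2)] ..
    also have "\<dots> = q \<cdot>\<^sub>m (B * A + u \<cdot>\<^sub>m (B * A' - B * A))"
      unfolding e using c by (intro eq_matI) (auto simp: algebra_simps)
    also have "B * A + u \<cdot>\<^sub>m (B * A' - B * A) = B * ?X u"
      unfolding mult_add_distrib_mat[OF c(2,1) d(2)] mult_smult_distrib[OF c(2) d(1)]
        mult_minus_distrib_mat[OF c(2,3,1)] ..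
    finally show ?thesis using c add_carrier_mat[OF d(2), of A] unfolding qpairs_def by simp
  qed
  have x1: "?X 1 = A'" using c by (intro eq_matI) auto
  have "infinite {u. P (?X u) \<noteq> 0}"
    using infinite_nonzero[OF P[OF X], of 1] nz unfolding x1 by blast
  then have "infinite {u. (?X u, B) \<in> F}" by (rule infinite_super[rotated]) (use F qp in blast)
  then have "(?X 0, B) \<in> F" by (rule curve[OF X upoly.mats_const[OF c(2)]])
  moreover have "?X 0 = A" using c by (intro eq_matI) auto
  ultimately show ?thesis by simp
qed

context degeneration_closed
begin

lemma perturb_fst:
  assumes "(A, B) \<in> qpairs q n" "(A', B) \<in> qpairs q n"
    and "\<And>X. X \<in> upoly.mats n n \<Longrightarrow> (\<lambda>u. P (X u)) \<in> upoly_funs" "P A' \<noteq> 0"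
    and "\<And>X. (X, B) \<in> qpairs q n \<Longrightarrow> P X \<noteq> 0 \<Longrightarrow> (X, B) \<in> F n"
  shows "(A, B) \<in> F n"
  by (rule perturb_generic[where P = P, OF _ assms]) (rule curve)

lemma split_mem:
  assumes IH: "\<And>m. 0 < m \<Longrightarrow> m < n \<Longrightarrow> qpairs q m \<subseteq> F m"
    and s: "\<exists>n1 n2 p1 p2. 0 < n1 \<and> 0 < n2 \<and> n1 + n2 = n \<and> p1 \<in> qpairs q n1 \<and> p2 \<in> qpairs q n2 \<and>
     gl_conj p (psum p1 p2)"
  shows "p \<in> F n"
proof -
  obtain n1 n2 p1 p2 where "0 < n1" "0 < n2" "n1 + n2 = n" "p1 \<in> qpairs q n1" "p2 \<in> qpairs q n2"
    "gl_conj p (psum p1 p2)" using s by blast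
  moreover from this have "p1 \<in> F n1" "p2 \<in> F n2" using IH[of n1] IH[of n2] by auto
  ultimately show ?thesis using psum conj by blast
qed

lemma disconnected_mem:
  assumes IH: "\<And>m. 0 < m \<Longrightarrow> m < n \<Longrightarrow> qpairs q m \<subseteq> F m"
    and AB: "(A, B) \<in> qpairs q n" and d: "\<not> q_connected q A"
  shows "(A, B) \<in> F n"
  using split_mem[OF IH disconnected_split[OF q0 AB d]] by blast

lemma disconnected_mem_snd:
  assumes IH: "\<And>m. 0 < m \<Longrightarrow> m < n \<Longrightarrow> qpairs q m \<subseteq> F m"
    and AB: "(A, B) \<in> qpairs q n" and d: "\<not> q_connected (inverse q) B"
  shows "(A, B) \<in> F n"
proof -
  interpret s: degeneration_closed "inverse q" "\<lambda>n. prod.swap ` F n"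
    by (rule degeneration_closed_swap) unfold_locales
  have "qpairs (inverse q) m \<subseteq> prod.swap ` F m" if "0 < m" "m < n" for m
  proof
    fix p assume "p \<in> qpairs (inverse q) m"
    then have "prod.swap p \<in> qpairs q m" using qpairs_swap[OF q0] by (cases p) auto
    then have "prod.swap p \<in> F m" using IH[OF that] by blast
    then show "p \<in> prod.swap ` F m" by (metis image_eqI swap_swap)
  qed
  then have "(B, A) \<in> prod.swap ` F n"
    using s.disconnected_mem[of n B A] d AB qpairs_swap[OF q0] by blast
  then show ?thesis by force
qed

end

lemma not_q_connected_zero:
  assumes q: "q \<noteq> 0" and x: "eigenvalue A 0" "eigenvalue A x" "x \<noteq> 0"
  shows "\<not> q_connected q A"
proof -
  have "y = 0" if "(0, y) \<in> (q_link q A)\<^sup>*" for y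
    using that by induction (auto simp: q_link_def q)
  then show ?thesis using x unfolding q_connected_def by blast
qed


section \<open>One matrix nilpotent\<close>

lemma mat_diag_blk: "blk (mat_diag k f) (mat_diag m g) = mat_diag (k + m) (\<lambda>i. if i < k then f i else g (i - k))"
  unfolding blk_eq[OF mat_diag_dim mat_diag_dim] by (rule eq_matI) (auto simp: mat_diag_def)

lemma blk_smult:
  "A \<in> Mat n \<Longrightarrow> B \<in> Mat m \<Longrightarrow> c \<cdot>\<^sub>m blk A B = blk (c \<cdot>\<^sub>m A) (c \<cdot>\<^sub>m (B :: 'a::semiring_1 mat))"
  by (simp add: blk_eq[of _ n _ m] smult_four_block_mat[of _ n n _ m _ m])

lemma q_commute_lincomb:
  fixes B :: "'a::comm_ring_1 mat"
  assumes W: "\<And>m. W m \<in> Mat n" and B: "B \<in> Mat n" and M: "\<And>m. W m * B = q \<cdot>\<^sub>m (B * W m)"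
  shows "mat n n (\<lambda>ij. \<Sum>m\<in>I. a m * W m $$ ij) * B = q \<cdot>\<^sub>m (B * mat n n (\<lambda>ij. \<Sum>m\<in>I. a m * W m $$ ij))"
    (is "?A * B = _")
proof (rule eq_matI)
  have A: "?A \<in> Mat n" by simp
  fix i j assume "i < dim_row (q \<cdot>\<^sub>m (B * ?A))" "j < dim_col (q \<cdot>\<^sub>m (B * ?A))"
  then have ij: "i < n" "j < n" using B by auto
  have e: "(\<Sum>r\<in>{0..<n}. W m $$ (i, r) * B $$ (r, j)) = q * (\<Sum>r\<in>{0..<n}. B $$ (i, r) * W m $$ (r, j))" for m
    unfolding mat_mult_entry[OF W B ij, symmetric] mat_mult_entry[OF B W ij, symmetric] M
    using ij B W[of m] by (intro index_smult_mat) auto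
  have "(?A * B) $$ (i, j) = (\<Sum>r\<in>{0..<n}. (\<Sum>m\<in>I. a m * W m $$ (i, r)) * B $$ (r, j))"
    unfolding mat_mult_entry[OF A B ij] using ij by (intro sum.cong) auto
  also have "\<dots> = (\<Sum>m\<in>I. a m * (\<Sum>r\<in>{0..<n}. W m $$ (i, r) * B $$ (r, j)))"
    unfolding sum_distrib_left sum_distrib_right by (subst sum.swap) (simp add: mult.assoc)
  also have "\<dots> = q * (\<Sum>r\<in>{0..<n}. B $$ (i, r) * (\<Sum>m\<in>I. a m * W m $$ (r, j)))"
    unfolding e sum_distrib_left by (subst sum.swap) (simp add: algebra_simps)
  also have "\<dots> = q * (B * ?A) $$ (i, j)"
    unfolding mat_mult_entry[OF B A ij] using ij by (intro arg_cong2[of _ _ _ _ "(*)"] refl sum.cong) auto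
  finally show "(?A * B) $$ (i, j) = (q \<cdot>\<^sub>m (B * ?A)) $$ (i, j)" using ij B by simp
qed (use B in auto)

lemma blk_q_commute:
  fixes A :: "'a::comm_ring_1 mat"
  assumes "A \<in> Mat n" "B \<in> Mat m" "C \<in> Mat n" "D \<in> Mat m"
    and "A * C = q \<cdot>\<^sub>m (C * A)" "B * D = q \<cdot>\<^sub>m (D * B)"
  shows "blk A B * blk C D = q \<cdot>\<^sub>m (blk C D * blk A B)"
  unfolding blk_mult[OF assms(1-4)] blk_mult[OF assms(3,4,1,2)] assms(5,6)
  by (rule blk_smult[symmetric]) (use assms in auto)

lemma mat_diag_jordan_block:
  fixes q :: "'a::field"
  assumes "q \<noteq> 0"
  shows "mat_diag k (\<lambda>i. c * inverse q ^ i) * jordan_block k 0 = q \<cdot>\<^sub>m (jordan_block k 0 * mat_diag k (\<lambda>i. c * inverse q ^ i))"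
  using assms
  by (subst mat_diag_mult_left[of _ k k], simp, subst mat_diag_mult_right[of _ k k], simp)
     (auto intro!: eq_matI simp: field_simps)

lemma nilpotent_jordan_weights:
  fixes q :: "'a::field"
  assumes q: "q \<noteq> 0" and xs: "\<forall>x\<in>set xs. snd x = 0"
  shows "\<exists>d. (\<forall>i. d i \<noteq> 0) \<and> mat_diag (sum_list (map fst xs)) d * jordan_matrix xs =
     q \<cdot>\<^sub>m (jordan_matrix xs * mat_diag (sum_list (map fst xs)) d)"
  using xs
proof (induction xs)
  case Nil
  show ?case by (intro exI[of _ "\<lambda>_. 1"]) (auto intro!: eq_matI simp: jordan_matrix_def)
next
  case (Cons x xs)
  obtain k where x: "x = (k, 0)" using Cons.prems by (cases x) auto
  let ?m = "sum_list (map fst xs)"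
  obtain d where d: "\<forall>i. d i \<noteq> 0" "mat_diag ?m d * jordan_matrix xs = q \<cdot>\<^sub>m (jordan_matrix xs * mat_diag ?m d)"
    using Cons by auto
  let ?d = "\<lambda>i. if i < k then 1 * inverse q ^ i else d (i - k)"
  have J: "jordan_matrix (x # xs) = blk (jordan_block k 0) (jordan_matrix xs)"
    unfolding x jordan_matrix_def blk_expand by (simp add: Let_def)
  have "mat_diag (k + ?m) ?d * jordan_matrix (x # xs) = q \<cdot>\<^sub>m (jordan_matrix (x # xs) * mat_diag (k + ?m) ?d)"
    unfolding J mat_diag_blk[of k "\<lambda>i. 1 * inverse q ^ i" ?m d, symmetric]
    by (rule blk_q_commute[OF mat_diag_dim mat_diag_dim jordan_block_carrier jordan_matrix_carrier
          mat_diag_jordan_block[OF q] d(2)])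
  moreover have "\<forall>i. ?d i \<noteq> 0" using d(1) q by auto
  ultimately show ?case unfolding x by (intro exI[of _ ?d]) simp
qed

lemma det_mat_diag: "det (mat_diag n f) = (\<Prod>i<n. f i)" for f :: "nat \<Rightarrow> 'a::comm_ring_1"
  by (subst det_upper_triangular[of _ n])
    (auto simp: mat_diag_def upper_triangular_def prod_list_diag_prod atLeast0LessThan)

lemma mat_diag_pow: "mat_diag n f ^\<^sub>m k = mat_diag n (\<lambda>i. f i ^ k)" for f :: "nat \<Rightarrow> 'a::comm_ring_1"
proof (induction k)
  case 0
  show ?case by (auto simp: mat_diag_def)
next
  case (Suc k)
  then show ?case by (simp add: mult.commute)
qed

text \<open>By \<open>q_connected_imp_det_zero\<close>, the spectrum is disconnected where this polynomial does not vanish.\<close>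

definition connected_test :: "'a::field \<Rightarrow> nat \<Rightarrow> 'a mat \<Rightarrow> 'a" where
  "connected_test q n X = (\<Prod>k\<in>{- int (n * (n * n))..int (n * (n * n))}. det (X ^\<^sub>m n - (q powi k * det X) \<cdot>\<^sub>m 1\<^sub>m n))"

lemma connected_test_nz:
  fixes X :: "'a::alg_closed_field mat"
  assumes "q \<noteq> 0" "X \<in> Mat n" "n > 0" "connected_test q n X \<noteq> 0"
  shows "\<not> q_connected q X"
proof
  assume "q_connected q X"
  then obtain k where "\<bar>k\<bar> \<le> int (n * (n * n))" "det (X ^\<^sub>m n - (q powi k * det X) \<cdot>\<^sub>m 1\<^sub>m n) = 0"
    using q_connected_imp_det_zero[OF assms(1-3)] by blast
  then have "connected_test q n X = 0" unfolding connected_test_def by (intro prod_zero bexI[of _ k]) (auto simp del: of_nat_mult)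
  then show False using assms(4) by simp
qed

lemma connected_test_upoly:
  "X \<in> upoly.mats n n \<Longrightarrow> (\<lambda>u. connected_test q n (X u)) \<in> upoly_funs"
  unfolding connected_test_def
  by (intro upoly.prod upoly.mats_det upoly.mats_minus upoly.mats_pow upoly.mats_smult upoly.mult
      upoly.const upoly.mats_const) auto

text \<open>Scaling one of at least two diagonal blocks by a generic factor disconnects the spectrum.\<close>

lemma generic_scaling_disconnects:
  fixes w :: "nat \<Rightarrow> 'a::field_char_0"
  assumes w: "\<And>i. w i \<noteq> 0" and q: "q \<noteq> 0" and k: "0 < k" "k < n"
  shows "\<exists>a. connected_test q n (mat_diag n (\<lambda>i. if i < k then a * w i else w i)) \<noteq> 0"
proof -
  define e where "e = (\<Prod>i<n. w i)"
  define p where "p i j = monom (w i ^ n) (if i < k then n else 0) - monom (q powi j * e) k" for i j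
  have "coeff (p i j) (if i < k then n else 0) = w i ^ n" for i j
    unfolding p_def using k by (simp add: coeff_monom)
  then have p: "p i j \<noteq> 0" for i j using w by (metis coeff_0 power_eq_0_iff)
  let ?N = "int (n * (n * n))"
  let ?bad = "\<Union>i\<in>{..<n}. \<Union>j\<in>{-?N..?N}. {a. poly (p i j) a = 0}"
  have "finite ?bad" using p by (intro finite_UN_I) (auto intro: poly_roots_finite)
  then obtain a where a: "a \<notin> ?bad" using ex_new_if_finite[OF infinite_UNIV_char_0] by blast
  let ?c = "\<lambda>i. if i < k then a * w i else w i"
  have "(\<Prod>i<n. ?c i) = (\<Prod>i<n. (if i < k then a else 1) * w i)" by (rule prod.cong) auto
  also have "\<dots> = (\<Prod>i<n. (if i < k then a else 1)) * e" unfolding prod.distrib e_def ..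
  also have "(\<Prod>i<n. (if i < k then a else 1)) = (\<Prod>i<k. a)"
    using k by (intro prod.mono_neutral_cong_right) auto
  finally have det: "det (mat_diag n ?c) = a ^ k * e" unfolding det_mat_diag by simp
  have "det (mat_diag n ?c ^\<^sub>m n - (q powi j * det (mat_diag n ?c)) \<cdot>\<^sub>m 1\<^sub>m n) \<noteq> 0" if j: "j \<in> {-?N..?N}" for j
  proof -
    have "mat_diag n ?c ^\<^sub>m n - (q powi j * det (mat_diag n ?c)) \<cdot>\<^sub>m 1\<^sub>m n =
      mat_diag n (\<lambda>i. ?c i ^ n - q powi j * (a ^ k * e))"
      unfolding mat_diag_pow det by (rule eq_matI) (auto simp: mat_diag_def)
    moreover have "?c i ^ n - q powi j * (a ^ k * e) = poly (p i j) a" for i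
      unfolding p_def by (auto simp: poly_monom power_mult_distrib)
    ultimately have "mat_diag n ?c ^\<^sub>m n - (q powi j * det (mat_diag n ?c)) \<cdot>\<^sub>m 1\<^sub>m n =
      mat_diag n (\<lambda>i. poly (p i j) a)" by presburger
    then have "det (mat_diag n ?c ^\<^sub>m n - (q powi j * det (mat_diag n ?c)) \<cdot>\<^sub>m 1\<^sub>m n) = (\<Prod>i<n. poly (p i j) a)"
      by (simp only: det_mat_diag)
    then show ?thesis using a j by auto
  qed
  then show ?thesis unfolding connected_test_def by (intro exI[of _ a]) auto
qed

text \<open>A matrix with enough distinct eigenvalues is diagonalised by its eigenvectors, with the
  eigenvalues in any prescribed order.\<close>

lemma diagonalizable_distinct:
  fixes X :: "'a::field mat"
  assumes X: "X \<in> Mat n" and ev: "\<And>i. i < n \<Longrightarrow> eigenvalue X (c i)" and inj: "inj_on c {..<n}"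
  shows "\<exists>P Q. P \<in> Mat n \<and> Q \<in> Mat n \<and> P * Q = 1\<^sub>m n \<and> Q * P = 1\<^sub>m n \<and> X * P = P * mat_diag n c"
proof -
  have "\<exists>v. v \<in> carrier_vec n \<and> v \<noteq> 0\<^sub>v n \<and> X *\<^sub>v v = c i \<cdot>\<^sub>v v" if "i < n" for i
    using ev[OF that] X unfolding eigenvalue_def eigenvector_def by auto
  then obtain v where v: "\<And>i. i < n \<Longrightarrow> v i \<in> carrier_vec n" "\<And>i. i < n \<Longrightarrow> v i \<noteq> 0\<^sub>v n"
    "\<And>i. i < n \<Longrightarrow> X *\<^sub>v v i = c i \<cdot>\<^sub>v v i" by metis
  define P where "P = mat n n (\<lambda>(i, j). v j $ i)"
  have P: "P \<in> Mat n" unfolding P_def by simp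
  have col: "col P j = v j" if "j < n" for j using v(1)[OF that] that unfolding P_def by (intro eq_vecI) auto
  have XP: "X * P = P * mat_diag n c"
  proof (rule eq_matI)
    fix i j assume "i < dim_row (P * mat_diag n c)" "j < dim_col (P * mat_diag n c)"
    then have ij: "i < n" "j < n" using P by (auto simp: mat_diag_def)
    have "(X * P) $$ (i, j) = (X *\<^sub>v v j) $ i" using ij X P col by simp
    also have "\<dots> = c j * v j $ i" using v(1,3)[OF ij(2)] ij by simp
    also have "\<dots> = (P * mat_diag n c) $$ (i, j)"
      unfolding mat_diag_mult_right[OF P] using ij by (simp add: P_def)
    finally show "(X * P) $$ (i, j) = (P * mat_diag n c) $$ (i, j)" .
  qed (use X P in \<open>auto simp: mat_diag_def\<close>)
  have "det P \<noteq> 0"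
  proof
    assume "det P = 0"
    then obtain w where w: "w \<in> carrier_vec n" "w \<noteq> 0\<^sub>v n" "P *\<^sub>v w = 0\<^sub>v n"
      unfolding det_0_iff_vec_prod_zero_field[OF P] by blast
    \<comment> \<open>Applying \<open>X - a\<close> to a linear relation between the eigenvectors eliminates one of them.\<close>
    have rel: "(\<Sum>i<n. v i $ r * ((\<Prod>a\<leftarrow>as. c i - a) * w $ i)) = 0" if "r < n" for r as
      using that
    proof (induction as arbitrary: r)
      case Nil
      have "(P *\<^sub>v w) $ r = (\<Sum>i<n. v i $ r * w $ i)" using Nil w(1) by (simp add: P_def scalar_prod_def atLeast0LessThan)
      then show ?case using w(3) Nil by simp
    next
      case (Cons a as)
      let ?u = "\<lambda>i. (\<Prod>a\<leftarrow>as. c i - a) * w $ i"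
      have ev: "c i * v i $ r = (\<Sum>k<n. X $$ (r, k) * v i $ k)" if "i < n" for i
        using arg_cong[OF v(3)[OF that], of "\<lambda>v. v $ r"] v(1)[OF that] X Cons.prems by (simp add: scalar_prod_def atLeast0LessThan)
      have "(\<Sum>i<n. v i $ r * ((\<Prod>a\<leftarrow>a # as. c i - a) * w $ i)) = (\<Sum>i<n. c i * v i $ r * ?u i) - a * (\<Sum>i<n. v i $ r * ?u i)"
        unfolding sum_distrib_left sum_subtractf[symmetric] by (intro sum.cong refl) (simp add: algebra_simps)
      also have "\<dots> = (\<Sum>i<n. \<Sum>k<n. X $$ (r, k) * (v i $ k * ?u i))"
        using Cons by (simp add: ev sum_distrib_right mult.assoc)
      also have "\<dots> = (\<Sum>k<n. X $$ (r, k) * (\<Sum>i<n. v i $ k * ?u i))" unfolding sum_distrib_left by (rule sum.swap)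
      also have "\<dots> = 0" using Cons.IH by simp
      finally show ?case .
    qed
    have "w $ i0 = 0" if i0: "i0 < n" for i0
    proof -
      let ?as = "map c (filter (\<lambda>i. i \<noteq> i0) [0..<n])"
      obtain r where r: "r < n" "v i0 $ r \<noteq> 0" using v(1,2)[OF i0] by (auto simp: vec_eq_iff)
      have z: "(\<Prod>a\<leftarrow>?as. c i - a) = 0" if "i < n" "i \<noteq> i0" for i unfolding prod_list_zero_iff using that by force
      have "(\<Sum>i<n. v i $ r * ((\<Prod>a\<leftarrow>?as. c i - a) * w $ i)) =
          (\<Sum>i<n. if i = i0 then v i0 $ r * ((\<Prod>a\<leftarrow>?as. c i0 - a) * w $ i0) else 0)"
      proof (rule sum.cong[OF refl])
        fix i assume "i \<in> {..<n}"
        then have e: "(\<Prod>a\<leftarrow>?as. c i - a) = 0" if "i \<noteq> i0" using z that by simp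
        show "v i $ r * ((\<Prod>a\<leftarrow>?as. c i - a) * w $ i) = (if i = i0 then v i0 $ r * ((\<Prod>a\<leftarrow>?as. c i0 - a) * w $ i0) else 0)"
          by (cases "i = i0") (simp_all only: e if_True if_False mult_zero_left mult_zero_right simp_thms)
      qed
      then have "(\<Sum>i<n. v i $ r * ((\<Prod>a\<leftarrow>?as. c i - a) * w $ i)) = v i0 $ r * ((\<Prod>a\<leftarrow>?as. c i0 - a) * w $ i0)"
        using i0 by simp
      moreover have "(\<Prod>a\<leftarrow>?as. c i0 - a) \<noteq> 0" unfolding prod_list_zero_iff using inj i0 by (auto simp: inj_on_def)
      ultimately show ?thesis using rel[OF r(1), of ?as] r(2) by simp
    qed
    then have "w = 0\<^sub>v n" using w(1) by (intro eq_vecI) auto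
    then show False using w(2) by simp
  qed
  then obtain Q where "Q \<in> Mat n" "P * Q = 1\<^sub>m n" "Q * P = 1\<^sub>m n"
    using det_non_zero_imp_unit[OF P, of "()"] unfolding Units_def ring_mat_simps by auto
  then show ?thesis using P XP by blast
qed

lemma gl_conj_of_inverse:
  fixes A :: "'a::field mat"
  assumes "A \<in> Mat n" "B \<in> Mat n" "A' \<in> Mat n"
    and P: "P \<in> Mat n" "Q \<in> Mat n" "P * Q = 1\<^sub>m n" and AP: "A * P = P * A'"
  shows "gl_conj (A, B) (A', Q * B * P)"
proof (rule gl_conjI[OF assms(1-3) _ P AP])
  show "Q * B * P \<in> Mat n" using assms by simp
  have "P * (Q * B * P) = P * (Q * (B * P))" using assoc_mult_mat[OF P(2) assms(2) P(1)] by simp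
  also have "\<dots> = (P * Q) * (B * P)" using assms by (intro assoc_mult_mat[symmetric, of P n n Q n _ n]) auto
  finally show "B * P = P * (Q * B * P)" using assms by simp
qed

lemma qorder_distinct_powers:
  assumes n: "enat n \<le> qorder q" and q: "(q::'a::field) \<noteq> 0" and i: "i < n" "j < n" and eq: "q ^ i = q ^ j"
  shows "i = j"
proof -
  have "\<not> a < b" if "a < n" "b < n" "q ^ a = q ^ b" for a b :: nat
  proof
    assume ab: "a < b"
    then have "q ^ b = q ^ a * q ^ (b - a)" by (simp flip: power_add)
    then have 1: "b - a > 0 \<and> q ^ (b - a) = 1" using that(3) q ab by simp
    then have "\<exists>k>0. q ^ k = 1" by blast
    then have "qorder q \<le> enat (b - a)"
      unfolding qorder_def using Least_le[of "\<lambda>k. k > 0 \<and> q ^ k = 1", OF 1] by simp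
    then show False using n ab that(2) by (metis diff_less_mono2 enat_ord_simps(1) le_less_trans leD less_imp_diff_less order_trans)
  qed
  then show ?thesis using i eq by (metis nat_neq_iff)
qed

lemma qorder_finite:
  assumes "qorder q = enat l"
  shows "0 < l" "q ^ l = 1"
proof -
  have ex: "\<exists>k>0. q ^ k = 1" and l: "l = (LEAST k. k > 0 \<and> q ^ k = 1)"
    using assms unfolding qorder_def by (auto split: if_splits)
  show "0 < l" "q ^ l = 1" using LeastI_ex[of "\<lambda>k. k > 0 \<and> q ^ k = 1"] ex unfolding l by auto
qed

text \<open>What \<open>q\<close>-commutes with a nilpotent Jordan block is upper triangular, and determined by its first row.\<close>

lemma jordan_q_commutant:
  fixes q :: "'a::field"
  assumes q: "q \<noteq> 0" and XJ: "(X, jordan_block n 0) \<in> qpairs q n"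
  shows "j < i \<Longrightarrow> i < n \<Longrightarrow> X $$ (i, j) = 0"
    and "i + m < n \<Longrightarrow> X $$ (i, i + m) = inverse q ^ i * X $$ (0, m)"
proof -
  have X: "X \<in> Mat n" and e: "X * jordan_block n 0 = q \<cdot>\<^sub>m (jordan_block n 0 * X)"
    using XJ unfolding qpairs_def by auto
  have R: "(jordan_block n 0 * X) $$ (i, j) = X $$ (Suc i, j)" if "Suc i < n" "j < n" for i j
  proof -
    have "(jordan_block n 0 * X) $$ (i, j) = (\<Sum>l\<in>{0..<n}. (if l = Suc i then 1 else 0) * X $$ (l, j))"
      using X that by (auto simp: scalar_prod_def intro!: sum.cong)
    also have "\<dots> = (\<Sum>l\<in>{Suc i}. X $$ (l, j))" using that by (intro sum.mono_neutral_cong_right) auto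
    finally show ?thesis by simp
  qed
  have L: "(X * jordan_block n 0) $$ (i, j) = (if j = 0 then 0 else X $$ (i, j - 1))" if "i < n" "j < n" for i j
  proof -
    have "(X * jordan_block n 0) $$ (i, j) = (\<Sum>l\<in>{0..<n}. X $$ (i, l) * (if Suc l = j then 1 else 0))"
      using X that by (auto simp: scalar_prod_def intro!: sum.cong)
    also have "\<dots> = (\<Sum>l\<in>(if j = 0 then {} else {j - 1}). X $$ (i, l))"
      using that by (intro sum.mono_neutral_cong_right) (auto split: if_splits)
    finally show ?thesis by simp
  qed
  have eq: "(if j = 0 then 0 else X $$ (i, j - 1)) = q * X $$ (Suc i, j)" if "Suc i < n" "j < n" for i j
    using arg_cong[OF e, of "\<lambda>M. M $$ (i, j)"] L[of i j] R[OF that] X that by simp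
  have first: "X $$ (i, 0) = 0" if "0 < i" "i < n" for i
    using eq[of "i - 1" 0] q that by simp
  have shift: "X $$ (Suc i, Suc j) = inverse q * X $$ (i, j)" if "Suc i < n" "Suc j < n" for i j
    using eq[of i "Suc j"] q that by (simp add: field_simps)
  show "X $$ (i, j) = 0" if "j < i" "i < n"
    using that
  proof (induction j arbitrary: i)
    case 0
    then show ?case using first by simp
  next
    case (Suc j)
    then obtain i' where "i = Suc i'" by (cases i) auto
    then show ?case using shift[of i' j] Suc by simp
  qed
  show "X $$ (i, i + m) = inverse q ^ i * X $$ (0, m)" if "i + m < n"
    using that by (induction i) (use shift in auto)
qed

context degeneration_closed
begin

text \<open>Up to perturbation \<open>A\<close> has the eigenvalues \<open>x, x q\<^sup>-\<^sup>1, \<dots>\<close> with \<open>x \<noteq> 0\<close>, which are distinct since \<open>n\<close>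
  does not exceed the order of \<open>q\<close>; so \<open>A\<close> can be diagonalised.\<close>

lemma short_jordan_block_mem:
  assumes le: "enat n \<le> qorder q" and n: "0 < n" and AJ: "(A, jordan_block n 0) \<in> qpairs q n"
    and base: "\<And>a X. a \<noteq> 0 \<Longrightarrow> (mat_diag n (\<lambda>k. a * inverse q ^ k), X) \<in> qpairs q n \<Longrightarrow>
      (mat_diag n (\<lambda>k. a * inverse q ^ k), X) \<in> F n"
  shows "(A, jordan_block n 0) \<in> F n"
proof -
  let ?J = "jordan_block n 0 :: 'a mat"
  let ?D = "mat_diag n (\<lambda>i. 1 * inverse q ^ i)"
  have D: "(?D, ?J) \<in> qpairs q n"
    using mat_diag_jordan_block[OF q0, of n 1] unfolding qpairs_def by simp
  show ?thesis
  proof (rule perturb_fst[OF AJ D, of "\<lambda>X. X $$ (0, 0)"])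
    show "(\<lambda>u. X u $$ (0, 0)) \<in> upoly_funs" if "X \<in> upoly.mats n n" for X
      using upoly.mats_entry[OF that n n] .
    show "?D $$ (0, 0) \<noteq> 0" using n by (simp add: mat_diag_def)
    fix X assume X: "(X, ?J) \<in> qpairs q n" and nz: "X $$ (0, 0) \<noteq> 0"
    then have Xc: "X \<in> Mat n" unfolding qpairs_def by simp
    let ?c = "\<lambda>i. X $$ (0, 0) * inverse q ^ i"
    have ut: "upper_triangular X" using jordan_q_commutant(1)[OF q0 X] Xc by (auto simp: upper_triangular_def)
    have "eigenvalue X (?c i)" if "i < n" for i
      using eigenvalue_upper_triangular[OF Xc ut] jordan_q_commutant(2)[OF q0 X, of i 0] that by (auto simp: mult.commute)
    moreover have "inj_on ?c {..<n}"
    proof (rule inj_onI)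
      fix i j assume "i \<in> {..<n}" "j \<in> {..<n}" "?c i = ?c j"
      then have "q ^ i = q ^ j" using nz q0 by (simp add: power_inverse)
      then show "i = j" using qorder_distinct_powers[OF le q0] \<open>i \<in> {..<n}\<close> \<open>j \<in> {..<n}\<close> by simp
    qed
    ultimately obtain P Q where PQ: "P \<in> Mat n" "Q \<in> Mat n" "P * Q = 1\<^sub>m n"
      "X * P = P * mat_diag n ?c" using diagonalizable_distinct[OF Xc] by metis
    have con: "gl_conj (X, ?J) (mat_diag n ?c, Q * ?J * P)"
      by (rule gl_conj_of_inverse[OF Xc _ mat_diag_dim PQ]) simp
    have "(mat_diag n ?c, Q * ?J * P) \<in> F n"
      by (rule base[OF nz gl_conj_qpairs[OF con X]])
    then show "(X, ?J) \<in> F n" by (rule conj[OF con])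
  qed
qed

text \<open>For \<open>n > l\<close>, the Jordan block \<open>J\<close> is deformed to \<open>J + s\<^sup>l E\<close> with \<open>E\<close> the matrix unit at \<open>(l - 1, 0)\<close>, which
  has both 0 and \<open>s\<close> among its eigenvalues. As \<open>E\<close> moves indices like \<open>J\<close> modulo \<open>l\<close>, it has the same relation to \<open>D = diag(1, q\<^sup>-\<^sup>1, \<dots>)\<close>
  as \<open>J\<close>; so \<open>A = D p(J)\<close>, with a polynomial \<open>p\<close>, can follow the deformation.\<close>

lemma long_jordan_block_mem:
  assumes IH: "\<And>m. 0 < m \<Longrightarrow> m < n \<Longrightarrow> qpairs q m \<subseteq> F m"
    and l: "qorder q = enat l" and ln: "l < n" and AJ: "(A, jordan_block n 0) \<in> qpairs q n"
  shows "(A, jordan_block n 0) \<in> F n"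
proof -
  have A: "A \<in> Mat n" using AJ unfolding qpairs_def by simp
  have n: "0 < n" using ln by simp
  have l0: "0 < l" "q ^ l = 1" using qorder_finite[OF l] by auto
  define E where "E = mat n n (\<lambda>(i, j). if i = l - 1 \<and> j = 0 then 1 else 0 :: 'a)"
  define Bt where "Bt s = jordan_block n 0 + s ^ l \<cdot>\<^sub>m E" for s :: 'a
  define D where "D = mat_diag n (\<lambda>i. inverse q ^ i)"
  define At where "At s = mat n n (\<lambda>ij. \<Sum>m<n. A $$ (0, m) * (D * Bt s ^\<^sub>m m) $$ ij)" for s
  have cB: "Bt s \<in> Mat n" and cD: "D \<in> Mat n" and cA: "At s \<in> Mat n" for s
    unfolding Bt_def E_def D_def At_def by auto
  have Bidx: "Bt s $$ (i, j) = (if Suc i = j then 1 else 0) + (if i = l - 1 \<and> j = 0 then s ^ l else 0)"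
    if "i < n" "j < n" for s i j unfolding Bt_def E_def using that by simp
  have DB: "D * Bt s = q \<cdot>\<^sub>m (Bt s * D)" for s
  proof (rule eq_matI)
    fix i j assume "i < dim_row (q \<cdot>\<^sub>m (Bt s * D))" "j < dim_col (q \<cdot>\<^sub>m (Bt s * D))"
    then have ij: "i < n" "j < n" using carrier_matD(1)[OF cB[of s]] carrier_matD(2)[OF cD] by simp_all
    have "inverse q ^ (l - 1) = q"
    proof -
      have "q ^ (l - 1) * q = 1" using l0 by (metis power_minus_mult)
      then show ?thesis using q0 by (simp add: field_simps power_inverse)
    qed
    moreover have "inverse q ^ i = q * inverse q ^ Suc i" using q0 by simp
    ultimately show "(D * Bt s) $$ (i, j) = (q \<cdot>\<^sub>m (Bt s * D)) $$ (i, j)"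
      using ij cB[of s] unfolding D_def mat_diag_mult_left[OF cB] mat_diag_mult_right[OF cB]
      by (auto simp: Bidx)
  qed (use cB[of s] cD in auto)
  have rel: "(At s, Bt s) \<in> qpairs q n" for s
  proof -
    have M: "(D * Bt s ^\<^sub>m m) * Bt s = q \<cdot>\<^sub>m (Bt s * (D * Bt s ^\<^sub>m m))" for m
    proof -
      have p: "Bt s ^\<^sub>m m \<in> Mat n" using cB by simp
      have comm: "Bt s ^\<^sub>m m * Bt s = Bt s * Bt s ^\<^sub>m m" 
        by (rule pow_mat_comm[OF cB])
      have "(D * Bt s ^\<^sub>m m) * Bt s = D * (Bt s * Bt s ^\<^sub>m m)"
        unfolding assoc_mult_mat[OF cD p cB] comm ..
      also have "\<dots> = (D * Bt s) * Bt s ^\<^sub>m m" using assoc_mult_mat[OF cD cB p] by simp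
      also have "\<dots> = q \<cdot>\<^sub>m (Bt s * D * Bt s ^\<^sub>m m)"
        unfolding DB by (rule mult_smult_assoc_mat[OF mult_carrier_mat[OF cB cD] p])
      also have "Bt s * D * Bt s ^\<^sub>m m = Bt s * (D * Bt s ^\<^sub>m m)" by (rule assoc_mult_mat[OF cB cD p])
      finally show ?thesis .
    qed
    have "At s * Bt s = q \<cdot>\<^sub>m (Bt s * At s)"
      unfolding At_def by (rule q_commute_lincomb[OF mult_carrier_mat[OF cD pow_carrier_mat[OF cB]] cB M])
    then show ?thesis unfolding qpairs_def using cA cB by simp
  qed
  have memF: "(At s, Bt s) \<in> F n" if s: "s \<noteq> 0" for s
  proof (rule disconnected_mem_snd[OF IH rel])
    have Bv: "Bt s *\<^sub>v vec n h = vec n (\<lambda>i. (if Suc i < n then h (Suc i) else 0) + (if i = l - 1 then s ^ l * h 0 else 0))" for h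
    proof (rule eq_vecI)
      fix i assume "i < dim_vec (vec n (\<lambda>i. (if Suc i < n then h (Suc i) else 0) + (if i = l - 1 then s ^ l * h 0 else 0)))"
      then have i: "i < n" by simp
      have "(Bt s *\<^sub>v vec n h) $ i = (\<Sum>j\<in>{0..<n}. (if j = Suc i then h j else 0) + (if j = 0 then if i = l - 1 then s ^ l * h j else 0 else 0))"
      proof -
        have "(Bt s *\<^sub>v vec n h) $ i = (\<Sum>j\<in>{0..<n}. Bt s $$ (i, j) * h j)" using i cB[of s] by (simp add: scalar_prod_def)
        also have "\<dots> = (\<Sum>j\<in>{0..<n}. (if j = Suc i then h j else 0) + (if j = 0 then if i = l - 1 then s ^ l * h j else 0 else 0))"
          by (rule sum.cong[OF refl]) (use i in \<open>auto simp: Bidx\<close>)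
        finally show ?thesis .
      qed
      then show "(Bt s *\<^sub>v vec n h) $ i = vec n (\<lambda>i. (if Suc i < n then h (Suc i) else 0) + (if i = l - 1 then s ^ l * h 0 else 0)) $ i"
        using i n by (simp add: sum.distrib)
    qed (use cB[of s] in simp)
    have eig: "eigenvalue (Bt s) x" if "vec n (\<lambda>i. (if Suc i < n then h (Suc i) else 0) + (if i = l - 1 then s ^ l * h 0 else 0)) = x \<cdot>\<^sub>v vec n h"
      and "h 0 = 1" for h x
    proof -
      have "vec n h $ 0 \<noteq> 0\<^sub>v n $ 0" using n that(2) by simp
      then have "vec n h \<noteq> 0\<^sub>v n" by metis
      then show ?thesis unfolding eigenvalue_def eigenvector_def using cB[of s] Bv[of h] that(1) by (intro exI[of _ "vec n h"]) auto
    qed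
    have e0: "eigenvalue (Bt s) 0"
      by (rule eig[of "\<lambda>i. if i = 0 then 1 else if i = l then - (s ^ l) else 0"]) (use ln l0(1) in \<open>auto intro!: eq_vecI\<close>)
    have "s ^ l = s * s ^ (l - 1)" using l0(1) by (simp add: power_eq_if)
    then have "eigenvalue (Bt s) s"
      by (intro eig[of "\<lambda>i. if i < l then s ^ i else 0"] eq_vecI) (use ln l0(1) in auto)
    then show "\<not> q_connected (inverse q) (Bt s)" using not_q_connected_zero[OF _ e0 _ s] q0 by simp
  qed
  have cur: "Bt \<in> upoly.mats n n"
    unfolding Bt_def by (intro upoly.mats_add upoly.mats_const upoly.mats_smult upoly.power upoly_ident)
      (auto simp: E_def)
  have curA: "At \<in> upoly.mats n n"
    unfolding At_def
    by (intro upoly.mats_mat upoly.sum upoly.mult upoly.const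
        upoly.mats_entry[OF upoly.mats_mult[OF upoly.mats_const[OF cD] upoly.mats_pow[OF cur]]])
  have "infinite {s. (At s, Bt s) \<in> F n}"
    by (rule infinite_super[OF _ infinite_nonzero[OF upoly_ident, of 1]]) (use memF in auto)
  from curve[OF curA cur this] have "(At 0, Bt 0) \<in> F n" .
  moreover have B0: "Bt 0 = jordan_block n 0"
    unfolding Bt_def E_def using l0 by (auto intro!: eq_matI)
  moreover have "At 0 = A"
  proof (rule eq_matI)
    fix i j assume "i < dim_row A" "j < dim_col A"
    then have ij: "i < n" "j < n" using A by auto
    have "At 0 $$ (i, j) = (\<Sum>m<n. A $$ (0, m) * (inverse q ^ i * (if j = i + m then 1 else 0)))"
    proof -
      have "(D * jordan_block n 0 ^\<^sub>m m) $$ (i, j) = inverse q ^ i * (if j = i + m then 1 else 0)" for m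
        unfolding D_def mat_diag_mult_left[OF jordan_block_pow_carrier] using ij
        by (simp add: jordan_block_zero_pow) auto
      then show ?thesis unfolding At_def B0 using ij by simp
    qed
    also have "\<dots> = A $$ (i, j)"
    proof (cases "i \<le> j")
      case True
      have "(\<Sum>m<n. A $$ (0, m) * (inverse q ^ i * (if j = i + m then 1 else 0))) =
        (\<Sum>m\<in>{j - i}. A $$ (0, m) * inverse q ^ i)"
        using True ij by (intro sum.mono_neutral_cong_right) auto
      also have "\<dots> = A $$ (i, j)" using jordan_q_commutant(2)[OF q0 AJ, of i "j - i"] True ij by (simp add: mult.commute)
      finally show ?thesis .
    next
      case False
      then have "(\<Sum>m<n. A $$ (0, m) * (inverse q ^ i * (if j = i + m then 1 else 0))) = 0"
        by (intro sum.neutral) auto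
      then show ?thesis using jordan_q_commutant(1)[OF q0 AJ, of j i] False ij by simp
    qed
    finally show "At 0 $$ (i, j) = A $$ (i, j)" .
  qed (use A cA in auto)
  ultimately show ?thesis by simp
qed

text \<open>If \<open>B\<close> has several Jordan blocks, a diagonal matrix \<open>q\<close>-commuting with \<open>B\<close> can be scaled on the first block alone,
  so a generic perturbation disconnects the spectrum of \<open>A\<close>.\<close>

lemma B_nilpotent:
  assumes IH: "\<And>m. 0 < m \<Longrightarrow> m < n \<Longrightarrow> qpairs q m \<subseteq> F m" and n: "0 < n"
    and AB: "(A, B) \<in> qpairs q n" and nil: "\<And>x. eigenvalue B x \<Longrightarrow> x = 0"
    and base: "\<And>a X. enat n \<le> qorder q \<Longrightarrow> a \<noteq> 0 \<Longrightarrow>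
      (mat_diag n (\<lambda>k. a * inverse q ^ k), X) \<in> qpairs q n \<Longrightarrow> (mat_diag n (\<lambda>k. a * inverse q ^ k), X) \<in> F n"
  shows "(A, B) \<in> F n"
proof -
  have c: "A \<in> Mat n" "B \<in> Mat n" using AB unfolding qpairs_def by auto
  obtain xs where xs: "jordan_nf B xs" using jordan_nf_exists_alg_closed[OF c(2)] by blast
  obtain P Q where w: "similar_mat_wit B (jordan_matrix xs) P Q"
    using xs unfolding jordan_nf_def similar_mat_def by blast
  note w' = similar_mat_witD2[OF c(2) w]
  have sz: "sum_list (map fst xs) = n" using w'(5) by auto
  have z: "\<forall>x\<in>set xs. snd x = 0" using nil eigenvalue_jordan_nf[OF xs c(2)] by blast
  let ?J = "jordan_matrix xs"
  have "gl_conj (B, A) (?J, Q * A * P)"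
    by (rule gl_conj_of_inverse[OF c(2,1) _ w'(6,7,1) similar_wit_intertwine(1)[OF c(2) w]]) (use w' in auto)
  then have con: "gl_conj (A, B) (Q * A * P, ?J)" using gl_conj_swap[of "(A, B)" "(Q * A * P, ?J)"] by simp
  define A1 where "A1 = Q * A * P"
  have A1J: "(A1, ?J) \<in> qpairs q n" using gl_conj_qpairs[OF con AB] unfolding A1_def .
  then have A1: "A1 \<in> Mat n" unfolding qpairs_def by auto
  have "(A1, ?J) \<in> F n"
  proof (cases xs)
    case Nil
    then show ?thesis using sz n by simp
  next
    case (Cons x ys)
    then obtain k where x: "x = (k, 0)" using z by (cases x) auto
    have "k \<noteq> 0" using xs Cons x unfolding jordan_nf_def by force
    show ?thesis
    proof (cases ys)
      case (Cons y ys')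
      have "fst y \<noteq> 0" using xs \<open>xs = x # ys\<close> Cons unfolding jordan_nf_def by force
      let ?m = "sum_list (map fst ys)"
      have k: "0 < k" "k < n" "n = k + ?m" using sz \<open>k \<noteq> 0\<close> \<open>fst y \<noteq> 0\<close> \<open>xs = x # ys\<close> Cons x by auto
      obtain d where d: "\<forall>i. d i \<noteq> 0" "mat_diag ?m d * jordan_matrix ys = q \<cdot>\<^sub>m (jordan_matrix ys * mat_diag ?m d)"
        using nilpotent_jordan_weights[OF q0, of ys] z \<open>xs = x # ys\<close> by auto
      define v where "v i = (if i < k then inverse q ^ i else d (i - k))" for i
      have "v i \<noteq> 0" for i using d(1) q0 unfolding v_def by auto
      then obtain a where a: "connected_test q n (mat_diag n (\<lambda>i. if i < k then a * v i else v i)) \<noteq> 0"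
        using generic_scaling_disconnects[of v, OF _ q0 k(1,2)] by blast
      let ?A' = "mat_diag n (\<lambda>i. if i < k then a * v i else v i)"
      have A': "?A' = blk (mat_diag k (\<lambda>i. a * inverse q ^ i)) (mat_diag ?m d)"
        unfolding mat_diag_blk k(3)[symmetric] by (rule eq_matI) (auto simp: mat_diag_def v_def)
      have J: "?J = blk (jordan_block k 0) (jordan_matrix ys)"
        unfolding x \<open>xs = x # ys\<close> jordan_matrix_def blk_expand by (simp add: Let_def)
      have "?A' * ?J = q \<cdot>\<^sub>m (?J * ?A')"
        unfolding A' J
        by (rule blk_q_commute[OF mat_diag_dim mat_diag_dim jordan_block_carrier jordan_matrix_carrier
          mat_diag_jordan_block[OF q0] d(2)])
      then have A'J: "(?A', ?J) \<in> qpairs q n" using w'(5) unfolding qpairs_def by simp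
      show ?thesis
      proof (rule perturb_fst[where P = "connected_test q n", OF A1J A'J connected_test_upoly a])
        fix X assume X: "(X, ?J) \<in> qpairs q n" "connected_test q n X \<noteq> 0"
        then have "X \<in> Mat n" unfolding qpairs_def by simp
        then show "(X, ?J) \<in> F n" using disconnected_mem[OF IH X(1)] connected_test_nz[OF q0 _ n X(2)] by blast
      qed
    next
      case Nil
      then have kn: "k = n" using sz \<open>xs = x # ys\<close> x by simp
      have J: "?J = jordan_block n 0" unfolding \<open>xs = x # ys\<close> Nil x kn jordan_matrix_def
        by (simp only: list.map split diag_block_mat_singleton)
      show ?thesis
      proof (cases "enat n \<le> qorder q")
        case True
        show ?thesis unfolding J by (rule short_jordan_block_mem[OF True n A1J[unfolded J] base[OF True]])
      next
        case False
        then obtain l where l: "qorder q = enat l" "l < n" by (cases "qorder q") auto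
        show ?thesis unfolding J by (rule long_jordan_block_mem[OF IH l A1J[unfolded J]])
      qed
    qed
  qed
  then show ?thesis using conj[OF con] unfolding A1_def by blast
qed

lemma A_nilpotent:
  assumes IH: "\<And>m. 0 < m \<Longrightarrow> m < n \<Longrightarrow> qpairs q m \<subseteq> F m" and n: "0 < n"
    and AB: "(A, B) \<in> qpairs q n" and nil: "\<And>x. eigenvalue A x \<Longrightarrow> x = 0"
    and base: "\<And>a X. enat n \<le> qorder q \<Longrightarrow> a \<noteq> 0 \<Longrightarrow>
      (X, mat_diag n (\<lambda>k. a * q ^ k)) \<in> qpairs q n \<Longrightarrow> (X, mat_diag n (\<lambda>k. a * q ^ k)) \<in> F n"
  shows "(A, B) \<in> F n"
proof -
  interpret s: degeneration_closed "inverse q" "\<lambda>n. prod.swap ` F n"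
    by (rule degeneration_closed_swap) unfold_locales
  have mem: "(X, Y) \<in> prod.swap ` F m \<longleftrightarrow> (Y, X) \<in> F m" for X Y m by force
  have "(B, A) \<in> prod.swap ` F n"
  proof (rule s.B_nilpotent[OF _ n _ nil])
    show "qpairs (inverse q) m \<subseteq> prod.swap ` F m" if "0 < m" "m < n" for m
    proof
      fix p assume "p \<in> qpairs (inverse q) m"
      then have "prod.swap p \<in> qpairs q m" using qpairs_swap[OF q0] by (cases p) auto
      then have "prod.swap p \<in> F m" using IH[OF that] by blast
      then show "p \<in> prod.swap ` F m" by (metis image_eqI swap_swap)
    qed
    show "(B, A) \<in> qpairs (inverse q) n" using AB qpairs_swap[OF q0] by blast
    show "(mat_diag n (\<lambda>k. a * inverse (inverse q) ^ k), X) \<in> prod.swap ` F n"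
      if "enat n \<le> qorder (inverse q)" "a \<noteq> 0" "(mat_diag n (\<lambda>k. a * inverse (inverse q) ^ k), X) \<in> qpairs (inverse q) n" for a X
      using base[of a X] that qpairs_swap[OF q0] unfolding mem qorder_inverse inverse_inverse_eq by blast
  qed
  then show ?thesis unfolding mem .
qed

end


section \<open>Commuting pairs\<close>

text \<open>For \<open>q = 1\<close> the connected spectra are the singletons, and subtracting the eigenvalue makes the
  first matrix nilpotent. This contains the theorem of Motzkin and Taussky.\<close>

lemma commuting_pairs_mem:
  fixes F :: "nat \<Rightarrow> ('a::{alg_closed_field, field_char_0} mat \<times> 'a mat) set"
  assumes dc: "degeneration_closed 1 F"
    and tr: "\<And>X Y n c. (X, Y) \<in> F n \<Longrightarrow> (X + c \<cdot>\<^sub>m 1\<^sub>m n, Y) \<in> F n"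
    and one: "qpairs 1 1 \<subseteq> F 1"
    and n: "0 < n"
  shows "qpairs 1 n \<subseteq> F n"
  using n
proof (induction n rule: less_induct)
  case (less n)
  interpret degeneration_closed 1 F by fact
  show ?case
  proof
    fix p :: "'a mat \<times> 'a mat" assume p: "p \<in> qpairs 1 n"
    obtain X Y where pe: "p = (X, Y)" by (cases p)
    have XY: "(X, Y) \<in> qpairs 1 n" using p pe by simp
    then have c: "X \<in> Mat n" "Y \<in> Mat n" "X * Y = Y * X" unfolding qpairs_def by auto
    have IH: "\<And>m. 0 < m \<Longrightarrow> m < n \<Longrightarrow> qpairs 1 m \<subseteq> F m" using less.IH by blast
    show "p \<in> F n"
    proof (cases "q_connected 1 X")
      case False
      then show ?thesis using disconnected_mem[OF IH XY] pe by simp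
    next
      case True
      obtain x where x: "eigenvalue X x" using exists_eigenvalue[OF c(1) less.prems] by blast
      have x': "y = x" if "eigenvalue X y" for y
        using True x that q_link_powi[OF _ c(1), of 1 y x] unfolding q_connected_def by auto
      let ?X = "X + (- x) \<cdot>\<^sub>m 1\<^sub>m n"
      have cX: "?X \<in> Mat n" using c by simp
      have onec: "1\<^sub>m n \<in> Mat n" and xone: "(- x) \<cdot>\<^sub>m 1\<^sub>m n \<in> Mat n" by auto
      have "?X * Y = Y * ?X"
        unfolding add_mult_distrib_mat[OF c(1) xone c(2)] mult_add_distrib_mat[OF c(2,1) xone]
          mult_smult_assoc_mat[OF onec c(2)] mult_smult_distrib[OF c(2) onec] using c by simp
      then have qp: "(?X, Y) \<in> qpairs 1 n" using c cX unfolding qpairs_def by (simp add: smat_one)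
      have nil: "y = 0" if y: "eigenvalue ?X y" for y
      proof -
        obtain v where v: "v \<in> carrier_vec n" "v \<noteq> 0\<^sub>v n" "?X *\<^sub>v v = y \<cdot>\<^sub>v v"
          using y c unfolding eigenvalue_def eigenvector_def by auto
        have "X *\<^sub>v v = (y + x) \<cdot>\<^sub>v v"
        proof (rule eq_vecI)
          fix i assume "i < dim_vec ((y + x) \<cdot>\<^sub>v v)"
          then have i: "i < n" using v by simp
          have "?X *\<^sub>v v = X *\<^sub>v v + (- x) \<cdot>\<^sub>v v"
            using v(1) c by (subst add_mult_distrib_mat_vec[of _ n n]) auto
          then have "(?X *\<^sub>v v) $ i = (X *\<^sub>v v) $ i - x * v $ i" using v(1) c i by simp
          then show "(X *\<^sub>v v) $ i = ((y + x) \<cdot>\<^sub>v v) $ i" unfolding v(3) using v(1) i by (simp add: algebra_simps)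
        qed (use c v in auto)
        then have "eigenvalue X (y + x)" unfolding eigenvalue_def eigenvector_def using v c by (intro exI[of _ v]) auto
        then show ?thesis using x' by force
      qed
      have "(?X, Y) \<in> F n"
      proof (rule A_nilpotent[OF IH less.prems qp nil])
        have "qorder (1::'a) = enat 1"
          unfolding qorder_def by (auto intro!: Least_equality exI[of _ 1])
        then show "(X', mat_diag n (\<lambda>k. a * 1 ^ k)) \<in> F n" if "enat n \<le> qorder (1::'a)"
          "(X', mat_diag n (\<lambda>k. a * 1 ^ k)) \<in> qpairs 1 n" for a X'
          using that less.prems subsetD[OF one] by (cases "n = 1") (auto simp del: One_nat_def)
      qed
      then have "(?X + x \<cdot>\<^sub>m 1\<^sub>m n, Y) \<in> F n" by (rule tr)
      moreover have "?X + x \<cdot>\<^sub>m 1\<^sub>m n = X" using c by (intro eq_matI) auto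
      ultimately show ?thesis using pe by simp
    qed
  qed
qed

section \<open>Both matrices invertible\<close>

lemma q_commute_mult:
  fixes A :: "'a::comm_ring_1 mat"
  assumes A: "A \<in> Mat n" and M: "M \<in> Mat n" and N: "N \<in> Mat n"
    and AM: "A * M = k \<cdot>\<^sub>m (M * A)" and AN: "A * N = k' \<cdot>\<^sub>m (N * A)"
  shows "A * (M * N) = (k * k') \<cdot>\<^sub>m (M * N * A)"
proof -
  have "A * (M * N) = A * M * N" by (rule assoc_mult_mat[symmetric, OF A M N])
  also have "\<dots> = k \<cdot>\<^sub>m (M * (A * N))"
    unfolding AM mult_smult_assoc_mat[OF mult_carrier_mat[OF M A] N] assoc_mult_mat[OF M A N] ..
  also have "\<dots> = k \<cdot>\<^sub>m (k' \<cdot>\<^sub>m (M * N * A))"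
    unfolding AN mult_smult_distrib[OF M mult_carrier_mat[OF N A]] assoc_mult_mat[OF M N A] ..
  finally show ?thesis unfolding smat_smat .
qed

lemma q_commute_pow:
  fixes A :: "'a::comm_ring_1 mat"
  assumes A: "A \<in> Mat n" and B: "B \<in> Mat n" and rel: "A * B = q \<cdot>\<^sub>m (B * A)"
  shows "A * B ^\<^sub>m k = q ^ k \<cdot>\<^sub>m (B ^\<^sub>m k * A)"
proof (induction k)
  case 0
  show ?case using A B by (simp add: smat_one)
next
  case (Suc k)
  show ?case
    using q_commute_mult[OF A pow_carrier_mat[OF B] B Suc rel] by (simp add: mult.commute)
qed

lemma inverse_pow:
  fixes C :: "'a::semiring_1 mat"
  assumes C: "C \<in> Mat n" and B: "B \<in> Mat n" and CB: "C * B = 1\<^sub>m n"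
  shows "C ^\<^sub>m k * B ^\<^sub>m k = 1\<^sub>m n"
proof (induction k)
  case 0
  show ?case using B C by simp
next
  case (Suc k)
  have p: "C ^\<^sub>m k \<in> Mat n" "B ^\<^sub>m k \<in> Mat n" using B C by auto
  have "C ^\<^sub>m Suc k * B ^\<^sub>m Suc k = C ^\<^sub>m k * C * (B * B ^\<^sub>m k)" using pow_mat_comm[OF B, of k] by simp
  also have "\<dots> = C ^\<^sub>m k * (C * (B * B ^\<^sub>m k))" by (rule assoc_mult_mat[OF p(1) C mult_carrier_mat[OF B p(2)]])
  also have "C * (B * B ^\<^sub>m k) = C * B * B ^\<^sub>m k" by (rule assoc_mult_mat[symmetric, OF C B p(2)])
  finally show ?case unfolding CB left_mult_one_mat[OF p(2)] Suc .
qed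

lemma (in function_ring) mats_if:
  "(b \<Longrightarrow> f \<in> mats m n) \<Longrightarrow> (\<not> b \<Longrightarrow> g \<in> mats m n) \<Longrightarrow> (\<lambda>x. if b then f x else g x) \<in> mats m n"
  by (cases b) simp_all

lemma (in function_ring) ring_if:
  "(b \<Longrightarrow> f \<in> R) \<Longrightarrow> (\<not> b \<Longrightarrow> g \<in> R) \<Longrightarrow> (\<lambda>x. if b then f x else g x) \<in> R"
  by (cases b) simp_all

text \<open>A matrix of \<open>l \<times> l\<close> blocks of size \<open>m\<close>, flattened so that the block index varies fastest; then
  block sums of the blocks become block sums of the flattened matrices.\<close>

definition flat :: "nat \<Rightarrow> nat \<Rightarrow> (nat \<Rightarrow> nat \<Rightarrow> 'a mat) \<Rightarrow> 'a mat" where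
  "flat l m f = mat (l * m) (l * m) (\<lambda>(a, b). f (a mod l) (b mod l) $$ (a div l, b div l))"

lemma flat_carrier: "flat l m f \<in> Mat (l * m)"
  unfolding flat_def by simp

lemma flat_index:
  "i < l * m \<Longrightarrow> j < l * m \<Longrightarrow> flat l m f $$ (i, j) = f (i mod l) (j mod l) $$ (i div l, j div l)"
  unfolding flat_def by simp

lemma div_less_flat: "a < l * m \<Longrightarrow> a div l < m" for a l m :: nat
  by (simp add: less_mult_imp_div_less mult.commute)

lemma flat_bound: "i < l \<Longrightarrow> k < m \<Longrightarrow> k * l + i < l * m" for i l k m :: nat
proof -
  assume "i < l" "k < m"
  then have "k * l + i < Suc k * l" by simp
  also have "\<dots> \<le> m * l" using \<open>k < m\<close> by (intro mult_le_mono1) simp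
  finally show ?thesis by (simp add: mult.commute)
qed

lemma sum_flat:
  fixes h :: "nat \<Rightarrow> nat \<Rightarrow> 'a::comm_monoid_add"
  assumes "0 < l"
  shows "(\<Sum>c\<in>{0..<l * m}. h (c mod l) (c div l)) = (\<Sum>i<l. \<Sum>k\<in>{0..<m}. h i k)"
proof -
  have "(\<Sum>c\<in>{0..<l * m}. h (c mod l) (c div l)) = (\<Sum>(i, k)\<in>{..<l} \<times> {0..<m}. h i k)"
    by (rule sum.reindex_bij_witness[of _ "\<lambda>(i, k). k * l + i" "\<lambda>c. (c mod l, c div l)"])
      (use assms in \<open>auto simp: div_less_flat mult.commute intro: flat_bound\<close>)
  then show ?thesis by (simp add: sum.cartesian_product)
qed

lemma flat_mult:
  fixes f g :: "nat \<Rightarrow> nat \<Rightarrow> 'a::semiring_0 mat"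
  assumes l: "0 < l" and f: "\<And>i j. f i j \<in> Mat m" and g: "\<And>i j. g i j \<in> Mat m"
    and h: "\<And>i j r s. i < l \<Longrightarrow> j < l \<Longrightarrow> r < m \<Longrightarrow> s < m \<Longrightarrow> h i j $$ (r, s) = (\<Sum>k<l. (f i k * g k j) $$ (r, s))"
  shows "flat l m f * flat l m g = flat l m h"
proof (rule eq_matI)
  fix a b assume "a < dim_row (flat l m h)" "b < dim_col (flat l m h)"
  then have ab: "a < l * m" "b < l * m" by (auto simp: flat_def)
  have d: "a div l < m" "b div l < m" "a mod l < l" "b mod l < l" using ab l by (auto simp: div_less_flat)
  have "(flat l m f * flat l m g) $$ (a, b) =
      (\<Sum>c\<in>{0..<l * m}. f (a mod l) (c mod l) $$ (a div l, c div l) * g (c mod l) (b mod l) $$ (c div l, b div l))"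
    unfolding mat_mult_entry[OF flat_carrier flat_carrier ab] using ab by (intro sum.cong) (auto simp: flat_index)
  also have "\<dots> = (\<Sum>i<l. \<Sum>k\<in>{0..<m}. f (a mod l) i $$ (a div l, k) * g i (b mod l) $$ (k, b div l))"
    by (rule sum_flat[OF l])
  also have "\<dots> = (\<Sum>i<l. (f (a mod l) i * g i (b mod l)) $$ (a div l, b div l))"
    unfolding mat_mult_entry[OF f g d(1,2)] ..
  also have "\<dots> = flat l m h $$ (a, b)" using ab d by (simp add: flat_index h)
  finally show "(flat l m f * flat l m g) $$ (a, b) = flat l m h $$ (a, b)" .
qed (auto simp: flat_def)

definition flat_diag :: "nat \<Rightarrow> nat \<Rightarrow> (nat \<Rightarrow> 'a::zero mat) \<Rightarrow> 'a mat" where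
  "flat_diag l m f = flat l m (\<lambda>i j. if i = j then f i else 0\<^sub>m m m)"

definition flat_cyc :: "nat \<Rightarrow> nat \<Rightarrow> 'a::{zero,one} mat \<Rightarrow> 'a mat" where
  "flat_cyc l m Y = flat l m (\<lambda>i j. if Suc i = j then 1\<^sub>m m else if i = l - 1 \<and> j = 0 then Y else 0\<^sub>m m m)"

lemma flat_diag_mult:
  fixes f g :: "nat \<Rightarrow> 'a::semiring_0 mat"
  assumes "0 < l" "\<And>i. f i \<in> Mat m" "\<And>i. g i \<in> Mat m"
  shows "flat_diag l m f * flat_diag l m g = flat_diag l m (\<lambda>i. f i * g i)"
  unfolding flat_diag_def
proof (rule flat_mult[OF assms(1)])
  fix i j r s assume ij: "i < l" "j < l" "r < m" "s < m"
  have "(\<Sum>k<l. ((if i = k then f i else 0\<^sub>m m m) * (if k = j then g k else 0\<^sub>m m m)) $$ (r, s)) =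
    (\<Sum>k\<in>{i}. (f i * (if i = j then g i else 0\<^sub>m m m)) $$ (r, s))"
    using ij assms by (intro sum.mono_neutral_cong_right) (auto simp: left_mult_zero_mat[of _ m m])
  then show "(if i = j then f i * g i else 0\<^sub>m m m) $$ (r, s) =
    (\<Sum>k<l. ((if i = k then f i else 0\<^sub>m m m) * (if k = j then g k else 0\<^sub>m m m)) $$ (r, s))"
    using ij assms by (auto simp: right_mult_zero_mat[of _ m m])
qed (use assms in auto)

lemma flat_diag_cyc:
  fixes f :: "nat \<Rightarrow> 'a::semiring_1 mat"
  assumes "0 < l" "\<And>i. f i \<in> Mat m" "Y \<in> Mat m"
  shows "flat_diag l m f * flat_cyc l m Y =
    flat l m (\<lambda>i j. if Suc i = j then f i else if i = l - 1 \<and> j = 0 then f i * Y else 0\<^sub>m m m)"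
  unfolding flat_diag_def flat_cyc_def
proof (rule flat_mult[OF assms(1)])
  fix i j r s assume ij: "i < l" "j < l" "r < m" "s < m"
  let ?c = "\<lambda>k. if Suc k = j then 1\<^sub>m m else if k = l - 1 \<and> j = 0 then Y else 0\<^sub>m m m"
  have "(\<Sum>k<l. ((if i = k then f i else 0\<^sub>m m m) * ?c k) $$ (r, s)) = (\<Sum>k\<in>{i}. (f i * ?c i) $$ (r, s))"
    using ij assms by (intro sum.mono_neutral_cong_right) (auto simp: left_mult_zero_mat[of _ m m])
  then show "(if Suc i = j then f i else if i = l - 1 \<and> j = 0 then f i * Y else 0\<^sub>m m m) $$ (r, s) =
    (\<Sum>k<l. ((if i = k then f i else 0\<^sub>m m m) * ?c k) $$ (r, s))"
    using ij assms by (auto simp: right_mult_zero_mat[of _ m m] right_mult_one_mat[of _ m m])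
qed (use assms in auto)

lemma flat_cyc_diag:
  fixes f :: "nat \<Rightarrow> 'a::semiring_1 mat"
  assumes "0 < l" "\<And>i. f i \<in> Mat m" "Y \<in> Mat m"
  shows "flat_cyc l m Y * flat_diag l m f =
    flat l m (\<lambda>i j. if Suc i = j then f j else if i = l - 1 \<and> j = 0 then Y * f j else 0\<^sub>m m m)"
  unfolding flat_diag_def flat_cyc_def
proof (rule flat_mult[OF assms(1)])
  fix i j r s assume ij: "i < l" "j < l" "r < m" "s < m"
  let ?c = "\<lambda>k. if Suc i = k then 1\<^sub>m m else if i = l - 1 \<and> k = 0 then Y else 0\<^sub>m m m"
  have "(\<Sum>k<l. (?c k * (if k = j then f k else 0\<^sub>m m m)) $$ (r, s)) = (\<Sum>k\<in>{j}. (?c j * f j) $$ (r, s))"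
    using ij assms by (intro sum.mono_neutral_cong_right) (auto simp: right_mult_zero_mat[of _ m m])
  then show "(if Suc i = j then f j else if i = l - 1 \<and> j = 0 then Y * f j else 0\<^sub>m m m) $$ (r, s) =
    (\<Sum>k<l. (?c k * (if k = j then f k else 0\<^sub>m m m)) $$ (r, s))"
    using ij assms by (auto simp: left_mult_zero_mat[of _ m m] left_mult_one_mat[of _ m m])
qed (use assms in auto)

lemma flat_cong:
  assumes "\<And>i j. i < l \<Longrightarrow> j < l \<Longrightarrow> f i j = g i j"
  shows "flat l m f = flat l m g"
proof (cases "l = 0")
  case False
  then show ?thesis unfolding flat_def using assms by (intro cong_mat) auto
qed (auto simp: flat_def intro!: eq_matI)

lemma flat_smult:
  assumes "0 < l" "\<And>i j. f i j \<in> Mat m"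
  shows "c \<cdot>\<^sub>m flat l m f = flat l m (\<lambda>i j. c \<cdot>\<^sub>m f i j)"
proof (rule eq_matI)
  fix a b assume "a < dim_row (flat l m (\<lambda>i j. c \<cdot>\<^sub>m f i j))" "b < dim_col (flat l m (\<lambda>i j. c \<cdot>\<^sub>m f i j))"
  then have ab: "a < l * m" "b < l * m" by (auto simp: flat_def)
  then show "(c \<cdot>\<^sub>m flat l m f) $$ (a, b) = flat l m (\<lambda>i j. c \<cdot>\<^sub>m f i j) $$ (a, b)"
    using carrier_matD[OF assms(2), of "a mod l" "b mod l"] carrier_matD[OF flat_carrier, of l m f]
    by (simp add: flat_index div_less_flat)
qed (auto simp: flat_def)

text \<open>At an \<open>l\<close>-th root of unity, commuting pairs of size \<open>m\<close> yield \<open>q\<close>-commuting pairs of size \<open>l m\<close>.\<close>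

definition twist :: "'a::field \<Rightarrow> nat \<Rightarrow> nat \<Rightarrow> 'a mat \<Rightarrow> 'a mat \<Rightarrow> 'a mat \<times> 'a mat" where
  "twist q l m X Y = (flat_diag l m (\<lambda>i. inverse q ^ i \<cdot>\<^sub>m X), flat_cyc l m Y)"

lemma twist_qpairs:
  assumes q: "(q::'a::field) \<noteq> 0" and l: "0 < l" "q ^ l = 1"
    and c: "X \<in> Mat m" "Y \<in> Mat m" and XY: "X * Y = Y * X"
  shows "twist q l m X Y \<in> qpairs q (l * m)"
proof -
  have sX: "inverse q ^ i \<cdot>\<^sub>m X \<in> Mat m" for i using c by simp
  let ?h = "\<lambda>i j. if Suc i = j then inverse q ^ j \<cdot>\<^sub>m X else if i = l - 1 \<and> j = 0 then Y * (inverse q ^ j \<cdot>\<^sub>m X) else 0\<^sub>m m m"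
  have "flat_diag l m (\<lambda>i. inverse q ^ i \<cdot>\<^sub>m X) * flat_cyc l m Y = flat l m (\<lambda>i j. q \<cdot>\<^sub>m ?h i j)"
    unfolding flat_diag_cyc[where f = "\<lambda>i. inverse q ^ i \<cdot>\<^sub>m X", OF l(1) sX c(2)]
  proof (rule flat_cong)
    fix i j assume ij: "i < l" "j < l"
    have e: "inverse q ^ i \<cdot>\<^sub>m X = q \<cdot>\<^sub>m (inverse q ^ Suc i \<cdot>\<^sub>m X)"
      unfolding smat_smat using q by (simp add: mult.assoc[symmetric])
    have "inverse q ^ (l - 1) = q"
    proof -
      have "q ^ (l - 1) * q = 1" using l by (metis power_minus_mult)
      then show ?thesis using q by (simp add: field_simps power_inverse)
    qed
    then have e2: "(inverse q ^ (l - 1) \<cdot>\<^sub>m X) * Y = q \<cdot>\<^sub>m (Y * X)"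
      using mult_smult_assoc_mat[OF c] XY by simp
    show "(if Suc i = j then inverse q ^ i \<cdot>\<^sub>m X else if i = l - 1 \<and> j = 0 then (inverse q ^ i \<cdot>\<^sub>m X) * Y else 0\<^sub>m m m) = q \<cdot>\<^sub>m ?h i j"
      using e e2 c by (auto simp: smat_one)
  qed
  also have "\<dots> = q \<cdot>\<^sub>m (flat_cyc l m Y * flat_diag l m (\<lambda>i. inverse q ^ i \<cdot>\<^sub>m X))"
    unfolding flat_cyc_diag[where f = "\<lambda>i. inverse q ^ i \<cdot>\<^sub>m X", OF l(1) sX c(2)]
    by (rule flat_smult[symmetric, OF l(1)]) (use c in auto)
  finally show ?thesis unfolding twist_def qpairs_def by (simp add: flat_diag_def flat_cyc_def flat_carrier)
qed

lemma twist_conj: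
  fixes X :: "'a::field mat"
  assumes l: "0 < l" and c: "X \<in> Mat m" "Y \<in> Mat m" "X' \<in> Mat m" "Y' \<in> Mat m"
    and P: "P \<in> Mat m" "Q \<in> Mat m" "P * Q = 1\<^sub>m m"
    and X: "X * P = P * X'" and Y: "Y * P = P * Y'"
  shows "gl_conj (twist q l m X Y) (twist q l m X' Y')"
  unfolding twist_def
proof (rule gl_conjI[of _ "l * m" _ _ _ "flat_diag l m (\<lambda>_. P)" "flat_diag l m (\<lambda>_. Q)"])
  have one: "flat_diag l m (\<lambda>_. 1\<^sub>m m) = 1\<^sub>m (l * m)"
  proof (rule eq_matI)
    fix a b assume "a < dim_row (1\<^sub>m (l * m))" "b < dim_col (1\<^sub>m (l * m))"
    then have ab: "a < l * m" "b < l * m" by auto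
    have "a = b" if "a mod l = b mod l" "a div l = b div l" using that by (metis div_mult_mod_eq)
    then show "flat_diag l m (\<lambda>_. 1\<^sub>m m) $$ (a, b) = 1\<^sub>m (l * m) $$ (a, b)"
      using ab by (auto simp: flat_diag_def flat_index div_less_flat)
  qed (auto simp: flat_diag_def flat_def)
  show "flat_diag l m (\<lambda>_. P) * flat_diag l m (\<lambda>_. Q) = 1\<^sub>m (l * m)"
    using flat_diag_mult[OF l, of "\<lambda>_. P" m "\<lambda>_. Q"] P one by simp
  have s: "inverse q ^ i \<cdot>\<^sub>m X \<in> Mat m" "inverse q ^ i \<cdot>\<^sub>m X' \<in> Mat m" for i using c by auto
  have "(inverse q ^ i \<cdot>\<^sub>m X) * P = P * (inverse q ^ i \<cdot>\<^sub>m X')" for i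
    unfolding mult_smult_assoc_mat[OF c(1) P(1)] mult_smult_distrib[OF P(1) c(3)] X ..
  then show "flat_diag l m (\<lambda>i. inverse q ^ i \<cdot>\<^sub>m X) * flat_diag l m (\<lambda>_. P) =
      flat_diag l m (\<lambda>_. P) * flat_diag l m (\<lambda>i. inverse q ^ i \<cdot>\<^sub>m X')"
    using flat_diag_mult[OF l s(1) P(1)] flat_diag_mult[OF l P(1) s(2)] by simp
  show "flat_cyc l m Y * flat_diag l m (\<lambda>_. P) = flat_diag l m (\<lambda>_. P) * flat_cyc l m Y'"
    unfolding flat_cyc_diag[OF l P(1) c(2)] flat_diag_cyc[OF l P(1) c(4)] Y
    by (rule flat_cong) auto
qed (auto simp: flat_diag_def flat_cyc_def flat_carrier)

lemma flat_blk:
  assumes l: "0 < l" and c: "\<And>i j. f i j \<in> Mat n" "\<And>i j. g i j \<in> Mat m"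
  shows "flat l (n + m) (\<lambda>i j. blk (f i j) (g i j)) = blk (flat l n f) (flat l m g)"
proof (rule mat_eqI[OF _ blk_carrier[OF flat_carrier flat_carrier]])
  show "flat l (n + m) (\<lambda>i j. blk (f i j) (g i j)) \<in> Mat (l * n + l * m)"
    using flat_carrier[of l "n + m"] by (simp add: distrib_left)
  fix a b assume ab: "a < l * n + l * m" "b < l * n + l * m"
  have lt: "x div l < n \<longleftrightarrow> x < l * n" for x using l by (simp add: div_less_iff_less_mult mult.commute)
  have sh: "(x - l * n) div l = x div l - n" "(x - l * n) mod l = x mod l" if "\<not> x < l * n" for x
  proof -
    have "x = l * n + (x - l * n)" using that by simp
    then obtain y where y: "x = l * n + y" by blast
    then show "(x - l * n) div l = x div l - n" "(x - l * n) mod l = x mod l" using l by simp_all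
  qed
  have d: "a div l < n + m" "b div l < n + m" using ab by (simp_all add: div_less_flat distrib_left)
  have "flat l (n + m) (\<lambda>i j. blk (f i j) (g i j)) $$ (a, b) = blk (f (a mod l) (b mod l)) (g (a mod l) (b mod l)) $$ (a div l, b div l)"
    using ab by (simp add: flat_index distrib_left)
  then show "flat l (n + m) (\<lambda>i j. blk (f i j) (g i j)) $$ (a, b) = blk (flat l n f) (flat l m g) $$ (a, b)"
    unfolding blk_entry[OF flat_carrier flat_carrier ab] blk_entry[OF c d] using ab by (simp add: lt flat_index sh)
qed

lemma twist_psum:
  fixes X :: "'a::field mat"
  assumes l: "0 < l" and c: "X \<in> Mat n" "Y \<in> Mat n" "X' \<in> Mat m" "Y' \<in> Mat m"
  shows "twist q l (n + m) (blk X X') (blk Y Y') = psum (twist q l n X Y) (twist q l m X' Y')"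
proof -
  have z: "0\<^sub>m (n + m) (n + m) = blk (0\<^sub>m n n) (0\<^sub>m m m :: 'a mat)" by (simp add: blk_eq[of _ n _ m])
  have "flat_diag l (n + m) (\<lambda>i. inverse q ^ i \<cdot>\<^sub>m blk X X') =
      blk (flat_diag l n (\<lambda>i. inverse q ^ i \<cdot>\<^sub>m X)) (flat_diag l m (\<lambda>i. inverse q ^ i \<cdot>\<^sub>m X'))"
    unfolding flat_diag_def
    by (subst flat_blk[OF l, symmetric]) (use c in \<open>auto intro!: flat_cong simp: blk_smult[of _ n _ m] z\<close>)
  moreover have "flat_cyc l (n + m) (blk Y Y') = blk (flat_cyc l n Y) (flat_cyc l m Y')"
    unfolding flat_cyc_def
    by (subst flat_blk[OF l, symmetric]) (use c in \<open>auto intro!: flat_cong simp: blk_one z\<close>)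
  ultimately show ?thesis unfolding twist_def psum_def by simp
qed

lemma flat_mats:
  assumes "\<And>i j. i < l \<Longrightarrow> j < l \<Longrightarrow> (\<lambda>u. f u i j) \<in> upoly.mats m m" "0 < l"
  shows "(\<lambda>u. flat l m (f u)) \<in> upoly.mats (l * m) (l * m)"
  unfolding flat_def
proof (rule upoly.mats_mat)
  fix a b assume "a < l * m" "b < l * m"
  then show "(\<lambda>u. case (a, b) of (a, b) \<Rightarrow> f u (a mod l) (b mod l) $$ (a div l, b div l)) \<in> upoly_funs"
    using upoly.mats_entry[OF assms(1), of "a mod l" "b mod l" "a div l" "b div l"] assms(2) by (simp add: div_less_flat)
qed

text \<open>The images of a generalised eigenspace of \<open>A\<close> under \<open>1, B, \<dots>, B\<^sup>l\<^sup>-\<^sup>1\<close> belong to different eigenvalues, hence are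
  independent. If its dimension is large enough they exhaust the space, and a basis adapted to them shows the form of a twist.\<close>

lemma invertible_pair_is_twist:
  fixes A :: "'a::alg_closed_field mat"
  assumes q: "q \<noteq> 0" and l: "qorder q = enat l" and AB: "(A, B) \<in> qpairs q n" and dB: "det B \<noteq> 0"
    and xs: "jordan_nf A xs" and x: "x \<noteq> 0"
    and mult: "n \<le> l * sum_list (map fst (filter (\<lambda>z. snd z = x) xs))"
  shows "\<exists>m X Y. n = l * m \<and> X \<in> Mat m \<and> Y \<in> Mat m \<and> X * Y = Y * X \<and> gl_conj (A, B) (twist q l m X Y)"
proof -
  note jordan_matrix_dim [simp del]
  have l0: "0 < l" "q ^ l = 1" using qorder_finite[OF l] by auto
  have c: "A \<in> Mat n" "B \<in> Mat n" and rel: "A * B = q \<cdot>\<^sub>m (B * A)" using AB unfolding qpairs_def by auto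
  define ys where "ys = filter (\<lambda>z. snd z = x) xs"
  define zs where "zs = filter (\<lambda>z. snd z \<noteq> x) xs"
  define m where "m = sum_list (map fst ys)"
  define m' where "m' = sum_list (map fst zs)"
  let ?J1 = "jordan_matrix ys" and ?J2 = "jordan_matrix zs"
  have "similar_mat A (blk ?J1 ?J2)" unfolding ys_def zs_def by (rule jordan_nf_partition[OF xs])
  then obtain P Q where w: "similar_mat_wit A (blk ?J1 ?J2) P Q" unfolding similar_mat_def by blast
  note w' = similar_mat_witD2[OF c(1) w]
  have cJ: "?J1 \<in> Mat m" "?J2 \<in> carrier_mat m' m'" unfolding m_def m'_def by auto
  have J: "blk ?J1 ?J2 \<in> Mat (m + m')" by (rule blk_carrier[OF cJ])
  then have n: "n = m + m'" using w'(5) by auto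
  note AP = similar_wit_intertwine(1)[OF c(1) w] and QA = similar_wit_intertwine(2)[OF c(1) w]
  define U where "U = mat n m (\<lambda>(i, j). P $$ (i, j))"
  define W where "W = mat m n (\<lambda>(i, j). Q $$ (i, j))"
  have cU: "U \<in> carrier_mat n m" and cW: "W \<in> carrier_mat m n" unfolding U_def W_def by auto
  note blk_idx = blk_entry[OF cJ, folded n]
  have AU: "A * U = U * ?J1"
  proof (rule eq_matI)
    fix i j assume "i < dim_row (U * ?J1)" "j < dim_col (U * ?J1)"
    then have ij: "i < n" "j < m" "j < n" using cU cJ n by auto
    have "(A * U) $$ (i, j) = (A * P) $$ (i, j)"
      unfolding mat_mult_entry[OF c(1) cU ij(1,2)] mat_mult_entry[OF c(1) w'(6) ij(1,3)]
      by (intro sum.cong refl) (use ij in \<open>simp add: U_def\<close>)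
    also have "\<dots> = (\<Sum>r\<in>{0..<n}. P $$ (i, r) * blk ?J1 ?J2 $$ (r, j))"
      unfolding AP by (rule mat_mult_entry[OF w'(6,5) ij(1,3)])
    also have "\<dots> = (\<Sum>r\<in>{0..<m}. P $$ (i, r) * ?J1 $$ (r, j))"
      using n ij by (intro sum.mono_neutral_cong_right) (auto simp: blk_idx)
    also have "\<dots> = (U * ?J1) $$ (i, j)"
      unfolding mat_mult_entry[OF cU cJ(1) ij(1,2)] by (intro sum.cong refl) (use ij n in \<open>simp add: U_def\<close>)
    finally show "(A * U) $$ (i, j) = (U * ?J1) $$ (i, j)" .
  qed (use c cU cJ in auto)
  have WA: "W * A = ?J1 * W"
  proof (rule eq_matI)
    fix i j assume "i < dim_row (?J1 * W)" "j < dim_col (?J1 * W)"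
    then have ij: "i < m" "j < n" "i < n" using cW cJ n by auto
    have "(W * A) $$ (i, j) = (Q * A) $$ (i, j)"
      unfolding mat_mult_entry[OF cW c(1) ij(1,2)] mat_mult_entry[OF w'(7) c(1) ij(3,2)]
      by (intro sum.cong refl) (use ij in \<open>simp add: W_def\<close>)
    also have "\<dots> = (\<Sum>r\<in>{0..<n}. blk ?J1 ?J2 $$ (i, r) * Q $$ (r, j))"
      unfolding QA by (rule mat_mult_entry[OF w'(5,7) ij(3,2)])
    also have "\<dots> = (\<Sum>r\<in>{0..<m}. ?J1 $$ (i, r) * Q $$ (r, j))"
      using n ij by (intro sum.mono_neutral_cong_right) (auto simp: blk_idx)
    also have "\<dots> = (?J1 * W) $$ (i, j)"
      unfolding mat_mult_entry[OF cJ(1) cW ij(1,2)] by (intro sum.cong refl) (use ij n in \<open>simp add: W_def\<close>)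
    finally show "(W * A) $$ (i, j) = (?J1 * W) $$ (i, j)" .
  qed (use c cW cJ in auto)
  have WU: "W * U = 1\<^sub>m m"
  proof (rule eq_matI)
    fix i j assume "i < dim_row (1\<^sub>m m)" "j < dim_col (1\<^sub>m m)"
    then have ij: "i < m" "j < m" "i < n" "j < n" using n by auto
    have "(W * U) $$ (i, j) = (Q * P) $$ (i, j)"
      unfolding mat_mult_entry[OF cW cU ij(1,2)] mat_mult_entry[OF w'(7,6) ij(3,4)]
      by (intro sum.cong refl) (use ij in \<open>simp add: U_def W_def\<close>)
    then show "(W * U) $$ (i, j) = 1\<^sub>m m $$ (i, j)" unfolding w'(2) using ij by simp
  qed (use cU cW in auto)
  \<comment> \<open>Whatever rescales \<open>A\<close> by a factor other than 1 moves the generalised eigenspace off itself.\<close>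
  have off: "W * M * U = 0\<^sub>m m m" if M: "M \<in> Mat n" "A * M = k \<cdot>\<^sub>m (M * A)" and k: "k \<noteq> 1" for M k
  proof (rule no_intertwiner[OF cJ(1) cJ(1) jordan_matrix_upper_triangular'])
    have WM: "W * M \<in> carrier_mat m n" using cW M by simp
    show "W * M * U \<in> Mat m" using WM cU by simp
    have "?J1 * (W * M * U) = ?J1 * W * M * U"
      using assoc_mult_mat[OF cJ(1) WM cU] assoc_mult_mat[OF cJ(1) cW M(1)] by simp
    also have "\<dots> = W * (A * M) * U" unfolding WA[symmetric] assoc_mult_mat[OF cW c(1) M(1)] ..
    also have "\<dots> = k \<cdot>\<^sub>m (W * (M * A) * U)"
      unfolding M(2) mult_smult_distrib[OF cW mult_carrier_mat[OF M(1) c(1)]]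
      by (rule mult_smult_assoc_mat[OF mult_carrier_mat[OF cW mult_carrier_mat[OF M(1) c(1)]] cU])
    also have "W * (M * A) * U = W * M * (A * U)"
      unfolding assoc_mult_mat[OF cW M(1) c(1), symmetric] by (rule assoc_mult_mat[OF WM c(1) cU])
    also have "\<dots> = W * M * U * ?J1" unfolding AU by (rule assoc_mult_mat[symmetric, OF WM cU cJ(1)])
    finally show "?J1 * (W * M * U) = k \<cdot>\<^sub>m (W * M * U * ?J1)" .
    have ev: "y = x" if "eigenvalue ?J1 y" for y using jordan_matrix_eigenvalue[OF that] unfolding ys_def by auto
    show "\<not> eigenvalue ?J1 (k * y)" if "eigenvalue ?J1 y" for y
      using ev[OF that] ev[of "k * y"] x k by auto
  qed
  obtain C where C: "C \<in> Mat n" "B * C = 1\<^sub>m n" "C * B = 1\<^sub>m n"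
    using det_non_zero_imp_unit[OF c(2) dB, of "()"] unfolding Units_def ring_mat_simps by auto
  have ABk: "A * B ^\<^sub>m k = q ^ k \<cdot>\<^sub>m (B ^\<^sub>m k * A)" for k by (rule q_commute_pow[OF c rel])
  have ACk: "A * C ^\<^sub>m k = inverse q ^ k \<cdot>\<^sub>m (C ^\<^sub>m k * A)" for k
  proof (rule q_commute_pow[OF c(1) C(1)])
    have "C * (A * B) * C = q \<cdot>\<^sub>m (C * (B * A) * C)"
      unfolding rel mult_smult_distrib[OF C(1) mult_carrier_mat[OF c(2,1)]]
      by (rule mult_smult_assoc_mat[OF mult_carrier_mat[OF C(1) mult_carrier_mat[OF c(2,1)]] C(1)])
    moreover have "C * (A * B) * C = C * A"
    proof -
      have "C * (A * B) * C = C * A * (B * C)"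
        unfolding assoc_mult_mat[OF C(1) c(1,2), symmetric] by (rule assoc_mult_mat[OF mult_carrier_mat[OF C(1) c(1)] c(2) C(1)])
      then show ?thesis unfolding C(2) using right_mult_one_mat[OF mult_carrier_mat[OF C(1) c(1)]] by simp
    qed
    moreover have "C * (B * A) * C = A * C"
      unfolding assoc_mult_mat[OF C(1) c(2,1), symmetric] C(3) using c by simp
    ultimately have "inverse q \<cdot>\<^sub>m (C * A) = (inverse q * q) \<cdot>\<^sub>m (A * C)" by (simp only: smat_smat)
    then show "A * C = inverse q \<cdot>\<^sub>m (C * A)" using q by (simp add: smat_one)
  qed
  have cp: "B ^\<^sub>m k \<in> Mat n" "C ^\<^sub>m k \<in> Mat n" for k using c C by auto
  have CB: "C ^\<^sub>m k * B ^\<^sub>m k = 1\<^sub>m n" for k by (rule inverse_pow[OF C(1) c(2) C(3)])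
  have comp: "A * (M * N) = (k * k') \<cdot>\<^sub>m (M * N * A)"
    if "M \<in> Mat n" "N \<in> Mat n" "A * M = k \<cdot>\<^sub>m (M * A)" "A * N = k' \<cdot>\<^sub>m (N * A)" for M N k k'
    by (rule q_commute_mult[OF c(1) that])
  have pw: "inverse q ^ (l - 1 - i) * q ^ (l - 1 - j) \<noteq> 1" if "i < l" "j < l" "i \<noteq> j" for i j
  proof
    assume "inverse q ^ (l - 1 - i) * q ^ (l - 1 - j) = 1"
    then have "q ^ (l - 1 - j) = q ^ (l - 1 - i)" using q by (simp add: field_simps power_inverse)
    then show False using qorder_distinct_powers[of l q "l - 1 - j" "l - 1 - i"] l q that by simp
  qed
  define V where "V = mat n (l * m) (\<lambda>(r, a). (B ^\<^sub>m (l - 1 - a mod l) * U) $$ (r, a div l))"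
  define V' where "V' = mat (l * m) n (\<lambda>(a, r). (W * C ^\<^sub>m (l - 1 - a mod l)) $$ (a div l, r))"
  have cV: "V \<in> carrier_mat n (l * m)" "V' \<in> carrier_mat (l * m) n" unfolding V_def V'_def by auto
  have VMV: "(V' * M * V) $$ (a, b) = (W * (C ^\<^sub>m (l - 1 - a mod l) * M * B ^\<^sub>m (l - 1 - b mod l)) * U) $$ (a div l, b div l)"
    if M: "M \<in> Mat n" and ab: "a < l * m" "b < l * m" for M a b
  proof -
    let ?C = "C ^\<^sub>m (l - 1 - a mod l)" and ?B = "B ^\<^sub>m (l - 1 - b mod l)"
    have d: "a div l < m" "b div l < m" using ab by (auto simp: div_less_flat)
    have c1: "W * ?C \<in> carrier_mat m n" "?B * U \<in> carrier_mat n m" "W * ?C * M \<in> carrier_mat m n"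
      using mult_carrier_mat[OF cW cp(2)] mult_carrier_mat[OF cp(1) cU] mult_carrier_mat[OF mult_carrier_mat[OF cW cp(2)] M] by auto
    have 1: "(V' * M) $$ (a, r) = (W * ?C * M) $$ (a div l, r)" if r: "r < n" for r
      unfolding mat_mult_entry[OF cV(2) M ab(1) r] mat_mult_entry[OF c1(1) M d(1) r]
      by (intro sum.cong refl) (use ab in \<open>simp add: V'_def\<close>)
    have "(V' * M * V) $$ (a, b) = (W * ?C * M * (?B * U)) $$ (a div l, b div l)"
      unfolding mat_mult_entry[OF mult_carrier_mat[OF cV(2) M] cV(1) ab] mat_mult_entry[OF c1(3,2) d]
      by (intro sum.cong refl arg_cong2[of _ _ _ _ "(*)"]) (use ab in \<open>simp_all add: 1 V_def\<close>)
    also have "W * ?C * M * (?B * U) = W * (?C * M) * ?B * U"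
      unfolding assoc_mult_mat[OF cW cp(2) M] 
      by (rule assoc_mult_mat[symmetric, OF mult_carrier_mat[OF cW mult_carrier_mat[OF cp(2) M]] cp(1) cU])
    also have "W * (?C * M) * ?B = W * (?C * M * ?B)" by (rule assoc_mult_mat[OF cW mult_carrier_mat[OF cp(2) M] cp(1)])
    finally show ?thesis .
  qed
  have modl: "a mod l < l" for a using l0 by simp
  have V'V: "V' * V = 1\<^sub>m (l * m)"
  proof (rule eq_matI)
    fix a b assume "a < dim_row (1\<^sub>m (l * m))" "b < dim_col (1\<^sub>m (l * m))"
    then have ab: "a < l * m" "b < l * m" by auto
    have d: "a div l < m" "b div l < m" using ab by (auto simp: div_less_flat)
    let ?M = "C ^\<^sub>m (l - 1 - a mod l) * B ^\<^sub>m (l - 1 - b mod l)"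
    have "V' * V = V' * 1\<^sub>m n * V" using cV by simp
    then have e: "(V' * V) $$ (a, b) = (W * ?M * U) $$ (a div l, b div l)"
      using VMV[OF one_carrier_mat ab] right_mult_one_mat[OF cp(2)] by simp
    show "(V' * V) $$ (a, b) = 1\<^sub>m (l * m) $$ (a, b)"
    proof (cases "a mod l = b mod l")
      case True
      then have "?M = 1\<^sub>m n" using CB by simp
      then have "(V' * V) $$ (a, b) = 1\<^sub>m m $$ (a div l, b div l)" unfolding e using cW WU by simp
      moreover have "a = b \<longleftrightarrow> a div l = b div l" using True by (metis div_mult_mod_eq)
      ultimately show ?thesis using ab d by auto
    next
      case False
      have "W * ?M * U = 0\<^sub>m m m"
        by (rule off[OF mult_carrier_mat[OF cp(2,1)] comp[OF cp(2,1) ACk ABk] pw[OF modl modl False]])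
      then show ?thesis unfolding e using ab d False by auto
    qed
  qed (use cV in auto)
  have "l * m \<le> n"
  proof (rule ccontr)
    assume "\<not> l * m \<le> n"
    then have "card {0..<n} < card {0..<l * m}" by simp
    from underdetermined_system_nontrivial[OF _ _ this, of "\<lambda>a r. V $$ (r, a)"]
    obtain cf where cf: "\<exists>a\<in>{0..<l * m}. cf a \<noteq> 0" "\<forall>r\<in>{0..<n}. (\<Sum>a\<in>{0..<l * m}. cf a * V $$ (r, a)) = 0" by auto
    let ?v = "vec (l * m) cf"
    have "V *\<^sub>v ?v = 0\<^sub>v n"
      using cf(2) cV by (intro eq_vecI) (auto simp: scalar_prod_def mult.commute)
    then have "(V' * V) *\<^sub>v ?v = V' *\<^sub>v 0\<^sub>v n" using assoc_mult_mat_vec[OF cV(2,1), of ?v] by simp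
    also have "\<dots> = 0\<^sub>v (l * m)" using cV by (intro eq_vecI) auto
    finally have "?v = 0\<^sub>v (l * m)" unfolding V'V by simp
    then have "cf a = 0" if "a < l * m" for a using that by (metis index_vec index_zero_vec(1))
    then show False using cf(1) by auto
  qed
  then have nl: "n = l * m" using mult unfolding m_def ys_def by simp
  note cV = cV[folded nl]
  have VV': "V * V' = 1\<^sub>m n" by (rule mat_mult_left_right_inverse[OF cV(2,1) V'V[folded nl]])
  define X where "X = inverse q \<cdot>\<^sub>m ?J1"
  define Y where "Y = W * B ^\<^sub>m l * U"
  have cX: "X \<in> Mat m" and cY: "Y \<in> Mat m" unfolding X_def Y_def using cJ cW cU cp by auto
  have JY: "?J1 * Y = Y * ?J1"
  proof -
    have WB: "W * B ^\<^sub>m l \<in> carrier_mat m n" using cW cp by simp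
    have "?J1 * Y = ?J1 * W * B ^\<^sub>m l * U"
      unfolding Y_def using assoc_mult_mat[OF cJ(1) WB cU] assoc_mult_mat[OF cJ(1) cW cp(1)] by simp
    also have "\<dots> = W * (A * B ^\<^sub>m l) * U" unfolding WA[symmetric] assoc_mult_mat[OF cW c(1) cp(1)] ..
    also have "A * B ^\<^sub>m l = B ^\<^sub>m l * A" unfolding ABk l0(2) by (simp add: smat_one)
    also have "W * (B ^\<^sub>m l * A) * U = W * B ^\<^sub>m l * (A * U)"
      unfolding assoc_mult_mat[OF cW cp(1) c(1), symmetric] by (rule assoc_mult_mat[OF WB c(1) cU])
    also have "\<dots> = Y * ?J1" unfolding AU Y_def by (rule assoc_mult_mat[symmetric, OF WB cU cJ(1)])
    finally show ?thesis .
  qed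
  have XY: "X * Y = Y * X"
    unfolding X_def mult_smult_assoc_mat[OF cJ(1) cY] mult_smult_distrib[OF cY cJ(1)] JY ..
  have tA: "V' * A * V = flat_diag l m (\<lambda>i. inverse q ^ i \<cdot>\<^sub>m X)"
  proof (rule eq_matI)
    fix a b assume "a < dim_row (flat_diag l m (\<lambda>i. inverse q ^ i \<cdot>\<^sub>m X))" "b < dim_col (flat_diag l m (\<lambda>i. inverse q ^ i \<cdot>\<^sub>m X))"
    then have ab: "a < l * m" "b < l * m" by (auto simp: flat_diag_def flat_def)
    have d: "a div l < m" "b div l < m" using ab by (auto simp: div_less_flat)
    let ?C = "C ^\<^sub>m (l - 1 - a mod l)" and ?B = "B ^\<^sub>m (l - 1 - b mod l)"
    have M: "?C * A * ?B = q ^ (l - 1 - b mod l) \<cdot>\<^sub>m (?C * ?B * A)"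
      unfolding assoc_mult_mat[OF cp(2) c(1) cp(1)] ABk mult_smult_distrib[OF cp(2) mult_carrier_mat[OF cp(1) c(1)]]
        assoc_mult_mat[OF cp(2,1) c(1)] ..
    have e: "(V' * A * V) $$ (a, b) = (W * (?C * A * ?B) * U) $$ (a div l, b div l)" by (rule VMV[OF c(1) ab])
    show "(V' * A * V) $$ (a, b) = flat_diag l m (\<lambda>i. inverse q ^ i \<cdot>\<^sub>m X) $$ (a, b)"
    proof (cases "a mod l = b mod l")
      case True
      then have "?C * ?B = 1\<^sub>m n" using CB by simp
      then have "?C * A * ?B = q ^ (l - 1 - b mod l) \<cdot>\<^sub>m A" unfolding M using c by simp
      then have "W * (?C * A * ?B) * U = q ^ (l - 1 - b mod l) \<cdot>\<^sub>m (W * A * U)"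
        using mult_smult_distrib[OF cW c(1)] mult_smult_assoc_mat[OF mult_carrier_mat[OF cW c(1)] cU] by simp
      also have "W * A * U = ?J1" unfolding WA assoc_mult_mat[OF cJ(1) cW cU] WU by (rule right_mult_one_mat[OF cJ(1)])
      finally have "(V' * A * V) $$ (a, b) = q ^ (l - 1 - b mod l) * ?J1 $$ (a div l, b div l)"
        unfolding e using d cJ by simp
      moreover have "q ^ (l - 1 - b mod l) = inverse q ^ (b mod l) * inverse q"
      proof -
        have "l = (l - 1 - b mod l) + Suc (b mod l)" using modl[of b] by simp
        then have "q ^ (l - 1 - b mod l) * q ^ Suc (b mod l) = 1" using l0(2) by (metis power_add)
        then have "q ^ (l - 1 - b mod l) = inverse (q ^ Suc (b mod l))" using q
          by (metis inverse_unique mult.commute)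
        then show ?thesis by (simp add: power_inverse mult.commute)
      qed
      ultimately show ?thesis using True ab d cJ unfolding flat_diag_def X_def by (simp add: flat_index)
    next
      case False
      have k: "A * (?C * A * ?B) = (inverse q ^ (l - 1 - a mod l) * 1 * q ^ (l - 1 - b mod l)) \<cdot>\<^sub>m (?C * A * ?B * A)"
        by (rule comp[OF mult_carrier_mat[OF cp(2) c(1)] cp(1) comp[OF cp(2) c(1) ACk] ABk]) (simp add: smat_one)
      have "W * (?C * A * ?B) * U = 0\<^sub>m m m"
        by (rule off[OF mult_carrier_mat[OF mult_carrier_mat[OF cp(2) c(1)] cp(1)] k]) (use pw[OF modl modl False] in simp)
      then show ?thesis unfolding e using ab d False unfolding flat_diag_def by (simp add: flat_index)
    qed
  qed (use cV nl in \<open>auto simp: flat_diag_def flat_def\<close>)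
  have tB: "V' * B * V = flat_cyc l m Y"
  proof (rule eq_matI)
    fix a b assume "a < dim_row (flat_cyc l m Y)" "b < dim_col (flat_cyc l m Y)"
    then have ab: "a < l * m" "b < l * m" by (auto simp: flat_cyc_def flat_def)
    have d: "a div l < m" "b div l < m" using ab by (auto simp: div_less_flat)
    let ?C = "C ^\<^sub>m (l - 1 - a mod l)" and ?B = "B ^\<^sub>m (l - 1 - b mod l)"
    have pB: "B * ?B = B ^\<^sub>m (l - b mod l)"
    proof -
      have "l - b mod l = Suc (l - 1 - b mod l)" using modl[of b] by simp
      then show ?thesis using pow_mat_comm[OF c(2), of "l - 1 - b mod l"] by simp
    qed
    have e: "(V' * B * V) $$ (a, b) = (W * (?C * B ^\<^sub>m (l - b mod l)) * U) $$ (a div l, b div l)"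
      using VMV[OF c(2) ab] assoc_mult_mat[OF cp(2) c(2) cp(1)] pB by simp
    consider "Suc (a mod l) = b mod l" | "a mod l = l - 1" "b mod l = 0" | "Suc (a mod l) \<noteq> b mod l" "\<not> (a mod l = l - 1 \<and> b mod l = 0)"
      by (cases "Suc (a mod l) = b mod l"; cases "a mod l = l - 1 \<and> b mod l = 0"; simp)
    then show "(V' * B * V) $$ (a, b) = flat_cyc l m Y $$ (a, b)"
    proof cases
      case 1
      then have "l - b mod l = l - 1 - a mod l" by simp
      then have "?C * B ^\<^sub>m (l - b mod l) = 1\<^sub>m n" using CB by simp
      then have "(V' * B * V) $$ (a, b) = 1\<^sub>m m $$ (a div l, b div l)" unfolding e using cW WU by simp
      then show ?thesis using 1 ab unfolding flat_cyc_def by (simp add: flat_index)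
    next
      case 2
      then have "?C * B ^\<^sub>m (l - b mod l) = B ^\<^sub>m l" using c C cp by simp
      then have "(V' * B * V) $$ (a, b) = Y $$ (a div l, b div l)" unfolding e Y_def by simp
      then show ?thesis using 2 ab unfolding flat_cyc_def by (simp add: flat_index)
    next
      case 3
      have "inverse q ^ (l - 1 - a mod l) * q ^ (l - b mod l) \<noteq> 1"
      proof
        assume "inverse q ^ (l - 1 - a mod l) * q ^ (l - b mod l) = 1"
        then have eq: "q ^ (l - b mod l) = q ^ (l - 1 - a mod l)" using q by (simp add: field_simps power_inverse)
        show False
        proof (cases "b mod l = 0")
          case True
          then have "q ^ 0 = q ^ (l - 1 - a mod l)" using eq l0(2) by simp
          then have "0 = l - 1 - a mod l" using qorder_distinct_powers[of l q 0 "l - 1 - a mod l"] l q l0 by simp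
          then show ?thesis using 3 True modl[of a] by simp
        next
          case False
          then have "l - b mod l = l - 1 - a mod l"
            using qorder_distinct_powers[of l q "l - b mod l" "l - 1 - a mod l"] l q l0 eq modl[of b] by simp
          then show ?thesis using 3 modl[of a] modl[of b] by simp
        qed
      qed
      then have "W * (?C * B ^\<^sub>m (l - b mod l)) * U = 0\<^sub>m m m"
        by (rule off[OF mult_carrier_mat[OF cp(2,1)] comp[OF cp(2,1) ACk ABk]])
      then show ?thesis unfolding e using ab d 3 unfolding flat_cyc_def by (auto simp: flat_index)
    qed
  qed (use cV nl in \<open>auto simp: flat_cyc_def flat_def\<close>)
  have conjM: "M * V = V * (V' * M * V)" if M: "M \<in> Mat n" for M
  proof -
    have "V * (V' * M * V) = V * (V' * (M * V))" using assoc_mult_mat[OF cV(2) M cV(1)] by simp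
    also have "\<dots> = V * V' * (M * V)" by (rule assoc_mult_mat[symmetric, OF cV mult_carrier_mat[OF M cV(1)]])
    finally show ?thesis unfolding VV' using left_mult_one_mat[OF mult_carrier_mat[OF M cV(1)]] by simp
  qed
  have "gl_conj (A, B) (V' * A * V, V' * B * V)"
    by (rule gl_conjI[OF c _ _ cV VV' conjM[OF c(1)] conjM[OF c(2)]]) (use cV c in auto)
  then have "gl_conj (A, B) (twist q l m X Y)" unfolding tA tB twist_def .
  then show ?thesis using nl cX cY XY by blast
qed


section \<open>Every pair is a degeneration\<close>

lemma sum_list_by_value:
  fixes xs :: "(nat \<times> 'a) list"
  assumes "finite S" "snd ` set xs \<subseteq> S"
  shows "sum_list (map fst xs) = (\<Sum>x\<in>S. sum_list (map fst (filter (\<lambda>z. snd z = x) xs)))"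
  using assms(2)
proof (induction xs)
  case (Cons z xs)
  have "(\<Sum>x\<in>S. sum_list (map fst (filter (\<lambda>z. snd z = x) (z # xs)))) =
    (\<Sum>x\<in>S. (if snd z = x then fst z else 0) + sum_list (map fst (filter (\<lambda>z. snd z = x) xs)))"
    by (rule sum.cong) auto
  also have "\<dots> = fst z + sum_list (map fst xs)"
    unfolding sum.distrib using Cons assms(1) by (simp add: sum.delta)
  finally show ?case by simp
qed simp

lemma connected_spectrum_card:
  fixes A :: "'a::field mat"
  assumes q: "q \<noteq> 0" and l: "qorder q = enat l" and A: "A \<in> Mat n" and con: "q_connected q A"
  shows "card (spectrum A) \<le> l"
proof (cases "spectrum A = {}")
  case False
  then obtain x where x: "eigenvalue A x" unfolding spectrum_def by blast
  have "spectrum A \<subseteq> (\<lambda>j. q ^ j * x) ` {..<l}"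
  proof
    fix y assume "y \<in> spectrum A"
    then have "(y, x) \<in> (q_link q A)\<^sup>*" using con x unfolding q_connected_def spectrum_def by simp
    then obtain k where "y = q powi k * x" using q_link_powi[OF q A] by blast
    moreover have "q powi k = q ^ nat (k mod int l)"
    proof -
      have "k = int l * (k div int l) + k mod int l" by simp
      then have "q powi k = (q powi int l) powi (k div int l) * q powi (k mod int l)"
        using q by (metis power_int_add power_int_mult)
      also have "q powi int l = 1" using qorder_finite[OF l] by simp
      finally show ?thesis using qorder_finite[OF l] by (simp add: power_int_def)
    qed
    moreover have "nat (k mod int l) < l" using qorder_finite[OF l] by (simp add: nat_less_iff)
    ultimately show "y \<in> (\<lambda>j. q ^ j * x) ` {..<l}" by (intro image_eqI[of _ _ "nat (k mod int l)"]) auto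
  qed
  then have "card (spectrum A) \<le> card {..<l}" by (rule surj_card_le[rotated]) simp
  then show ?thesis by simp
qed simp

lemma eigenvalue_zero_iff_det:
  fixes A :: "'a::field mat"
  assumes "A \<in> Mat n"
  shows "eigenvalue A 0 \<longleftrightarrow> det A = 0"
proof -
  have "0 \<cdot>\<^sub>v v = 0\<^sub>v n" if "v \<in> carrier_vec n" for v :: "'a vec" using that by auto
  then show ?thesis
  unfolding det_0_iff_vec_prod_zero_field[OF assms] eigenvalue_def eigenvector_def using assms by auto
qed

context degeneration_closed
begin

text \<open>The pairs \<open>(X, Y)\<close> for which all translates \<open>(X + c, Y)\<close> have their twists in \<open>F\<close> form a family to which
  \<open>commuting_pairs_mem\<close> applies; its base case \<open>m = 1\<close> is the one where \<open>A\<close> is diagonal.\<close>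

lemma twist_mem:
  assumes l: "qorder q = enat l"
    and base: "\<And>a X. a \<noteq> 0 \<Longrightarrow> (mat_diag l (\<lambda>k. a * inverse q ^ k), X) \<in> qpairs q l \<Longrightarrow>
      (mat_diag l (\<lambda>k. a * inverse q ^ k), X) \<in> F l"
    and m: "0 < m" and c: "X \<in> Mat m" "Y \<in> Mat m" and XY: "X * Y = Y * X"
  shows "twist q l m X Y \<in> F (l * m)"
proof -
  have l0: "0 < l" "q ^ l = 1" using qorder_finite[OF l] by auto
  define G where "G m = {p \<in> qpairs 1 m. \<forall>c. twist q l m (fst p + c \<cdot>\<^sub>m 1\<^sub>m m) (snd p) \<in> F (l * m)}" for m
  have mem: "(X, Y) \<in> G m \<longleftrightarrow> (X, Y) \<in> qpairs 1 m \<and> (\<forall>c. twist q l m (X + c \<cdot>\<^sub>m 1\<^sub>m m) Y \<in> F (l * m))" for X Y m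
    unfolding G_def by simp
  have "degeneration_closed 1 G"
  proof
    show "(1::'a) \<noteq> 0" by simp
    show "G m \<subseteq> qpairs 1 m" for m unfolding G_def by blast
    show "(A v, B v) \<in> G m" if A: "A \<in> upoly.mats m m" and B: "B \<in> upoly.mats m m"
      and inf: "infinite {u. (A u, B u) \<in> G m}" for A B m v
      unfolding mem
    proof (intro conjI allI)
      have qp: "closedin (zariski m) (qpairs (1::'a) m)" by (rule closedin_qpairs)
      have "infinite {u. (A u, B u) \<in> zcl m (qpairs 1 m)}"
        by (rule infinite_super[OF _ inf]) (use zcl_superset[OF qpairs_subset] in \<open>auto simp: mem\<close>)
      from zcl_curve[OF A B this] show "(A v, B v) \<in> qpairs 1 m" using zcl_minimal[OF qp order_refl] by blast
      fix c
      have "(\<lambda>u. flat_diag l m (\<lambda>i. inverse q ^ i \<cdot>\<^sub>m (A u + c \<cdot>\<^sub>m 1\<^sub>m m))) \<in> upoly.mats (l * m) (l * m)"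
        unfolding flat_diag_def
        by (rule flat_mats[OF _ l0(1)])
          (intro upoly.mats_if upoly.mats_smult upoly.mats_add upoly.mats_const upoly.const A; simp)
      moreover have "(\<lambda>u. flat_cyc l m (B u)) \<in> upoly.mats (l * m) (l * m)"
        unfolding flat_cyc_def by (rule flat_mats[OF _ l0(1)]) (intro upoly.mats_if upoly.mats_const B; simp)
      moreover have "infinite {u. (flat_diag l m (\<lambda>i. inverse q ^ i \<cdot>\<^sub>m (A u + c \<cdot>\<^sub>m 1\<^sub>m m)), flat_cyc l m (B u)) \<in> F (l * m)}"
        by (rule infinite_super[OF _ inf]) (auto simp: mem twist_def)
      ultimately show "twist q l m (A v + c \<cdot>\<^sub>m 1\<^sub>m m) (B v) \<in> F (l * m)"
        unfolding twist_def by (rule curve)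
    qed
    show "p \<in> G m" if con: "gl_conj p p'" and p': "p' \<in> G m" for p p' m
    proof -
      have qp: "p \<in> qpairs 1 m" using gl_conj_qpairs[OF gl_conj_sym[OF con]] p' unfolding G_def by blast
      then have "p \<in> pairs m" using qpairs_subset by blast
      from gl_conjE[OF con this] obtain P Q where P: "P \<in> Mat m" "Q \<in> Mat m" "P * Q = 1\<^sub>m m"
        "p' \<in> pairs m" "fst p * P = P * fst p'" "snd p * P = P * snd p'" by metis
      have c: "fst p \<in> Mat m" "snd p \<in> Mat m" "fst p' \<in> Mat m" "snd p' \<in> Mat m"
        using \<open>p \<in> pairs m\<close> P(4) by (simp_all add: mem_Times_iff)
      have "gl_conj (twist q l m (fst p + c \<cdot>\<^sub>m 1\<^sub>m m) (snd p)) (twist q l m (fst p' + c \<cdot>\<^sub>m 1\<^sub>m m) (snd p'))" for c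
      proof (rule twist_conj[OF l0(1) _ c(2) _ c(4) P(1-3) _ P(6)])
        have o: "c \<cdot>\<^sub>m 1\<^sub>m m \<in> Mat m" by simp
        show "(fst p + c \<cdot>\<^sub>m 1\<^sub>m m) * P = P * (fst p' + c \<cdot>\<^sub>m 1\<^sub>m m)"
          unfolding add_mult_distrib_mat[OF c(1) o P(1)] mult_add_distrib_mat[OF P(1) c(3) o] P(5)
            mult_smult_assoc_mat[OF one_carrier_mat P(1)] mult_smult_distrib[OF P(1) one_carrier_mat] using P(1) by simp
      qed (use c in auto)
      then show ?thesis using qp p' conj unfolding G_def by blast
    qed
    show "psum p r \<in> G (m + k)" if p: "p \<in> G m" and r: "r \<in> G k" for p r m k
    proof -
      have pp: "p \<in> pairs m" "r \<in> pairs k" using p r qpairs_subset unfolding G_def by blast+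
      then have c: "fst p \<in> Mat m" "snd p \<in> Mat m" "fst r \<in> Mat k" "snd r \<in> Mat k"
        by (simp_all add: mem_Times_iff)
      have "twist q l (m + k) (blk (fst p) (fst r) + c \<cdot>\<^sub>m 1\<^sub>m (m + k)) (blk (snd p) (snd r)) \<in> F (l * (m + k))" for c
      proof -
        have "blk (fst p) (fst r) + c \<cdot>\<^sub>m 1\<^sub>m (m + k) = blk (fst p + c \<cdot>\<^sub>m 1\<^sub>m m) (fst r + c \<cdot>\<^sub>m 1\<^sub>m k)"
          unfolding blk_eq[OF c(1,3)] blk_eq[OF add_carrier_mat[OF smult_carrier_mat[OF one_carrier_mat]] add_carrier_mat[OF smult_carrier_mat[OF one_carrier_mat]]]
          using c by (intro eq_matI) auto
        then have "twist q l (m + k) (blk (fst p) (fst r) + c \<cdot>\<^sub>m 1\<^sub>m (m + k)) (blk (snd p) (snd r)) =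
          psum (twist q l m (fst p + c \<cdot>\<^sub>m 1\<^sub>m m) (snd p)) (twist q l k (fst r + c \<cdot>\<^sub>m 1\<^sub>m k) (snd r))"
          using twist_psum[OF l0(1), of "fst p + c \<cdot>\<^sub>m 1\<^sub>m m" m "snd p" "fst r + c \<cdot>\<^sub>m 1\<^sub>m k" k "snd r" q] c by simp
        moreover have "\<dots> \<in> F (l * m + l * k)" using p r unfolding G_def by (intro psum) auto
        ultimately show ?thesis by (simp add: distrib_left)
      qed
      moreover have "psum p r \<in> qpairs 1 (m + k)" using psum_qpairs_iff[OF pp, of 1] p r unfolding G_def by blast
      ultimately show ?thesis unfolding G_def psum_def by simp
    qed
  qed
  moreover have "(X + c \<cdot>\<^sub>m 1\<^sub>m m, Y) \<in> G m" if XY: "(X, Y) \<in> G m" for X Y m c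
  proof -
    have cX: "X \<in> Mat m" "Y \<in> Mat m" "X * Y = Y * X" using XY unfolding mem qpairs_def by (auto simp: smat_one)
    have "X + c \<cdot>\<^sub>m 1\<^sub>m m + c' \<cdot>\<^sub>m 1\<^sub>m m = X + (c + c') \<cdot>\<^sub>m 1\<^sub>m m" for c'
      using cX by (intro eq_matI) auto
    moreover have "(X + c \<cdot>\<^sub>m 1\<^sub>m m) * Y = Y * (X + c \<cdot>\<^sub>m 1\<^sub>m m)"
    proof -
      have o: "c \<cdot>\<^sub>m 1\<^sub>m m \<in> Mat m" by simp
      show ?thesis
        unfolding add_mult_distrib_mat[OF cX(1) o cX(2)] mult_add_distrib_mat[OF cX(2,1) o]
          mult_smult_assoc_mat[OF one_carrier_mat cX(2)] mult_smult_distrib[OF cX(2) one_carrier_mat] using cX by simp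
    qed
    ultimately show ?thesis using XY cX unfolding mem qpairs_def by (simp add: smat_one)
  qed
  moreover have "qpairs 1 1 \<subseteq> G 1"
  proof
    fix p :: "'a mat \<times> 'a mat" assume p: "p \<in> qpairs 1 1"
    obtain X Y where pe: "p = (X, Y)" by (cases p)
    have c: "X \<in> Mat 1" "Y \<in> Mat 1" using p unfolding pe qpairs_def by auto
    let ?M = "\<lambda>u. mat 1 1 (\<lambda>_. u) :: 'a mat"
    have comm: "?M u * Y = Y * ?M u" for u
      using c by (intro eq_matI) (auto simp: scalar_prod_def)
    have tw: "twist q l 1 (?M u) Y = (mat_diag l (\<lambda>k. u * inverse q ^ k), flat_cyc l 1 Y)" for u
      unfolding twist_def flat_diag_def flat_def mat_diag_def by (auto intro!: eq_matI)
    have nz: "twist q l 1 (?M u) Y \<in> F (l * 1)" if u: "u \<noteq> 0" for u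
      using twist_qpairs[OF q0 l0 _ c(2) comm, of u] base[OF u, of "flat_cyc l 1 Y"] unfolding tw by simp
    have all: "twist q l 1 (?M u) Y \<in> F (l * 1)" for u
      unfolding tw
    proof (rule curve[where A = "\<lambda>u. mat_diag l (\<lambda>k. u * inverse q ^ k)" and B = "\<lambda>_. flat_cyc l 1 Y" and v = u])
      show "(\<lambda>u. mat_diag l (\<lambda>k. u * inverse q ^ k)) \<in> upoly.mats (l * 1) (l * 1)"
        unfolding mat_diag_def nat_mult_1_right by (intro upoly.mats_mat) (simp only: split, intro upoly.ring_if upoly.const upoly.mult upoly_ident)
      show "(\<lambda>_. flat_cyc l 1 Y) \<in> upoly.mats (l * 1) (l * 1)"
        unfolding flat_cyc_def by (rule upoly.mats_const[OF flat_carrier])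
      show "infinite {u. (mat_diag l (\<lambda>k. u * inverse q ^ k), flat_cyc l 1 Y) \<in> F (l * 1)}"
        by (rule infinite_super[OF _ infinite_nonzero[OF upoly_ident, of 1]]) (use nz[unfolded tw] in auto)
    qed
    have "X + c \<cdot>\<^sub>m 1\<^sub>m 1 = ?M (X $$ (0, 0) + c)" for c using \<open>X \<in> Mat 1\<close> by (intro eq_matI) auto
    then show "p \<in> G 1" using p all unfolding pe mem by simp
  qed
  ultimately have "qpairs 1 m \<subseteq> G m" by (intro commuting_pairs_mem[OF _ _ _ m])
  moreover have "(X, Y) \<in> qpairs 1 m" using c XY unfolding qpairs_def by (simp add: smat_one)
  ultimately have "(X, Y) \<in> G m" by blast
  then have "twist q l m (X + 0 \<cdot>\<^sub>m 1\<^sub>m m) Y \<in> F (l * m)" unfolding mem by blast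
  moreover have "X + 0 \<cdot>\<^sub>m 1\<^sub>m m = X" using c by (intro eq_matI) auto
  ultimately show ?thesis by simp
qed

lemma invertible_mem:
  assumes l: "qorder q = enat l"
    and base: "\<And>a X. a \<noteq> 0 \<Longrightarrow> (mat_diag l (\<lambda>k. a * inverse q ^ k), X) \<in> qpairs q l \<Longrightarrow>
      (mat_diag l (\<lambda>k. a * inverse q ^ k), X) \<in> F l"
    and n: "0 < n" and AB: "(A, B) \<in> qpairs q n" and dB: "det B \<noteq> 0" and xs: "jordan_nf A xs"
    and x: "x \<noteq> 0" and mult: "n \<le> l * sum_list (map fst (filter (\<lambda>z. snd z = x) xs))"
  shows "(A, B) \<in> F n"
proof -
  obtain m X Y where m: "n = l * m" "X \<in> Mat m" "Y \<in> Mat m" "X * Y = Y * X" "gl_conj (A, B) (twist q l m X Y)"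
    using invertible_pair_is_twist[OF q0 l AB dB xs x mult] by blast
  then have "0 < m" using n by (cases m) auto
  then show ?thesis using conj[OF m(5)] twist_mem[OF l base _ m(2-4)] m(1) by simp
qed

text \<open>Here \<open>X\<close> is a weighted cycle, invertible up to perturbation, so the pair is a twist of scalars.\<close>

lemma cyclic_pair_mem:
  assumes l: "qorder q = enat n"
    and base: "\<And>a X. a \<noteq> 0 \<Longrightarrow> (mat_diag n (\<lambda>k. a * inverse q ^ k), X) \<in> qpairs q n \<Longrightarrow>
      (mat_diag n (\<lambda>k. a * inverse q ^ k), X) \<in> F n"
    and n: "0 < n" and a: "a \<noteq> 0" and X: "(X, mat_diag n (\<lambda>k. a * q ^ k)) \<in> qpairs q n"
  shows "(X, mat_diag n (\<lambda>k. a * q ^ k)) \<in> F n"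
proof -
  let ?D = "mat_diag n (\<lambda>k. a * q ^ k)"
  have ln: "q ^ n = 1" using qorder_finite[OF l] by simp
  define E where "E = mat n n (\<lambda>(i, j). if Suc i = j \<or> (i = n - 1 \<and> j = 0) then 1 else 0 :: 'a)"
  have cE: "E \<in> Mat n" unfolding E_def by simp
  have "E * ?D = q \<cdot>\<^sub>m (?D * E)"
    unfolding mat_diag_mult_left[OF cE] mat_diag_mult_right[OF cE]
  proof (rule eq_matI)
    have "q * q ^ (n - 1) = 1" using ln n by (metis power_Suc Suc_pred')
    then have "a = q * (a * q ^ (n - 1))" by (metis mult.left_commute mult.right_neutral)
    then show "Matrix.mat n n (\<lambda>(i, j). E $$ (i, j) * (a * q ^ j)) $$ (i, j) =
      (q \<cdot>\<^sub>m Matrix.mat n n (\<lambda>(i, j). a * q ^ i * E $$ (i, j))) $$ (i, j)"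
      if "i < dim_row (q \<cdot>\<^sub>m Matrix.mat n n (\<lambda>(i, j). a * q ^ i * E $$ (i, j)))"
        "j < dim_col (q \<cdot>\<^sub>m Matrix.mat n n (\<lambda>(i, j). a * q ^ i * E $$ (i, j)))" for i j
      using that by (auto simp: E_def)
  qed auto
  then have ED: "(E, ?D) \<in> qpairs q n" using cE unfolding qpairs_def by simp
  have dE: "det E \<noteq> 0"
  proof
    assume "det E = 0"
    then obtain v where v: "v \<in> carrier_vec n" "v \<noteq> 0\<^sub>v n" "E *\<^sub>v v = 0\<^sub>v n"
      unfolding det_0_iff_vec_prod_zero_field[OF cE] by blast
    have row: "(\<Sum>j\<in>{0..<n}. (if Suc i = j \<or> (i = n - 1 \<and> j = 0) then 1 else 0) * v $ j) = 0" if "i < n" for i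
    proof -
      have "(E *\<^sub>v v) $ i = (\<Sum>j\<in>{0..<n}. (if Suc i = j \<or> (i = n - 1 \<and> j = 0) then 1 else 0) * v $ j)"
        using that v(1) unfolding E_def by (simp add: scalar_prod_def)
      then show ?thesis using v(3) that by simp
    qed
    have "v $ j = 0" if j: "j < n" for j
    proof -
      define i where "i = (if j = 0 then n - 1 else j - 1)"
      have i: "i < n" unfolding i_def using j by auto
      have "(\<Sum>j'\<in>{0..<n}. (if Suc i = j' \<or> (i = n - 1 \<and> j' = 0) then 1 else 0) * v $ j') = (\<Sum>j'\<in>{j}. v $ j')"
        using j by (intro sum.mono_neutral_cong_right) (auto simp: i_def split: if_splits)
      then show ?thesis using row[OF i] by simp
    qed
    then have "v = 0\<^sub>v n" using v(1) by (intro eq_vecI) auto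
    then show False using v(2) by simp
  qed
  show ?thesis
  proof (rule perturb_fst[where P = det, OF X ED _ dE])
    show "(\<lambda>u. det (Z u)) \<in> upoly_funs" if "Z \<in> upoly.mats n n" for Z by (rule upoly.mats_det[OF that])
    fix Z assume Z: "(Z, ?D) \<in> qpairs q n" "det Z \<noteq> 0"
    then have cZ: "Z \<in> Mat n" unfolding qpairs_def by simp
    obtain xs where xs: "jordan_nf Z xs" using jordan_nf_exists_alg_closed[OF cZ] by blast
    obtain x where x: "eigenvalue Z x" using exists_eigenvalue[OF cZ n] by blast
    then have x0: "x \<noteq> 0" using eigenvalue_zero_iff_det[OF cZ] Z(2) by auto
    have "det ?D \<noteq> 0" unfolding det_mat_diag using a q0 by simp
    moreover have "n \<le> n * sum_list (map fst (filter (\<lambda>z. snd z = x) xs))"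
    proof -
      obtain k where k: "(k, x) \<in> set xs" using x unfolding eigenvalue_jordan_nf[OF xs cZ] by auto
      then have "k \<noteq> 0" using xs unfolding jordan_nf_def by (metis fst_conv image_eqI)
      moreover have "k \<in> set (map fst (filter (\<lambda>z. snd z = x) xs))" using k by force
      ultimately have "1 \<le> sum_list (map fst (filter (\<lambda>z. snd z = x) xs))"
        using member_le_sum_list[of k "map fst (filter (\<lambda>z. snd z = x) xs)"] by linarith
      then have "n * 1 \<le> n * sum_list (map fst (filter (\<lambda>z. snd z = x) xs))" by (rule mult_le_mono2)
      then show ?thesis by simp
    qed
    ultimately show "(Z, ?D) \<in> F n" by (intro invertible_mem[OF l base n Z(1) _ xs x0])
  qed
qed

text \<open>Taking determinants shows that \<open>q\<close> is a root of unity. Being connected, the spectrum of \<open>A\<close> has at most \<open>l\<close>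
  elements, so one of the multiplicities is at least \<open>n / l\<close>.\<close>

lemma connected_invertible_mem:
  assumes base: "\<And>l a X. qorder q = enat l \<Longrightarrow> a \<noteq> 0 \<Longrightarrow> (mat_diag l (\<lambda>k. a * inverse q ^ k), X) \<in> qpairs q l \<Longrightarrow>
      (mat_diag l (\<lambda>k. a * inverse q ^ k), X) \<in> F l"
    and n: "0 < n" and AB: "(A, B) \<in> qpairs q n" and con: "q_connected q A" and nz: "\<not> eigenvalue A 0" "\<not> eigenvalue B 0"
  shows "(A, B) \<in> F n"
proof -
  have c: "A \<in> Mat n" "B \<in> Mat n" "A * B = q \<cdot>\<^sub>m (B * A)" using AB unfolding qpairs_def by auto
  have dA: "det A \<noteq> 0" and dB: "det B \<noteq> 0" using nz c eigenvalue_zero_iff_det by auto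
  have "det A * det B = q ^ n * (det B * det A)"
    unfolding det_mult[OF c(1,2), symmetric] det_mult[OF c(2,1), symmetric] c(3)
    using det_smult[of q "B * A"] c by simp
  then have "q ^ n = 1" using dA dB by simp
  then have "\<exists>k>0. q ^ k = 1" using n by blast
  then obtain l where l: "qorder q = enat l" unfolding qorder_def by auto
  obtain xs where xs: "jordan_nf A xs" using jordan_nf_exists_alg_closed[OF c(1)] by blast
  let ?mu = "\<lambda>x. sum_list (map fst (filter (\<lambda>z. snd z = x) xs))"
  have sp: "snd ` set xs = spectrum A" unfolding spectrum_def using eigenvalue_jordan_nf[OF xs c(1)] by blast
  have fin: "finite (spectrum A)" using card_finite_spectrum[OF c(1)] by simp
  have ne: "spectrum A \<noteq> {}" using exists_eigenvalue[OF c(1) n] unfolding spectrum_def by blast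
  define M where "M = Max (?mu ` spectrum A)"
  have "M \<in> ?mu ` spectrum A" unfolding M_def using fin ne by (intro Max_in) auto
  then obtain x where x: "x \<in> spectrum A" "?mu x = M" by blast
  have "similar_mat A (jordan_matrix xs)" using xs unfolding jordan_nf_def by blast
  then obtain k where "A \<in> Mat k" "jordan_matrix xs \<in> Mat k" using similar_matD by blast
  then have "n = sum_list (map fst xs)" using c(1) by (metis carrier_matD(1) jordan_matrix_dim(1))
  also have "\<dots> = (\<Sum>x\<in>spectrum A. ?mu x)" by (rule sum_list_by_value[OF fin]) (simp add: sp)
  also have "\<dots> \<le> (\<Sum>x\<in>spectrum A. M)" unfolding M_def using fin by (intro sum_mono Max_ge) auto
  also have "\<dots> = card (spectrum A) * M" by simp
  also have "\<dots> \<le> l * M" using connected_spectrum_card[OF q0 l c(1)] con by (intro mult_le_mono1) blast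
  finally have "n \<le> l * ?mu x" using x by simp
  moreover have "x \<noteq> 0" using x nz unfolding spectrum_def by auto
  ultimately show ?thesis by (intro invertible_mem[OF l base[OF l] n AB dB xs])
qed

theorem all_pairs_mem:
  assumes baseD: "\<And>i a X. 0 < i \<Longrightarrow> enat i \<le> qorder q \<Longrightarrow> a \<noteq> 0 \<Longrightarrow>
      (mat_diag i (\<lambda>k. a * inverse q ^ k), X) \<in> qpairs q i \<Longrightarrow> (mat_diag i (\<lambda>k. a * inverse q ^ k), X) \<in> F i"
    and baseN: "\<And>i a X. 0 < i \<Longrightarrow> enat i < qorder q \<Longrightarrow> a \<noteq> 0 \<Longrightarrow>
      (X, mat_diag i (\<lambda>k. a * q ^ k)) \<in> qpairs q i \<Longrightarrow> (X, mat_diag i (\<lambda>k. a * q ^ k)) \<in> F i"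
    and n: "0 < n"
  shows "qpairs q n \<subseteq> F n"
proof -
  have baseD': "(mat_diag l (\<lambda>k. a * inverse q ^ k), X) \<in> F l"
    if "qorder q = enat l" "a \<noteq> 0" "(mat_diag l (\<lambda>k. a * inverse q ^ k), X) \<in> qpairs q l" for l a X
    using baseD[OF _ _ that(2,3)] qorder_finite(1)[OF that(1)] that(1) by simp
  show ?thesis using n
  proof (induction n rule: less_induct)
    case (less n)
    have IH: "\<And>m. 0 < m \<Longrightarrow> m < n \<Longrightarrow> qpairs q m \<subseteq> F m" using less.IH by blast
    show ?case
    proof
      fix p assume p: "p \<in> qpairs q n"
      obtain A B where pe: "p = (A, B)" by (cases p)
      have AB: "(A, B) \<in> qpairs q n" using p pe by simp
      have "(A, B) \<in> F n"
      proof (cases "q_connected q A \<and> q_connected (inverse q) B")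
        case False
        then show ?thesis using disconnected_mem[OF IH AB] disconnected_mem_snd[OF IH AB] by blast
      next
        case True
        consider "\<And>x. eigenvalue B x \<Longrightarrow> x = 0" | "\<And>x. eigenvalue A x \<Longrightarrow> x = 0" | "\<not> eigenvalue A 0" "\<not> eigenvalue B 0"
          using True not_q_connected_zero[OF q0, of A] not_q_connected_zero[of "inverse q" B] q0 by fastforce
        then show ?thesis
        proof cases
          case 1
          show ?thesis by (rule B_nilpotent[OF IH less.prems AB 1 baseD[OF less.prems]])
        next
          case 2
          show ?thesis
          proof (rule A_nilpotent[OF IH less.prems AB 2])
            fix a X assume le: "enat n \<le> qorder q" and a: "a \<noteq> 0" and X: "(X, mat_diag n (\<lambda>k. a * q ^ k)) \<in> qpairs q n"
            let ?D = "mat_diag n (\<lambda>k. a * q ^ k)"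
            show "(X, ?D) \<in> F n"
            proof (cases "enat n < qorder q")
              case True
              then show ?thesis by (rule baseN[OF less.prems _ a X])
            next
              case False
              then have l: "qorder q = enat n" using le by simp
              show ?thesis by (rule cyclic_pair_mem[OF l baseD[OF less.prems le] less.prems a X])
            qed
          qed
        next
          case 3
          show ?thesis by (rule connected_invertible_mem[OF baseD' less.prems AB conjunct1[OF True] 3])
        qed
      qed
      then show "p \<in> F n" using pe by simp
    qed
  qed
qed

end

section \<open>The candidate components as closures of block sums\<close>

definition conj_inv :: "('a::field mat \<times> 'a mat) set \<Rightarrow> bool" where
  "conj_inv V \<longleftrightarrow> (\<forall>p p'. gl_conj p p' \<longrightarrow> p' \<in> V \<longrightarrow> p \<in> V)"

text \<open>Iterated block sums up to one conjugation at the end, so that nesting and order do not matter.\<close>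

definition conj_sum :: "('a::field mat \<times> 'a mat) set list \<Rightarrow> ('a mat \<times> 'a mat) set" where
  "conj_sum Vs = {p. \<exists>xs. list_all2 (\<in>) xs Vs \<and> gl_conj p (psum_list xs)}"

definition squares :: "('a mat \<times> 'a mat) set \<Rightarrow> bool" where
  "squares V \<longleftrightarrow> (\<forall>p\<in>V. square_pair p)"

lemma conj_invD: "conj_inv V \<Longrightarrow> gl_conj p p' \<Longrightarrow> p' \<in> V \<Longrightarrow> p \<in> V"
  unfolding conj_inv_def by blast

lemma gl_orbits_conj_inv: "conj_inv (gl_orbits V)"
  unfolding conj_inv_def gl_orbits_def using gl_conj_trans by blast

lemma conj_sum_conj_inv: "conj_inv (conj_sum Vs)"
  unfolding conj_inv_def conj_sum_def using gl_conj_trans by blast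

lemma square_pair_conj: "gl_conj p p' \<Longrightarrow> square_pair p' \<Longrightarrow> square_pair p"
  using gl_conj_pairs[OF gl_conj_sym] square_pairI unfolding square_pair_def by blast

lemma list_all2_squares: "list_all2 (\<in>) xs Vs \<Longrightarrow> \<forall>V\<in>set Vs. squares V \<Longrightarrow> \<forall>x\<in>set xs. square_pair x"
  unfolding squares_def by (induction rule: list_all2_induct) auto

lemma conj_sum_squares: "\<forall>V\<in>set Vs. squares V \<Longrightarrow> squares (conj_sum Vs)"
proof -
  assume sq: "\<forall>V\<in>set Vs. squares V"
  have "square_pair p" if "list_all2 (\<in>) xs Vs" "gl_conj p (psum_list xs)" for p xs
    by (rule square_pair_conj[OF that(2) square_pairI[OF psum_list_pairs[OF list_all2_squares[OF that(1) sq]]]])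
  then show "squares (conj_sum Vs)" unfolding squares_def conj_sum_def by blast
qed

lemma conj_sum_single: "conj_inv V \<Longrightarrow> squares V \<Longrightarrow> conj_sum [V] = V"
proof (intro equalityI subsetI)
  fix p assume "conj_inv V" "p \<in> conj_sum [V]"
  then obtain x where "x \<in> V" "gl_conj p x" unfolding conj_sum_def by (auto simp: list_all2_Cons2 psum_list_single)
  then show "p \<in> V" using \<open>conj_inv V\<close> unfolding conj_inv_def by blast
next
  fix p assume "squares V" "p \<in> V"
  then have "list_all2 (\<in>) [p] [V]" "square_pair p" unfolding squares_def by auto
  moreover from this(2) have "gl_conj p (psum_list [p])"
    unfolding psum_list_single by (intro gl_conj_refl[OF square_pairD])
  ultimately have "list_all2 (\<in>) [p] [V]" "gl_conj p (psum_list [p])" by auto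
  then show "p \<in> conj_sum [V]" unfolding conj_sum_def by blast
qed

lemma conj_sum_append:
  assumes sq: "\<forall>V\<in>set Vs. squares V" "\<forall>W\<in>set Ws. squares W"
  shows "conj_sum (Vs @ Ws) = {p. \<exists>r\<in>conj_sum Vs. \<exists>s\<in>conj_sum Ws. gl_conj p (psum r s)}"
proof (intro equalityI subsetI)
  fix p assume "p \<in> conj_sum (Vs @ Ws)"
  then obtain xs ys where xy: "list_all2 (\<in>) xs Vs" "list_all2 (\<in>) ys Ws" "gl_conj p (psum_list (xs @ ys))"
    unfolding conj_sum_def by (auto simp: list_all2_append2)
  note s = list_all2_squares[OF xy(1) sq(1)] list_all2_squares[OF xy(2) sq(2)]
  have "psum_list xs \<in> conj_sum Vs" "psum_list ys \<in> conj_sum Ws"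
    unfolding conj_sum_def using xy gl_conj_refl[OF psum_list_pairs[OF s(1)]] gl_conj_refl[OF psum_list_pairs[OF s(2)]] by blast+
  then show "p \<in> {p. \<exists>r\<in>conj_sum Vs. \<exists>s\<in>conj_sum Ws. gl_conj p (psum r s)}"
    using xy(3) unfolding psum_list_append[OF s] by blast
next
  fix p assume "p \<in> {p. \<exists>r\<in>conj_sum Vs. \<exists>s\<in>conj_sum Ws. gl_conj p (psum r s)}"
  then obtain r s xs ys where rs: "list_all2 (\<in>) xs Vs" "gl_conj r (psum_list xs)" "list_all2 (\<in>) ys Ws"
    "gl_conj s (psum_list ys)" "gl_conj p (psum r s)" unfolding conj_sum_def by blast
  note sx = list_all2_squares[OF rs(1) sq(1)] and sy = list_all2_squares[OF rs(3) sq(2)]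
  have "square_pair r" "square_pair s"
    using square_pair_conj[OF rs(2) square_pairI[OF psum_list_pairs[OF sx]]]
      square_pair_conj[OF rs(4) square_pairI[OF psum_list_pairs[OF sy]]] by auto
  then have "gl_conj (psum r s) (psum_list (xs @ ys))"
    unfolding psum_list_append[OF sx sy] by (intro gl_conj_psum[OF rs(2,4) square_pairD square_pairD])
  then have "gl_conj p (psum_list (xs @ ys))" using rs(5) gl_conj_trans by blast
  moreover have "list_all2 (\<in>) (xs @ ys) (Vs @ Ws)" using rs by (intro list_all2_appendI)
  ultimately show "p \<in> conj_sum (Vs @ Ws)" unfolding conj_sum_def by blast
qed

lemma dsum2_eq: "dsum2 V W = {p. \<exists>r\<in>V. \<exists>s\<in>W. gl_conj p (psum r s)}"
proof -
  have "{(diag_block_mat [A1, A2], diag_block_mat [B1, B2]) | A1 B1 A2 B2. (A1, B1) \<in> V \<and> (A2, B2) \<in> W} =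
    {psum r s | r s. r \<in> V \<and> s \<in> W}"
    unfolding psum_def blk_def by (force simp del: diag_block_mat.simps)
  then show ?thesis unfolding dsum2_def gl_orbits_def by (simp only:) blast
qed

lemma dsum_eq_conj_sum:
  assumes "Vs \<noteq> []" "\<forall>V\<in>set Vs. conj_inv V \<and> squares V"
  shows "dsum Vs = conj_sum Vs"
  using assms
proof (induction Vs rule: dsum.induct)
  case (2 V)
  then show ?case using conj_sum_single by auto
next
  case (3 V W Vs)
  then have "dsum (V # W # Vs) = {p. \<exists>r\<in>conj_sum [V]. \<exists>s\<in>conj_sum (W # Vs). gl_conj p (psum r s)}"
    unfolding dsum.simps dsum2_eq using conj_sum_single[of V] by auto
  also have "\<dots> = conj_sum ([V] @ W # Vs)"
    by (rule conj_sum_append[symmetric]) (use 3 in auto)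
  finally show ?case by simp
qed simp

lemma conj_sum_concat:
  assumes "\<forall>Vs\<in>set Vss. \<forall>V\<in>set Vs. squares V"
  shows "conj_sum (map conj_sum Vss) = conj_sum (concat Vss)"
  using assms
proof (induction Vss)
  case (Cons Vs Vss)
  have sq: "\<forall>V\<in>set Vs. squares V" "\<forall>V\<in>set (concat Vss). squares V" "\<forall>V\<in>set (map conj_sum Vss). squares V"
    using Cons.prems conj_sum_squares by auto
  have "conj_sum (map conj_sum (Vs # Vss)) = conj_sum ([conj_sum Vs] @ map conj_sum Vss)" by simp
  also have "\<dots> = {p. \<exists>r\<in>conj_sum [conj_sum Vs]. \<exists>s\<in>conj_sum (map conj_sum Vss). gl_conj p (psum r s)}"
    by (rule conj_sum_append) (use sq conj_sum_squares in auto)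
  also have "\<dots> = {p. \<exists>r\<in>conj_sum Vs. \<exists>s\<in>conj_sum (concat Vss). gl_conj p (psum r s)}"
    using Cons conj_sum_single[OF conj_sum_conj_inv conj_sum_squares[OF sq(1)]] by simp
  also have "\<dots> = conj_sum (Vs @ concat Vss)" by (rule conj_sum_append[symmetric]) (use sq in auto)
  finally show ?case by simp
qed simp

lemma conj_sum_perm:
  assumes "mset Vs = mset Ws" "\<forall>V\<in>set Vs. squares V"
  shows "conj_sum Vs = conj_sum Ws"
proof -
  have "conj_sum Vs \<subseteq> conj_sum Ws" if ms: "mset Vs = mset Ws" and sq: "\<forall>V\<in>set Vs. squares V"
    for Vs Ws :: "('a mat \<times> 'a mat) set list"
  proof
    fix p assume "p \<in> conj_sum Vs"
    then obtain xs where xs: "list_all2 (\<in>) xs Vs" "gl_conj p (psum_list xs)" unfolding conj_sum_def by blast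
    have "list_all2 (\<lambda>V x. x \<in> V) Vs xs" using xs(1) by (simp add: list_all2_conv_all_nth)
    then obtain ys where "list_all2 (\<lambda>V x. x \<in> V) Ws ys" "mset ys = mset xs"
      using list_all2_reorder_left_invariance[OF _ ms[symmetric]] by blast
    then have ys: "list_all2 (\<in>) ys Ws" "mset ys = mset xs" by (simp_all add: list_all2_conv_all_nth)
    have "gl_conj (psum_list xs) (psum_list ys)"
      using gl_conj_psum_list_perm[OF ys(2)[symmetric] list_all2_squares[OF xs(1) sq]] .
    then show "p \<in> conj_sum Ws" using ys(1) xs(2) gl_conj_trans unfolding conj_sum_def by blast
  qed
  from this[OF assms] this[OF assms(1)[symmetric]] assms show ?thesis
    by (metis mset_eq_setD subset_antisym)
qed


text \<open>A block type is a size together with the information which of the two matrices is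
  semisimple on the block: \<open>True\<close> for the first one.\<close>

definition component :: "'a::field \<Rightarrow> bool \<times> nat \<Rightarrow> ('a mat \<times> 'a mat) set" where
  "component q t = (if fst t then D_comp q (snd t) else N_comp q (snd t))"

abbreviation total :: "(bool \<times> nat) list \<Rightarrow> nat" where
  "total ts \<equiv> sum_list (map snd ts)"

definition block_types :: "'a::field \<Rightarrow> nat \<Rightarrow> (bool \<times> nat) list set" where
  "block_types q n = {ts. total ts = n \<and>
     (\<forall>(d, k)\<in>set ts. 1 \<le> k \<and> enat k \<le> qorder q \<and> (\<not> d \<longrightarrow> enat k < qorder q))}"

definition K_types :: "'a::field \<Rightarrow> (bool \<times> nat) list \<Rightarrow> ('a mat \<times> 'a mat) set" where
  "K_types q ts = zcl (total ts) (conj_sum (map (component q) ts))"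

definition types_of :: "(nat \<Rightarrow> nat) \<Rightarrow> (nat \<Rightarrow> nat) \<Rightarrow> (bool \<times> nat) list" where
  "types_of m r = concat (map (\<lambda>i. replicate (m i) (True, i)) (sorted_list_of_set {i. m i \<noteq> 0})) @
     concat (map (\<lambda>i. replicate (r i) (False, i)) (sorted_list_of_set {i. r i \<noteq> 0}))"

definition comp_gen :: "'a::field \<Rightarrow> bool \<times> nat \<Rightarrow> ('a mat \<times> 'a mat) set" where
  "comp_gen q t = gl_orbits (if fst t then {(A, B) \<in> qpairs q (snd t). \<exists>a. a \<noteq> 0 \<and> A = mat_diag (snd t) (\<lambda>k. a * inverse q ^ k)}
     else {(A, B) \<in> qpairs q (snd t). A = jordan_block (snd t) 0})"

lemma comp_eq_zcl: "component q t = zcl (snd t) (comp_gen q t)" and comp_gen_qpairs: "comp_gen q t \<subseteq> qpairs q (snd t)"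
proof -
  show s: "comp_gen q t \<subseteq> qpairs q (snd t)"
    unfolding comp_gen_def by (rule gl_orbits_subset) auto
  show "component q t = zcl (snd t) (comp_gen q t)"
    using qpairs_closure_of[OF s] unfolding component_def D_comp_def N_comp_def comp_gen_def by (cases t) auto
qed

lemma comp_qpairs: "component q t \<subseteq> qpairs q (snd t)"
  unfolding comp_eq_zcl by (rule zcl_subset_qpairs[OF comp_gen_qpairs])

lemma comp_squares: "squares (component q t)"
  unfolding squares_def using comp_qpairs qpairs_subset square_pairI by blast

text \<open>Conjugation and block sums with a fixed pair are polynomial maps.\<close>

lemma zcl_conj_inv:
  fixes S :: "('a::field mat \<times> 'a mat) set"
  assumes S: "conj_inv S" "S \<subseteq> pairs n"
  shows "conj_inv (zcl n S)"
  unfolding conj_inv_def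
proof (intro allI impI)
  fix p p' assume con: "gl_conj p p'" and p': "p' \<in> zcl n S"
  have pp: "p' \<in> pairs n" using p' zcl_subset by blast
  from gl_conjE[OF gl_conj_sym[OF con] pp] obtain P Q where P: "P \<in> Mat n" "Q \<in> Mat n"
    "P * Q = 1\<^sub>m n" "Q * P = 1\<^sub>m n" "p \<in> pairs n" "fst p' * P = P * fst p" "snd p' * P = P * snd p" by metis
  define h where "h x = (Q * proj1 n x * P, Q * proj2 n x * P)" for x
  have h: "(\<lambda>x. f (h x)) \<in> poly_funs n" if "f \<in> poly_funs n" for f
    unfolding h_def using that
    by (rule poly_funs.poly_funs_comp[OF _
          poly_funs.mats_mult[OF poly_funs.mats_mult[OF poly_funs.mats_const[OF P(2)] proj_mats(1)] poly_funs.mats_const[OF P(1)]]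
          poly_funs.mats_mult[OF poly_funs.mats_mult[OF poly_funs.mats_const[OF P(2)] proj_mats(2)] poly_funs.mats_const[OF P(1)]]])
  have hx: "h x = (Q * fst x * P, Q * snd x * P)" if "x \<in> pairs n" for x
    using that unfolding h_def by (cases x) (simp add: proj_eq)
  have can: "Q * X * P = Y" if "X \<in> Mat n" "Y \<in> Mat n" "X * P = P * Y" for X Y
  proof -
    have "Q * X * P = Q * (P * Y)" unfolding that(3)[symmetric] by (rule assoc_mult_mat[OF P(2) that(1) P(1)])
    also have "\<dots> = Q * P * Y" by (rule assoc_mult_mat[symmetric, OF P(2,1) that(2)])
    finally show ?thesis using P that by simp
  qed
  have hp: "h p' = p" unfolding hx[OF pp]
    using can[OF _ _ P(6)] can[OF _ _ P(7)] pp P(5) by (simp add: mem_Times_iff)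
  have "h p' \<in> zcl n S"
  proof (rule zcl_image[OF p' h])
    show "h p' \<in> pairs n" unfolding hp by (rule P(5))
    fix s assume s: "s \<in> S"
    then have sp: "s \<in> pairs n" using S(2) by blast
    then have sc: "fst s \<in> Mat n" "snd s \<in> Mat n" by (simp_all add: mem_Times_iff)
    have cc: "P * (Q * X * P) = X * P" if X: "X \<in> Mat n" for X
    proof -
      have "P * (Q * X * P) = P * (Q * (X * P))" using assoc_mult_mat[OF P(2) X P(1)] by simp
      also have "\<dots> = P * Q * (X * P)" by (rule assoc_mult_mat[symmetric, OF P(1,2) mult_carrier_mat[OF X P(1)]])
      finally show ?thesis unfolding P(3) using left_mult_one_mat[OF mult_carrier_mat[OF X P(1)]] by simp
    qed
    have "gl_conj (fst s, snd s) (h s)"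
      unfolding hx[OF sp] by (rule gl_conjI[OF sc _ _ P(1-3)]) (use sc P cc in auto)
    then have "h s \<in> S" using conj_invD[OF S(1) gl_conj_sym] s by simp
    then show "h s \<in> zcl n S" using zcl_superset[OF S(2)] by blast
  qed
  then show "p \<in> zcl n S" unfolding hp .
qed

lemma blk_mats:
  assumes "A \<in> function_ring.mats R n n" "B \<in> function_ring.mats R m m" "function_ring R"
  shows "(\<lambda>x. blk (A x) (B x)) \<in> function_ring.mats R (n + m) (n + m)"
proof -
  interpret function_ring R by fact
  have "blk (A x) (B x) = mat (n + m) (n + m) (\<lambda>(i, j). if i < n then if j < n then A x $$ (i, j) else 0
      else if j < n then 0 else B x $$ (i - n, j - n))" for x
    unfolding blk_eq[OF mats_carrier[OF assms(1)] mats_carrier[OF assms(2)]]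
    using mats_carrier[OF assms(1), of x] mats_carrier[OF assms(2), of x] by (intro eq_matI) auto
  moreover have "(\<lambda>x. mat (n + m) (n + m) (\<lambda>(i, j). if i < n then if j < n then A x $$ (i, j) else 0
      else if j < n then 0 else B x $$ (i - n, j - n))) \<in> mats (n + m) (n + m)"
  proof (rule mats_mat)
    fix i j assume "i < n + m" "j < n + m"
    then show "(\<lambda>x. case (i, j) of (i, j) \<Rightarrow> if i < n then if j < n then A x $$ (i, j) else 0
      else if j < n then 0 else B x $$ (i - n, j - n)) \<in> R"
      unfolding split
      by (intro ring_if const mats_entry[OF assms(1)] mats_entry[OF assms(2)]) auto
  qed
  ultimately show ?thesis by simp
qed

text \<open>One argument at a time: for fixed \<open>s\<close> in \<open>S\<close> the map \<open>psum s\<close> is continuous, and then so is \<open>psum\<close> with second argument \<open>y\<close>.\<close>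

lemma zcl_psum:
  fixes S :: "('a::field mat \<times> 'a mat) set"
  assumes x: "x \<in> zcl n S" and y: "y \<in> zcl m T" and S: "S \<subseteq> pairs n" and T: "T \<subseteq> pairs m"
    and ST: "\<And>s t. s \<in> S \<Longrightarrow> t \<in> T \<Longrightarrow> psum s t \<in> zcl (n + m) Z"
  shows "psum x y \<in> zcl (n + m) Z"
proof -
  have hf: "(\<lambda>p. f (blk C (proj1 k p), blk D (proj2 k p))) \<in> poly_funs k"
    "(\<lambda>p. f (blk (proj1 k p) C, blk (proj2 k p) D)) \<in> poly_funs k"
    if "C \<in> Mat l" "D \<in> Mat l" "f \<in> poly_funs (l + k)" for f :: "'a mat \<times> 'a mat \<Rightarrow> 'a" and C D k l
  proof -
    note r = poly_funs.function_ring_axioms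
    have "f \<in> poly_funs (k + l)" using that(3) by (simp add: add.commute)
    then show "(\<lambda>p. f (blk (proj1 k p) C, blk (proj2 k p) D)) \<in> poly_funs k"
      by (rule poly_funs.poly_funs_comp[OF _ blk_mats[OF proj_mats(1) poly_funs.mats_const[OF that(1)] r]
          blk_mats[OF proj_mats(2) poly_funs.mats_const[OF that(2)] r]])
    show "(\<lambda>p. f (blk C (proj1 k p), blk D (proj2 k p))) \<in> poly_funs k"
      by (rule poly_funs.poly_funs_comp[OF that(3) blk_mats[OF poly_funs.mats_const[OF that(1)] proj_mats(1) r]
          blk_mats[OF poly_funs.mats_const[OF that(2)] proj_mats(2) r]])
  qed
  have yp: "y \<in> pairs m" and xp: "x \<in> pairs n" using x y zcl_subset by blast+
  have 1: "psum s y \<in> zcl (n + m) Z" if s: "s \<in> S" for s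
  proof -
    have sp: "s \<in> pairs n" using s S by blast
    let ?h = "\<lambda>p. (blk (fst s) (proj1 m p), blk (snd s) (proj2 m p))"
    have hp: "?h p = psum s p" if "p \<in> pairs m" for p
      using that unfolding psum_def by (cases p) (simp add: proj_eq)
    have "?h y \<in> zcl (n + m) Z"
    proof (rule zcl_image[OF y])
      show "(\<lambda>p. f (?h p)) \<in> poly_funs m" if "f \<in> poly_funs (n + m)" for f
        using hf(1)[OF _ _ that] sp by (simp add: mem_Times_iff)
      show "?h y \<in> pairs (n + m)" unfolding hp[OF yp] by (rule psum_pairs[OF sp yp])
      show "?h t \<in> zcl (n + m) Z" if "t \<in> T" for t unfolding hp[OF subsetD[OF T that]] by (rule ST[OF s that])
    qed
    then show ?thesis unfolding hp[OF yp] .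
  qed
  let ?h = "\<lambda>p. (blk (proj1 n p) (fst y), blk (proj2 n p) (snd y))"
  have hp: "?h p = psum p y" if "p \<in> pairs n" for p
    using that unfolding psum_def by (cases p) (simp add: proj_eq)
  have "?h x \<in> zcl (n + m) Z"
  proof (rule zcl_image[OF x])
    show "(\<lambda>p. f (?h p)) \<in> poly_funs n" if "f \<in> poly_funs (n + m)" for f
      using hf(2)[of "fst y" m "snd y" f n] that yp by (simp add: mem_Times_iff add.commute)
    show "?h x \<in> pairs (n + m)" unfolding hp[OF xp] by (rule psum_pairs[OF xp yp])
    show "?h s \<in> zcl (n + m) Z" if "s \<in> S" for s unfolding hp[OF subsetD[OF S that]] by (rule 1[OF that])
  qed
  then show ?thesis unfolding hp[OF xp] .
qed

lemma comp_conj_inv: "conj_inv (component q t)"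
  unfolding comp_eq_zcl
  by (rule zcl_conj_inv[OF _ order_trans[OF comp_gen_qpairs qpairs_subset]]) (simp add: comp_gen_def gl_orbits_conj_inv)

lemma conj_sum_comp_qpairs: "conj_sum (map (component q) ts) \<subseteq> qpairs q (total ts)"
proof -
  have "psum_list xs \<in> qpairs q (total ts)" if "list_all2 (\<in>) xs (map (component q) ts)" for xs
    using that
  proof (induction ts arbitrary: xs)
    case Nil
    then show ?case by (auto simp: psum_list_def qpairs_def)
  next
    case (Cons t ts)
    then obtain x ys where xs: "xs = x # ys" "x \<in> component q t" "list_all2 (\<in>) ys (map (component q) ts)"
      by (auto simp: list_all2_Cons2)
    note x = subsetD[OF comp_qpairs xs(2)] and y = Cons.IH[OF xs(3)]
    have "psum x (psum_list ys) \<in> qpairs q (snd t + total ts)"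
      unfolding psum_qpairs_iff[OF subsetD[OF qpairs_subset x] subsetD[OF qpairs_subset y]] using x y by blast
    then show ?case unfolding xs psum_list_Cons by simp
  qed
  then show ?thesis unfolding conj_sum_def using gl_conj_qpairs gl_conj_sym by blast
qed

lemma K_types_qpairs: "K_types q ts \<subseteq> qpairs q (total ts)"
  unfolding K_types_def by (rule zcl_subset_qpairs[OF conj_sum_comp_qpairs])

lemma conj_sum_comp_subset_K_types: "conj_sum (map (component q) ts) \<subseteq> K_types q ts"
  unfolding K_types_def by (rule zcl_superset[OF order_trans[OF conj_sum_comp_qpairs qpairs_subset]])

lemma K_types_conj_inv: "conj_inv (K_types q ts)"
  unfolding K_types_def
  by (rule zcl_conj_inv[OF conj_sum_conj_inv order_trans[OF conj_sum_comp_qpairs qpairs_subset]])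

lemma comp_subset_K_types: "component q t \<subseteq> K_types q [t]"
proof -
  have "conj_sum (map (component q) [t]) = component q t"
    using conj_sum_single[OF comp_conj_inv comp_squares, of q t] by simp
  then show ?thesis using conj_sum_comp_subset_K_types[of q "[t]"] by simp
qed

lemma comps_squares: "\<forall>V\<in>set (map (component q) ts). squares V"
  using comp_squares by auto

lemma K_types_psum:
  assumes "x \<in> K_types q ts" "y \<in> K_types q us"
  shows "psum x y \<in> K_types q (ts @ us)"
proof -
  note c = order_trans[OF conj_sum_comp_qpairs qpairs_subset]
  have "psum x y \<in> zcl (total ts + total us) (conj_sum (map (component q) (ts @ us)))"
  proof (rule zcl_psum[OF assms[unfolded K_types_def] c c])
    fix s t assume st: "s \<in> conj_sum (map (component q) ts)" "t \<in> conj_sum (map (component q) us)"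
    then have "gl_conj (psum s t) (psum s t)" using gl_conj_refl[OF psum_pairs] c by blast
    then have "psum s t \<in> conj_sum (map (component q) (ts @ us))"
      unfolding map_append conj_sum_append[OF comps_squares comps_squares] using st by blast
    then show "psum s t \<in> zcl (total ts + total us) (conj_sum (map (component q) (ts @ us)))"
      using zcl_superset[OF c[of q "ts @ us"]] by auto
  qed
  then show ?thesis unfolding K_types_def by simp
qed

lemma K_types_perm: "mset ts = mset us \<Longrightarrow> K_types q ts = K_types q us"
  unfolding K_types_def
  using conj_sum_perm[of "map (component q) ts" "map (component q) us", OF _ comps_squares]
  by (metis mset_map sum_mset_sum_list)

lemma sum_list_concat_replicate:
  "sum_list (map snd (concat (map (\<lambda>i. replicate (m i) (b, i)) is))) = sum_list (map (\<lambda>i. i * m i) is)"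
  by (induction "is") (auto simp: sum_list_replicate)

lemma types_of_sum:
  assumes "finite {i. m i \<noteq> 0}" "finite {i. r i \<noteq> 0}"
  shows "sum_list (map snd (types_of m r)) = wnorm m + wnorm r"
  unfolding types_of_def wnorm_def map_append sum_list_append sum_list_concat_replicate
  using assms by (simp add: sum_list_distinct_conv_sum_set)

lemma types_of_count:
  assumes "finite {i. m i \<noteq> 0}" "finite {i. r i \<noteq> 0}"
  shows "count (mset (types_of m r)) (d, i) = (if d then m i else r i)"
proof -
  have c: "count (mset (concat (map (\<lambda>i. replicate (m i) (b, i)) is))) (d, i) = (if b = d \<and> i \<in> set is then m i else 0)"
    if "distinct is" for m b "is"
    using that by (induction "is") auto
  show ?thesis unfolding types_of_def mset_append count_union
    using c[of "sorted_list_of_set {i. m i \<noteq> 0}" m True] c[of "sorted_list_of_set {i. r i \<noteq> 0}" r False] assms by auto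
qed

lemma types_of_block_types:
  assumes "(m, r) \<in> qparams q n"
  shows "types_of m r \<in> block_types q n"
proof -
  have fin: "finite {i. m i \<noteq> 0}" "finite {i. r i \<noteq> 0}" and s: "wnorm m + wnorm r = n"
    and v: "\<And>i. m i \<noteq> 0 \<Longrightarrow> 1 \<le> i \<and> enat i \<le> qorder q" "\<And>i. r i \<noteq> 0 \<Longrightarrow> 1 \<le> i \<and> enat i < qorder q"
    using assms unfolding qparams_def by auto
  have "1 \<le> k \<and> enat k \<le> qorder q \<and> (\<not> d \<longrightarrow> enat k < qorder q)" if "(d, k) \<in> set (types_of m r)" for d k
  proof -
    have "count (mset (types_of m r)) (d, k) \<noteq> 0" using that by (simp add: count_eq_zero_iff)
    then show ?thesis unfolding types_of_count[OF fin] using v(1)[of k] v(2)[of k] by (cases d) (auto simp: less_imp_le)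
  qed
  then show ?thesis unfolding block_types_def using types_of_sum[OF fin] s by auto
qed

lemma block_types_of:
  assumes "ts \<in> block_types q n"
  shows "\<exists>(m, r)\<in>qparams q n. mset (types_of m r) = mset ts"
proof -
  define m where "m i = count (mset ts) (True, i)" for i
  define r where "r i = count (mset ts) (False, i)" for i
  have "{i. m i \<noteq> 0} \<subseteq> snd ` set ts" "{i. r i \<noteq> 0} \<subseteq> snd ` set ts"
    unfolding m_def r_def by (force simp: count_eq_zero_iff)+
  then have fin: "finite {i. m i \<noteq> 0}" "finite {i. r i \<noteq> 0}" by (auto intro: finite_subset)
  have ms: "mset (types_of m r) = mset ts"
    by (rule multiset_eqI) (auto simp: types_of_count[OF fin] m_def r_def)
  have "wnorm m + wnorm r = n"
    using types_of_sum[OF fin] assms ms unfolding block_types_def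
    by (metis (mono_tags, lifting) mem_Collect_eq mset_map sum_mset_sum_list)
  moreover have "1 \<le> i \<and> enat i \<le> qorder q" if "m i \<noteq> 0" for i
    using that assms unfolding m_def block_types_def by (auto simp: count_eq_zero_iff)
  moreover have "1 \<le> i \<and> enat i < qorder q" if "r i \<noteq> 0" for i
    using that assms unfolding r_def block_types_def by (auto simp: count_eq_zero_iff)
  ultimately have "(m, r) \<in> qparams q n" unfolding qparams_def using fin by auto
  then show ?thesis using ms by blast
qed

text \<open>All sets involved are conjugation-invariant, so the powers and the sum of the powers flatten to one block sum.\<close>

lemma K_comp_eq_K_types:
  assumes n: "n \<ge> 1" and mr: "(m, r) \<in> qparams q n"
  shows "K_comp q n m r = K_types q (types_of m r)"
proof -
  have fin: "finite {i. m i \<noteq> 0}" "finite {i. r i \<noteq> 0}" and s: "wnorm m + wnorm r = n"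
    using mr unfolding qparams_def by auto
  let ?is = "sorted_list_of_set {i. m i \<noteq> 0}" and ?js = "sorted_list_of_set {i. r i \<noteq> 0}"
  define Vss where "Vss = map (\<lambda>i. replicate (m i) (D_comp q i)) ?is @ map (\<lambda>i. replicate (r i) (N_comp q i)) ?js"
  have con: "concat Vss = map (component q) (types_of m r)"
    unfolding Vss_def types_of_def by (simp add: map_concat o_def component_def)
  have D: "conj_inv (D_comp q i) \<and> squares (D_comp q i)" "conj_inv (N_comp q i) \<and> squares (N_comp q i)" for i
    using comp_conj_inv[of q "(True, i)"] comp_squares[of q "(True, i)"]
      comp_conj_inv[of q "(False, i)"] comp_squares[of q "(False, i)"] by (auto simp: component_def)
  have Vss: "Vs \<noteq> [] \<and> (\<forall>V\<in>set Vs. conj_inv V \<and> squares V)" if "Vs \<in> set Vss" for Vs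
    using that D fin unfolding Vss_def by auto
  have "Vss \<noteq> []"
  proof
    assume "Vss = []"
    then have "types_of m r = []" using con by simp
    then show False using types_of_sum[OF fin] s n by simp
  qed
  then have "dsum (map dsum Vss) = dsum (map conj_sum Vss)"
    using Vss dsum_eq_conj_sum by (intro arg_cong[of _ _ dsum] map_cong) auto
  also have "\<dots> = conj_sum (map conj_sum Vss)"
  proof (rule dsum_eq_conj_sum)
    show "\<forall>V\<in>set (map conj_sum Vss). conj_inv V \<and> squares V"
    proof
      fix V assume "V \<in> set (map conj_sum Vss)"
      then obtain Vs where Vs: "Vs \<in> set Vss" "V = conj_sum Vs" by auto
      then have "\<forall>V\<in>set Vs. squares V" using Vss by blast
      then show "conj_inv V \<and> squares V" unfolding Vs(2) using conj_sum_conj_inv conj_sum_squares by blast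
    qed
  qed (use \<open>Vss \<noteq> []\<close> in simp)
  also have "\<dots> = conj_sum (map (component q) (types_of m r))"
    unfolding con[symmetric] using Vss by (intro conj_sum_concat) auto
  finally have "dsum (map dsum Vss) = conj_sum (map (component q) (types_of m r))" .
  moreover have "map dsum Vss = map (\<lambda>i. dpow (D_comp q i) (m i)) ?is @ map (\<lambda>i. dpow (N_comp q i) (r i)) ?js"
    unfolding Vss_def dpow_def by simp
  ultimately show ?thesis
    unfolding K_comp_def K_types_def using qpairs_closure_of[OF conj_sum_comp_qpairs[of q "types_of m r"]]
      types_of_sum[OF fin] s by simp
qed


section \<open>The candidate components cover everything\<close>

lemma finite_block_types: "finite (block_types q n)"
proof -
  have "length ts \<le> n \<and> set ts \<subseteq> UNIV \<times> {..n}" if "ts \<in> block_types q n" for ts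
  proof -
    have s: "total ts = n" and k: "\<forall>t\<in>set ts. 1 \<le> snd t" using that unfolding block_types_def by auto
    have "length ts \<le> total ts" using k by (induction ts) auto
    moreover have "snd t \<le> n" if "t \<in> set ts" for t
      using s member_le_sum_list[of "snd t" "map snd ts"] that by auto
    ultimately show ?thesis using s by auto
  qed
  then have "block_types q n \<subseteq> {ts. set ts \<subseteq> UNIV \<times> {..n} \<and> length ts \<le> n}" by auto
  then show ?thesis by (rule finite_subset) (intro finite_lists_length_le, simp)
qed

lemma diag_q_commute_entries:
  fixes q :: "'a::field"
  assumes q: "q \<noteq> 0" and k: "enat k < qorder q" and a: "a \<noteq> 0"
    and X: "(X, mat_diag k (\<lambda>i. a * q ^ i)) \<in> qpairs q k" and ij: "i < k" "j < k" "j \<noteq> Suc i"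
  shows "X $$ (i, j) = 0"
proof -
  have c: "X \<in> Mat k" and e: "X * mat_diag k (\<lambda>i. a * q ^ i) = q \<cdot>\<^sub>m (mat_diag k (\<lambda>i. a * q ^ i) * X)"
    using X unfolding qpairs_def by auto
  have "X $$ (i, j) * (a * q ^ j) = q * (a * q ^ i * X $$ (i, j))"
    using arg_cong[OF e, of "\<lambda>M. M $$ (i, j)"] ij unfolding mat_diag_mult_left[OF c] mat_diag_mult_right[OF c] by simp
  then have "X $$ (i, j) = 0 \<or> q ^ j = q ^ Suc i" using a by auto
  moreover have "q ^ j \<noteq> q ^ Suc i"
  proof
    assume "q ^ j = q ^ Suc i"
    moreover have "enat (Suc k) \<le> qorder q" using k by (metis Suc_ile_eq)
    ultimately have "j = Suc i" using qorder_distinct_powers[of "Suc k" q j "Suc i"] q ij by simp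
    then show False using ij by simp
  qed
  ultimately show ?thesis by blast
qed

text \<open>A generic member of \<open>N\<close> has all weights nonzero, and then a diagonal change of basis turns the
  first matrix into the Jordan block.\<close>

lemma diag_mem_N_comp:
  fixes q :: "'a::{alg_closed_field, field_char_0}"
  assumes q: "q \<noteq> 0" and k: "enat k < qorder q" and a: "a \<noteq> 0" and X: "(X, mat_diag k (\<lambda>i. a * q ^ i)) \<in> qpairs q k"
  shows "(X, mat_diag k (\<lambda>i. a * q ^ i)) \<in> component q (False, k)"
proof -
  let ?D = "mat_diag k (\<lambda>i. a * q ^ i)" and ?J = "jordan_block k 0 :: 'a mat"
  have DJ: "(?D, ?J) \<in> qpairs (inverse q) k"
    using mat_diag_jordan_block[of "inverse q" k a] q unfolding qpairs_def by simp
  show ?thesis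
  proof (rule perturb_generic[where P = "\<lambda>Y. \<Prod>i<k - 1. Y $$ (i, Suc i)", OF _ X])
    show "(A v, B v) \<in> component q (False, k)"
      if "A \<in> upoly.mats k k" "B \<in> upoly.mats k k" "infinite {u. (A u, B u) \<in> component q (False, k)}" for A B v
      using zcl_curve[OF that(1,2)] that(3) unfolding comp_eq_zcl by simp
    show "(?J, ?D) \<in> qpairs q k" using DJ qpairs_swap[OF q] by blast
    show "(\<lambda>u. \<Prod>i<k - 1. Y u $$ (i, Suc i)) \<in> upoly_funs" if "Y \<in> upoly.mats k k" for Y
      by (rule upoly.prod, rule upoly.mats_entry[OF that]) auto
    show "(\<Prod>i<k - 1. ?J $$ (i, Suc i)) \<noteq> 0" by simp
    fix Y assume Y: "(Y, ?D) \<in> qpairs q k" and nz: "(\<Prod>i<k - 1. Y $$ (i, Suc i)) \<noteq> 0"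
    have cY: "Y \<in> Mat k" using Y unfolding qpairs_def by simp
    define p where "p i = (\<Prod>j<i. inverse (Y $$ (j, Suc j)))" for i
    have w: "Y $$ (i, Suc i) \<noteq> 0" if "Suc i < k" for i using nz that by simp
    have p0: "p i \<noteq> 0" if "i < k" for i unfolding p_def using w that by (auto simp del: prod_inversef)
    have pS: "Y $$ (i, Suc i) * p (Suc i) = p i" if "Suc i < k" for i unfolding p_def using w[OF that] by simp
    have XP: "Y * mat_diag k p = mat_diag k p * ?J"
      unfolding mat_diag_mult_left[OF jordan_block_carrier] mat_diag_mult_right[OF cY]
    proof (rule cong_mat)
      fix i j assume ij: "i < k" "j < k"
      show "(\<lambda>(i, j). Y $$ (i, j) * p j) (i, j) = (\<lambda>(i, j). p i * ?J $$ (i, j)) (i, j)"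
        using diag_q_commute_entries[OF q k a Y ij] ij pS[of i] by (cases "j = Suc i") auto
    qed simp_all
    have DP: "?D * mat_diag k p = mat_diag k p * ?D" by (simp add: mult.commute)
    have inv: "mat_diag k p * mat_diag k (\<lambda>i. inverse (p i)) = 1\<^sub>m k"
      unfolding mat_diag_diag using p0 by (intro eq_matI) (auto simp: mat_diag_def)
    have con: "gl_conj (Y, ?D) (?J, ?D)"
      by (rule gl_conjI[OF cY mat_diag_dim jordan_block_carrier mat_diag_dim mat_diag_dim mat_diag_dim inv XP DP])
    have "(Y, ?D) \<in> comp_gen q (False, k)"
      using con gl_conj_qpairs[OF con Y] unfolding comp_gen_def gl_orbits_def by auto
    then show "(Y, ?D) \<in> component q (False, k)"
      unfolding comp_eq_zcl snd_conv using zcl_superset[OF order_trans[OF comp_gen_qpairs qpairs_subset], of q "(False, k)"] by auto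
  qed
qed

lemma diag_mem_D_comp:
  assumes a: "a \<noteq> 0" and X: "(mat_diag k (\<lambda>i. a * inverse q ^ i), X) \<in> qpairs q k"
  shows "(mat_diag k (\<lambda>i. a * inverse q ^ i), X) \<in> component q (True, k)"
proof -
  have "(mat_diag k (\<lambda>i. a * inverse q ^ i), X) \<in> comp_gen q (True, k)"
    unfolding comp_gen_def gl_orbits_def using a X gl_conj_refl[OF subsetD[OF qpairs_subset X]] by auto
  then show ?thesis
    unfolding comp_eq_zcl using zcl_superset[OF order_trans[OF comp_gen_qpairs qpairs_subset], of q "(True, k)"] by auto
qed

text \<open>A curve that meets a union of finitely many closed sets infinitely often meets one of them infinitely often.\<close>

theorem qpairs_eq_Union_K_types:
  fixes q :: "'a::{alg_closed_field, field_char_0}"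
  assumes q: "q \<noteq> 0" and n: "0 < n"
  shows "qpairs q n = (\<Union>ts\<in>block_types q n. K_types q ts)"
proof -
  define F where "F n = (\<Union>ts\<in>block_types q n. K_types q ts)" for n
  have "degeneration_closed q F"
  proof
    show "q \<noteq> 0" by (rule q)
    show sub: "F n \<subseteq> qpairs q n" for n unfolding F_def using K_types_qpairs[of q] unfolding block_types_def by blast
    show "(A v, B v) \<in> F n" if A: "A \<in> upoly.mats n n" and B: "B \<in> upoly.mats n n"
      and inf: "infinite {u. (A u, B u) \<in> F n}" for A B n v
    proof -
      have "{u. (A u, B u) \<in> F n} = (\<Union>ts\<in>block_types q n. {u. (A u, B u) \<in> K_types q ts})" unfolding F_def by auto
      then obtain ts where ts: "ts \<in> block_types q n" "infinite {u. (A u, B u) \<in> K_types q ts}"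
        using inf finite_block_types[of q n] by auto
      then have "total ts = n" unfolding block_types_def by simp
      then have "(A v, B v) \<in> K_types q ts" using zcl_curve[OF A B, of "conj_sum (map (component q) ts)" v] ts(2) unfolding K_types_def by simp
      then show ?thesis unfolding F_def using ts(1) by blast
    qed
    show "p \<in> F n" if "gl_conj p p'" "p' \<in> F n" for p p' n
      using that K_types_conj_inv unfolding F_def conj_inv_def by blast
    show "psum p r \<in> F (n + m)" if p: "p \<in> F n" and r: "r \<in> F m" for p r n m
    proof -
      obtain ts us where "ts \<in> block_types q n" "us \<in> block_types q m" "p \<in> K_types q ts" "r \<in> K_types q us"
        using p r unfolding F_def by blast
      moreover from this have "ts @ us \<in> block_types q (n + m)" unfolding block_types_def by auto
      ultimately show ?thesis unfolding F_def using K_types_psum by blast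
    qed
  qed
  then interpret degeneration_closed q F .
  have "qpairs q n \<subseteq> F n"
  proof (rule all_pairs_mem[OF _ _ n])
    fix i :: nat and a :: 'a and X assume i: "0 < i" "a \<noteq> 0"
    show "(mat_diag i (\<lambda>k. a * inverse q ^ k), X) \<in> F i" if "enat i \<le> qorder q" "(mat_diag i (\<lambda>k. a * inverse q ^ k), X) \<in> qpairs q i"
    proof -
      have "[(True, i)] \<in> block_types q i" unfolding block_types_def using i that by auto
      then show ?thesis unfolding F_def using diag_mem_D_comp[OF i(2) that(2)] comp_subset_K_types by blast
    qed
    show "(X, mat_diag i (\<lambda>k. a * q ^ k)) \<in> F i" if "enat i < qorder q" "(X, mat_diag i (\<lambda>k. a * q ^ k)) \<in> qpairs q i"
    proof -
      have "[(False, i)] \<in> block_types q i" unfolding block_types_def using i that by auto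
      then show ?thesis unfolding F_def using diag_mem_N_comp[OF q that(1) i(2) that(2)] comp_subset_K_types by blast
    qed
  qed
  then show ?thesis using sub unfolding F_def by blast
qed

section \<open>Normal forms of the summands\<close>

text \<open>The block structure seen from an index \<open>i\<close>: whether the first matrix is the diagonal one on the block of \<open>i\<close>, the
  size of that block and its first index.\<close>

primrec block_diag :: "(bool \<times> nat) list \<Rightarrow> nat \<Rightarrow> bool" where
  "block_diag [] i = False"
| "block_diag (t # ts) i = (if i < snd t then fst t else block_diag ts (i - snd t))"

primrec block_size :: "(bool \<times> nat) list \<Rightarrow> nat \<Rightarrow> nat" where
  "block_size [] i = 0"
| "block_size (t # ts) i = (if i < snd t then snd t else block_size ts (i - snd t))"

primrec block_start :: "(bool \<times> nat) list \<Rightarrow> nat \<Rightarrow> nat" where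
  "block_start [] i = 0"
| "block_start (t # ts) i = (if i < snd t then 0 else snd t + block_start ts (i - snd t))"

lemma block_bounds:
  "i < total ts \<Longrightarrow> block_start ts i \<le> i \<and> i < block_start ts i + block_size ts i \<and>
    block_start ts i + block_size ts i \<le> total ts \<and> (block_diag ts i, block_size ts i) \<in> set ts"
proof (induction ts arbitrary: i)
  case (Cons t ts)
  then show ?case
  proof (cases "i < snd t")
    case True
    then show ?thesis by simp
  next
    case False
    then show ?thesis using Cons.IH[of "i - snd t"] Cons.prems by fastforce
  qed
qed simp

lemma block_const:
  "i < total ts \<Longrightarrow> block_start ts i \<le> j \<Longrightarrow> j < block_start ts i + block_size ts i \<Longrightarrow>
    block_start ts j = block_start ts i \<and> block_size ts j = block_size ts i \<and> block_diag ts j = block_diag ts i"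
proof (induction ts arbitrary: i j)
  case (Cons t ts)
  then show ?case
  proof (cases "i < snd t")
    case True
    then show ?thesis using Cons.prems by simp
  next
    case False
    then show ?thesis using Cons.IH[of "i - snd t" "j - snd t"] Cons.prems by auto
  qed
qed simp

text \<open>The normal form of a block sum. At the first index of a block, \<open>\<tau>\<close> is the first eigenvalue; at any other index it is the
  weight of the shift there. The corner entry that closes a shift to a cycle is \<open>\<gamma>\<close> at the first index.\<close>

definition modelA :: "'a::field \<Rightarrow> (bool \<times> nat) list \<Rightarrow> (nat \<Rightarrow> 'a) \<Rightarrow> 'a mat" where
  "modelA q ts \<tau> = (let n = total ts in mat n n (\<lambda>(i, j).
     if block_diag ts j then if i = j then \<tau> (block_start ts j) * inverse q ^ (j - block_start ts j) else 0
     else if Suc i = j \<and> block_start ts j \<noteq> j then \<tau> j else 0))"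

definition modelB :: "'a::field \<Rightarrow> (bool \<times> nat) list \<Rightarrow> (nat \<Rightarrow> 'a) \<Rightarrow> (nat \<Rightarrow> 'a) \<Rightarrow> 'a mat" where
  "modelB q ts \<tau> \<gamma> = (let n = total ts in mat n n (\<lambda>(i, j).
     if block_diag ts j then if Suc i = j \<and> block_start ts j \<noteq> j then \<tau> j
       else if block_start ts j = j \<and> Suc i = j + block_size ts j \<and> enat (block_size ts j) = qorder q then \<gamma> j else 0
     else if i = j then \<tau> (block_start ts j) * q ^ (j - block_start ts j) else 0))"

lemma model_carrier:
  "modelA q ts \<tau> \<in> carrier_mat (total ts) (total ts)"
  "modelB q ts \<tau> \<gamma> \<in> carrier_mat (total ts) (total ts)"
  unfolding modelA_def modelB_def by (simp_all add: Let_def)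

lemma modelA_entry:
  assumes "i < total ts" "j < total ts"
  shows "modelA q ts \<tau> $$ (i, j) = (if block_diag ts j
     then if i = j then \<tau> (block_start ts j) * inverse q ^ (j - block_start ts j) else 0
     else if Suc i = j \<and> block_start ts j \<noteq> j then \<tau> j else 0)"
  using assms unfolding modelA_def by (simp add: Let_def)

lemma modelB_entry:
  assumes "i < total ts" "j < total ts"
  shows "modelB q ts \<tau> \<gamma> $$ (i, j) = (if block_diag ts j then if Suc i = j \<and> block_start ts j \<noteq> j then \<tau> j
       else if block_start ts j = j \<and> Suc i = j + block_size ts j \<and> enat (block_size ts j) = qorder q then \<gamma> j else 0
     else if i = j then \<tau> (block_start ts j) * q ^ (j - block_start ts j) else 0)"
  using assms unfolding modelB_def by (simp add: Let_def)

lemma model_Cons: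
  "(modelA q (t # ts) \<tau>, modelB q (t # ts) \<tau> \<gamma>) = psum (modelA q [t] \<tau>, modelB q [t] \<tau> \<gamma>)
     (modelA q ts (\<lambda>i. \<tau> (snd t + i)), modelB q ts (\<lambda>i. \<tau> (snd t + i)) (\<lambda>i. \<gamma> (snd t + i)))"
proof -
  let ?k = "snd t" and ?m = "total ts"
  let ?t = "\<lambda>i. \<tau> (?k + i)" and ?g = "\<lambda>i. \<gamma> (?k + i)"
  have c: "modelA q [t] \<tau> \<in> carrier_mat ?k ?k" "modelB q [t] \<tau> \<gamma> \<in> carrier_mat ?k ?k"
    using model_carrier[of q "[t]"] by auto
  have b: "block_start ts (j - ?k) \<le> j - ?k \<and> 0 < block_size ts (j - ?k)" if "\<not> j < ?k" "j < ?k + ?m" for j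
    using block_bounds[of "j - ?k" ts] that by linarith
  have shift: "Suc i = j \<longleftrightarrow> Suc (i - ?k) = j - ?k" "?k + block_start ts (j - ?k) = j \<longleftrightarrow> block_start ts (j - ?k) = j - ?k"
    "i = j \<longleftrightarrow> i - ?k = j - ?k" "j - (?k + block_start ts (j - ?k)) = j - ?k - block_start ts (j - ?k)"
    "Suc i = j + block_size ts (j - ?k) \<longleftrightarrow> Suc (i - ?k) = j - ?k + block_size ts (j - ?k)" "?k + (j - ?k) = j"
    if "\<not> (i < ?k \<or> j < ?k)" for i j using that by linarith+
  have "modelA q (t # ts) \<tau> = blk (modelA q [t] \<tau>) (modelA q ts ?t)"
  proof (rule mat_eqI[OF _ blk_carrier[OF c(1) model_carrier(1)]])
    fix i j assume ij: "i < ?k + ?m" "j < ?k + ?m"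
    consider (both) "\<not> (i < ?k \<or> j < ?k)" | "i < ?k" "j < ?k" | "i < ?k" "\<not> j < ?k" | "\<not> i < ?k" "j < ?k" by blast
    then show "modelA q (t # ts) \<tau> $$ (i, j) = blk (modelA q [t] \<tau>) (modelA q ts ?t) $$ (i, j)"
      unfolding blk_entry[OF c(1) model_carrier(1) ij]
    proof cases
      case both
      then show "modelA q (t # ts) \<tau> $$ (i, j) = (if i < ?k then if j < ?k then modelA q [t] \<tau> $$ (i, j) else 0
          else if j < ?k then 0 else modelA q ts ?t $$ (i - ?k, j - ?k))"
        using shift[OF both] ij by (simp add: modelA_entry)
    qed (use ij b[of j] in \<open>auto simp: modelA_entry\<close>)
  qed (use model_carrier(1)[of q "t # ts"] in simp)
  moreover have "modelB q (t # ts) \<tau> \<gamma> = blk (modelB q [t] \<tau> \<gamma>) (modelB q ts ?t ?g)"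
  proof (rule mat_eqI[OF _ blk_carrier[OF c(2) model_carrier(2)]])
    fix i j assume ij: "i < ?k + ?m" "j < ?k + ?m"
    consider (both) "\<not> (i < ?k \<or> j < ?k)" | "i < ?k" "j < ?k" | "i < ?k" "\<not> j < ?k" | "\<not> i < ?k" "j < ?k" by blast
    then show "modelB q (t # ts) \<tau> \<gamma> $$ (i, j) = blk (modelB q [t] \<tau> \<gamma>) (modelB q ts ?t ?g) $$ (i, j)"
      unfolding blk_entry[OF c(2) model_carrier(2) ij]
    proof cases
      case both
      then show "modelB q (t # ts) \<tau> \<gamma> $$ (i, j) = (if i < ?k then if j < ?k then modelB q [t] \<tau> \<gamma> $$ (i, j) else 0
          else if j < ?k then 0 else modelB q ts ?t ?g $$ (i - ?k, j - ?k))"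
        using shift[OF both] ij by (simp add: modelB_entry)
    qed (use ij b[of j] in \<open>auto simp: modelB_entry\<close>)
  qed (use model_carrier(2)[of q "t # ts"] in simp)
  ultimately show ?thesis unfolding psum_def by simp
qed

lemma model_single:
  "modelA q [(True, k)] \<tau> = mat_diag k (\<lambda>i. \<tau> 0 * inverse q ^ i)"
  "modelB q [(False, k)] \<tau> \<gamma> = mat_diag k (\<lambda>i. \<tau> 0 * q ^ i)"
  by (auto intro!: eq_matI simp: modelA_def modelB_def mat_diag_def)

lemma diag_mult_entry:
  fixes M :: "'a::comm_ring_1 mat"
  assumes "M \<in> Mat k" "i < k" "j < k"
  shows "(mat_diag k f * M) $$ (i, j) = f i * M $$ (i, j)" "(M * mat_diag k f) $$ (i, j) = M $$ (i, j) * f j"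
  using mat_diag_mult_left[OF assms(1)] mat_diag_mult_right[OF assms(1)] assms by (simp_all add: mat_diag_def)

lemma single_model_qpairs:
  fixes q :: "'a::field"
  assumes q: "q \<noteq> 0"
  shows "(modelA q [(d, k)] \<tau>, modelB q [(d, k)] \<tau> \<gamma>) \<in> qpairs q k"
proof -
  let ?A = "modelA q [(d, k)] \<tau>" and ?B = "modelB q [(d, k)] \<tau> \<gamma>"
  have c: "?A \<in> Mat k" "?B \<in> Mat k" using model_carrier[of q "[(d, k)]"] by auto
  have "?A * ?B = q \<cdot>\<^sub>m (?B * ?A)"
  proof (rule eq_matI)
    fix i j assume "i < dim_row (q \<cdot>\<^sub>m (?B * ?A))" "j < dim_col (q \<cdot>\<^sub>m (?B * ?A))"
    then have ij: "i < k" "j < k" using c by auto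
    have sm: "(q \<cdot>\<^sub>m (?B * ?A)) $$ (i, j) = q * (?B * ?A) $$ (i, j)" using c ij by simp
    show "(?A * ?B) $$ (i, j) = (q \<cdot>\<^sub>m (?B * ?A)) $$ (i, j)"
    proof (cases d)
      case True
      have "inverse q ^ i * ?B $$ (i, j) = q * (inverse q ^ j * ?B $$ (i, j))"
      proof (cases "Suc i = j")
        case True
        then show ?thesis using q by (auto simp: field_simps)
      next
        case F: False
        show ?thesis
        proof (cases "?B $$ (i, j) = 0")
          case False
          then have j: "j = 0" "Suc i = k" "enat k = qorder q" using True F ij by (auto simp: modelB_entry split: if_splits)
          have "q * q ^ i = 1" using qorder_finite(2)[OF j(3)[symmetric]] unfolding j(2)[symmetric] by simp
          then show ?thesis using q j(1) by (simp add: field_simps power_inverse)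
        qed simp
      qed
      moreover have "?A = mat_diag k (\<lambda>i. \<tau> 0 * inverse q ^ i)" using True by (simp add: model_single)
      ultimately show ?thesis unfolding sm using diag_mult_entry[OF c(2) ij] by (simp add: algebra_simps)
    next
      case False
      have "q ^ j * ?A $$ (i, j) = q * (q ^ i * ?A $$ (i, j))"
      proof (cases "Suc i = j")
        case True
        then show ?thesis by auto
      next
        case F: False
        then have "?A $$ (i, j) = 0" using False ij by (auto simp: modelA_entry)
        then show ?thesis by simp
      qed
      moreover have "?B = mat_diag k (\<lambda>i. \<tau> 0 * q ^ i)" using False by (simp add: model_single)
      ultimately show ?thesis unfolding sm using diag_mult_entry[OF c(1) ij] by (simp add: algebra_simps)
    qed
  qed (use c in auto)
  then show ?thesis using c unfolding qpairs_def by simp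
qed

lemma single_model_mem_component:
  fixes q :: "'a::{alg_closed_field, field_char_0}"
  assumes q: "q \<noteq> 0" and N: "\<not> d \<Longrightarrow> enat k < qorder q" and t: "\<tau> 0 \<noteq> 0"
  shows "(modelA q [(d, k)] \<tau>, modelB q [(d, k)] \<tau> \<gamma>) \<in> component q (d, k)"
proof (cases d)
  case True
  show ?thesis
    using single_model_qpairs[OF q, of True k \<tau> \<gamma>] diag_mem_D_comp[OF t] by (simp add: True model_single)
next
  case False
  then have "d = False" by simp
  then show ?thesis
    using single_model_qpairs[OF q, of False k \<tau> \<gamma>] diag_mem_N_comp[OF q N t, of "modelA q [(d, k)] \<tau>"] by (simp add: model_single)
qed

definition model_orbits :: "'a::field \<Rightarrow> (bool \<times> nat) list \<Rightarrow> ('a mat \<times> 'a mat) set" where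
  "model_orbits q ts = {p. \<exists>\<tau> \<gamma>. (\<forall>i<total ts. block_start ts i = i \<longrightarrow> \<tau> i \<noteq> 0) \<and>
     gl_conj p (modelA q ts \<tau>, modelB q ts \<tau> \<gamma>)}"

lemma model_orbits_mem_conj_sum:
  fixes q :: "'a::{alg_closed_field, field_char_0}"
  assumes q: "q \<noteq> 0" and ts: "\<forall>(d, k)\<in>set ts. 1 \<le> k \<and> (\<not> d \<longrightarrow> enat k < qorder q)"
  shows "model_orbits q ts \<subseteq> conj_sum (map (component q) ts)"
proof -
  have "\<exists>xs. list_all2 (\<in>) xs (map (component q) ts) \<and> (modelA q ts \<tau>, modelB q ts \<tau> \<gamma>) = psum_list xs"
    if "\<forall>i<total ts. block_start ts i = i \<longrightarrow> \<tau> i \<noteq> 0" for \<tau> \<gamma>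
    using ts that
  proof (induction ts arbitrary: \<tau> \<gamma>)
    case Nil
    have "(modelA q [] \<tau>, modelB q [] \<tau> \<gamma>) = psum_list []"
      by (auto intro!: eq_matI simp: psum_list_def modelA_def modelB_def)
    then show ?case by (intro exI[of _ "[]"]) simp
  next
    case (Cons t ts)
    obtain d k where t: "t = (d, k)" by (cases t)
    have k: "1 \<le> k" "\<not> d \<longrightarrow> enat k < qorder q" using Cons.prems(1) t by auto
    let ?s = "\<lambda>i. \<tau> (k + i)" and ?g = "\<lambda>i. \<gamma> (k + i)"
    have "\<forall>i<total ts. block_start ts i = i \<longrightarrow> ?s i \<noteq> 0"
      using Cons.prems(2) unfolding t by (auto dest: spec[of _ "k + _"])
    then obtain xs where xs: "list_all2 (\<in>) xs (map (component q) ts)"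
      "(modelA q ts ?s, modelB q ts ?s ?g) = psum_list xs" using Cons.IH[of ?s ?g] Cons.prems(1) by auto
    have "\<tau> 0 \<noteq> 0" using Cons.prems(2) k unfolding t by auto
    then have "(modelA q [t] \<tau>, modelB q [t] \<tau> \<gamma>) \<in> component q t"
      using single_model_mem_component[OF q, of d k] k unfolding t by blast
    then have "list_all2 (\<in>) ((modelA q [t] \<tau>, modelB q [t] \<tau> \<gamma>) # xs) (map (component q) (t # ts))"
      using xs(1) by simp
    moreover have "(modelA q (t # ts) \<tau>, modelB q (t # ts) \<tau> \<gamma>) = psum_list ((modelA q [t] \<tau>, modelB q [t] \<tau> \<gamma>) # xs)"
      using model_Cons[of q t ts \<tau> \<gamma>] xs(2) unfolding psum_list_Cons t by simp
    ultimately show ?case by blast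
  qed
  then show ?thesis unfolding model_orbits_def conj_sum_def by (auto; metis)
qed

text \<open>The entry \<open>(i, j)\<close> can only be nonzero if \<open>q\<^sup>j = q\<^sup>i\<^sup>+\<^sup>1\<close>, that is for \<open>j = i + 1\<close>, and in the corner if the size is the order of \<open>q\<close>.\<close>

lemma diag_pair_is_model:
  fixes q :: "'a::field"
  assumes q: "q \<noteq> 0" and k: "enat k \<le> qorder q" and a: "a \<noteq> 0"
    and X: "(mat_diag k (\<lambda>i. a * inverse q ^ i), X) \<in> qpairs q k"
  shows "(mat_diag k (\<lambda>i. a * inverse q ^ i), X) \<in> model_orbits q [(True, k)]"
proof -
  let ?D = "mat_diag k (\<lambda>i. a * inverse q ^ i)"
  define \<tau> where "\<tau> j = (if j = 0 then a else X $$ (j - 1, j))" for j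
  define \<gamma> where "\<gamma> j = X $$ (k - 1, 0)" for j :: nat
  have c: "X \<in> Mat k" and e: "?D * X = q \<cdot>\<^sub>m (X * ?D)" using X unfolding qpairs_def by auto
  have z: "j = Suc i \<or> j = 0 \<and> Suc i = k \<and> enat k = qorder q" if ij: "i < k" "j < k" and nz: "X $$ (i, j) \<noteq> 0" for i j
  proof -
    have "a * inverse q ^ i * X $$ (i, j) = q * (X $$ (i, j) * (a * inverse q ^ j))"
      using arg_cong[OF e, of "\<lambda>M. M $$ (i, j)"] ij c unfolding mat_diag_mult_left[OF c] mat_diag_mult_right[OF c] by simp
    then have "inverse q ^ i = q * inverse q ^ j" using nz a by simp
    then have eq: "q ^ j = q ^ Suc i" using q by (simp add: field_simps power_inverse)
    show ?thesis
    proof (cases "Suc i < k")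
      case True
      then show ?thesis using qorder_distinct_powers[OF k q ij(2) True eq] by simp
    next
      case False
      then have ik: "Suc i = k" using ij by simp
      show ?thesis
      proof (cases "enat k = qorder q")
        case True
        then have "q ^ k = q ^ 0" using qorder_finite(2)[of q k] by simp
        then have "j = 0" using qorder_distinct_powers[OF k q ij(2), of 0] ij eq ik by simp
        then show ?thesis using ik True by simp
      next
        case False
        then have "enat (Suc k) \<le> qorder q" using k by (metis Suc_ile_eq order_le_imp_less_or_eq)
        then show ?thesis using qorder_distinct_powers[of "Suc k" q j "Suc i"] q ij ik eq by simp
      qed
    qed
  qed
  have "X = modelB q [(True, k)] \<tau> \<gamma>"
  proof (rule mat_eqI[OF c])
    show "modelB q [(True, k)] \<tau> \<gamma> \<in> Mat k" using model_carrier(2)[of q "[(True, k)]"] by simp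
    show "X $$ (i, j) = modelB q [(True, k)] \<tau> \<gamma> $$ (i, j)" if "i < k" "j < k" for i j
      using z[OF that] that by (cases "X $$ (i, j) = 0") (auto simp: modelB_entry \<tau>_def \<gamma>_def)
  qed
  moreover have "?D = modelA q [(True, k)] \<tau>" unfolding model_single \<tau>_def by simp
  moreover have "(?D, X) \<in> pairs k" using c by simp
  ultimately have "gl_conj (?D, X) (modelA q [(True, k)] \<tau>, modelB q [(True, k)] \<tau> \<gamma>)"
    using gl_conj_refl[of "(?D, X)" k] by simp
  moreover have "\<forall>i<k. i = 0 \<longrightarrow> \<tau> i \<noteq> 0" using a by (simp add: \<tau>_def)
  ultimately show ?thesis unfolding model_orbits_def
    by (intro CollectI exI[of _ \<tau>] exI[of _ \<gamma>]) auto
qed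

lemma snd_diag_pair_is_model:
  fixes q :: "'a::field"
  assumes q: "q \<noteq> 0" and k: "enat k < qorder q" and a: "a \<noteq> 0"
    and X: "(X, mat_diag k (\<lambda>i. a * q ^ i)) \<in> qpairs q k"
  shows "(X, mat_diag k (\<lambda>i. a * q ^ i)) \<in> model_orbits q [(False, k)]"
proof -
  let ?D = "mat_diag k (\<lambda>i. a * q ^ i)"
  define \<tau> where "\<tau> j = (if j = 0 then a else X $$ (j - 1, j))" for j
  have c: "X \<in> Mat k" using X unfolding qpairs_def by auto
  have "X = modelA q [(False, k)] \<tau>"
  proof (rule mat_eqI[OF c])
    show "modelA q [(False, k)] \<tau> \<in> Mat k" using model_carrier(1)[of q "[(False, k)]"] by simp
    show "X $$ (i, j) = modelA q [(False, k)] \<tau> $$ (i, j)" if "i < k" "j < k" for i j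
      using diag_q_commute_entries[OF q k a X that] that by (auto simp: modelA_entry \<tau>_def)
  qed
  moreover have "?D = modelB q [(False, k)] \<tau> (\<lambda>_. 0)" unfolding model_single \<tau>_def by simp
  moreover have "(X, ?D) \<in> pairs k" using c by simp
  ultimately have "gl_conj (X, ?D) (modelA q [(False, k)] \<tau>, modelB q [(False, k)] \<tau> (\<lambda>_. 0))"
    using gl_conj_refl[of "(X, ?D)" k] by simp
  moreover have "\<forall>i<k. i = 0 \<longrightarrow> \<tau> i \<noteq> 0" using a by (simp add: \<tau>_def)
  ultimately show ?thesis unfolding model_orbits_def
    by (intro CollectI exI[of _ \<tau>] exI[of _ "\<lambda>_. 0"]) auto
qed

lemma model_orbits_conj_inv: "conj_inv (model_orbits q ts)"
  unfolding conj_inv_def model_orbits_def using gl_conj_trans by blast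

lemma model_orbits_pairs: "model_orbits q ts \<subseteq> pairs (total ts)"
proof
  fix p assume "p \<in> model_orbits q ts"
  then obtain \<tau> \<gamma> where "gl_conj (modelA q ts \<tau>, modelB q ts \<tau> \<gamma>) p" unfolding model_orbits_def using gl_conj_sym by blast
  then show "p \<in> pairs (total ts)" by (rule gl_conj_pairs) (use model_carrier[of q ts] in simp)
qed

text \<open>The second matrix is upper triangular with diagonal \<open>x, x q, \<dots>\<close>, where \<open>x \<noteq> 0\<close> up to perturbation; diagonalising it
  turns the Jordan block into a weighted shift.\<close>

lemma jordan_pair_degeneration:
  fixes q :: "'a::field_char_0"
  assumes q: "q \<noteq> 0" and k: "enat k < qorder q" "0 < k" and X: "(jordan_block k 0, X) \<in> qpairs q k"
  shows "(jordan_block k 0, X) \<in> zcl k (model_orbits q [(False, k)])"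
proof -
  let ?J = "jordan_block k 0 :: 'a mat" and ?F = "prod.swap ` zcl k (model_orbits q [(False, k)])"
  note swp = qpairs_swap[OF q, of _ _ k]
  have q': "inverse q \<noteq> 0" using q by simp
  let ?D = "mat_diag k (\<lambda>i. 1 * inverse (inverse q) ^ i)"
  have XJ: "(X, ?J) \<in> qpairs (inverse q) k" using X swp by blast
  have D: "(?D, ?J) \<in> qpairs (inverse q) k"
    using mat_diag_jordan_block[OF q', of k 1] unfolding qpairs_def by simp
  have mem: "(X, Y) \<in> ?F \<longleftrightarrow> (Y, X) \<in> zcl k (model_orbits q [(False, k)])" for X Y by force
  have pairs: "model_orbits q [(False, k)] \<subseteq> pairs k" using model_orbits_pairs[of q "[(False, k)]"] by simp
  have "(X, ?J) \<in> ?F"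
  proof (rule perturb_generic[OF _ XJ D, of _ "\<lambda>X. X $$ (0, 0)"])
    show "(A v, B v) \<in> ?F" if "A \<in> upoly.mats k k" "B \<in> upoly.mats k k" "infinite {u. (A u, B u) \<in> ?F}" for A B v
      using zcl_curve[OF that(2,1)] that(3) unfolding mem by blast
    show "(\<lambda>u. X u $$ (0, 0)) \<in> upoly_funs" if "X \<in> upoly.mats k k" for X
      using upoly.mats_entry[OF that k(2,2)] .
    show "?D $$ (0, 0) \<noteq> 0" using k by (simp add: mat_diag_def)
    fix Y assume Y: "(Y, ?J) \<in> qpairs (inverse q) k" and nz: "Y $$ (0, 0) \<noteq> 0"
    then have Yc: "Y \<in> Mat k" unfolding qpairs_def by simp
    let ?c = "\<lambda>i. Y $$ (0, 0) * q ^ i"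
    have ut: "upper_triangular Y" using jordan_q_commutant(1)[OF q' Y] Yc by (auto simp: upper_triangular_def)
    have "eigenvalue Y (?c i)" if "i < k" for i
      using eigenvalue_upper_triangular[OF Yc ut] jordan_q_commutant(2)[OF q' Y, of i 0] that by (auto simp: mult.commute)
    moreover have "inj_on ?c {..<k}"
    proof (rule inj_onI)
      fix i j assume "i \<in> {..<k}" "j \<in> {..<k}" "?c i = ?c j"
      then have "q ^ i = q ^ j" using nz by simp
      then show "i = j" using qorder_distinct_powers[OF less_imp_le[OF k(1)] q] \<open>i \<in> {..<k}\<close> \<open>j \<in> {..<k}\<close> by simp
    qed
    ultimately obtain P Q where PQ: "P \<in> Mat k" "Q \<in> Mat k" "P * Q = 1\<^sub>m k"
      "Y * P = P * mat_diag k ?c" using diagonalizable_distinct[OF Yc] by metis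
    have "gl_conj (Y, ?J) (mat_diag k ?c, Q * ?J * P)"
      by (rule gl_conj_of_inverse[OF Yc _ mat_diag_dim PQ]) simp
    then have con: "gl_conj (?J, Y) (Q * ?J * P, mat_diag k ?c)"
      using gl_conj_swap[of "(?J, Y)" "(Q * ?J * P, mat_diag k ?c)"] by simp
    have "(?J, Y) \<in> qpairs q k" using Y swp by blast
    from snd_diag_pair_is_model[OF q k(1) nz gl_conj_qpairs[OF con this]]
    have "(?J, Y) \<in> model_orbits q [(False, k)]" by (rule conj_invD[OF model_orbits_conj_inv con])
    then have "(?J, Y) \<in> zcl k (model_orbits q [(False, k)])" using zcl_superset[OF pairs] by blast
    then show "(Y, ?J) \<in> ?F" unfolding mem .
  qed
  then show ?thesis unfolding mem .
qed

lemma component_subset_model_closure: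
  fixes q :: "'a::field_char_0"
  assumes q: "q \<noteq> 0" and k: "1 \<le> k" "enat k \<le> qorder q" "\<not> d \<Longrightarrow> enat k < qorder q"
  shows "component q (d, k) \<subseteq> zcl k (model_orbits q [(d, k)])"
proof -
  have pairs: "model_orbits q [(d, k)] \<subseteq> pairs k" using model_orbits_pairs[of q "[(d, k)]"] by simp
  note sup = zcl_superset[OF pairs]
  note ci = zcl_conj_inv[OF model_orbits_conj_inv pairs]
  have "comp_gen q (d, k) \<subseteq> zcl k (model_orbits q [(d, k)])"
  proof
    fix p assume "p \<in> comp_gen q (d, k)"
    then obtain p' where con: "gl_conj p p'" and p': "p' \<in> (if d then {(A, B) \<in> qpairs q k. \<exists>a. a \<noteq> 0 \<and> A = mat_diag k (\<lambda>k. a * inverse q ^ k)}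
     else {(A, B) \<in> qpairs q k. A = jordan_block k 0})"
      unfolding comp_gen_def gl_orbits_def fst_conv snd_conv by blast
    have "p' \<in> zcl k (model_orbits q [(d, k)])"
    proof (cases d)
      case True
      then obtain a X where "p' = (mat_diag k (\<lambda>k. a * inverse q ^ k), X)" "a \<noteq> 0" "p' \<in> qpairs q k"
        using p' by auto
      then show ?thesis using diag_pair_is_model[OF q k(2)] sup True by auto
    next
      case False
      then obtain X where "p' = (jordan_block k 0, X)" "p' \<in> qpairs q k" using p' by auto
      then show ?thesis using jordan_pair_degeneration[OF q k(3)[OF False]] k(1) False by auto
    qed
    then show "p \<in> zcl k (model_orbits q [(d, k)])" by (rule conj_invD[OF ci con])
  qed
  then show ?thesis unfolding comp_eq_zcl snd_conv by (rule zcl_least)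
qed

text \<open>So \<open>K_types q ts\<close> is the closure of the orbits of the models: a sum of limits of models is a limit of
  models.\<close>

lemma K_types_eq_model_closure:
  fixes q :: "'a::{alg_closed_field, field_char_0}"
  assumes q: "q \<noteq> 0" and ts: "ts \<in> block_types q n"
  shows "K_types q ts = zcl n (model_orbits q ts)"
proof
  have n: "n = total ts" using ts unfolding block_types_def by auto
  have ts': "\<forall>(d, k)\<in>set ts. 1 \<le> k \<and> enat k \<le> qorder q \<and> (\<not> d \<longrightarrow> enat k < qorder q)"
    using ts unfolding block_types_def by auto
  show "zcl n (model_orbits q ts) \<subseteq> K_types q ts"
    unfolding K_types_def n using ts' by (intro zcl_mono model_orbits_mem_conj_sum[OF q]) auto
  have sum: "psum_list xs \<in> zcl (total ts) (model_orbits q ts)"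
    if "list_all2 (\<in>) xs (map (component q) ts)" for xs
    using that ts'
  proof (induction ts arbitrary: xs)
    case Nil
    then have xs: "xs = []" by simp
    have "psum_list [] = (modelA q [] (\<lambda>_. 1), modelB q [] (\<lambda>_. 1) (\<lambda>_. 0))"
      by (auto intro!: eq_matI simp: psum_list_def modelA_def modelB_def)
    moreover have "(modelA q [] (\<lambda>_. 1), modelB q [] (\<lambda>_. 1) (\<lambda>_. 0)) \<in> model_orbits q []"
      unfolding model_orbits_def using gl_conj_refl[of "(modelA q [] (\<lambda>_. 1), modelB q [] (\<lambda>_. 1) (\<lambda>_. 0))" 0] model_carrier[of q "[]"]
      by auto
    ultimately show ?case using zcl_superset[OF model_orbits_pairs[of q "[]"]] unfolding xs by auto
  next
    case (Cons t ts)
    obtain d k where t: "t = (d, k)" by (cases t)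
    obtain x ys where xs: "xs = x # ys" "x \<in> component q t" "list_all2 (\<in>) ys (map (component q) ts)"
      using Cons.prems(1) by (auto simp: list_all2_Cons2)
    have y: "psum_list ys \<in> zcl (total ts) (model_orbits q ts)"
      using Cons.IH[OF xs(3)] Cons.prems(2) by simp
    have x: "x \<in> zcl k (model_orbits q [t])"
      using component_subset_model_closure[OF q, of k d] Cons.prems(2) xs(2) unfolding t by auto
    have P: "model_orbits q [t] \<subseteq> pairs k" using model_orbits_pairs[of q "[t]"] unfolding t by simp
    have "psum x (psum_list ys) \<in> zcl (k + total ts) (model_orbits q (t # ts))"
    proof (rule zcl_psum[OF x y P model_orbits_pairs])
      fix s r assume s: "s \<in> model_orbits q [t]" and r: "r \<in> model_orbits q ts"
      obtain \<tau> \<gamma> where s': "k > 0 \<longrightarrow> \<tau> 0 \<noteq> 0" "gl_conj s (modelA q [t] \<tau>, modelB q [t] \<tau> \<gamma>)"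
        using s unfolding model_orbits_def t by auto
      obtain \<tau>' \<gamma>' where r': "\<forall>i<total ts. block_start ts i = i \<longrightarrow> \<tau>' i \<noteq> 0"
        "gl_conj r (modelA q ts \<tau>', modelB q ts \<tau>' \<gamma>')" using r unfolding model_orbits_def by auto
      define \<tau>2 where "\<tau>2 i = (if i < k then \<tau> i else \<tau>' (i - k))" for i
      define \<gamma>2 where "\<gamma>2 i = (if i < k then \<gamma> i else \<gamma>' (i - k))" for i
      have k0: "k > 0" using Cons.prems(2) t by auto
      have e: "modelA q [t] \<tau>2 = modelA q [t] \<tau>" "modelB q [t] \<tau>2 \<gamma>2 = modelB q [t] \<tau> \<gamma>"
        using k0 unfolding t \<tau>2_def \<gamma>2_def modelA_def modelB_def by (auto intro!: cong_mat simp: Let_def)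
      have sh: "(\<lambda>i. \<tau>2 (k + i)) = \<tau>'" "(\<lambda>i. \<gamma>2 (k + i)) = \<gamma>'" unfolding \<tau>2_def \<gamma>2_def by auto
      have mc: "(modelA q (t # ts) \<tau>2, modelB q (t # ts) \<tau>2 \<gamma>2)
          = psum (modelA q [t] \<tau>, modelB q [t] \<tau> \<gamma>) (modelA q ts \<tau>', modelB q ts \<tau>' \<gamma>')"
        using model_Cons[of q t ts \<tau>2 \<gamma>2] unfolding e by (simp add: sh t)
      have "gl_conj (psum s r) (modelA q (t # ts) \<tau>2, modelB q (t # ts) \<tau>2 \<gamma>2)"
        unfolding mc by (rule gl_conj_psum[OF s'(2) r'(2)]) (use s r P model_orbits_pairs in blast)+
      moreover have "\<tau>2 i \<noteq> 0" if "i < total (t # ts)" "block_start (t # ts) i = i" for i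
        using that s'(1) r'(1) k0 by (auto simp: \<tau>2_def t split: if_splits dest!: spec[of _ "i - k"])
      ultimately have "psum s r \<in> model_orbits q (t # ts)" unfolding model_orbits_def by blast
      moreover have "model_orbits q (t # ts) \<subseteq> pairs (k + total ts)"
        using model_orbits_pairs[of q "t # ts"] unfolding t by simp
      ultimately show "psum s r \<in> zcl (k + total ts) (model_orbits q (t # ts))"
        using zcl_superset by blast
    qed
    then show ?case unfolding xs(1) psum_list_Cons t by simp
  qed
  show "K_types q ts \<subseteq> zcl n (model_orbits q ts)"
    unfolding K_types_def n
  proof (rule zcl_least, rule subsetI)
    fix p assume "p \<in> conj_sum (map (component q) ts)"
    then obtain xs where xs: "list_all2 (\<in>) xs (map (component q) ts)" "gl_conj p (psum_list xs)"
      unfolding conj_sum_def by blast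
    show "p \<in> zcl (total ts) (model_orbits q ts)"
      by (rule conj_invD[OF zcl_conj_inv[OF model_orbits_conj_inv model_orbits_pairs] xs(2) sum[OF xs(1)]])
  qed
qed

section \<open>A rational parametrisation of each closure\<close>

text \<open>\<open>G M G\<^sup>-\<^sup>1\<close>, written so that its denominator is visible.\<close>

definition conj_by :: "'a::field mat \<Rightarrow> 'a mat \<Rightarrow> 'a mat" where
  "conj_by G M = inverse (det G) \<cdot>\<^sub>m (G * M * adj_mat G)"

lemma conj_by_props:
  fixes G :: "'a::field mat"
  assumes G: "G \<in> Mat n" "det G \<noteq> 0" and M: "M \<in> Mat n"
  shows "conj_by G M \<in> Mat n" and "conj_by G M * G = G * M"
    and "\<And>X. X \<in> Mat n \<Longrightarrow> X * G = G * M \<Longrightarrow> X = conj_by G M"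
    and "\<And>i j. i < n \<Longrightarrow> j < n \<Longrightarrow> det G * conj_by G M $$ (i, j) = (G * M * adj_mat G) $$ (i, j)"
proof -
  note a = adj_mat[OF G(1)]
  have GM: "G * M \<in> Mat n" using G M by simp
  show c: "conj_by G M \<in> Mat n" unfolding conj_by_def using GM a by simp
  show "conj_by G M * G = G * M"
  proof -
    have "conj_by G M * G = inverse (det G) \<cdot>\<^sub>m (G * M * adj_mat G * G)"
      unfolding conj_by_def by (rule mult_smult_assoc_mat[OF mult_carrier_mat[OF GM a(1)] G(1)])
    also have "G * M * adj_mat G * G = G * M * (adj_mat G * G)" by (rule assoc_mult_mat[OF GM a(1) G(1)])
    also have "\<dots> = det G \<cdot>\<^sub>m (G * M)" unfolding a(3) mult_smult_distrib[OF GM one_carrier_mat] right_mult_one_mat[OF GM] ..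
    finally show ?thesis using G(2) by (simp add: smat_smat smat_one)
  qed
  show "X = conj_by G M" if X: "X \<in> Mat n" "X * G = G * M" for X
  proof -
    have "G * M * adj_mat G = X * (G * adj_mat G)" unfolding X(2)[symmetric] by (rule assoc_mult_mat[OF X(1) G(1) a(1)])
    also have "\<dots> = det G \<cdot>\<^sub>m X" unfolding a(2) mult_smult_distrib[OF X(1) one_carrier_mat] right_mult_one_mat[OF X(1)] ..
    finally show ?thesis unfolding conj_by_def using G(2) by (simp add: smat_smat smat_one)
  qed
  show "det G * conj_by G M $$ (i, j) = (G * M * adj_mat G) $$ (i, j)" if "i < n" "j < n" for i j
    using that G a(1) unfolding conj_by_def by simp
qed

lemma gl_conj_conj_by:
  fixes G :: "'a::field mat"
  assumes G: "G \<in> Mat n" "det G \<noteq> 0" and M: "A \<in> Mat n" "B \<in> Mat n"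
  shows "gl_conj (conj_by G A, conj_by G B) (A, B)"
proof (rule gl_conjI[OF conj_by_props(1)[OF G M(1)] conj_by_props(1)[OF G M(2)] M G(1) _ _ conj_by_props(2)[OF G M(1)] conj_by_props(2)[OF G M(2)]])
  note a = adj_mat[OF G(1)]
  show "inverse (det G) \<cdot>\<^sub>m adj_mat G \<in> Mat n" using a by simp
  show "G * (inverse (det G) \<cdot>\<^sub>m adj_mat G) = 1\<^sub>m n"
    unfolding mult_smult_distrib[OF G(1) a(1)] a(2) using G(2) by (simp add: smat_smat smat_one)
qed

definition unit_mat :: "nat \<Rightarrow> (nat \<times> nat \<Rightarrow> 'a::field) \<Rightarrow> 'a mat" where
  "unit_mat n T = mat n n (\<lambda>(i, j). if i = j then 1 else T (i, j))"

text \<open>The first indices of the summands \<open>D\<close> whose size is the order of \<open>q\<close>, one for each corner entry.\<close>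

definition full_starts :: "'a::field \<Rightarrow> (bool \<times> nat) list \<Rightarrow> nat set" where
  "full_starts q ts = {f. f < total ts \<and> block_diag ts f \<and> block_start ts f = f \<and>
     enat (block_size ts f) = qorder q}"

text \<open>The diagonal position \<open>(i, i)\<close> holds the eigenvalue or the weight with index \<open>i\<close>, and an extra row the
  corner entries; the other positions are the entries of \<open>unit_mat\<close>.\<close>

definition par_index :: "'a::field \<Rightarrow> (bool \<times> nat) list \<Rightarrow> (nat \<times> nat) set" where
  "par_index q ts = {..<total ts} \<times> {..<total ts} \<union> Pair (total ts) ` full_starts q ts"

definition par_denom :: "(bool \<times> nat) list \<Rightarrow> (nat \<times> nat \<Rightarrow> 'a::field) \<Rightarrow> 'a" where
  "par_denom ts T = det (unit_mat (total ts) T) *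
     (\<Prod>f | f < total ts \<and> block_start ts f = f. T (f, f))"

definition par_A :: "'a::field \<Rightarrow> (bool \<times> nat) list \<Rightarrow> (nat \<times> nat \<Rightarrow> 'a) \<Rightarrow> 'a mat" where
  "par_A q ts T = modelA q ts (\<lambda>i. T (i, i))"

definition par_B :: "'a::field \<Rightarrow> (bool \<times> nat) list \<Rightarrow> (nat \<times> nat \<Rightarrow> 'a) \<Rightarrow> 'a mat" where
  "par_B q ts T = modelB q ts (\<lambda>i. T (i, i)) (\<lambda>f. T (total ts, f))"

definition par_pair :: "'a::field \<Rightarrow> (bool \<times> nat) list \<Rightarrow> (nat \<times> nat \<Rightarrow> 'a) \<Rightarrow> 'a mat \<times> 'a mat" where
  "par_pair q ts T = (conj_by (unit_mat (total ts) T) (par_A q ts T),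
     conj_by (unit_mat (total ts) T) (par_B q ts T))"

lemma card_full_starts: "finite (full_starts q ts)"
  "card (full_starts q ts) = length (filter (\<lambda>(d, k). d \<and> enat k = qorder q \<and> 0 < k) ts)"
proof -
  show "finite (full_starts q ts)" unfolding full_starts_def by simp
  show "card (full_starts q ts) = length (filter (\<lambda>(d, k). d \<and> enat k = qorder q \<and> 0 < k) ts)"
  proof (induction ts)
    case Nil
    then show ?case by (simp add: full_starts_def)
  next
    case (Cons t ts)
    obtain d k where t: "t = (d, k)" by (cases t)
    let ?E = "if d \<and> enat k = qorder q \<and> 0 < k then {0} else {}"
    have "full_starts q (t # ts) = ?E \<union> (\<lambda>f. k + f) ` full_starts q ts"
    proof (intro Set.set_eqI iffI)
      fix f assume f: "f \<in> full_starts q (t # ts)"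
      show "f \<in> ?E \<union> (\<lambda>f. k + f) ` full_starts q ts"
      proof (cases "f < k")
        case True
        then show ?thesis using f unfolding full_starts_def t by auto
      next
        case False
        then have "f = k + (f - k)" "f - k \<in> full_starts q ts" using f unfolding full_starts_def t by auto
        then show ?thesis by blast
      qed
    qed (auto simp: full_starts_def t split: if_splits)
    moreover have "?E \<inter> (\<lambda>f. k + f) ` full_starts q ts = {}" by auto
    moreover have "finite (full_starts q ts)" unfolding full_starts_def by simp
    ultimately have "card (full_starts q (t # ts)) = card ?E + card (full_starts q ts)"
      by (simp add: card_Un_disjoint card_image)
    then show ?case using Cons.IH unfolding t by auto
  qed
qed

lemma card_par_index: "finite (par_index q ts)"
  "card (par_index q ts) = (total ts)\<^sup>2 + card (full_starts q ts)"
proof -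
  let ?n = "total ts"
  have f: "finite (full_starts q ts)" by (rule card_full_starts)
  show "finite (par_index q ts)" unfolding par_index_def using f by auto
  have "({..<?n} \<times> {..<?n}) \<inter> Pair ?n ` full_starts q ts = {}" by auto
  then show "card (par_index q ts) = ?n\<^sup>2 + card (full_starts q ts)"
    unfolding par_index_def using f by (simp add: card_Un_disjoint card_image inj_on_def power2_eq_square)
qed

lemma unit_mat_carrier: "unit_mat n T \<in> Mat n"
  unfolding unit_mat_def by simp

lemma par_carrier: "par_A q ts T \<in> carrier_mat (total ts) (total ts)"
  "par_B q ts T \<in> carrier_mat (total ts) (total ts)"
  unfolding par_A_def par_B_def by (rule model_carrier)+

locale block_family =
  fixes q :: "'a::{alg_closed_field, field_char_0}" and ts :: "(bool \<times> nat) list" and n :: nat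
  assumes q0: "q \<noteq> 0" and ts: "ts \<in> block_types q n"
begin

abbreviation "D \<equiv> block_diag ts"
abbreviation "K \<equiv> block_size ts"
abbreviation "S \<equiv> block_start ts"

lemma nsum: "total ts = n"
  using ts unfolding block_types_def by blast

lemma bounds: "i < n \<Longrightarrow> S i \<le> i" "i < n \<Longrightarrow> i < S i + K i" "i < n \<Longrightarrow> S i + K i \<le> n"
    "i < n \<Longrightarrow> enat (K i) \<le> qorder q" "i < n \<Longrightarrow> \<not> D i \<Longrightarrow> enat (K i) < qorder q"
proof -
  assume "i < n"
  then have b: "S i \<le> i \<and> i < S i + K i \<and> S i + K i \<le> n \<and> (D i, K i) \<in> set ts"
    using block_bounds[of i ts] unfolding nsum by blast
  then show "S i \<le> i" "i < S i + K i" "S i + K i \<le> n" by auto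
  have "\<forall>(d, k)\<in>set ts. enat k \<le> qorder q \<and> (\<not> d \<longrightarrow> enat k < qorder q)" using ts unfolding block_types_def by auto
  then have "enat (K i) \<le> qorder q \<and> (\<not> D i \<longrightarrow> enat (K i) < qorder q)" using b by blast
  then show "enat (K i) \<le> qorder q" "\<not> D i \<Longrightarrow> enat (K i) < qorder q" by auto
qed

lemma same_block: "i < n \<Longrightarrow> S i \<le> j \<Longrightarrow> j < S i + K i \<Longrightarrow> S j = S i \<and> K j = K i \<and> D j = D i"
  using block_const[of i ts j] unfolding nsum .

lemma pred_block:
  assumes "Suc i < n" "S (Suc i) \<noteq> Suc i"
  shows "S i = S (Suc i)" "K i = K (Suc i)" "D i = D (Suc i)"
  using same_block[of "Suc i" i] bounds[of "Suc i"] assms by auto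

lemma start_start: "i < n \<Longrightarrow> S (S i) = S i" "i < n \<Longrightarrow> D (S i) = D i" "i < n \<Longrightarrow> K (S i) = K i"
  using same_block[of i "S i"] bounds[of i] by auto

lemma A_entry: "i < n \<Longrightarrow> j < n \<Longrightarrow> par_A q ts T $$ (i, j) =
    (if D j then if i = j then T (S j, S j) * inverse q ^ (j - S j) else 0
     else if Suc i = j \<and> S j \<noteq> j then T (j, j) else 0)"
  unfolding par_A_def by (subst modelA_entry) (simp_all add: nsum)

lemma B_entry: "i < n \<Longrightarrow> j < n \<Longrightarrow> par_B q ts T $$ (i, j) =
    (if D j then if Suc i = j \<and> S j \<noteq> j then T (j, j)
       else if S j = j \<and> Suc i = j + K j \<and> enat (K j) = qorder q then T (n, j) else 0
     else if i = j then T (S j, S j) * q ^ (j - S j) else 0)"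
  unfolding par_B_def by (subst modelB_entry) (simp_all add: nsum)

lemma carrier: "par_A q ts T \<in> Mat n" "par_B q ts T \<in> Mat n"
  using par_carrier[of q ts T] unfolding nsum by auto

lemma denom: "par_denom ts T = det (unit_mat n T) * (\<Prod>f | f < n \<and> S f = f. T (f, f))"
  unfolding par_denom_def nsum ..

lemma denom_nz: "par_denom ts T \<noteq> 0 \<longleftrightarrow> det (unit_mat n T) \<noteq> 0 \<and> (\<forall>f<n. S f = f \<longrightarrow> T (f, f) \<noteq> 0)"
  unfolding denom by auto

lemma pair: "par_pair q ts T = (conj_by (unit_mat n T) (par_A q ts T), conj_by (unit_mat n T) (par_B q ts T))"
  unfolding par_pair_def nsum ..

lemma index: "par_index q ts = {..<n} \<times> {..<n} \<union> Pair n ` full_starts q ts"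
  unfolding par_index_def nsum ..

lemma param: "param_family n (par_index q ts) (par_denom ts :: _ \<Rightarrow> 'a) (par_pair q ts)"
proof -
  let ?I = "par_index q ts" and ?m = "\<lambda>T. \<Prod>f | f < n \<and> S f = f. T (f, f) :: 'a"
  have fin: "finite ?I" by (rule card_par_index)
  interpret function_ring "par_funs ?I :: ((nat \<times> nat \<Rightarrow> 'a) \<Rightarrow> 'a) set" by (rule par_funs_ring[OF fin])
  have co: "(\<lambda>T :: nat \<times> nat \<Rightarrow> 'a. T (i, j)) \<in> par_funs ?I" if "(i, j) \<in> ?I" for i j
    by (rule par_funs_coord[OF fin that])
  have co': "(\<lambda>T :: nat \<times> nat \<Rightarrow> 'a. T (i, j)) \<in> par_funs ?I" if "i < n" "j < n" for i j
    using that by (intro co) (simp add: index)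
  have G: "unit_mat n \<in> mats n n"
    unfolding unit_mat_def
  proof (rule mats_mat)
    show "(\<lambda>T :: nat \<times> nat \<Rightarrow> 'a. case (i, j) of (i, j) \<Rightarrow> if i = j then 1 else T (i, j)) \<in> par_funs ?I"
      if "i < n" "j < n" for i j
      using co'[OF that] const[of 1] by (cases "i = j") simp_all
  qed
  have A: "par_A q ts \<in> mats n n"
  proof -
    have "(\<lambda>T. mat n n (\<lambda>ij. par_A q ts T $$ ij)) \<in> mats n n"
    proof (rule mats_mat)
      fix i j assume ij: "i < n" "j < n"
      then have "S j < n" using bounds(1)[of j] by simp
      then show "(\<lambda>T. par_A q ts T $$ (i, j)) \<in> par_funs ?I"
        unfolding A_entry[OF ij] using ij by (intro ring_if co' const mult; simp)
    qed
    moreover have "mat n n (\<lambda>ij. par_A q ts T $$ ij) = par_A q ts T" for T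
      using carrier(1)[of T] by (intro eq_matI) auto
    ultimately show ?thesis by simp
  qed
  have B: "par_B q ts \<in> mats n n"
  proof -
    have "(\<lambda>T. mat n n (\<lambda>ij. par_B q ts T $$ ij)) \<in> mats n n"
    proof (rule mats_mat)
      fix i j assume ij: "i < n" "j < n"
      then have "S j < n" using bounds(1)[of j] by simp
      moreover have "(n, j) \<in> ?I" if "D j" "S j = j" "enat (K j) = qorder q"
        using that ij unfolding index full_starts_def nsum by blast
      ultimately show "(\<lambda>T. par_B q ts T $$ (i, j)) \<in> par_funs ?I"
        unfolding B_entry[OF ij] using ij by (intro ring_if const mult; simp add: co co')
    qed
    moreover have "mat n n (\<lambda>ij. par_B q ts T $$ ij) = par_B q ts T" for T
      using carrier(2)[of T] by (intro eq_matI) auto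
    ultimately show ?thesis by simp
  qed
  have m: "?m \<in> par_funs ?I" by (rule prod) (simp add: co')
  have d: "(par_denom ts :: (nat \<times> nat \<Rightarrow> 'a) \<Rightarrow> 'a) \<in> par_funs ?I" unfolding denom by (rule mult[OF mats_det[OF G] m])
  have e: "\<exists>p\<in>par_funs ?I. \<forall>T. par_denom ts T \<noteq> 0 \<longrightarrow> par_denom ts T * conj_by (unit_mat n T) (M T) $$ (i, j) = p T"
    if M: "M \<in> mats n n" and ij: "i < n" "j < n" for M i j
  proof (intro bexI allI impI)
    show "(\<lambda>T. ?m T * (unit_mat n T * M T * adj_mat (unit_mat n T)) $$ (i, j)) \<in> par_funs ?I"
      by (rule mult[OF m mats_entry[OF mats_mult[OF mats_mult[OF G M] mats_adj[OF G]] ij]])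
    fix T :: "nat \<times> nat \<Rightarrow> 'a" assume "par_denom ts T \<noteq> 0"
    then have "det (unit_mat n T) \<noteq> 0" unfolding denom_nz by blast
    from conj_by_props(4)[OF unit_mat_carrier this mats_carrier[OF M] ij]
    show "par_denom ts T * conj_by (unit_mat n T) (M T) $$ (i, j) = ?m T * (unit_mat n T * M T * adj_mat (unit_mat n T)) $$ (i, j)"
      unfolding denom by (simp add: mult.commute mult.left_commute)
  qed
  show ?thesis
  proof
    show "finite ?I" "(par_denom ts :: (nat \<times> nat \<Rightarrow> 'a) \<Rightarrow> 'a) \<in> par_funs ?I" by (fact fin, fact d)
    show "par_pair q ts T \<in> pairs n" if "par_denom ts T \<noteq> 0" for T :: "nat \<times> nat \<Rightarrow> 'a"
      unfolding pair using conj_by_props(1)[OF unit_mat_carrier _ carrier(1)] conj_by_props(1)[OF unit_mat_carrier _ carrier(2)]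
        that unfolding denom_nz by blast
    show "\<exists>c. \<exists>p\<in>par_funs ?I. \<forall>T. par_denom ts T \<noteq> 0 \<longrightarrow> par_denom ts T ^ c * f (par_pair q ts T) = p T"
      if f: "f \<in> poly_funs n" for f :: "'a mat \<times> 'a mat \<Rightarrow> 'a"
      by (rule clear_denominators[OF d _ _ f]) (unfold pair fst_conv snd_conv, (rule e[OF A] e[OF B]; assumption)+)
  qed
qed

text \<open>Factor \<open>R\<close> into a matrix with unit diagonal and a diagonal one; conjugation by the latter rescales weights and corners.\<close>

lemma conj_mem_par:
  assumes R: "R \<in> Mat n" "det R \<noteq> 0" "\<And>i. i < n \<Longrightarrow> R $$ (i, i) \<noteq> 0"
    and \<tau>: "\<And>f. f < n \<Longrightarrow> S f = f \<Longrightarrow> \<tau> f \<noteq> 0"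
  shows "\<exists>T. par_denom ts T \<noteq> 0 \<and> par_pair q ts T = (conj_by R (modelA q ts \<tau>), conj_by R (modelB q ts \<tau> \<gamma>))"
proof -
  let ?r = "\<lambda>i. R $$ (i, i)"
  define T where "T = (\<lambda>(i, j). if i = n then ?r (j + K j - 1) * \<gamma> j / ?r j
    else if i = j then if S i = i then \<tau> i else ?r (i - 1) * \<tau> i / ?r i else R $$ (i, j) / ?r j)"
  let ?G = "unit_mat n T"
  define d where "d = mat_diag n ?r"
  have d: "d \<in> Mat n" unfolding d_def by simp
  have RG: "R = ?G * d"
  proof (rule mat_eqI[OF R(1) mult_carrier_mat[OF unit_mat_carrier d]])
    show "R $$ (i, j) = (?G * d) $$ (i, j)" if "i < n" "j < n" for i j
      unfolding d_def diag_mult_entry(2)[OF unit_mat_carrier that] using that R(3) by (simp add: unit_mat_def T_def)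
  qed
  have "det R = det ?G * det d" unfolding RG by (rule det_mult[OF unit_mat_carrier d])
  then have detG: "det ?G \<noteq> 0" using R(2) by auto
  have nz: "par_denom ts T \<noteq> 0" unfolding denom_nz using detG \<tau> by (auto simp: T_def)
  have mc: "modelA q ts \<tau> \<in> Mat n" "modelB q ts \<tau> \<gamma> \<in> Mat n"
    using model_carrier[of q ts] unfolding nsum by auto
  have wA: "par_A q ts T * d = d * modelA q ts \<tau>"
  proof (rule mat_eqI[OF mult_carrier_mat[OF carrier(1) d] mult_carrier_mat[OF d mc(1)]])
    fix i j assume ij: "i < n" "j < n"
    then have "S j < n" "S (S j) = S j" using bounds(1)[of j] start_start by auto
    then show "(par_A q ts T * d) $$ (i, j) = (d * modelA q ts \<tau>) $$ (i, j)"
      unfolding d_def diag_mult_entry(1)[OF mc(1) ij] diag_mult_entry(2)[OF carrier(1) ij] A_entry[OF ij]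
        modelA_entry[of i ts j, unfolded nsum, OF ij] using R(3) ij by (auto simp: T_def)
  qed
  have wB: "par_B q ts T * d = d * modelB q ts \<tau> \<gamma>"
  proof (rule mat_eqI[OF mult_carrier_mat[OF carrier(2) d] mult_carrier_mat[OF d mc(2)]])
    fix i j assume ij: "i < n" "j < n"
    then have "S j < n" "S (S j) = S j" using bounds(1)[of j] start_start by auto
    moreover have "i = j + K j - Suc 0" if "Suc i = j + K j" using that by simp
    ultimately show "(par_B q ts T * d) $$ (i, j) = (d * modelB q ts \<tau> \<gamma>) $$ (i, j)"
      unfolding d_def diag_mult_entry(1)[OF mc(2) ij] diag_mult_entry(2)[OF carrier(2) ij] B_entry[OF ij]
        modelB_entry[of i ts j, unfolded nsum, OF ij] using R(3) ij by (auto simp: T_def)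
  qed
  have main: "conj_by R M = conj_by ?G M'" if M: "M \<in> Mat n" "M' \<in> Mat n" "M' * d = d * M" for M M'
  proof (rule conj_by_props(3)[OF unit_mat_carrier detG M(2)])
    let ?X = "conj_by R M"
    show X: "?X \<in> Mat n" by (rule conj_by_props(1)[OF R(1,2) M(1)])
    note XG = mult_carrier_mat[OF X unit_mat_carrier] and GM = mult_carrier_mat[OF unit_mat_carrier[of n T] M(2)]
    have "?X * ?G * d = ?X * R" unfolding assoc_mult_mat[OF X unit_mat_carrier d] RG[symmetric] ..
    also have "\<dots> = R * M" by (rule conj_by_props(2)[OF R(1,2) M(1)])
    also have "\<dots> = ?G * (d * M)" unfolding RG by (rule assoc_mult_mat[OF unit_mat_carrier d M(1)])
    also have "\<dots> = ?G * M' * d" unfolding M(3)[symmetric] by (rule assoc_mult_mat[symmetric, OF unit_mat_carrier M(2) d])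
    finally have eq: "?X * ?G * d = ?G * M' * d" .
    show "?X * ?G = ?G * M'"
    proof (rule mat_eqI[OF XG GM])
      fix i j assume ij: "i < n" "j < n"
      show "(?X * ?G) $$ (i, j) = (?G * M') $$ (i, j)"
        using arg_cong[OF eq, of "\<lambda>M. M $$ (i, j)"] R(3)[OF ij(2)]
        unfolding d_def diag_mult_entry(2)[OF XG ij] diag_mult_entry(2)[OF GM ij] by simp
    qed
  qed
  show ?thesis
    using nz main[OF mc(1) carrier(1) wA] main[OF mc(2) carrier(2) wB] unfolding pair by metis
qed

text \<open>A matrix with a zero diagonal entry cannot be rescaled to unit diagonal, but it lies on a line
  through the identity, whose other points can.\<close>

lemma K_types_eq_par: "K_types q ts = zcl n (par_pair q ts ` {T. par_denom ts T \<noteq> 0})" (is "_ = zcl n ?im")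
proof -
  have "?im \<subseteq> model_orbits q ts"
  proof
    fix p assume "p \<in> ?im"
    then obtain T where T: "p = par_pair q ts T" "det (unit_mat n T) \<noteq> 0" "\<forall>f<n. S f = f \<longrightarrow> T (f, f) \<noteq> 0"
      unfolding denom_nz by blast
    have "gl_conj p (par_A q ts T, par_B q ts T)"
      unfolding T(1) pair by (rule gl_conj_conj_by[OF unit_mat_carrier T(2) carrier])
    then show "p \<in> model_orbits q ts"
      unfolding model_orbits_def par_A_def par_B_def nsum using T(3)
      by (intro CollectI exI[of _ "\<lambda>i. T (i, i)"] exI[of _ "\<lambda>f. T (n, f)"]) simp
  qed
  then have 1: "zcl n ?im \<subseteq> zcl n (model_orbits q ts)" by (rule zcl_mono)
  have "p \<in> zcl n ?im" if p: "p \<in> model_orbits q ts" for p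
  proof -
    have pp: "p \<in> pairs n" using p model_orbits_pairs[of q ts] unfolding nsum by blast
    obtain \<tau> \<gamma> where \<tau>: "\<forall>i<n. S i = i \<longrightarrow> \<tau> i \<noteq> 0" and con: "gl_conj p (modelA q ts \<tau>, modelB q ts \<tau> \<gamma>)"
      using p unfolding model_orbits_def nsum by blast
    let ?A = "modelA q ts \<tau>" and ?B = "modelB q ts \<tau> \<gamma>"
    have mc: "?A \<in> Mat n" "?B \<in> Mat n" using model_carrier[of q ts] unfolding nsum by auto
    from gl_conjE[OF con pp] obtain P Q where P: "P \<in> Mat n" "Q \<in> Mat n" "P * Q = 1\<^sub>m n"
      "fst p * P = P * ?A" "snd p * P = P * ?B" by (metis fst_conv snd_conv)
    have "det P * det Q = 1" using arg_cong[OF P(3), of det] det_mult[OF P(1,2)] by simp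
    then have detP: "det P \<noteq> 0" by auto
    let ?R = "\<lambda>u. P + u \<cdot>\<^sub>m (1\<^sub>m n - P)" and ?p = "\<lambda>u. (conj_by (P + u \<cdot>\<^sub>m (1\<^sub>m n - P)) ?A, conj_by (P + u \<cdot>\<^sub>m (1\<^sub>m n - P)) ?B)"
    have R: "?R \<in> upoly.mats n n" by (rule upoly_line[OF P(1) one_carrier_mat])
    have R0: "?R 0 = P" and R1: "?R 1 = 1\<^sub>m n" using P(1) by (auto intro!: eq_matI)
    \<comment> \<open>Where \<open>?g\<close> does not vanish, \<open>?R u\<close> is invertible and can be rescaled to unit diagonal.\<close>
    let ?g = "\<lambda>u. det (?R u) * (\<Prod>i<n. ?R u $$ (i, i))"
    have g: "?g \<in> upoly_funs"
      by (intro upoly.mult upoly.mats_det[OF R] upoly.prod upoly.mats_entry[OF R]) auto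
    have "?g 1 \<noteq> 0" unfolding R1 by simp
    then have inf: "infinite {u. ?g u \<noteq> 0}" by (rule infinite_nonzero[OF g])
    have e: "\<exists>r\<in>upoly_funs. \<forall>u. det (?R u) \<noteq> 0 \<longrightarrow> det (?R u) * conj_by (?R u) M $$ (i, j) = r u"
      if M: "M \<in> Mat n" and ij: "i < n" "j < n" for M i j
    proof (intro bexI allI impI)
      show "(\<lambda>u. (?R u * M * adj_mat (?R u)) $$ (i, j)) \<in> upoly_funs"
        by (rule upoly.mats_entry[OF upoly.mats_mult[OF upoly.mats_mult[OF R upoly.mats_const[OF M]] upoly.mats_adj[OF R]] ij])
      fix u assume "det (?R u) \<noteq> 0"
      from conj_by_props(4)[OF upoly.mats_carrier[OF R] this M ij]
      show "det (?R u) * conj_by (?R u) M $$ (i, j) = (?R u * M * adj_mat (?R u)) $$ (i, j)" .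
    qed
    have "f p = 0" if f: "f \<in> poly_funs n" and van: "\<forall>s\<in>?im. f s = 0" for f
    proof -
      have "\<exists>c. \<exists>r\<in>upoly_funs. \<forall>u. det (?R u) \<noteq> 0 \<longrightarrow> det (?R u) ^ c * f (?p u) = r u"
        by (rule upoly.clear_denominators[OF upoly.mats_det[OF R] _ _ f])
          (unfold fst_conv snd_conv, (rule e[OF mc(1)] e[OF mc(2)]; assumption)+)
      then obtain c r where r: "r \<in> upoly_funs" "\<And>u. det (?R u) \<noteq> 0 \<Longrightarrow> det (?R u) ^ c * f (?p u) = r u" by blast
      have "r u = 0" if "?g u \<noteq> 0" for u
      proof -
        have nz: "det (?R u) \<noteq> 0" "\<And>i. i < n \<Longrightarrow> ?R u $$ (i, i) \<noteq> 0" using that by auto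
        from conj_mem_par[OF upoly.mats_carrier[OF R] nz, of \<tau> \<gamma>] \<tau>
        obtain T where "par_denom ts T \<noteq> 0" "par_pair q ts T = ?p u" by blast
        then have "f (?p u) = 0" using van by (metis (mono_tags, lifting) image_eqI mem_Collect_eq)
        then show ?thesis using r(2)[OF nz(1)] by simp
      qed
      then have "infinite {u. r u = 0}" using infinite_super[OF _ inf, of "{u. r u = 0}"] by blast
      from upoly_zero[OF r(1) this, of 0] have "det P ^ c * f (?p 0) = 0" using r(2)[of 0] detP unfolding R0 by simp
      moreover have "?p 0 = p"
      proof -
        have pc: "fst p \<in> Mat n" "snd p \<in> Mat n" using pp by auto
        show ?thesis
          unfolding R0 conj_by_props(3)[OF P(1) detP mc(1) pc(1) P(4), symmetric]
            conj_by_props(3)[OF P(1) detP mc(2) pc(2) P(5), symmetric] by simp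
      qed
      ultimately show "f p = 0" using detP by simp
    qed
    then show ?thesis using pp unfolding zcl_def by blast
  qed
  then have "zcl n (model_orbits q ts) \<subseteq> zcl n ?im" by (intro zcl_least subsetI)
  then show ?thesis unfolding K_types_eq_model_closure[OF q0 ts] using 1 by blast
qed

end

section \<open>A chain of full length\<close>

text \<open>Parameters are released in the order of their rank \<open>\<rho>\<close>; the order among parameters of equal rank is immaterial.\<close>

lemma (in param_family) chain_from_ranking:
  fixes \<rho> :: "'i \<Rightarrow> nat"
  assumes T0: "d T0 \<noteq> 0"
    and dep: "\<And>S T. (\<And>i. i \<in> I \<Longrightarrow> S i = T i) \<Longrightarrow> Phi S = Phi T \<and> d S = d T"
    and rel: "\<And>x. x \<in> I \<Longrightarrow> \<exists>F\<in>poly_funs n.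
        (\<forall>T. d T \<noteq> 0 \<longrightarrow> T x = T0 x \<longrightarrow> (\<forall>y\<in>I. \<rho> x < \<rho> y \<longrightarrow> T y = T0 y) \<longrightarrow> F (Phi T) = 0) \<and>
        (\<exists>T. d T \<noteq> 0 \<and> (\<forall>y\<in>I. y \<noteq> x \<longrightarrow> \<rho> x \<le> \<rho> y \<longrightarrow> T y = T0 y) \<and> F (Phi T) \<noteq> 0)"
  shows "\<exists>Z. irr_chain n (zcl n (Phi ` {T. d T \<noteq> 0})) (card I) Z"
proof -
  obtain xs where xs: "set xs = I" "distinct xs" using finite_distinct_list[OF finI] by blast
  define ys where "ys = sort_key \<rho> xs"
  have ys: "set ys = I" "distinct ys" "length ys = card I" "sorted (map \<rho> ys)"
    using xs distinct_card[OF xs(2)] unfolding ys_def by simp_all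
  let ?idx = "\<lambda>k. ys ! k"
  have bij: "bij_betw ?idx {..<card I} I"
    by (rule bij_betw_nth[OF ys(2)]) (simp_all add: ys(1,3))
  have "\<exists>F\<in>poly_funs n.
        (\<forall>T. d T \<noteq> 0 \<longrightarrow> (\<forall>k<card I. j \<le> k \<longrightarrow> T (?idx k) = T0 (?idx k)) \<longrightarrow> F (Phi T) = 0) \<and>
        (\<exists>T. d T \<noteq> 0 \<and> (\<forall>k<card I. j < k \<longrightarrow> T (?idx k) = T0 (?idx k)) \<and> F (Phi T) \<noteq> 0)" if j: "j < card I" for j
  proof -
    have "?idx j \<in> I" using bij_betwE[OF bij] j by simp
    then obtain F T where F: "F \<in> poly_funs n"
      "\<And>T. d T \<noteq> 0 \<Longrightarrow> T (?idx j) = T0 (?idx j) \<Longrightarrow> (\<forall>y\<in>I. \<rho> (?idx j) < \<rho> y \<longrightarrow> T y = T0 y) \<Longrightarrow> F (Phi T) = 0"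
      "d T \<noteq> 0" "\<forall>y\<in>I. y \<noteq> ?idx j \<longrightarrow> \<rho> (?idx j) \<le> \<rho> y \<longrightarrow> T y = T0 y" "F (Phi T) \<noteq> 0"
      using rel[of "?idx j"] by blast
    have "F (Phi T) = 0" if "d T \<noteq> 0" and T: "\<forall>k<card I. j \<le> k \<longrightarrow> T (?idx k) = T0 (?idx k)" for T
    proof (rule F(2)[OF that(1)])
      show "T (?idx j) = T0 (?idx j)" using T j by simp
      show "\<forall>y\<in>I. \<rho> (?idx j) < \<rho> y \<longrightarrow> T y = T0 y"
      proof (intro ballI impI)
        fix y assume "y \<in> I" and r: "\<rho> (?idx j) < \<rho> y"
        then obtain k where k: "k < card I" "y = ?idx k" using ys(1,3) by (metis in_set_conv_nth)
        have "j \<le> k"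
        proof (rule ccontr)
          assume "\<not> j \<le> k"
          then have "\<rho> (?idx k) \<le> \<rho> (?idx j)" using sorted_nth_mono[OF ys(4), of k j] j k ys(3) by simp
          then show False using r k by simp
        qed
        then show "T y = T0 y" using T k by simp
      qed
    qed
    moreover have "T (?idx k) = T0 (?idx k)" if k: "k < card I" "j < k" for k
    proof -
      have "?idx k \<noteq> ?idx j" using nth_eq_iff_index_eq[OF ys(2)] k j ys(3) by simp
      moreover have "\<rho> (?idx j) \<le> \<rho> (?idx k)" using sorted_nth_mono[OF ys(4), of j k] j k ys(3) by simp
      ultimately show ?thesis using F(4) bij_betwE[OF bij] k by simp
    qed
    ultimately show ?thesis using F(1,3,5) by (intro bexI[OF _ F(1)] conjI allI impI exI[of _ T]) auto
  qed
  from chain_from_slices[OF T0 bij dep this] show ?thesis by blast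
qed

definition shift_prod :: "nat \<Rightarrow> 'a::comm_ring_1 mat \<Rightarrow> 'a list \<Rightarrow> 'a mat" where
  "shift_prod n X cs = foldr (\<lambda>c M. (X - c \<cdot>\<^sub>m 1\<^sub>m n) * M) cs (1\<^sub>m n)"

lemma shift_prod_simps:
  "shift_prod n X [] = 1\<^sub>m n" "shift_prod n X (c # cs) = (X - c \<cdot>\<^sub>m 1\<^sub>m n) * shift_prod n X cs"
  unfolding shift_prod_def by simp_all

lemma shift_carrier: "X \<in> Mat n \<Longrightarrow> X - c \<cdot>\<^sub>m 1\<^sub>m n \<in> Mat n"
  by (rule minus_carrier_mat) simp

lemma shift_prod_carrier: "X \<in> Mat n \<Longrightarrow> shift_prod n X cs \<in> Mat n"
  by (induction cs) (simp_all add: shift_prod_simps mult_carrier_mat[OF shift_carrier])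

lemma (in function_ring) mats_shift_prod: "X \<in> mats n n \<Longrightarrow> (\<lambda>x. shift_prod n (X x) cs) \<in> mats n n"
proof (induction cs)
  case (Cons c cs)
  show ?case unfolding shift_prod_simps
    by (rule mats_mult[OF mats_minus[OF Cons.prems mats_const] Cons.IH[OF Cons.prems]]) simp
qed (simp add: shift_prod_simps mats_const)

lemma shift_intertwine:
  fixes X :: "'a::comm_ring_1 mat"
  assumes c: "X \<in> Mat n" "G \<in> Mat n" "M \<in> Mat n" and e: "X * G = G * M"
  shows "(X - c \<cdot>\<^sub>m 1\<^sub>m n) * G = G * (M - c \<cdot>\<^sub>m 1\<^sub>m n)"
proof -
  have o: "c \<cdot>\<^sub>m 1\<^sub>m n \<in> Mat n" by simp
  have "(X - c \<cdot>\<^sub>m 1\<^sub>m n) * G = G * M - c \<cdot>\<^sub>m G"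
    unfolding minus_mult_distrib_mat[OF c(1) o c(2)] e mult_smult_assoc_mat[OF one_carrier_mat c(2)] using c by simp
  also have "\<dots> = G * (M - c \<cdot>\<^sub>m 1\<^sub>m n)"
    unfolding mult_minus_distrib_mat[OF c(2,3) o] mult_smult_distrib[OF c(2) one_carrier_mat] using c by simp
  finally show ?thesis .
qed

lemma mult_intertwine:
  fixes X :: "'a::comm_ring_1 mat"
  assumes c: "X \<in> Mat n" "Y \<in> Mat n" "G \<in> Mat n" "M \<in> Mat n" "N \<in> Mat n"
    and e: "X * G = G * M" "Y * G = G * N"
  shows "(X * Y) * G = G * (M * N)"
proof -
  have "(X * Y) * G = X * (G * N)" unfolding assoc_mult_mat[OF c(1,2,3)] e(2) ..
  also have "\<dots> = G * M * N" unfolding assoc_mult_mat[OF c(1,3,5), symmetric] e(1) ..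
  finally show ?thesis unfolding assoc_mult_mat[OF c(3,4,5)] .
qed

lemma shift_prod_intertwine:
  fixes X :: "'a::comm_ring_1 mat"
  assumes c: "X \<in> Mat n" "G \<in> Mat n" "M \<in> Mat n" and e: "X * G = G * M"
  shows "shift_prod n X cs * G = G * shift_prod n M cs"
proof (induction cs)
  case (Cons a cs)
  show ?case unfolding shift_prod_simps
    by (rule mult_intertwine[OF shift_carrier[OF c(1)] shift_prod_carrier[OF c(1)] c(2) shift_carrier[OF c(3)]
        shift_prod_carrier[OF c(3)] shift_intertwine[OF c e] Cons.IH])
qed (use c in \<open>simp add: shift_prod_simps\<close>)

lemma shift_prod_column:
  fixes X :: "'a::comm_ring_1 mat"
  assumes X: "X \<in> Mat n" and j: "j < n" and col: "\<And>r. r < n \<Longrightarrow> X $$ (r, j) = (if r = j then y else 0)"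
    and r: "r < n"
  shows "shift_prod n X cs $$ (r, j) = (if r = j then \<Prod>c\<leftarrow>cs. y - c else 0)"
  using r
proof (induction cs arbitrary: r)
  case (Cons c cs)
  have "shift_prod n X (c # cs) $$ (r, j) = (\<Sum>l\<in>{0..<n}. (X - c \<cdot>\<^sub>m 1\<^sub>m n) $$ (r, l) * shift_prod n X cs $$ (l, j))"
    unfolding shift_prod_simps by (rule mat_mult_entry[OF shift_carrier[OF X] shift_prod_carrier[OF X] Cons.prems j])
  also have "\<dots> = (\<Sum>l\<in>{0..<n}. if l = j then (X - c \<cdot>\<^sub>m 1\<^sub>m n) $$ (r, j) * (\<Prod>c\<leftarrow>cs. y - c) else 0)"
    by (rule sum.cong) (auto simp: Cons.IH)
  also have "\<dots> = (X - c \<cdot>\<^sub>m 1\<^sub>m n) $$ (r, j) * (\<Prod>c\<leftarrow>cs. y - c)" using j by simp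
  finally show ?case using X Cons.prems j col[OF Cons.prems] by simp
qed (use j in \<open>simp add: shift_prod_simps\<close>)

lemma shift_prod_invariant:
  fixes X :: "'a::comm_ring_1 mat"
  assumes X: "X \<in> Mat n" and inv: "\<And>r j. r < n \<Longrightarrow> j < n \<Longrightarrow> j \<in> P \<Longrightarrow> r \<notin> P \<Longrightarrow> X $$ (r, j) = 0"
    and rj: "r < n" "j < n" "j \<in> P" "r \<notin> P"
  shows "shift_prod n X cs $$ (r, j) = 0"
  using rj
proof (induction cs arbitrary: r j)
  case (Cons c cs)
  have "shift_prod n X (c # cs) $$ (r, j) = (\<Sum>l\<in>{0..<n}. (X - c \<cdot>\<^sub>m 1\<^sub>m n) $$ (r, l) * shift_prod n X cs $$ (l, j))"
    unfolding shift_prod_simps by (rule mat_mult_entry[OF shift_carrier[OF X] shift_prod_carrier[OF X] Cons.prems(1,2)])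
  also have "\<dots> = 0"
  proof (rule sum.neutral, rule ballI)
    fix l assume l: "l \<in> {0..<n}"
    show "(X - c \<cdot>\<^sub>m 1\<^sub>m n) $$ (r, l) * shift_prod n X cs $$ (l, j) = 0"
    proof (cases "l \<in> P")
      case True
      then have "(X - c \<cdot>\<^sub>m 1\<^sub>m n) $$ (r, l) = 0" using X l Cons.prems inv[of r l] by auto
      then show ?thesis by simp
    next
      case False
      then show ?thesis using Cons.IH[of l j] l Cons.prems by simp
    qed
  qed
  finally show ?case .
qed (auto simp: shift_prod_simps)

lemma exists_separated_eigenvalues:
  fixes q :: "'a::field_char_0"
  assumes q: "q \<noteq> 0"
  shows "\<exists>b::nat \<Rightarrow> 'a. (\<forall>f<m. b f \<noteq> 0) \<and>
    (\<forall>f<m. \<forall>g<m. f \<noteq> g \<longrightarrow> (\<forall>u\<le>n. \<forall>v\<le>n. b f * q ^ u \<noteq> b g * q ^ v))"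
proof (induction m)
  case (Suc m)
  from Suc.IH obtain b :: "nat \<Rightarrow> 'a" where b': "\<forall>f<m. b f \<noteq> 0"
    "\<forall>f<m. \<forall>g<m. f \<noteq> g \<longrightarrow> (\<forall>u\<le>n. \<forall>v\<le>n. b f * q ^ u \<noteq> b g * q ^ v)" by (elim exE conjE)
  have b: "b f \<noteq> 0" if "f < m" for f using b'(1) that by simp
  have b2: "b f * q ^ u \<noteq> b g * q ^ v" if "f < m" "g < m" "f \<noteq> g" "u \<le> n" "v \<le> n" for f g u v
    using b'(2) that by simp
  let ?X = "insert 0 ((\<lambda>(g, u, v). b g * q ^ v / q ^ u) ` ({..<m} \<times> {..n} \<times> {..n}))"
  have "finite ?X" by simp
  then obtain x where x: "x \<notin> ?X" using ex_new_if_finite[OF infinite_UNIV_char_0] by blast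
  have x': "x * q ^ u \<noteq> b g * q ^ v" if "g < m" "u \<le> n" "v \<le> n" for g u v
  proof
    assume "x * q ^ u = b g * q ^ v"
    then have "x = (\<lambda>(g, u, v). b g * q ^ v / q ^ u) (g, u, v)" using q by (simp add: field_simps)
    then show False using x that by blast
  qed
  let ?b = "b(m := x)"
  have "?b f * q ^ u \<noteq> ?b g * q ^ v" if "f < Suc m" "g < Suc m" "f \<noteq> g" "u \<le> n" "v \<le> n" for f g u v
  proof (cases "f = m")
    case True
    then show ?thesis using x'[of g u v] that by simp
  next
    case f: False
    show ?thesis
    proof (cases "g = m")
      case True
      then show ?thesis using x'[of f v u] that by (metis f fun_upd_def less_SucE)
    qed (use b2[of f g u v] f that in simp)
  qed
  moreover have "?b f \<noteq> 0" if "f < Suc m" for f using x b[of f] that by auto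
  ultimately show ?case by (intro exI[of _ ?b]) simp
qed simp

lemma conj_by_one: "M \<in> Mat n \<Longrightarrow> conj_by (1\<^sub>m n) M = (M :: 'a::field mat)"
  by (rule conj_by_props(3)[symmetric, of _ n]) simp_all

text \<open>Eigenvalues \<open>b\<close> of the summands that differ even up to powers of \<open>q\<close> with exponents at most \<open>n\<close>.\<close>

locale block_family_base = block_family q ts n
  for q :: "'a::{alg_closed_field, field_char_0}" and ts n +
  fixes b :: "nat \<Rightarrow> 'a"
  assumes b0: "f < n \<Longrightarrow> b f \<noteq> 0"
    and bsep: "f < n \<Longrightarrow> g < n \<Longrightarrow> f \<noteq> g \<Longrightarrow> u \<le> n \<Longrightarrow> v \<le> n \<Longrightarrow> b f * q ^ u \<noteq> b g * q ^ v"
begin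

definition base :: "nat \<times> nat \<Rightarrow> 'a" where
  "base = (\<lambda>(i, j). if i = j then if S i = i then b i else 1 else 0)"

definition ev :: "(nat \<times> nat \<Rightarrow> 'a) \<Rightarrow> nat \<Rightarrow> 'a" where
  "ev T i = T (S i, S i) * (if D i then inverse q else q) ^ (i - S i)"

lemma ev_base: "i < n \<Longrightarrow> ev base i = b (S i) * (if D i then inverse q else q) ^ (i - S i)"
  using start_start(1)[of i] unfolding ev_def base_def by simp

lemma ev_base_nz: "i < n \<Longrightarrow> ev base i \<noteq> 0"
  using ev_base[of i] b0[of "S i"] q0 bounds(1)[of i] by simp

lemma ev_classes:
  assumes ij: "i < n" "j < n" "D i = D j" "S i \<noteq> S j"
  shows "ev base i \<noteq> ev base j" "q * ev base i \<noteq> ev base j" "ev base i \<noteq> q * ev base j"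
proof -
  let ?u = "i - S i" and ?v = "j - S j"
  have le: "?u \<le> n" "?v \<le> n" "Suc ?u \<le> n" "Suc ?v \<le> n" using ij by auto
  have S: "S i < n" "S j < n" using bounds(1) ij(1,2) le_less_trans by blast+
  note bs = bsep[OF S ij(4)]
  show "ev base i \<noteq> ev base j" "q * ev base i \<noteq> ev base j" "ev base i \<noteq> q * ev base j"
    using bs[OF le(2,1)] bs[OF le(1,2)] bs[OF le(3,2)] bs[OF le(1,4)] bs[OF le(4,1)] bs[OF le(2,3)] q0 ij(3)
    unfolding ev_base[OF ij(1)] ev_base[OF ij(2)] by (auto simp: field_simps power_inverse)
qed

lemma ev_distinct:
  assumes ij: "i < n" "j < n" "D i = D j" "i \<noteq> j"
  shows "ev base i \<noteq> ev base j"
proof (cases "S i = S j")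
  case True
  have K: "K i = K j" using start_start(3) ij(1,2) True by metis
  have o: "i - S i < K i" "j - S j < K i" "i - S i \<noteq> j - S j"
    using bounds(1,2)[OF ij(1)] bounds(1,2)[OF ij(2)] K ij(4) True by linarith+
  then have "q ^ (i - S i) \<noteq> q ^ (j - S j)"
    using qorder_distinct_powers[OF bounds(4)[OF ij(1)] q0 o(1,2)] by blast
  then show ?thesis unfolding ev_base[OF ij(1)] ev_base[OF ij(2)] using True ij b0[of "S j"] bounds(1)[of j] q0
    by (simp add: power_inverse)
qed (rule ev_classes[OF ij(1-3)])

end

context block_family
begin

definition sel :: "bool \<Rightarrow> 'a mat \<times> 'a mat \<Rightarrow> 'a mat" where
  "sel d p = (if d then proj1 n p else proj2 n p)"

definition model :: "bool \<Rightarrow> (nat \<times> nat \<Rightarrow> 'a) \<Rightarrow> 'a mat" where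
  "model d T = (if d then par_A q ts T else par_B q ts T)"

lemma sel_mats: "sel d \<in> poly_funs.mats n n n"
  unfolding sel_def using proj_mats by (cases d) simp_all

lemma model_carr: "model d T \<in> Mat n"
  unfolding model_def using carrier by simp

lemma sel_pair:
  assumes "det (unit_mat n T) \<noteq> 0"
  shows "sel d (par_pair q ts T) = conj_by (unit_mat n T) (model d T)"
  unfolding pair sel_def model_def
  using proj_eq(1)[OF conj_by_props(1)[OF unit_mat_carrier assms carrier(1)]]
    proj_eq(2)[OF conj_by_props(1)[OF unit_mat_carrier assms carrier(2)]] by simp

lemma sel_intertwine:
  assumes "det (unit_mat n T) \<noteq> 0"
  shows "sel d (par_pair q ts T) \<in> Mat n"
    "sel d (par_pair q ts T) * unit_mat n T = unit_mat n T * model d T"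
  unfolding sel_pair[OF assms] using conj_by_props(1,2)[OF unit_mat_carrier assms model_carr] by simp_all

lemma unit_mat_eq_one: "\<forall>i<n. \<forall>j<n. i \<noteq> j \<longrightarrow> T (i, j) = 0 \<Longrightarrow> unit_mat n T = 1\<^sub>m n"
  unfolding unit_mat_def by (rule eq_matI) auto

lemma sel_pair_one:
  assumes "\<forall>i<n. \<forall>j<n. i \<noteq> j \<longrightarrow> T (i, j) = 0"
  shows "sel d (par_pair q ts T) = model d T"
  using sel_pair[of T d] unfolding unit_mat_eq_one[OF assms] conj_by_one[OF model_carr] by simp

lemma model_block_diagonal: "r < n \<Longrightarrow> j < n \<Longrightarrow> S r \<noteq> S j \<Longrightarrow> model d T $$ (r, j) = 0"
proof -
  assume rj: "r < n" "j < n" "S r \<noteq> S j"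
  have 1: "\<not> (Suc r = j \<and> S j \<noteq> j)" using pred_block[of r] rj by auto
  have 2: "\<not> (S j = j \<and> Suc r = j + K j)"
    using same_block[OF rj(2), of r] bounds(1)[OF rj(2)] bounds(2)[OF rj(2)] rj by (cases "r < j") auto
  have 3: "r \<noteq> j" using rj by auto
  show ?thesis unfolding model_def using A_entry[OF rj(1,2), of T] B_entry[OF rj(1,2), of T] 1 2 3 by auto
qed

lemma model_invariant: "r < n \<Longrightarrow> j < n \<Longrightarrow> D r \<noteq> D j \<Longrightarrow> model d T $$ (r, j) = 0"
  using model_block_diagonal[of r j d T] start_start(2)[of r] start_start(2)[of j] by metis

lemma dependence:
  fixes T T' :: "nat \<times> nat \<Rightarrow> 'a"
  assumes eq: "\<And>i. i \<in> par_index q ts \<Longrightarrow> T i = T' i"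
  shows "par_pair q ts T = par_pair q ts T' \<and> par_denom ts T = par_denom ts T'"
proof -
  have eq': "T (i, j) = T' (i, j)" if "i < n" "j < n" for i j using eq that unfolding index by simp
  have "unit_mat n T = unit_mat n T'" unfolding unit_mat_def using eq' by (auto intro!: cong_mat)
  moreover have "par_A q ts T = par_A q ts T'"
  proof (rule mat_eqI[OF carrier(1) carrier(1)])
    fix i j assume ij: "i < n" "j < n"
    then have "S j < n" using bounds(1)[of j] by simp
    then show "par_A q ts T $$ (i, j) = par_A q ts T' $$ (i, j)" unfolding A_entry[OF ij] using eq' ij by simp
  qed
  moreover have "par_B q ts T = par_B q ts T'"
  proof (rule mat_eqI[OF carrier(2) carrier(2)])
    fix i j assume ij: "i < n" "j < n"
    then have "S j < n" using bounds(1)[of j] by simp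
    moreover have "T (n, j) = T' (n, j)" if "D j" "S j = j" "enat (K j) = qorder q"
      using that ij eq[of "(n, j)"] unfolding index full_starts_def nsum by blast
    ultimately show "par_B q ts T $$ (i, j) = par_B q ts T' $$ (i, j)" unfolding B_entry[OF ij] using eq' ij by simp
  qed
  moreover have "(\<Prod>f | f < n \<and> S f = f. T (f, f)) = (\<Prod>f | f < n \<and> S f = f. T' (f, f))"
    by (rule prod.cong) (auto simp: eq')
  ultimately show ?thesis unfolding pair denom by simp
qed

end

context block_family_base
begin

lemma model_eigen_column:
  "r < n \<Longrightarrow> j < n \<Longrightarrow> D j = d \<Longrightarrow> model d T $$ (r, j) = (if r = j then ev T j else 0)"
  unfolding model_def ev_def using A_entry[of r j T] B_entry[of r j T] by auto

lemma model_diagonal: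
  assumes "r < n" "j < n" and w: "S j \<noteq> j \<Longrightarrow> T (j, j) = 0" and c: "T (n, j) = 0"
  shows "model d T $$ (r, j) = (if r = j then if D j = d then ev T j else 0 else 0)"
  unfolding model_def ev_def using A_entry[OF assms(1,2), of T] B_entry[OF assms(1,2), of T] w c by auto

definition rank :: "nat \<times> nat \<Rightarrow> nat" where
  "rank = (\<lambda>(i, j). if i = j then if S i = i then 2 else 0 else if i = n then 0 else 1)"

lemma base_off: "i \<noteq> j \<Longrightarrow> base (i, j) = 0"
  unfolding base_def by simp

lemma base_upd_denom:
  assumes "\<forall>i<n. \<forall>j<n. i \<noteq> j \<longrightarrow> T (i, j) = 0" "\<forall>f<n. S f = f \<longrightarrow> T (f, f) \<noteq> 0"
  shows "par_denom ts T \<noteq> 0"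
  unfolding denom_nz unit_mat_eq_one[OF assms(1)] using assms(2) by simp

lemma base_denom: "par_denom ts base \<noteq> 0"
  by (rule base_upd_denom) (auto simp: base_def b0)

text \<open>Some polynomial function vanishes as long as the parameter \<open>x\<close> and those of higher rank have their base values,
  but not when \<open>x\<close> is released as well. Weights and corners are released first, while \<open>G = 1\<close>; then the entries of \<open>G\<close>, while the eigenvalues
  are fixed; and the eigenvalues last.\<close>

definition separated :: "nat \<times> nat \<Rightarrow> bool" where
  "separated x \<longleftrightarrow> (\<exists>F\<in>poly_funs n.
     (\<forall>T. par_denom ts T \<noteq> 0 \<longrightarrow> T x = base x \<longrightarrow> (\<forall>y\<in>par_index q ts. rank x < rank y \<longrightarrow> T y = base y) \<longrightarrow> F (par_pair q ts T) = 0) \<and>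
     (\<exists>T. par_denom ts T \<noteq> 0 \<and> (\<forall>y\<in>par_index q ts. y \<noteq> x \<longrightarrow> rank x \<le> rank y \<longrightarrow> T y = base y) \<and> F (par_pair q ts T) \<noteq> 0))"

text \<open>For \<open>G = 1\<close> the parameter is itself an entry of \<open>A\<close> or \<open>B\<close>.\<close>

lemma separated_weight:
  assumes x: "x \<in> par_index q ts" "rank x = 0"
  shows "separated x"
proof -
  have "\<exists>d r c. r < n \<and> c < n \<and> (\<forall>T. model d T $$ (r, c) = T x)"
  proof -
    obtain i j where ij: "x = (i, j)" by (cases x)
    show ?thesis
    proof (cases "i = j")
      case True
      then have j: "j < n" "S j \<noteq> j" using x unfolding ij rank_def index full_starts_def nsum by (auto split: if_splits)
      then have "j \<noteq> 0" using bounds(1)[of j] by auto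
      then have r: "j - 1 < n" "Suc (j - 1) = j" "j - 1 \<noteq> j" using j by auto
      show ?thesis unfolding ij True model_def
        by (intro exI[of _ "\<not> D j"] exI[of _ "j - 1"] exI[of _ j])
          (use A_entry[OF r(1) j(1)] B_entry[OF r(1) j(1)] r j in auto)
    next
      case False
      then have j: "i = n" "j < n" "D j" "S j = j" "enat (K j) = qorder q"
        using x unfolding ij rank_def index full_starts_def nsum by (auto split: if_splits)
      have r: "j + K j - 1 < n" "Suc (j + K j - 1) = j + K j" using bounds(2,3)[OF j(2)] j(4) by auto
      show ?thesis unfolding ij j(1) model_def
        by (intro exI[of _ False] exI[of _ "j + K j - 1"] exI[of _ j]) (use B_entry[OF r(1) j(2)] r j in auto)
    qed
  qed
  then obtain d r c where m: "r < n" "c < n" "\<And>T. model d T $$ (r, c) = T x" by blast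
  let ?T = "base(x := base x + 1)"
  have off: "\<forall>i<n. \<forall>j<n. i \<noteq> j \<longrightarrow> ?T (i, j) = 0"
    using x base_off unfolding rank_def by (auto split: if_splits)
  have first: "\<forall>f<n. S f = f \<longrightarrow> ?T (f, f) \<noteq> 0"
    using x b0 unfolding rank_def base_def by auto
  show ?thesis unfolding separated_def
  proof (intro bexI[of _ "\<lambda>p. sel d p $$ (r, c) - base x"] conjI allI impI exI[of _ ?T])
    show "(\<lambda>p. sel d p $$ (r, c) - base x) \<in> poly_funs n"
      by (rule poly_funs.diff[OF poly_funs.mats_entry[OF sel_mats m(1,2)] poly_funs.const])
    show "par_denom ts ?T \<noteq> 0" by (rule base_upd_denom[OF off first])
    show "\<forall>y\<in>par_index q ts. y \<noteq> x \<longrightarrow> rank x \<le> rank y \<longrightarrow> ?T y = base y" by simp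
    show "sel d (par_pair q ts ?T) $$ (r, c) - base x \<noteq> 0" unfolding sel_pair_one[OF off] m(3) by simp
    fix T assume T: "T x = base x" "\<forall>y\<in>par_index q ts. rank x < rank y \<longrightarrow> T y = base y"
    have "\<forall>i<n. \<forall>j<n. i \<noteq> j \<longrightarrow> T (i, j) = 0"
      using T(2) x(2) base_off unfolding index rank_def by auto
    from sel_pair_one[OF this] show "sel d (par_pair q ts T) $$ (r, c) - base x = 0" using m(3) T(1) by simp
  qed
qed

text \<open>The function is \<open>det (A - b)\<close> or \<open>det (B - b)\<close>, with the base value \<open>b\<close> of the eigenvalue.\<close>

lemma separated_eigenvalue:
  assumes f: "f < n" "S f = f"
  shows "separated (f, f)"
proof -
  let ?d = "D f" and ?x = "(f, f)"
  have "finite (insert 0 ((\<lambda>u. b f * q ^ u) ` {..n} \<union> (\<lambda>u. b f * inverse q ^ u) ` {..n}))" by simp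
  then obtain v where v: "v \<notin> insert 0 ((\<lambda>u. b f * q ^ u) ` {..n} \<union> (\<lambda>u. b f * inverse q ^ u) ` {..n})"
    using ex_new_if_finite[OF infinite_UNIV_char_0] by blast
  let ?T = "base(?x := v)"
  let ?F = "\<lambda>p. det (sel ?d p - b f \<cdot>\<^sub>m 1\<^sub>m n)"
  have off: "\<forall>i<n. \<forall>j<n. i \<noteq> j \<longrightarrow> ?T (i, j) = 0" using base_off by auto
  have first: "\<forall>g<n. S g = g \<longrightarrow> ?T (g, g) \<noteq> 0" using v b0 unfolding base_def by auto
  have diag: "model ?d ?T $$ (i, i) \<noteq> b f" if i: "i < n" for i
  proof (cases "D i = ?d")
    case False
    then have "model ?d ?T $$ (i, i) = 0"
      unfolding model_def using A_entry[OF i i, of ?T] B_entry[OF i i, of ?T] base_off[of n i] i by auto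
    then show ?thesis using b0[OF f(1)] by simp
  next
    case True
    have m: "model ?d ?T $$ (i, i) = ev ?T i" using model_eigen_column[OF i i True] by simp
    show ?thesis
    proof (cases "S i = f")
      case True
      then have e: "ev ?T i = v * (if D i then inverse q else q) ^ (i - f)" unfolding ev_def by simp
      have "i - f \<le> n" using i by simp
      then have v': "v \<noteq> b f * q ^ (i - f)" "v \<noteq> b f * inverse q ^ (i - f)" using v by blast+
      show ?thesis
      proof
        assume "model ?d ?T $$ (i, i) = b f"
        then have "v * (if D i then inverse q else q) ^ (i - f) = b f" unfolding m e .
        then show False using v' q0 by (auto simp: field_simps power_inverse split: if_splits)
      qed
    next
      case F: False
      then have "ev ?T i = ev base i" unfolding ev_def by auto
      moreover have "ev base f = b f" using ev_base[OF f(1)] f(2) by simp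
      ultimately show ?thesis using ev_classes(1)[OF i f(1) True] F f(2) unfolding m by simp
    qed
  qed
  show ?thesis unfolding separated_def
  proof (intro bexI[of _ ?F] conjI allI impI exI[of _ ?T])
    show "?F \<in> poly_funs n"
      by (rule poly_funs.mats_det[OF poly_funs.mats_minus[OF sel_mats poly_funs.mats_const]]) simp
    show "par_denom ts ?T \<noteq> 0" by (rule base_upd_denom[OF off first])
    show "\<forall>y\<in>par_index q ts. y \<noteq> ?x \<longrightarrow> rank ?x \<le> rank y \<longrightarrow> ?T y = base y" by simp
    have c: "model ?d ?T - b f \<cdot>\<^sub>m 1\<^sub>m n \<in> Mat n" by (rule shift_carrier[OF model_carr])
    have "model ?d ?T $$ (i, j) = 0" if ij: "i < n" "j < n" "j < i" for i j
      unfolding model_def using A_entry[OF ij(1,2), of ?T] B_entry[OF ij(1,2), of ?T] base_off[of n j] ij by auto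
    then have ut: "upper_triangular (model ?d ?T - b f \<cdot>\<^sub>m 1\<^sub>m n)"
      unfolding upper_triangular_def using model_carr[of ?d ?T] by auto
    show "?F (par_pair q ts ?T) \<noteq> 0"
      unfolding sel_pair_one[OF off] det_upper_triangular[OF ut c] diag_mat_def prod_list_zero_iff
      using model_carr[of ?d ?T] diag by auto
    fix T assume T: "par_denom ts T \<noteq> 0" "T ?x = base ?x"
    then have G: "det (unit_mat n T) \<noteq> 0" unfolding denom_nz by blast
    let ?X = "sel ?d (par_pair q ts T)" and ?M = "model ?d T" and ?G = "unit_mat n T"
    note si = sel_intertwine[OF G, of ?d]
    have cX: "?X - b f \<cdot>\<^sub>m 1\<^sub>m n \<in> Mat n" and cM: "?M - b f \<cdot>\<^sub>m 1\<^sub>m n \<in> Mat n"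
      by (rule shift_carrier[OF si(1)], rule shift_carrier[OF model_carr])
    have ev: "ev T f = b f" using T(2) f(2) unfolding ev_def base_def by simp
    have "(?M - b f \<cdot>\<^sub>m 1\<^sub>m n) *\<^sub>v unit_vec n f = 0\<^sub>v n"
    proof (rule eq_vecI)
      fix i assume "i < dim_vec (0\<^sub>v n :: 'a vec)"
      then have i: "i < n" by simp
      have "((?M - b f \<cdot>\<^sub>m 1\<^sub>m n) *\<^sub>v unit_vec n f) $ i = (?M - b f \<cdot>\<^sub>m 1\<^sub>m n) $$ (i, f)"
        using cM i f(1) model_carr[of ?d T] by (auto simp: mult_mat_vec_def)
      then show "((?M - b f \<cdot>\<^sub>m 1\<^sub>m n) *\<^sub>v unit_vec n f) $ i = 0\<^sub>v n $ i"
        using model_eigen_column[OF i f(1) refl, of T] i f(1) ev model_carr[of ?d T] by simp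
    qed (use cM in simp)
    moreover have "unit_vec n f \<noteq> (0\<^sub>v n :: 'a vec)" using f(1) by (metis index_unit_vec(2) index_zero_vec(1) zero_neq_one)
    ultimately have "det (?M - b f \<cdot>\<^sub>m 1\<^sub>m n) = 0"
      unfolding det_0_iff_vec_prod_zero[OF cM] using unit_vec_carrier[of n f] by blast
    moreover have "det (?X - b f \<cdot>\<^sub>m 1\<^sub>m n) * det ?G = det ?G * det (?M - b f \<cdot>\<^sub>m 1\<^sub>m n)"
      using arg_cong[OF shift_intertwine[OF si(1) unit_mat_carrier model_carr si(2), of "b f"], of det]
      unfolding det_mult[OF cX unit_mat_carrier] det_mult[OF unit_mat_carrier cM] .
    ultimately show "?F (par_pair q ts T) = 0" using G by simp
  qed
qed

lemma conj_transvection_entry: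
  fixes X :: "'b::comm_ring_1 mat"
  assumes X: "X \<in> Mat n" and Y: "Y \<in> Mat n" and si: "s < n" "i < n" "s \<noteq> i"
    and e: "X * addrow_mat n 1 s i = addrow_mat n 1 s i * Y"
    and z: "Y $$ (s, i) = 0" "Y $$ (s, s) = 0" "Y $$ (i, s) = 0"
  shows "X $$ (s, i) = Y $$ (i, i)"
proof -
  let ?G = "addrow_mat n 1 s i :: 'b mat"
  have G: "?G $$ (r, c) = (if r = c \<or> r = s \<and> c = i then 1 else 0)" if "r < n" "c < n" for r c
    using that si by (auto simp: addrow_mat_def)
  have L: "(X * ?G) $$ (s, c) = (\<Sum>l\<in>(if c = i then {s, i} else {c}). X $$ (s, l))" if "c < n" for c
    unfolding mat_mult_entry[OF X addrow_mat_carrier si(1) that] using that si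
    by (intro sum.mono_neutral_cong_right) (auto simp: G split: if_splits)
  have R: "(?G * Y) $$ (s, c) = (\<Sum>l\<in>{s, i}. Y $$ (l, c))" if "c < n" for c
    unfolding mat_mult_entry[OF addrow_mat_carrier Y si(1) that] using that si
    by (intro sum.mono_neutral_cong_right) (auto simp: G)
  have "X $$ (s, s) = 0" using L[OF si(1)] R[OF si(1)] si z unfolding e by simp
  then show ?thesis using L[OF si(2)] R[OF si(2)] si z unfolding e by simp
qed

text \<open>The product of \<open>A - \<lambda>\<close> and \<open>B - \<mu>\<close> over all joint eigenvalues but the \<open>i\<close>-th maps everything into
  the line of the \<open>i\<close>-th joint eigenvector, whatever the weights are; so its entry \<open>(s, i)\<close> detects whether the \<open>s\<close>-th
  coordinate of that eigenvector vanishes.\<close>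

lemma separated_off_diagonal:
  assumes si: "s < n" "i < n" "s \<noteq> i"
  shows "separated (s, i)"
proof -
  let ?d = "D i" and ?x = "(s, i)"
  let ?same = "map (ev base) (filter (\<lambda>k. D k = ?d \<and> k \<noteq> i) [0..<n])"
  let ?other = "map (ev base) (filter (\<lambda>k. D k \<noteq> ?d) [0..<n])"
  define E where "E X Y = shift_prod n X ?same * shift_prod n Y ?other" for X Y :: "'a mat"
  let ?E = "\<lambda>p. E (sel ?d p) (sel (\<not> ?d) p)" and ?E' = "\<lambda>T. E (model ?d T) (model (\<not> ?d) T)"
  let ?G = "unit_mat n :: (nat \<times> nat \<Rightarrow> 'a) \<Rightarrow> 'a mat"
  have cE: "E X Y \<in> Mat n" if "X \<in> Mat n" "Y \<in> Mat n" for X Y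
    unfolding E_def by (intro mult_carrier_mat[of _ _ n] shift_prod_carrier that)
  have cE': "?E' T \<in> Mat n" for T by (rule cE[OF model_carr model_carr])
  have int: "?E (par_pair q ts T) \<in> Mat n" "?E (par_pair q ts T) * ?G T = ?G T * ?E' T"
    if G: "det (?G T) \<noteq> 0" for T
  proof -
    note s1 = sel_intertwine[OF G, of ?d] and s2 = sel_intertwine[OF G, of "\<not> ?d"]
    show "?E (par_pair q ts T) \<in> Mat n" by (rule cE[OF s1(1) s2(1)])
    show "?E (par_pair q ts T) * ?G T = ?G T * ?E' T"
      unfolding E_def
      by (rule mult_intertwine[OF shift_prod_carrier[OF s1(1)] shift_prod_carrier[OF s2(1)] unit_mat_carrier
          shift_prod_carrier[OF model_carr] shift_prod_carrier[OF model_carr]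
          shift_prod_intertwine[OF s1(1) unit_mat_carrier model_carr s1(2)]
          shift_prod_intertwine[OF s2(1) unit_mat_carrier model_carr s2(2)]])
  qed
  have entry: "?E' T $$ (r, j) = (\<Sum>l\<in>{0..<n}. shift_prod n (model ?d T) ?same $$ (r, l) * shift_prod n (model (\<not> ?d) T) ?other $$ (l, j))"
    if "r < n" "j < n" for T r j
    unfolding E_def by (rule mat_mult_entry[OF shift_prod_carrier[OF model_carr] shift_prod_carrier[OF model_carr] that])
  have ev_eq: "ev T j = ev base j" if T: "\<forall>y\<in>par_index q ts. rank ?x < rank y \<longrightarrow> T y = base y" and j: "j < n" for T j
  proof -
    have "S j < n" "S (S j) = S j" using bounds(1)[OF j] start_start(1)[OF j] j by auto
    then have "T (S j, S j) = base (S j, S j)" using T si unfolding index rank_def by auto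
    then show ?thesis unfolding ev_def by simp
  qed
  have row: "?E' T $$ (r, j) = 0" if T: "\<forall>y\<in>par_index q ts. rank ?x < rank y \<longrightarrow> T y = base y" and rj: "r < n" "j < n" "r \<noteq> i" for T r j
    unfolding entry[OF rj(1,2)]
  proof (rule sum.neutral, rule ballI)
    fix l assume "l \<in> {0..<n}"
    then have l: "l < n" by simp
    show "shift_prod n (model ?d T) ?same $$ (r, l) * shift_prod n (model (\<not> ?d) T) ?other $$ (l, j) = 0"
    proof (cases "D l = ?d")
      case True
      have "shift_prod n (model ?d T) ?same $$ (r, l) = (if r = l then \<Prod>c\<leftarrow>?same. ev T l - c else 0)"
        by (rule shift_prod_column[OF model_carr l model_eigen_column[OF _ l True] rj(1)])
      moreover have "(\<Prod>c\<leftarrow>?same. ev T l - c) = 0" if "r = l"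
        unfolding prod_list_zero_iff using that True l rj(3) ev_eq[OF T l] by force
      ultimately show ?thesis by simp
    next
      case F: False
      have "shift_prod n (model (\<not> ?d) T) ?other $$ (l, j) = 0"
      proof (cases "D j = ?d")
        case True
        show ?thesis
          by (rule shift_prod_invariant[OF model_carr, of "{j. D j = ?d}"]) (use model_invariant l rj(2) F True in auto)
      next
        case False
        then have dj: "D j = (\<not> ?d)" by simp
        have "shift_prod n (model (\<not> ?d) T) ?other $$ (l, j) = (if l = j then \<Prod>c\<leftarrow>?other. ev T j - c else 0)"
          by (rule shift_prod_column[OF model_carr rj(2) model_eigen_column[OF _ rj(2) dj] l])
        moreover have "(\<Prod>c\<leftarrow>?other. ev T j - c) = 0"
          unfolding prod_list_zero_iff using dj rj(2) ev_eq[OF T rj(2)] by force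
        ultimately show ?thesis by simp
      qed
      then show ?thesis by simp
    qed
  qed
  \<comment> \<open>Without weights and corners both models are diagonal, and \<open>G\<close> is a transvection.\<close>
  let ?T = "\<lambda>y. if y = ?x then 1 else if rank y = 0 then 0 else base y"
  have T2: "\<forall>y\<in>par_index q ts. rank ?x < rank y \<longrightarrow> ?T y = base y" by auto
  have Gr: "?G ?T $$ (r, c) = (if r = c \<or> r = s \<and> c = i then 1 else 0)" if "r < n" "c < n" for r c
    using that si by (auto simp: unit_mat_def rank_def base_def)
  have Ga: "?G ?T = addrow_mat n 1 s i"
    by (rule mat_eqI[OF unit_mat_carrier addrow_mat_carrier]) (use Gr si in \<open>auto simp: addrow_mat_def\<close>)
  have detG: "det (?G ?T) = 1" unfolding Ga using det_addrow_mat[OF si(3), of n 1] by simp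
  have first: "?T (f, f) \<noteq> 0" if "f < n" "S f = f" for f using that b0[of f] si by (auto simp: rank_def base_def)
  have nzT: "par_denom ts ?T \<noteq> 0" unfolding denom_nz using detG first by auto
  have dg: "model e ?T $$ (r, j) = (if r = j then if D j = e then ev ?T j else 0 else 0)" if "r < n" "j < n" for e r j
    by (rule model_diagonal[OF that]) (use si that in \<open>auto simp: rank_def\<close>)
  have col: "shift_prod n (model e ?T) cs $$ (r, j) = (if r = j then \<Prod>c\<leftarrow>cs. (if D j = e then ev ?T j else 0) - c else 0)"
    if "r < n" "j < n" for e cs r j
    by (rule shift_prod_column[OF model_carr that(2) dg[OF _ that(2)] that(1)])
  have evT: "ev ?T j = ev base j" if "j < n" for j by (rule ev_eq[OF T2 that])
  have E'T: "?E' ?T $$ (r, j) = (if r = j then (\<Prod>c\<leftarrow>?same. (if D j = ?d then ev base j else 0) - c) *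
      (\<Prod>c\<leftarrow>?other. (if D j \<noteq> ?d then ev base j else 0) - c) else 0)" if rj: "r < n" "j < n" for r j
  proof -
    have "?E' ?T $$ (r, j) = (\<Sum>l\<in>{0..<n}. (if r = l then \<Prod>c\<leftarrow>?same. (if D l = ?d then ev ?T l else 0) - c else 0) *
        (if l = j then \<Prod>c\<leftarrow>?other. (if D j = (\<not> ?d) then ev ?T j else 0) - c else 0))"
      unfolding entry[OF rj] by (rule sum.cong[OF refl]) (simp only: atLeastLessThan_iff col rj)
    also have "\<dots> = (\<Sum>l\<in>{0..<n}. if l = j then (if r = j then (\<Prod>c\<leftarrow>?same. (if D j = ?d then ev ?T j else 0) - c) *
        (\<Prod>c\<leftarrow>?other. (if D j = (\<not> ?d) then ev ?T j else 0) - c) else 0) else 0)"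
      by (intro sum.cong refl) auto
    also have "\<dots> = (if r = j then (\<Prod>c\<leftarrow>?same. (if D j = ?d then ev base j else 0) - c) *
      (\<Prod>c\<leftarrow>?other. (if D j \<noteq> ?d then ev base j else 0) - c) else 0)" using rj evT[of j] by simp
    finally show ?thesis .
  qed
  let ?c = "?E' ?T $$ (i, i)"
  have c: "?c \<noteq> 0"
    unfolding E'T[OF si(2,2)] using ev_distinct[OF si(2)] ev_base_nz by (fastforce simp: prod_list_zero_iff)
  show ?thesis unfolding separated_def
  proof (intro bexI[of _ "\<lambda>p. ?E p $$ (s, i)"] conjI allI impI exI[of _ ?T])
    show "(\<lambda>p. ?E p $$ (s, i)) \<in> poly_funs n"
      unfolding E_def
      by (rule poly_funs.mats_entry[OF poly_funs.mats_mult[OF poly_funs.mats_shift_prod[OF sel_mats]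
          poly_funs.mats_shift_prod[OF sel_mats]] si(1,2)])
    show "par_denom ts ?T \<noteq> 0" by (rule nzT)
    show "\<forall>y\<in>par_index q ts. y \<noteq> ?x \<longrightarrow> rank ?x \<le> rank y \<longrightarrow> ?T y = base y" using si by (auto simp: rank_def)
    have "det (?G ?T) \<noteq> 0" using detG by simp
    note I = int[OF this]
    have "?E (par_pair q ts ?T) $$ (s, i) = ?c"
      by (rule conj_transvection_entry[OF I(1) cE' si I(2)[unfolded Ga] row[OF T2 si(1,2,3)] row[OF T2 si(1,1,3)]])
        (use E'T[OF si(2,1)] not_sym[OF si(3)] in \<open>simp only: if_False\<close>)
    then show "?E (par_pair q ts ?T) $$ (s, i) \<noteq> 0" using c by metis
    fix T assume T: "par_denom ts T \<noteq> 0" "T ?x = base ?x" "\<forall>y\<in>par_index q ts. rank ?x < rank y \<longrightarrow> T y = base y"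
    then have G: "det (?G T) \<noteq> 0" unfolding denom_nz by blast
    let ?X = "?E (par_pair q ts T)"
    have G0: "?G T $$ (s, i) = 0" using T(2) si base_off[OF si(3)] by (simp add: unit_mat_def)
    have z: "(?X * ?G T) $$ (s, j) = 0" if j: "j < n" for j
      unfolding int(2)[OF G] mat_mult_entry[OF unit_mat_carrier cE' si(1) j]
    proof (rule sum.neutral, rule ballI)
      fix l assume "l \<in> {0..<n}"
      then show "?G T $$ (s, l) * ?E' T $$ (l, j) = 0" using row[OF T(3) _ j, of l] G0 by (cases "l = i") auto
    qed
    note a = adj_mat[OF unit_mat_carrier[of n T]]
    have "det (?G T) * ?X $$ (s, i) = (det (?G T) \<cdot>\<^sub>m ?X) $$ (s, i)" using int(1)[OF G] si by simp
    also have "det (?G T) \<cdot>\<^sub>m ?X = ?X * ?G T * adj_mat (?G T)"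
      unfolding assoc_mult_mat[OF int(1)[OF G] unit_mat_carrier a(1)] a(2) mult_smult_distrib[OF int(1)[OF G] one_carrier_mat]
        right_mult_one_mat[OF int(1)[OF G]] ..
    also have "\<dots> $$ (s, i) = 0"
      unfolding mat_mult_entry[OF mult_carrier_mat[OF int(1)[OF G] unit_mat_carrier] a(1) si(1,2)]
      by (rule sum.neutral) (simp add: z)
    finally show "?X $$ (s, i) = 0" using G by simp
  qed
qed

theorem K_types_chain: "\<exists>Z. irr_chain n (K_types q ts) (card (par_index q ts)) Z"
  unfolding K_types_eq_par
proof (rule param_family.chain_from_ranking[OF param, where ?T0.0 = base and \<rho> = rank])
  show "par_denom ts base \<noteq> 0" by (rule base_denom)
  show "par_pair q ts T = par_pair q ts T' \<and> par_denom ts T = par_denom ts T'" if "\<And>i. i \<in> par_index q ts \<Longrightarrow> T i = T' i" for T T'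
    by (rule dependence[OF that])
  fix x assume x: "x \<in> par_index q ts"
  have "separated x"
  proof (cases "rank x = 0")
    case False
    then obtain i j where "x = (i, j)" "i < n" "j < n" "i = j \<longrightarrow> S i = i"
      using x unfolding index rank_def full_starts_def nsum by (auto split: if_splits)
    then show ?thesis using separated_eigenvalue[of i] separated_off_diagonal[of i j] by (cases "i = j") auto
  qed (rule separated_weight[OF x])
  then show "\<exists>F\<in>poly_funs n.
     (\<forall>T. par_denom ts T \<noteq> 0 \<longrightarrow> T x = base x \<longrightarrow> (\<forall>y\<in>par_index q ts. rank x < rank y \<longrightarrow> T y = base y) \<longrightarrow> F (par_pair q ts T) = 0) \<and>
     (\<exists>T. par_denom ts T \<noteq> 0 \<and> (\<forall>y\<in>par_index q ts. y \<noteq> x \<longrightarrow> rank x \<le> rank y \<longrightarrow> T y = base y) \<and> F (par_pair q ts T) \<noteq> 0)"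
    unfolding separated_def .
qed

end

section \<open>No closure contains another\<close>

context block_family
begin

definition cyc_succ :: "nat \<Rightarrow> nat" where
  "cyc_succ j = (if Suc j < S j + K j then Suc j else S j)"

definition cyc_pred :: "nat \<Rightarrow> nat" where
  "cyc_pred j = (if S j = j then S j + K j - 1 else j - 1)"

lemma cyc:
  assumes "j < n"
  shows "cyc_succ j < n" "S (cyc_succ j) = S j" "cyc_pred (cyc_succ j) = j"
    "cyc_pred j < n" "S (cyc_pred j) = S j" "cyc_succ (cyc_pred j) = j"
proof -
  note b = bounds(1-3)[OF assms]
  have s: "S j \<le> cyc_succ j" "cyc_succ j < S j + K j" using b unfolding cyc_succ_def by auto
  have p: "S j \<le> cyc_pred j" "cyc_pred j < S j + K j" using b unfolding cyc_pred_def by auto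
  note s' = same_block[OF assms s] and p' = same_block[OF assms p]
  show "cyc_succ j < n" "S (cyc_succ j) = S j" "cyc_pred j < n" "S (cyc_pred j) = S j" using s p s' p' b by auto
  show "cyc_pred (cyc_succ j) = j" unfolding cyc_pred_def using s' b by (auto simp: cyc_succ_def)
  show "cyc_succ (cyc_pred j) = j" unfolding cyc_succ_def using p' b by (auto simp: cyc_pred_def)
qed

lemma full_block:
  assumes f: "f \<in> full_starts q ts" and j: "j < n" "S j = f"
  shows "D j" "enat (K j) = qorder q" "f < n" "q ^ K j = 1" "S f = f"
proof -
  have f': "f < n" "D f" "S f = f" "enat (K f) = qorder q" using f unfolding full_starts_def nsum by auto
  then show "D j" "enat (K j) = qorder q" "f < n" "S f = f" using start_start(2,3)[OF j(1)] j(2) by auto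
  then show "q ^ K j = 1" using qorder_finite(2)[of q "K j"] by simp
qed

definition weight :: "(nat \<times> nat \<Rightarrow> 'a) \<Rightarrow> nat \<Rightarrow> 'a" where
  "weight T j = (if S j = j then T (n, j) else T (j, j))"

definition eig :: "(nat \<times> nat \<Rightarrow> 'a) \<Rightarrow> nat \<Rightarrow> 'a" where
  "eig T j = T (S j, S j) * inverse q ^ (j - S j)"

lemma full_columns:
  assumes f: "f \<in> full_starts q ts" and j: "j < n" "S j = f" and l: "l < n"
  shows "model True T $$ (l, j) = (if l = j then eig T j else 0)"
    and "model False T $$ (l, j) = (if l = cyc_pred j then weight T j else 0)"
proof -
  note F = full_block[OF f j]
  show "model True T $$ (l, j) = (if l = j then eig T j else 0)"
    unfolding model_def eig_def using A_entry[OF l j(1)] F(1) by simp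
  have k: "0 < K j" using bounds(1,2)[OF j(1)] by linarith
  show "model False T $$ (l, j) = (if l = cyc_pred j then weight T j else 0)"
  proof (cases "S j = j")
    case True
    have "Suc l = j + K j \<longleftrightarrow> l = S j + K j - 1" using True k by linarith
    then show ?thesis unfolding model_def weight_def cyc_pred_def using B_entry[OF l j(1), of T] F(1,2) True by simp
  next
    case False
    then have "j \<noteq> 0" using bounds(1)[OF j(1)] by linarith
    then have "Suc l = j \<longleftrightarrow> l = j - 1" by linarith
    then show ?thesis unfolding model_def weight_def cyc_pred_def using B_entry[OF l j(1), of T] F(1) False by simp
  qed
qed

text \<open>On a summand of size the order of \<open>q\<close>, the equations say that \<open>Z\<close> is a weighted cyclic shift whose
  weights \<open>z\<close> satisfy \<open>w\<^sub>j\<^sub>+\<^sub>1 z\<^sub>j\<^sub>+\<^sub>1 = q w\<^sub>j z\<^sub>j\<close> around the cycle, where \<open>w\<close> are the weights of \<open>B\<close>. This is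
  consistent since \<open>q\<close> to the length of the cycle is 1; and if some \<open>w\<^sub>j\<close> vanishes, \<open>z\<close> can be supported at \<open>j\<close>.\<close>

lemma full_block_solution:
  assumes f: "f \<in> full_starts q ts"
  shows "\<exists>Z\<in>carrier_mat n n. Z * model True T = q \<cdot>\<^sub>m (model True T * Z) \<and> model False T * Z = q \<cdot>\<^sub>m (Z * model False T) \<and>
    (\<exists>i<n. \<exists>j<n. S j = f \<and> Z $$ (i, j) \<noteq> 0) \<and> (\<forall>i<n. \<forall>j<n. S j \<noteq> f \<longrightarrow> Z $$ (i, j) = 0)"
proof -
  have f': "f < n" "S f = f" using f unfolding full_starts_def nsum by auto
  have "\<exists>z e. (\<exists>i<n. S i = f \<and> z i \<noteq> 0) \<and> (\<forall>i<n. S i = f \<longrightarrow> weight T i * z i = e * q ^ (i - f))"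
  proof (cases "\<exists>i<n. S i = f \<and> weight T i = 0")
    case True
    then obtain k where k: "k < n" "S k = f" "weight T k = 0" by blast
    then show ?thesis
      by (intro exI[of _ "\<lambda>i. if i = k then 1 else 0"] exI[of _ "0 :: 'a"]) (auto intro!: exI[of _ k])
  next
    case False
    then show ?thesis using f' q0
      by (intro exI[of _ "\<lambda>i. q ^ (i - f) / weight T i"] exI[of _ "1 :: 'a"]) (auto intro!: exI[of _ f])
  qed
  then obtain z e i0 where z: "i0 < n" "S i0 = f" "z i0 \<noteq> 0"
    "\<And>i. i < n \<Longrightarrow> S i = f \<Longrightarrow> weight T i * z i = e * q ^ (i - f)" by blast
  define Z where "Z = mat n n (\<lambda>(i, j). if S j = f \<and> i = cyc_succ j then z i else 0)"
  have Z: "Z \<in> Mat n" unfolding Z_def by simp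
  have Zij: "Z $$ (i, j) = (if S j = f \<and> i = cyc_succ j then z i else 0)" if "i < n" "j < n" for i j
    unfolding Z_def using that by simp
  let ?A = "model True T" and ?B = "model False T"
  have A: "?A \<in> Mat n" and B: "?B \<in> Mat n" by (rule model_carr)+
  have up: "q ^ (cyc_succ j - f) = q * q ^ (j - f)" if "j < n" "S j = f" for j
  proof -
    have b: "f \<le> j" "j < f + K j" using bounds(1,2)[OF that(1)] that(2) by auto
    show ?thesis
    proof (cases "Suc j < S j + K j")
      case True
      then have "cyc_succ j - f = Suc (j - f)" using b unfolding cyc_succ_def that(2) by simp
      then show ?thesis by simp
    next
      case False
      then have "cyc_succ j - f = 0" "Suc (j - f) = K j" using b unfolding cyc_succ_def that(2) by auto
      then show ?thesis using full_block(4)[OF f that] by (metis power_0 power_Suc)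
    qed
  qed
  have dead: "Z $$ (i, l) * model d T $$ (l, j) = 0" "model d T $$ (i, l) * Z $$ (l, j) = 0"
    if "i < n" "j < n" "l < n" "S j \<noteq> f" for i j l d
  proof -
    show "Z $$ (i, l) * model d T $$ (l, j) = 0"
      using Zij[OF that(1,3)] model_block_diagonal[OF that(3,2), of d T] that(4) by (cases "S l = S j") auto
    show "model d T $$ (i, l) * Z $$ (l, j) = 0" using Zij[OF that(3,2)] that(4) by simp
  qed
  have "Z * ?A = q \<cdot>\<^sub>m (?A * Z)"
  proof (rule mat_eqI[OF mult_carrier_mat[OF Z A] smult_carrier_mat[OF mult_carrier_mat[OF A Z]]])
    fix i j assume ij: "i < n" "j < n"
    have sm: "(q \<cdot>\<^sub>m (?A * Z)) $$ (i, j) = q * (?A * Z) $$ (i, j)" using A Z ij by simp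
    show "(Z * ?A) $$ (i, j) = (q \<cdot>\<^sub>m (?A * Z)) $$ (i, j)"
    proof (cases "S j = f")
      case False
      have "(Z * ?A) $$ (i, j) = 0" "(?A * Z) $$ (i, j) = 0"
        unfolding mat_mult_entry[OF Z A ij] mat_mult_entry[OF A Z ij]
        by (rule sum.neutral, use dead[OF ij _ False] in simp)+
      then show ?thesis unfolding sm by simp
    next
      case True
      note c = cyc(1-3)[OF ij(2)]
      have "(Z * ?A) $$ (i, j) = (\<Sum>l\<in>{0..<n}. if l = j then Z $$ (i, j) * eig T j else 0)"
        unfolding mat_mult_entry[OF Z A ij] by (rule sum.cong) (auto simp: full_columns(1)[OF f ij(2) True])
      then have 1: "(Z * ?A) $$ (i, j) = (if i = cyc_succ j then z i * eig T j else 0)" using ij True Zij[OF ij] by simp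
      have "(?A * Z) $$ (i, j) = (\<Sum>l\<in>{0..<n}. if l = cyc_succ j then ?A $$ (i, l) * z l else 0)"
        unfolding mat_mult_entry[OF A Z ij] using True ij by (intro sum.cong) (auto simp: Zij)
      then have 2: "(?A * Z) $$ (i, j) = (if i = cyc_succ j then eig T i * z i else 0)"
        using c full_columns(1)[OF f c(1) c(2)[unfolded True] ij(1), of T] by simp
      have "eig T j = q * eig T (cyc_succ j)"
        using up[OF ij(2) True] q0 c(2) True unfolding eig_def by (auto simp: field_simps power_inverse)
      then show ?thesis unfolding sm 1 2 by simp
    qed
  qed
  moreover have "?B * Z = q \<cdot>\<^sub>m (Z * ?B)"
  proof (rule mat_eqI[OF mult_carrier_mat[OF B Z] smult_carrier_mat[OF mult_carrier_mat[OF Z B]]])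
    fix i j assume ij: "i < n" "j < n"
    have sm: "(q \<cdot>\<^sub>m (Z * ?B)) $$ (i, j) = q * (Z * ?B) $$ (i, j)" using B Z ij by simp
    show "(?B * Z) $$ (i, j) = (q \<cdot>\<^sub>m (Z * ?B)) $$ (i, j)"
    proof (cases "S j = f")
      case False
      have "(Z * ?B) $$ (i, j) = 0" "(?B * Z) $$ (i, j) = 0"
        unfolding mat_mult_entry[OF Z B ij] mat_mult_entry[OF B Z ij]
        by (rule sum.neutral, use dead[OF ij _ False] in simp)+
      then show ?thesis unfolding sm by simp
    next
      case True
      note c = cyc[OF ij(2)]
      have "(?B * Z) $$ (i, j) = (\<Sum>l\<in>{0..<n}. if l = cyc_succ j then ?B $$ (i, l) * z l else 0)"
        unfolding mat_mult_entry[OF B Z ij] using True ij by (intro sum.cong) (auto simp: Zij)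
      then have 1: "(?B * Z) $$ (i, j) = (if i = j then weight T (cyc_succ j) * z (cyc_succ j) else 0)"
        using c full_columns(2)[OF f c(1) c(2)[unfolded True] ij(1), of T] by simp
      have "(Z * ?B) $$ (i, j) = (\<Sum>l\<in>{0..<n}. if l = cyc_pred j then Z $$ (i, l) * weight T j else 0)"
        unfolding mat_mult_entry[OF Z B ij] by (rule sum.cong) (auto simp: full_columns(2)[OF f ij(2) True])
      then have 2: "(Z * ?B) $$ (i, j) = (if i = j then weight T j * z j else 0)"
        using c True Zij[OF ij(1) c(4)] by simp
      have "weight T (cyc_succ j) * z (cyc_succ j) = q * (weight T j * z j)"
        unfolding z(4)[OF c(1) c(2)[unfolded True]] z(4)[OF ij(2) True] up[OF ij(2) True] by simp
      then show ?thesis unfolding sm 1 2 by simp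
    qed
  qed
  moreover have "Z $$ (i0, cyc_pred i0) \<noteq> 0" using Zij[OF z(1) cyc(4)[OF z(1)]] cyc(5,6)[OF z(1)] z(2,3) by simp
  moreover have "Z $$ (i, j) = 0" if "i < n" "j < n" "S j \<noteq> f" for i j using Zij[OF that(1,2)] that(3) by simp
  ultimately show ?thesis using Z z(1) cyc(4,5)[OF z(1)] z(2) by (intro bexI[OF _ Z]) blast
qed

end

context block_family_base
begin

lemma base_model_column:
  assumes "r < n" "j < n"
  shows "model d base $$ (r, j) = (if D j = d then if r = j then ev base j else 0
    else if Suc r = j \<and> S j \<noteq> j then 1 else 0)"
  unfolding model_def ev_def using A_entry[OF assms, of base] B_entry[OF assms, of base] assms base_off[of n j]
  by (auto simp: base_def)

lemma base_mult_right:
  assumes Z: "Z \<in> Mat n" and ij: "i < n" "j < n"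
  shows "(Z * model d base) $$ (i, j) = (if D j = d then Z $$ (i, j) * ev base j else if S j \<noteq> j then Z $$ (i, j - 1) else 0)"
proof -
  have "(Z * model d base) $$ (i, j) = (\<Sum>l\<in>{0..<n}. if l = (if D j = d then j else j - 1)
      then if D j = d then Z $$ (i, l) * ev base j else if S j \<noteq> j then Z $$ (i, l) else 0 else 0)"
    unfolding mat_mult_entry[OF Z model_carr ij]
    using bounds(1)[OF ij(2)] ij by (intro sum.cong) (auto simp: base_model_column)
  moreover have "j - 1 < n" using ij by simp
  ultimately show ?thesis using ij by simp
qed

lemma base_mult_left:
  assumes Z: "Z \<in> Mat n" and ij: "i < n" "j < n"
  shows "(model d base * Z) $$ (i, j) = (if D i = d then ev base i * Z $$ (i, j)
    else if Suc i < S i + K i then Z $$ (Suc i, j) else 0)"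
proof (cases "Suc i < S i + K i")
  case True
  then have s: "S (Suc i) = S i" "D (Suc i) = D i" "Suc i < n" using same_block[OF ij(1), of "Suc i"] bounds(1,3)[OF ij(1)] by auto
  have s': "S (Suc i) \<noteq> Suc i" using s bounds(1)[OF ij(1)] by simp
  have e: "model d base $$ (i, l) = (if l = (if D i = d then i else Suc i) then if D i = d then ev base i else 1 else 0)" if "l < n" for l
    using base_model_column[OF ij(1) that, of d] s s' by auto
  have "(model d base * Z) $$ (i, j) = (\<Sum>l\<in>{0..<n}. if l = (if D i = d then i else Suc i)
      then if D i = d then ev base i * Z $$ (l, j) else Z $$ (l, j) else 0)"
    unfolding mat_mult_entry[OF model_carr Z ij] by (rule sum.cong) (auto simp: e)
  then show ?thesis using ij s(3) True by simp
next
  case False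
  have e: "model d base $$ (i, l) = (if l = i then if D i = d then ev base i else 0 else 0)" if "l < n" for l
  proof -
    have "\<not> (Suc i = l \<and> S l \<noteq> l)"
    proof
      assume l: "Suc i = l \<and> S l \<noteq> l"
      then have "S i = S l \<and> K i = K l" using pred_block[of i] that by simp
      then show False using bounds(2)[OF that] False l by simp
    qed
    then show ?thesis using base_model_column[OF ij(1) that, of d] by auto
  qed
  have "(model d base * Z) $$ (i, j) = (\<Sum>l\<in>{0..<n}. if l = i then if D i = d then ev base i * Z $$ (l, j) else 0 else 0)"
    unfolding mat_mult_entry[OF model_carr Z ij] by (rule sum.cong) (auto simp: e)
  then show ?thesis using ij False by simp
qed

text \<open>The base eigenvalues being in different classes, a quotient \<open>q\<close> occurs only within a block, and there only between cyclic neighbours.\<close>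

lemma ev_step:
  assumes ij: "i < n" "j < n" "D i = D j" and e: "if D i then ev base j = q * ev base i else ev base i = q * ev base j"
  shows "S i = S j" and "i = Suc j \<or> (S i \<in> full_starts q ts \<and> i = S i \<and> Suc j = S i + K i)"
proof -
  show s: "S i = S j" using ev_classes(2,3)[OF ij] e by (metis (full_types))
  have K: "K i = K j" using start_start(3)[OF ij(1)] start_start(3)[OF ij(2)] s by simp
  let ?u = "i - S i" and ?v = "j - S j"
  note b = bounds(1,2)[OF ij(1)] bounds(1,2)[OF ij(2)]
  have bi: "b (S j) \<noteq> 0" using b0[of "S j"] b(3) ij(2) by simp
  have eq: "q ^ ?u = q ^ Suc ?v"
    using e bi q0 ij(3) s unfolding ev_base[OF ij(1)] ev_base[OF ij(2)]
    by (auto simp: field_simps power_inverse split: if_splits)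
  have uv: "?u < K i" "?v < K i" using b K by auto
  show "i = Suc j \<or> (S i \<in> full_starts q ts \<and> i = S i \<and> Suc j = S i + K i)"
  proof (cases "enat (K i) < qorder q \<or> Suc ?v < K i")
    case True
    then have "?u = Suc ?v"
    proof
      assume "enat (K i) < qorder q"
      then have "enat (Suc (K i)) \<le> qorder q" by (metis Suc_ile_eq)
      from qorder_distinct_powers[OF this q0 _ _ eq] show ?thesis using uv by simp
    next
      assume "Suc ?v < K i"
      from qorder_distinct_powers[OF bounds(4)[OF ij(1)] q0 uv(1) this eq] show ?thesis .
    qed
    then show ?thesis using b s by auto
  next
    case False
    then have k: "enat (K i) = qorder q" "Suc ?v = K i" using bounds(4)[OF ij(1)] uv by auto
    then have "q ^ ?u = q ^ 0" using eq qorder_finite(2)[of q "K i"] by simp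
    from qorder_distinct_powers[OF bounds(4)[OF ij(1)] q0 uv(1) _ this] uv have "?u = 0" by simp
    moreover have "D i" using bounds(5)[OF ij(1)] k(1) by auto
    ultimately have "S i \<in> full_starts q ts"
      unfolding full_starts_def nsum using start_start[OF ij(1)] k(1) b ij(1) by auto
    then show ?thesis using \<open>?u = 0\<close> k(2) b s K by auto
  qed
qed

text \<open>At the base point, where all corners vanish, such a shift has \<open>w = 0\<close> at the first index and \<open>w = 1\<close> elsewhere,
  so only the entry at the corner survives; and there is nothing else.\<close>

lemma base_rigid:
  assumes Z: "Z \<in> Mat n" and e1: "Z * model True base = q \<cdot>\<^sub>m (model True base * Z)"
    and e2: "model False base * Z = q \<cdot>\<^sub>m (Z * model False base)"
    and corner: "\<And>f. f \<in> full_starts q ts \<Longrightarrow> Z $$ (f, f + K f - 1) = 0"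
    and ij: "i < n" "j < n"
  shows "Z $$ (i, j) = 0"
proof -
  have E1: "(if D j then Z $$ (i, j) * ev base j else if S j \<noteq> j then Z $$ (i, j - 1) else 0) =
      q * (if D i then ev base i * Z $$ (i, j) else if Suc i < S i + K i then Z $$ (Suc i, j) else 0)"
    if ij: "i < n" "j < n" for i j
    using arg_cong[OF e1, of "\<lambda>M. M $$ (i, j)"] base_mult_right[OF Z ij, of True] base_mult_left[OF Z ij, of True] Z ij
      model_carr[of True base] by simp
  have E2: "(if \<not> D i then ev base i * Z $$ (i, j) else if Suc i < S i + K i then Z $$ (Suc i, j) else 0) =
      q * (if \<not> D j then Z $$ (i, j) * ev base j else if S j \<noteq> j then Z $$ (i, j - 1) else 0)"
    if ij: "i < n" "j < n" for i j
    using arg_cong[OF e2, of "\<lambda>M. M $$ (i, j)"] base_mult_right[OF Z ij, of False] base_mult_left[OF Z ij, of False] Z ij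
      model_carr[of False base] by simp
  have sub: "Z $$ (Suc j, j) = 0" if "Suc j < S j + K j" "j < n" for j
    using that
  proof (induction j)
    case 0
    have "S 0 = 0" using bounds(1)[OF 0(2)] by simp
    then show ?case using E1[OF 0(2) 0(2)] E2[OF 0(2) 0(2)] 0 q0 by (cases "D 0") auto
  next
    case (Suc j)
    have "(if S (Suc j) \<noteq> Suc j then Z $$ (Suc j, j) else 0) = 0"
    proof (cases "S (Suc j) = Suc j")
      case False
      then have "S j = S (Suc j)" "K j = K (Suc j)" using pred_block[OF Suc.prems(2)] by auto
      then show ?thesis using Suc by simp
    qed simp
    then show ?case using E1[OF Suc.prems(2,2), unfolded diff_Suc_1] E2[OF Suc.prems(2,2), unfolded diff_Suc_1] Suc.prems q0
      by (cases "D (Suc j)") simp_all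
  qed
  show ?thesis
  proof (cases "D i = D j")
    case True
    show ?thesis
    proof (rule ccontr)
      assume nz: "Z $$ (i, j) \<noteq> 0"
      have "if D i then ev base j = q * ev base i else ev base i = q * ev base j"
        using E1[OF ij] E2[OF ij] True nz by (auto simp: mult.left_commute)
      from ev_step[OF ij True this] have s: "S i = S j"
        and "i = Suc j \<or> (S i \<in> full_starts q ts \<and> i = S i \<and> Suc j = S i + K i)" by auto
      then show False
      proof (elim disjE conjE)
        assume "i = Suc j"
        moreover have "Suc j < S j + K j"
          using bounds(2)[OF ij(1)] start_start(3)[OF ij(1)] start_start(3)[OF ij(2)] s \<open>i = Suc j\<close> by simp
        ultimately show False using sub ij nz by simp
      next
        assume f: "S i \<in> full_starts q ts" "i = S i" "Suc j = S i + K i"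
        then have "j = i + K i - 1" by simp
        then show False using corner[of i] f(1,2) nz by simp
      qed
    qed
  next
    case False
    show ?thesis
    proof (cases "D i")
      case True
      then have "\<not> D j" using False by simp
      then show ?thesis using ij
      proof (induction j)
        case 0
        then have "S 0 = 0" using bounds(1)[of 0] by simp
        then show ?case using E1[OF 0(2,3)] 0 True q0 ev_base_nz[OF 0(2)] by simp
      next
        case (Suc j)
        have "(if S (Suc j) \<noteq> Suc j then Z $$ (i, j) else 0) = 0"
          using Suc pred_block[OF Suc.prems(3)] by auto
        then show ?case using E1[OF Suc.prems(2,3), unfolded diff_Suc_1] Suc.prems True q0 ev_base_nz[OF Suc.prems(2)] by simp
      qed
    next
      case Di: False
      then have Dj: "D j" using False by simp
      show ?thesis using Di ij(1)
      proof (induction "n - i" arbitrary: i rule: less_induct)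
        case less
        have "(if Suc i < S i + K i then Z $$ (Suc i, j) else 0) = 0"
        proof (cases "Suc i < S i + K i")
          case True
          then have "D (Suc i) = D i" "Suc i < n"
            using same_block[OF less.prems(2), of "Suc i"] bounds(1,3)[OF less.prems(2)] by auto
          then show ?thesis using less.hyps[of "Suc i"] less.prems by simp
        qed simp
        then show ?case using E1[OF less.prems(2) ij(2)] less.prems Dj ev_base_nz[OF ij(2)] by simp
      qed
    qed
  qed
qed

end

lemma sum_row_mult:
  fixes X :: "'a::comm_ring_1 mat"
  assumes X: "X \<in> Mat n" and Z: "Z \<in> Mat n" and ij: "i < n" "j < n"
  shows "(\<Sum>x\<in>{..<n} \<times> {..<n}. (if fst x = i then X $$ (snd x, j) else 0) * Z $$ x) = (Z * X) $$ (i, j)" (is ?R)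
    and "(\<Sum>x\<in>{..<n} \<times> {..<n}. (if snd x = j then X $$ (i, fst x) else 0) * Z $$ x) = (X * Z) $$ (i, j)" (is ?L)
proof -
  have "(\<Sum>x\<in>{..<n} \<times> {..<n}. (if fst x = i then X $$ (snd x, j) else 0) * Z $$ x)
      = (\<Sum>r<n. \<Sum>c<n. (if r = i then X $$ (c, j) else 0) * Z $$ (r, c))"
    by (simp add: sum.cartesian_product case_prod_beta)
  also have "\<dots> = (\<Sum>r<n. if r = i then \<Sum>c<n. X $$ (c, j) * Z $$ (r, c) else 0)"
    by (rule sum.cong) auto
  also have "\<dots> = (\<Sum>c\<in>{0..<n}. Z $$ (i, c) * X $$ (c, j))"
    using ij by (simp add: lessThan_atLeast0 mult.commute)
  finally show ?R unfolding mat_mult_entry[OF Z X ij] .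
  have "(\<Sum>x\<in>{..<n} \<times> {..<n}. (if snd x = j then X $$ (i, fst x) else 0) * Z $$ x)
      = (\<Sum>r<n. \<Sum>c<n. if c = j then X $$ (i, r) * Z $$ (r, c) else 0)"
  proof -
    have "(\<Sum>x\<in>{..<n} \<times> {..<n}. (if snd x = j then X $$ (i, fst x) else 0) * Z $$ x)
        = (\<Sum>r<n. \<Sum>c<n. (if c = j then X $$ (i, r) else 0) * Z $$ (r, c))"
      by (simp add: sum.cartesian_product case_prod_beta)
    also have "\<dots> = (\<Sum>r<n. \<Sum>c<n. if c = j then X $$ (i, r) * Z $$ (r, c) else 0)" by (intro sum.cong refl) simp
    finally show ?thesis .
  qed
  also have "\<dots> = (\<Sum>r\<in>{0..<n}. X $$ (i, r) * Z $$ (r, j))" using ij by (simp add: lessThan_atLeast0)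
  finally show ?L unfolding mat_mult_entry[OF X Z ij] .
qed

lemma sandwich_lincomb:
  fixes G :: "'a::comm_ring_1 mat"
  assumes G: "G \<in> Mat n" and H: "H \<in> Mat n" and Z: "\<And>f. Z f \<in> Mat n" and ij: "i < n" "j < n"
  shows "(G * mat n n (\<lambda>ij. \<Sum>f\<in>I. c f * Z f $$ ij) * H) $$ (i, j) = (\<Sum>f\<in>I. c f * (G * Z f * H) $$ (i, j))"
proof -
  let ?Z = "mat n n (\<lambda>ij. \<Sum>f\<in>I. c f * Z f $$ ij)"
  have e: "(G * M * H) $$ (i, j) = (\<Sum>s\<in>{0..<n}. \<Sum>r\<in>{0..<n}. G $$ (i, r) * M $$ (r, s) * H $$ (s, j))"
    if M: "M \<in> Mat n" for M
    unfolding mat_mult_entry[OF mult_carrier_mat[OF G M] H ij]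
    by (rule sum.cong[OF refl]) (simp add: mat_mult_entry[OF G M ij(1)] sum_distrib_right)
  have "(G * ?Z * H) $$ (i, j) = (\<Sum>s\<in>{0..<n}. \<Sum>r\<in>{0..<n}. \<Sum>f\<in>I. c f * (G $$ (i, r) * Z f $$ (r, s) * H $$ (s, j)))"
    unfolding e[OF mat_carrier] by (intro sum.cong refl) (simp add: sum_distrib_left sum_distrib_right algebra_simps)
  also have "\<dots> = (\<Sum>s\<in>{0..<n}. \<Sum>f\<in>I. \<Sum>r\<in>{0..<n}. c f * (G $$ (i, r) * Z f $$ (r, s) * H $$ (s, j)))"
    by (intro sum.cong refl sum.swap)
  also have "\<dots> = (\<Sum>f\<in>I. \<Sum>s\<in>{0..<n}. \<Sum>r\<in>{0..<n}. c f * (G $$ (i, r) * Z f $$ (r, s) * H $$ (s, j)))"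
    by (rule sum.swap)
  finally show ?thesis unfolding e[OF Z] by (simp add: sum_distrib_left)
qed

text \<open>The linear system in the unknown entries of \<open>Z\<close>, for a pair \<open>p\<close>: \<open>Z A = q A Z\<close>, \<open>B Z = q Z B\<close>, and
  vanishing of single entries.\<close>

definition Z_system :: "'a::field \<Rightarrow> nat \<Rightarrow> nat \<times> nat \<times> nat \<Rightarrow> nat \<times> nat \<Rightarrow> 'a mat \<times> 'a mat \<Rightarrow> 'a" where
  "Z_system q n = (\<lambda>(k, i, j) x p.
     if k = 0 then (if fst x = i then proj1 n p $$ (snd x, j) else 0) - q * (if snd x = j then proj1 n p $$ (i, fst x) else 0)
     else if k = 1 then (if snd x = j then proj2 n p $$ (i, fst x) else 0) - q * (if fst x = i then proj2 n p $$ (snd x, j) else 0)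
     else if x = (i, j) then 1 else 0)"

lemma Z_system_poly:
  assumes "snd e \<in> {..<n} \<times> {..<n}" "x \<in> {..<n} \<times> {..<n}"
  shows "Z_system q n e x \<in> poly_funs n"
proof -
  obtain k i j where e: "e = (k, i, j)" by (cases e)
  have lt: "i < n" "j < n" "fst x < n" "snd x < n" using assms unfolding e by auto
  have p: "(\<lambda>p. proj1 n p $$ (r, c)) \<in> poly_funs n" "(\<lambda>p. proj2 n p $$ (r, c)) \<in> poly_funs n" if "r < n" "c < n" for r c
    using poly_funs.mats_entry[OF proj_mats(1) that] poly_funs.mats_entry[OF proj_mats(2) that] by auto
  show ?thesis unfolding e Z_system_def split
    by (intro poly_funs.ring_if poly_funs.diff poly_funs.mult[OF poly_funs.const] poly_funs.const p lt)
qed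

lemma Z_system_sum:
  assumes A: "proj1 n p \<in> Mat n" and B: "proj2 n p \<in> Mat n" and Z: "Z \<in> Mat n" and ij: "i < n" "j < n"
  shows "(\<Sum>x\<in>{..<n} \<times> {..<n}. Z_system q n (0, i, j) x p * Z $$ x) = (Z * proj1 n p) $$ (i, j) - (q \<cdot>\<^sub>m (proj1 n p * Z)) $$ (i, j)"
    and "(\<Sum>x\<in>{..<n} \<times> {..<n}. Z_system q n (1, i, j) x p * Z $$ x) = (proj2 n p * Z) $$ (i, j) - (q \<cdot>\<^sub>m (Z * proj2 n p)) $$ (i, j)"
    and "(\<Sum>x\<in>{..<n} \<times> {..<n}. Z_system q n (2, i, j) x p * Z $$ x) = Z $$ (i, j)"
proof -
  have 1: "(q \<cdot>\<^sub>m (proj1 n p * Z)) $$ (i, j) = q * (proj1 n p * Z) $$ (i, j)"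
    "(q \<cdot>\<^sub>m (Z * proj2 n p)) $$ (i, j) = q * (Z * proj2 n p) $$ (i, j)" using A B Z ij by auto
  show "(\<Sum>x\<in>{..<n} \<times> {..<n}. Z_system q n (0, i, j) x p * Z $$ x) = (Z * proj1 n p) $$ (i, j) - (q \<cdot>\<^sub>m (proj1 n p * Z)) $$ (i, j)"
    unfolding 1 sum_row_mult[OF A Z ij, symmetric] sum_distrib_left sum_subtractf[symmetric] Z_system_def
    by (intro sum.cong refl) (simp add: algebra_simps)
  show "(\<Sum>x\<in>{..<n} \<times> {..<n}. Z_system q n (1, i, j) x p * Z $$ x) = (proj2 n p * Z) $$ (i, j) - (q \<cdot>\<^sub>m (Z * proj2 n p)) $$ (i, j)"
    unfolding 1 sum_row_mult[OF B Z ij, symmetric] sum_distrib_left sum_subtractf[symmetric] Z_system_def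
    by (intro sum.cong refl) (simp add: algebra_simps)
  have "(\<Sum>x\<in>{..<n} \<times> {..<n}. Z_system q n (2, i, j) x p * Z $$ x) = (\<Sum>x\<in>{..<n} \<times> {..<n}. if x = (i, j) then Z $$ x else 0)"
    unfolding Z_system_def by (intro sum.cong refl) simp
  then show "(\<Sum>x\<in>{..<n} \<times> {..<n}. Z_system q n (2, i, j) x p * Z $$ x) = Z $$ (i, j)" using ij by simp
qed

lemma (in block_family) image_pairs: "par_pair q ts ` {T. par_denom ts T \<noteq> 0} \<subseteq> pairs n"
  using param_family.carr[OF param] by blast

text \<open>The solutions for the different summands are independent, so one of their combinations satisfies the fewer conditions in \<open>M\<close>.\<close>

lemma (in block_family) many_solutions:
  assumes nz: "par_denom ts T \<noteq> 0" and M: "finite M" "M \<subseteq> {..<n} \<times> {..<n}" "card M < card (full_starts q ts)"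
  shows "\<exists>Z\<in>carrier_mat n n. (\<exists>i<n. \<exists>j<n. Z $$ (i, j) \<noteq> 0) \<and>
    Z * sel True (par_pair q ts T) = q \<cdot>\<^sub>m (sel True (par_pair q ts T) * Z) \<and>
    sel False (par_pair q ts T) * Z = q \<cdot>\<^sub>m (Z * sel False (par_pair q ts T)) \<and> (\<forall>x\<in>M. Z $$ x = 0)"
proof -
  let ?G = "unit_mat n T" and ?I = "full_starts q ts"
  let ?A = "model True T" and ?B = "model False T" and ?X = "sel True (par_pair q ts T)" and ?Y = "sel False (par_pair q ts T)"
  have G: "det ?G \<noteq> 0" using nz unfolding denom_nz by blast
  note X = sel_intertwine[OF G, of True] and Y = sel_intertwine[OF G, of False]
  note cA = model_carr[of True T] and cB = model_carr[of False T] and a = adj_mat[OF unit_mat_carrier[of n T]]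
  have "\<exists>Z. Z \<in> Mat n \<and> Z * ?A = q \<cdot>\<^sub>m (?A * Z) \<and> ?B * Z = q \<cdot>\<^sub>m (Z * ?B) \<and>
    (f \<in> ?I \<longrightarrow> (\<exists>i<n. \<exists>j<n. S j = f \<and> Z $$ (i, j) \<noteq> 0) \<and> (\<forall>i<n. \<forall>j<n. S j \<noteq> f \<longrightarrow> Z $$ (i, j) = 0))" for f
  proof (cases "f \<in> ?I")
    case True
    from full_block_solution[OF this, of T] show ?thesis by blast
  next
    case False
    have "0\<^sub>m n n * ?A = q \<cdot>\<^sub>m (?A * 0\<^sub>m n n)" "?B * 0\<^sub>m n n = q \<cdot>\<^sub>m (0\<^sub>m n n * ?B)"
      using cA cB by (auto intro!: eq_matI)
    then show ?thesis using False by (intro exI[of _ "0\<^sub>m n n"]) simp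
  qed
  then obtain Z where Z: "\<And>f. Z f \<in> Mat n" "\<And>f. Z f * ?A = q \<cdot>\<^sub>m (?A * Z f)" "\<And>f. ?B * Z f = q \<cdot>\<^sub>m (Z f * ?B)"
    and Znz: "\<And>f. f \<in> ?I \<Longrightarrow> \<exists>i<n. \<exists>j<n. S j = f \<and> Z f $$ (i, j) \<noteq> 0"
    and Zsup: "\<And>f i j. f \<in> ?I \<Longrightarrow> i < n \<Longrightarrow> j < n \<Longrightarrow> S j \<noteq> f \<Longrightarrow> Z f $$ (i, j) = 0" by metis
  have fin: "finite ?I" by (rule card_full_starts)
  obtain c f0 where c: "f0 \<in> ?I" "c f0 \<noteq> 0" "\<And>x. x \<in> M \<Longrightarrow> (\<Sum>f\<in>?I. c f * (?G * Z f * adj_mat ?G) $$ x) = 0"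
    using underdetermined_system_nontrivial[OF M(1) fin M(3), of "\<lambda>f x. (?G * Z f * adj_mat ?G) $$ x"] by blast
  define C where "C = mat n n (\<lambda>ij. \<Sum>f\<in>?I. c f * Z f $$ ij)"
  have cC: "C \<in> Mat n" unfolding C_def by simp
  have C1: "C * ?A = q \<cdot>\<^sub>m (?A * C)" unfolding C_def by (rule q_commute_lincomb[OF Z(1) cA Z(2)])
  have iq: "Z f * ?B = inverse q \<cdot>\<^sub>m (?B * Z f)" for f unfolding Z(3) using q0 by (simp add: smat_smat smat_one)
  have "C * ?B = inverse q \<cdot>\<^sub>m (?B * C)" unfolding C_def by (rule q_commute_lincomb[OF Z(1) cB iq])
  then have C2: "?B * C = q \<cdot>\<^sub>m (C * ?B)" using q0 by (simp add: smat_smat smat_one)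
  define W where "W = conj_by ?G C"
  have W: "W \<in> Mat n" "W * ?G = ?G * C" unfolding W_def by (rule conj_by_props(1,2)[OF unit_mat_carrier G cC])+
  have sm: "(q \<cdot>\<^sub>m L) * ?G = ?G * (q \<cdot>\<^sub>m R)" if "L \<in> Mat n" "R \<in> Mat n" "L * ?G = ?G * R" for L R
    unfolding mult_smult_assoc_mat[OF that(1) unit_mat_carrier] mult_smult_distrib[OF unit_mat_carrier that(2)] that(3) ..
  have cancel: "L = R" if "L \<in> Mat n" "R \<in> Mat n" "N \<in> Mat n" "L * ?G = ?G * N" "R * ?G = ?G * N" for L R N
    using conj_by_props(3)[OF unit_mat_carrier G that(3,1,4)] conj_by_props(3)[OF unit_mat_carrier G that(3,2,5)] by simp
  have "W * ?X = q \<cdot>\<^sub>m (?X * W)"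
  proof (rule cancel[OF mult_carrier_mat[OF W(1) X(1)] smult_carrier_mat[OF mult_carrier_mat[OF X(1) W(1)]] mult_carrier_mat[OF cC cA]])
    show "W * ?X * ?G = ?G * (C * ?A)" by (rule mult_intertwine[OF W(1) X(1) unit_mat_carrier cC cA W(2) X(2)])
    show "q \<cdot>\<^sub>m (?X * W) * ?G = ?G * (C * ?A)" unfolding C1
      by (rule sm[OF mult_carrier_mat[OF X(1) W(1)] mult_carrier_mat[OF cA cC] mult_intertwine[OF X(1) W(1) unit_mat_carrier cA cC X(2) W(2)]])
  qed
  moreover have "?Y * W = q \<cdot>\<^sub>m (W * ?Y)"
  proof (rule cancel[OF mult_carrier_mat[OF Y(1) W(1)] smult_carrier_mat[OF mult_carrier_mat[OF W(1) Y(1)]] mult_carrier_mat[OF cB cC]])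
    show "?Y * W * ?G = ?G * (?B * C)" by (rule mult_intertwine[OF Y(1) W(1) unit_mat_carrier cB cC Y(2) W(2)])
    show "q \<cdot>\<^sub>m (W * ?Y) * ?G = ?G * (?B * C)" unfolding C2
      by (rule sm[OF mult_carrier_mat[OF W(1) Y(1)] mult_carrier_mat[OF cC cB] mult_intertwine[OF W(1) Y(1) unit_mat_carrier cC cB W(2) Y(2)]])
  qed
  moreover have "W $$ x = 0" if x: "x \<in> M" for x
  proof -
    obtain i j where ij: "x = (i, j)" "i < n" "j < n" using x M(2) by blast
    have "det ?G * W $$ (i, j) = (\<Sum>f\<in>?I. c f * (?G * Z f * adj_mat ?G) $$ (i, j))"
      unfolding W_def conj_by_props(4)[OF unit_mat_carrier G cC ij(2,3)] unfolding C_def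
      by (rule sandwich_lincomb[OF unit_mat_carrier a(1) Z(1) ij(2,3)])
    then show ?thesis using c(3)[OF x] G unfolding ij(1) by simp
  qed
  moreover have "\<exists>i<n. \<exists>j<n. W $$ (i, j) \<noteq> 0"
  proof (rule ccontr)
    assume "\<not> ?thesis"
    then have "W = 0\<^sub>m n n" using W(1) by (intro mat_eqI[OF W(1) zero_carrier_mat]) simp
    then have "?G * C = 0\<^sub>m n n"
      unfolding W(2)[symmetric] by (simp only:) (rule left_mult_zero_mat[OF unit_mat_carrier])
    then have "?G * C = ?G * 0\<^sub>m n n" unfolding right_mult_zero_mat[OF unit_mat_carrier[of n T]] .
    then have "adj_mat ?G * ?G * C = adj_mat ?G * ?G * 0\<^sub>m n n"
      unfolding assoc_mult_mat[OF a(1) unit_mat_carrier cC] assoc_mult_mat[OF a(1) unit_mat_carrier zero_carrier_mat] by simp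
    then have z: "det ?G \<cdot>\<^sub>m C = det ?G \<cdot>\<^sub>m 0\<^sub>m n n"
      unfolding a(3) mult_smult_assoc_mat[OF one_carrier_mat cC] mult_smult_assoc_mat[OF one_carrier_mat zero_carrier_mat]
      using cC by simp
    obtain i j where ij: "i < n" "j < n" "S j = f0" "Z f0 $$ (i, j) \<noteq> 0" using Znz[OF c(1)] by blast
    have "C $$ (i, j) = (\<Sum>f\<in>?I. if f = f0 then c f * Z f $$ (i, j) else 0)"
      unfolding C_def using ij Zsup by (auto intro!: sum.cong)
    also have "\<dots> = c f0 * Z f0 $$ (i, j)" using c(1) fin by simp
    finally have "C $$ (i, j) \<noteq> 0" using c(2) ij(4) by simp
    moreover have "det ?G * C $$ (i, j) = 0" using arg_cong[OF z, of "\<lambda>M. M $$ (i, j)"] cC ij by simp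
    ultimately show False using G by simp
  qed
  ultimately show ?thesis using W(1) by blast
qed

lemma block_family_baseI:
  fixes q :: "'a::{alg_closed_field, field_char_0}"
  assumes "q \<noteq> 0" "ts \<in> block_types q n"
  shows "\<exists>b. block_family_base q ts n b"
proof -
  obtain b :: "nat \<Rightarrow> 'a" where "\<forall>f<n. b f \<noteq> 0"
    "\<forall>f<n. \<forall>g<n. f \<noteq> g \<longrightarrow> (\<forall>u\<le>n. \<forall>v\<le>n. b f * q ^ u \<noteq> b g * q ^ v)"
    using exists_separated_eigenvalues[OF assms(1), of n n] by (elim exE conjE)
  then have "block_family_base q ts n b" using assms by unfold_locales simp_all
  then show ?thesis by blast
qed

text \<open>The number of summands \<open>D\<close> of size the order of \<open>q\<close> is thus the generic dimension of the space of all \<open>Z\<close>,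
  and this dimension can only drop under generization.\<close>

lemma full_count_mono:
  fixes q :: "'a::{alg_closed_field, field_char_0}"
  assumes q: "q \<noteq> 0" and ts: "ts \<in> block_types q n" and us: "us \<in> block_types q n"
    and sub: "K_types q ts \<subseteq> K_types q us"
  shows "card (full_starts q us) \<le> card (full_starts q ts)"
proof (rule ccontr)
  assume "\<not> ?thesis"
  then have less: "card (full_starts q ts) < card (full_starts q us)" by simp
  obtain b where "block_family_base q ts n b" using block_family_baseI[OF q ts] by blast
  then interpret t: block_family_base q ts n b .
  interpret u: block_family q us n using q us by unfold_locales
  let ?J = "{..<n} \<times> {..<n}"
  define M where "M = (\<lambda>f. (f, f + block_size ts f - 1)) ` full_starts q ts"
  have M: "finite M" "card M \<le> card (full_starts q ts)" unfolding M_def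
    using card_full_starts(1)[of q ts] by (simp_all add: card_image_le)
  have MJ: "M \<subseteq> ?J"
  proof
    fix x assume "x \<in> M"
    then obtain f where f: "f \<in> full_starts q ts" "x = (f, f + block_size ts f - 1)" unfolding M_def by blast
    then have "f < n" "block_start ts f = f" unfolding full_starts_def t.nsum by auto
    then show "x \<in> ?J" using t.bounds(1-3)[of f] f(2) by auto
  qed
  define E where "E = {0, 1} \<times> ?J \<union> (\<lambda>x. (2::nat, x)) ` M"
  let ?x0 = "par_pair q ts t.base"
  have x0: "?x0 \<in> par_pair q ts ` {T. par_denom ts T \<noteq> 0}" using t.base_denom by blast
  have selp: "t.sel True p = proj1 n p" "t.sel False p = proj2 n p" "u.sel True p = proj1 n p" "u.sel False p = proj2 n p" for p
    unfolding t.sel_def u.sel_def by simp_all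
  have x0m: "proj1 n ?x0 = t.model True t.base" "proj2 n ?x0 = t.model False t.base"
    using t.sel_pair_one[of t.base True] t.sel_pair_one[of t.base False] t.base_off unfolding selp by auto
  have pc: "proj1 n p \<in> Mat n" "proj2 n p \<in> Mat n" for p :: "'a mat \<times> 'a mat"
    by (rule poly_funs.mats_carrier[OF proj_mats(1)], rule poly_funs.mats_carrier[OF proj_mats(2)])
  have "\<exists>P\<in>poly_funs n. P ?x0 \<noteq> 0 \<and> (\<forall>x. P x \<noteq> 0 \<longrightarrow>
     (\<forall>z. (\<forall>e\<in>E. (\<Sum>j\<in>?J. Z_system q n e j x * z j) = 0) \<longrightarrow> (\<forall>j\<in>?J. z j = 0)))"
  proof (rule poly_funs.trivial_kernel_open)
    show "u * v = 0 \<Longrightarrow> u = 0 \<or> v = 0" "u \<noteq> 0 \<Longrightarrow> \<exists>v. u * v = 1" for u v :: 'a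
      by (simp, metis right_inverse)
    show "finite ?J" by simp
    show "Z_system q n e j \<in> poly_funs n" if "e \<in> E" "j \<in> ?J" for e j
    proof (rule Z_system_poly[OF _ that(2)])
      have "snd e \<in> ?J \<union> M" using that(1) unfolding E_def by auto
      then show "snd e \<in> ?J" using MJ by blast
    qed
    fix z assume z: "\<And>e. e \<in> E \<Longrightarrow> (\<Sum>j\<in>?J. Z_system q n e j ?x0 * z j) = 0"
    let ?Z = "mat n n z"
    have c: "?Z \<in> Mat n" by simp
    have sum: "(\<Sum>j\<in>?J. Z_system q n e j ?x0 * ?Z $$ j) = 0" if "e \<in> E" for e
    proof -
      have "(\<Sum>j\<in>?J. Z_system q n e j ?x0 * ?Z $$ j) = (\<Sum>j\<in>?J. Z_system q n e j ?x0 * z j)"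
        by (rule sum.cong) auto
      then show ?thesis using z[OF that] by simp
    qed
    note zs = Z_system_sum[OF pc c]
    have e1: "?Z * t.model True t.base = q \<cdot>\<^sub>m (t.model True t.base * ?Z)"
    proof (rule mat_eqI[OF mult_carrier_mat[OF c t.model_carr] smult_carrier_mat[OF mult_carrier_mat[OF t.model_carr c]]])
      fix i j assume ij: "i < n" "j < n"
      then have "(0, i, j) \<in> E" unfolding E_def by simp
      from sum[OF this] show "(?Z * t.model True t.base) $$ (i, j) = (q \<cdot>\<^sub>m (t.model True t.base * ?Z)) $$ (i, j)"
        unfolding zs(1)[OF ij] x0m by simp
    qed
    have e2: "t.model False t.base * ?Z = q \<cdot>\<^sub>m (?Z * t.model False t.base)"
    proof (rule mat_eqI[OF mult_carrier_mat[OF t.model_carr c] smult_carrier_mat[OF mult_carrier_mat[OF c t.model_carr]]])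
      fix i j assume ij: "i < n" "j < n"
      then have "(1, i, j) \<in> E" unfolding E_def by simp
      from sum[OF this] show "(t.model False t.base * ?Z) $$ (i, j) = (q \<cdot>\<^sub>m (?Z * t.model False t.base)) $$ (i, j)"
        unfolding zs(2)[OF ij] x0m by simp
    qed
    have e3: "?Z $$ (f, f + block_size ts f - 1) = 0" if f: "f \<in> full_starts q ts" for f
    proof -
      have m: "(f, f + block_size ts f - 1) \<in> M" unfolding M_def using f by (rule imageI)
      then have ij: "f < n" "f + block_size ts f - 1 < n" using MJ by auto
      have "(2, f, f + block_size ts f - 1) \<in> E" unfolding E_def using m by (intro UnI2 imageI)
      from sum[OF this] show ?thesis unfolding zs(3)[OF ij] .
    qed
    show "\<forall>j\<in>?J. z j = 0"
    proof
      fix x assume "x \<in> ?J"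
      then obtain i j where ij: "x = (i, j)" "i < n" "j < n" by blast
      show "z x = 0" using t.base_rigid[OF c e1 e2 e3 ij(2,3)] ij by simp
    qed
  qed
  then obtain P where P: "P \<in> poly_funs n" "P ?x0 \<noteq> 0"
    and ker: "\<And>x z. P x \<noteq> 0 \<Longrightarrow> (\<forall>e\<in>E. (\<Sum>j\<in>?J. Z_system q n e j x * z j) = 0) \<Longrightarrow> \<forall>j\<in>?J. z j = 0" by blast
  have "?x0 \<in> K_types q ts" unfolding t.K_types_eq_par using zcl_superset[OF t.image_pairs] x0 by blast
  then have "?x0 \<in> zcl n (par_pair q us ` {T. par_denom us T \<noteq> 0})" using sub unfolding u.K_types_eq_par by blast
  from zclD[OF this P(1)] P(2) obtain T where T: "par_denom us T \<noteq> 0" "P (par_pair q us T) \<noteq> 0" by blast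
  let ?p = "par_pair q us T"
  obtain Z i j where Z: "Z \<in> Mat n" "i < n" "j < n" "Z $$ (i, j) \<noteq> 0"
    "Z * proj1 n ?p = q \<cdot>\<^sub>m (proj1 n ?p * Z)" "proj2 n ?p * Z = q \<cdot>\<^sub>m (Z * proj2 n ?p)" "\<forall>x\<in>M. Z $$ x = 0"
    using u.many_solutions[OF T(1) M(1) MJ] M(2) less unfolding selp by (metis le_less_trans)
  have "(\<Sum>j\<in>?J. Z_system q n e j ?p * Z $$ j) = 0" if e: "e \<in> E" for e
  proof -
    note zs = Z_system_sum[OF pc Z(1)]
    consider i j where "e = (0, i, j)" "i < n" "j < n" | i j where "e = (1, i, j)" "i < n" "j < n"
      | i j where "e = (2, i, j)" "(i, j) \<in> M" using e unfolding E_def by auto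
    then show ?thesis
    proof cases
      case (1 i j)
      then show ?thesis using zs(1)[of i j q ?p] Z(5) by simp
    next
      case (2 i j)
      then show ?thesis using zs(2)[of i j q ?p] Z(6) by simp
    next
      case (3 i j)
      then have "i < n" "j < n" using MJ by auto
      then show ?thesis using zs(3)[of i j q ?p] Z(7) 3 by simp
    qed
  qed
  then have "\<forall>x\<in>?J. Z $$ x = 0" using ker[OF T(2), of "\<lambda>x. Z $$ x"] by blast
  then show False using Z(2-4) by simp
qed

section \<open>Irreducible components and dimension\<close>

lemma K_types_zcl:
  assumes "ts \<in> block_types q n"
  shows "zcl n (K_types q ts) = K_types q ts"
proof -
  have "n = total ts" using assms unfolding block_types_def by simp
  then show ?thesis unfolding K_types_def by (simp add: zcl_zcl)
qed

lemma K_types_pirr: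
  fixes q :: "'a::{alg_closed_field, field_char_0}"
  assumes q: "q \<noteq> 0" and ts: "ts \<in> block_types q n"
  shows "pirr n (K_types q ts)"
proof -
  obtain b where "block_family_base q ts n b" using block_family_baseI[OF q ts] by blast
  then interpret t: block_family_base q ts n b .
  have "pirr n (par_pair q ts ` {T \<in> UNIV. par_denom ts T \<noteq> 0})"
    by (rule param_family.pirr_slice[OF t.param, of UNIV t.base, OF UNIV_I UNIV_I t.base_denom])
  then have "pirr n (par_pair q ts ` {T. par_denom ts T \<noteq> 0})" by (simp only: UNIV_I simp_thms)
  then show ?thesis unfolding t.K_types_eq_par by (rule pirr_zcl[OF _ t.image_pairs])
qed

lemma K_types_chain_lengths:
  fixes q :: "'a::{alg_closed_field, field_char_0}"
  assumes q: "q \<noteq> 0" and ts: "ts \<in> block_types q n"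
  shows "irr_chain n (K_types q ts) k Z \<Longrightarrow> k \<le> n\<^sup>2 + card (full_starts q ts)"
    and "\<exists>Z. irr_chain n (K_types q ts) (n\<^sup>2 + card (full_starts q ts)) Z"
proof -
  obtain b where "block_family_base q ts n b" using block_family_baseI[OF q ts] by blast
  then interpret t: block_family_base q ts n b .
  show "\<exists>Z. irr_chain n (K_types q ts) (n\<^sup>2 + card (full_starts q ts)) Z"
    using t.K_types_chain unfolding card_par_index t.nsum .
  assume "irr_chain n (K_types q ts) k Z"
  from param_family.chain_length_le[OF t.param this[unfolded t.K_types_eq_par]]
  show "k \<le> n\<^sup>2 + card (full_starts q ts)" unfolding card_par_index t.nsum .
qed

text \<open>Otherwise a chain of full length in the smaller set could be prolonged by the larger one, whose dimension is no larger.\<close>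

lemma K_types_maximal:
  fixes q :: "'a::{alg_closed_field, field_char_0}"
  assumes q: "q \<noteq> 0" and ts: "ts \<in> block_types q n" and us: "us \<in> block_types q n"
    and sub: "K_types q ts \<subseteq> K_types q us"
  shows "K_types q ts = K_types q us"
proof (rule ccontr)
  assume ne: "K_types q ts \<noteq> K_types q us"
  let ?k = "n\<^sup>2 + card (full_starts q ts)"
  obtain Z where Z: "irr_chain n (K_types q ts) ?k Z" using K_types_chain_lengths(2)[OF q ts] by blast
  have Zi: "Z i \<subseteq> K_types q ts" "zcl n (Z i) = Z i" "pirr n (Z i)" if "i \<le> ?k" for i
    using Z that unfolding irr_chain_def by blast+
  have Zs: "Z i \<subset> Z (Suc i)" if "i < ?k" for i using Z that unfolding irr_chain_def by blast
  let ?Z = "\<lambda>i. if i \<le> ?k then Z i else K_types q us"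
  have "irr_chain n (K_types q us) (Suc ?k) ?Z"
    unfolding irr_chain_def
  proof (intro conjI allI impI)
    fix i
    show "?Z i \<subseteq> K_types q us" using Zi(1)[of i] sub by auto
    show "zcl n (?Z i) = ?Z i" using Zi(2)[of i] K_types_zcl[OF us] by auto
    show "pirr n (?Z i)" using Zi(3)[of i] K_types_pirr[OF q us] by auto
    assume i: "i < Suc ?k"
    show "?Z i \<subset> ?Z (Suc i)"
    proof (cases "i < ?k")
      case True
      then show ?thesis using Zs[of i] by auto
    next
      case False
      then have "i = ?k" using i by simp
      then show ?thesis using Zi(1)[of ?k] sub ne by auto
    qed
  qed
  from K_types_chain_lengths(1)[OF q us this] full_count_mono[OF q ts us sub] show False by simp
qed

lemma pirr_subset_Union:
  assumes T: "pirr n T" "T \<subseteq> pairs n"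
  shows "finite \<U> \<Longrightarrow> \<forall>U\<in>\<U>. zcl n U = U \<Longrightarrow> T \<subseteq> zcl n (\<Union>\<U>) \<Longrightarrow> \<exists>U\<in>\<U>. T \<subseteq> U"
proof (induction \<U> rule: finite_induct)
  case empty
  obtain t where "t \<in> T" using T(1) unfolding pirr_def by blast
  then have "t \<in> zcl n {}" using empty by auto
  from zclD[OF this poly_funs.const[of 1]] show ?case by simp
next
  case (insert U \<U>)
  show ?case
  proof (cases "T \<subseteq> U")
    case False
    then obtain t where t: "t \<in> T" "t \<notin> zcl n U" using insert.prems(1) by auto
    moreover have "t \<in> pairs n" using t T(2) by blast
    ultimately obtain f where f: "f \<in> poly_funs n" "\<forall>s\<in>U. f s = 0" "f t \<noteq> 0" unfolding zcl_def by blast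
    have "T \<subseteq> zcl n (\<Union>\<U>)"
    proof
      fix p assume p: "p \<in> T"
      have "g p = 0" if g: "g \<in> poly_funs n" "\<forall>s\<in>\<Union>\<U>. g s = 0" for g
      proof -
        have fg: "(\<lambda>p. f p * g p) \<in> poly_funs n" by (rule poly_funs.mult[OF f(1) g(1)])
        have "\<forall>s\<in>\<Union>(insert U \<U>). f s * g s = 0" using f(2) g(2) by auto
        then have "\<forall>z\<in>T. f z * g z = 0" using zclD[OF _ fg] insert.prems(2) by blast
        then have "(\<forall>z\<in>T. f z = 0) \<or> (\<forall>z\<in>T. g z = 0)" using T(1) f(1) g(1) unfolding pirr_def by blast
        then show ?thesis using f(3) t(1) p by blast
      qed
      then show "p \<in> zcl n (\<Union>\<U>)" using p T(2) unfolding zcl_def by blast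
    qed
    then show ?thesis using insert by auto
  qed blast
qed

theorem K_types_component:
  fixes q :: "'a::{alg_closed_field, field_char_0}"
  assumes q: "q \<noteq> 0" and n: "0 < n" and ts: "ts \<in> block_types q n"
  shows "irreducible_component_of (qpairs_top q n) (K_types q ts)"
proof -
  have nsum: "n = total ts" using ts unfolding block_types_def by simp
  have sub: "K_types q ts \<subseteq> qpairs q n" unfolding nsum by (rule K_types_qpairs)
  note irr = irreducible_in_iff_pirr[OF _ qpairs_subset, of _ q n, folded qpairs_top_def]
  show ?thesis unfolding irreducible_component_of_def
  proof (intro conjI allI impI)
    show "irreducible_in (qpairs_top q n) (K_types q ts)" unfolding irr[OF sub] by (rule K_types_pirr[OF q ts])
    fix T assume T: "irreducible_in (qpairs_top q n) T \<and> K_types q ts \<subseteq> T"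
    then have Tq: "T \<subseteq> qpairs q n" unfolding irreducible_in_def by simp
    have Tp: "pirr n T" using T unfolding irr[OF Tq] by blast
    have "\<exists>U\<in>K_types q ` block_types q n. T \<subseteq> U"
    proof (rule pirr_subset_Union[OF Tp order_trans[OF Tq qpairs_subset]])
      show "finite (K_types q ` block_types q n)" using finite_block_types by blast
      show "\<forall>U\<in>K_types q ` block_types q n. zcl n U = U" using K_types_zcl by blast
      have "\<Union>(K_types q ` block_types q n) = qpairs q n" using qpairs_eq_Union_K_types[OF q n] by simp
      then show "T \<subseteq> zcl n (\<Union>(K_types q ` block_types q n))" using Tq zcl_superset[OF qpairs_subset[of q n]] by simp
    qed
    then obtain us where us: "us \<in> block_types q n" "T \<subseteq> K_types q us" by blast
    then have "K_types q ts = K_types q us" using K_types_maximal[OF q ts us(1)] T by blast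
    then show "T = K_types q ts" using us(2) T by blast
  qed
qed

lemma card_full_starts_types_of:
  assumes mr: "(m, r) \<in> qparams q n"
  shows "card (full_starts q (types_of m r)) = (case qorder q of enat l \<Rightarrow> m l | \<infinity> \<Rightarrow> 0)"
proof (cases "qorder q")
  case (enat l)
  have fin: "finite {i. m i \<noteq> 0}" "finite {i. r i \<noteq> 0}" using mr unfolding qparams_def by auto
  have "0 < l" using qorder_finite(1)[OF enat] .
  then have "filter (\<lambda>(d, k). d \<and> enat k = qorder q \<and> 0 < k) ts = filter ((=) (True, l)) ts" for ts
    unfolding enat by (intro filter_cong) auto
  then have "card (full_starts q (types_of m r)) = count (mset (types_of m r)) (True, l)"
    unfolding card_full_starts(2) by (simp only: count_mset count_list_eq_length_filter)
  then show ?thesis using types_of_count[OF fin, of True l] enat by simp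
qed (auto simp: card_full_starts(2) case_prod_beta)

theorem theorem1p1:
  fixes q :: "'a::{alg_closed_field, field_char_0}" and n :: nat
  assumes "q \<noteq> 0" and "n \<ge> 1"
  shows "(\<forall>(m, r) \<in> qparams q n. irreducible_component_of (qpairs_top q n) (K_comp q n m r))
    \<and> qpairs q n = (\<Union>(m, r) \<in> qparams q n. K_comp q n m r)
    \<and> (\<forall>(m, r) \<in> qparams q n. krull_dim (subtopology (qpairs_top q n) (K_comp q n m r)) =
          (case qorder q of enat l \<Rightarrow> enat (n ^ 2 + m l) | \<infinity> \<Rightarrow> enat (n ^ 2)))"
proof -
  have n: "0 < n" using assms(2) by simp
  have comp: "irreducible_component_of (qpairs_top q n) (K_comp q n m r)" if "(m, r) \<in> qparams q n" for m r
    unfolding K_comp_eq_K_types[OF assms(2) that] by (rule K_types_component[OF assms(1) n types_of_block_types[OF that]])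
  have "(\<Union>ts\<in>block_types q n. K_types q ts) = (\<Union>(m, r)\<in>qparams q n. K_types q (types_of m r))"
  proof (intro equalityI subsetI)
    fix p assume "p \<in> (\<Union>ts\<in>block_types q n. K_types q ts)"
    then obtain ts where ts: "ts \<in> block_types q n" "p \<in> K_types q ts" by blast
    then obtain m r where "(m, r) \<in> qparams q n" "mset (types_of m r) = mset ts" using block_types_of[OF ts(1)] by blast
    then show "p \<in> (\<Union>(m, r)\<in>qparams q n. K_types q (types_of m r))" using K_types_perm ts(2) by blast
  next
    fix p assume "p \<in> (\<Union>(m, r)\<in>qparams q n. K_types q (types_of m r))"
    then show "p \<in> (\<Union>ts\<in>block_types q n. K_types q ts)" using types_of_block_types by blast
  qed
  also have "\<dots> = (\<Union>(m, r)\<in>qparams q n. K_comp q n m r)"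
    using K_comp_eq_K_types[OF assms(2)] by (intro SUP_cong refl) auto
  finally have union: "qpairs q n = (\<Union>(m, r)\<in>qparams q n. K_comp q n m r)"
    using qpairs_eq_Union_K_types[OF assms(1) n] by simp
  have "krull_dim (subtopology (qpairs_top q n) (K_comp q n m r)) =
      (case qorder q of enat l \<Rightarrow> enat (n ^ 2 + m l) | \<infinity> \<Rightarrow> enat (n ^ 2))" if mr: "(m, r) \<in> qparams q n" for m r
  proof -
    let ?ts = "types_of m r"
    have ts: "?ts \<in> block_types q n" by (rule types_of_block_types[OF mr])
    then have nsum: "n = total ?ts" unfolding block_types_def by simp
    have sub: "K_types q ?ts \<subseteq> qpairs q n" using K_types_qpairs[of q ?ts] nsum by simp
    obtain Z where Z: "irr_chain n (K_types q ?ts) (n\<^sup>2 + card (full_starts q ?ts)) Z"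
      using K_types_chain_lengths(2)[OF assms(1) ts] by blast
    have cl: "closedin (zariski n) (K_types q ?ts)" using zcl_closed[of n "K_types q ?ts"] unfolding K_types_zcl[OF ts] .
    have "krull_dim (subtopology (qpairs_top q n) (K_types q ?ts)) = enat (n\<^sup>2 + card (full_starts q ?ts))"
      by (rule krull_dim_eqI[OF cl sub K_types_chain_lengths(1)[OF assms(1) ts] Z])
    then show ?thesis unfolding K_comp_eq_K_types[OF assms(2) mr] card_full_starts_types_of[OF mr]
      by (cases "qorder q") simp_all
  qed
  then show ?thesis using comp union by blast
qed

end
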